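(* Let $n\ge2$ and let $\Omega$ be a nice compact subset of $V_1(\mathbb{R})=\{X\in\mathrm{SL}_{2n}(\mathbb{R}):X^T=-X\}$. For $T\ge1$ let $$\pi_{\mathrm{Skew}_{2n},\mathrm{Pff}}(T,\Omega)=\#\{A\in T\Omega\cap\mathrm{Skew}_{2n}(\mathbb{Z}):\mathrm{Pff}(A)\text{ is prime}\}.$$ Then as $T\to\infty$, $$\pi_{\mathrm{Skew}_{2n},\mathrm{Pff}}(T,\Omega)\sim\mathfrak{S}_{\mathrm{Skew}_{2n},\mathrm{Pff}}\int_{T\Omega}\frac{dx}{\log^+(\mathrm{Pff}(x))},$$ where $$\mathfrak{S}_{\mathrm{Skew}_{2n},\mathrm{Pff}}=\prod_p\frac{1-p^{-(2n^2-n)}\#\{x\in\mathrm{Skew}_{2n}(\mathbb{F}_p):\mathrm{Pff}(x)\equiv0\bmod p\}}{1-1/p}.$$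
   Context: $\mathrm{Skew}_{2n}$ denotes skew-symmetric $2n\times2n$ matrices and $\mathrm{Pff}$ the Pfaffian. A compact subset of $V_1(\mathbb{R})$ is nice if its boundary in $V_1(\mathbb{R})$ has measure zero. $T\Omega=\{t\omega:t\in[0,T],\omega\in\Omega\}$. $dx$ is Lebesgue measure on $\mathrm{Skew}_{2n}(\mathbb{R})\cong\mathbb{R}^{2n^2-n}$. For real $y$, $\log^+(y)=\max(2,\log y)$ if $y>0$ and $=\infty$ if $y\le0$.
   Formalization: Added assumption: the part of Ω with positive Pfaffian is empty or not of measure zero in V_1(R) (cone measure). Otherwise it fails: if Ω is one point, a multiple of an integral matrix of prime Pfaffian, the integral is 0 but the count is positive. *)

theory Defs
  imports "HOL-Analysis.Analysis" "HOL-Combinatorics.Permutations"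
    "HOL-Computational_Algebra.Primes" "HOL-Library.Landau_Symbols"
begin

text \<open>
  Matrices of size \<open>2n\<close> are indexed by a finite linearly ordered type with \<open>2n\<close> elements; the
  order is needed because it determines the sign of the Pfaffian.
\<close>

type_synonym ('a, 'm) sq_matrix = "(('a, 'm) vec, 'm) vec"

definition nth_index :: "nat \<Rightarrow> 'm::{finite,linorder}" where
  "nth_index k = sorted_list_of_set (UNIV :: 'm set) ! k"

definition is_skew :: "('a::uminus, 'm::finite) sq_matrix \<Rightarrow> bool" where
  "is_skew A \<longleftrightarrow> transpose A = - A"

text \<open>
  The Pfaffian as the signed sum over perfect matchings. A matching
  \<open>{{\<sigma> 0, \<sigma> 1}, {\<sigma> 2, \<sigma> 3}, \<dots>}\<close> is represented by its unique permutation that increases inside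
  each pair and lists the pairs by increasing first element. Unlike the average over all
  permutations, this makes sense over every commutative ring, in particular over the integers.
\<close>

definition matching_perms :: "nat \<Rightarrow> (nat \<Rightarrow> nat) set" where
  "matching_perms n =
     {\<sigma>. \<sigma> permutes {..<2 * n} \<and>
          (\<forall>i<n. \<sigma> (2 * i) < \<sigma> (2 * i + 1)) \<and>
          (\<forall>j<n. \<forall>i<j. \<sigma> (2 * i) < \<sigma> (2 * j))}"

definition pfaffian :: "('a::comm_ring_1, 'm::{finite,linorder}) sq_matrix \<Rightarrow> 'a" where
  "pfaffian A =
     (\<Sum>\<sigma>\<in>matching_perms (CARD('m) div 2).
        of_int (sign \<sigma>) *
        (\<Prod>i<CARD('m) div 2. A $ nth_index (\<sigma> (2 * i)) $ nth_index (\<sigma> (2 * i + 1))))"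

definition V1 :: "(real, 'm::{finite,linorder}) sq_matrix set" where
  "V1 = {X. det X = 1 \<and> is_skew X}"

text \<open>Lebesgue measure on the skew matrices, in the strictly upper triangular entries.\<close>

definition skew_of_coords :: "('m \<times> 'm \<Rightarrow> real) \<Rightarrow> (real, 'm::{finite,linorder}) sq_matrix" where
  "skew_of_coords c = (\<chi> i j. if i < j then c (i, j) else if j < i then - c (j, i) else 0)"

definition skew_lebesgue :: "(real, 'm::{finite,linorder}) sq_matrix measure" where
  "skew_lebesgue =
     distr (Pi\<^sub>M {(i, j). i < j} (\<lambda>_. lborel)) borel skew_of_coords"

definition dilate :: "real \<Rightarrow> 'b::real_vector set \<Rightarrow> 'b set" where
  "dilate T \<Omega> = {t *\<^sub>R \<omega> | t \<omega>. t \<in> {0..T} \<and> \<omega> \<in> \<Omega>}"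

text \<open>
  The measure on \<open>V1\<close> is the cone measure \<open>E \<mapsto> vol {t \<omega> | 0 \<le> t \<le> 1, \<omega> \<in> E}\<close>. Since
  \<open>X \<mapsto> g X g\<^sup>T\<close> with \<open>det g = 1\<close> preserves Lebesgue measure on the skew matrices, this is the
  invariant measure, unique up to scaling on each of the two orbits of the special linear group
  in \<open>V1\<close>; it has the same null sets as the Riemannian volume of the submanifold \<open>V1\<close>.
\<close>

definition V1_null :: "(real, 'm::{finite,linorder}) sq_matrix set \<Rightarrow> bool" where
  "V1_null E \<longleftrightarrow> dilate 1 E \<in> null_sets skew_lebesgue"

definition nice :: "(real, 'm::{finite,linorder}) sq_matrix set \<Rightarrow> bool" where
  "nice \<Omega> \<longleftrightarrow> V1_null (top_of_set V1 frontier_of \<Omega>)"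

definition real_matrix :: "(int, 'm::finite) sq_matrix \<Rightarrow> (real, 'm) sq_matrix" where
  "real_matrix A = (\<chi> i j. real_of_int (A $ i $ j))"

text \<open>Primes of type \<^typ>\<open>int\<close> are positive, so matrices with negative Pfaffian do not count.\<close>

definition prime_count :: "real \<Rightarrow> (real, 'm::{finite,linorder}) sq_matrix set \<Rightarrow> nat" where
  "prime_count T \<Omega> =
     card {A :: (int, 'm) sq_matrix. is_skew A \<and> real_matrix A \<in> dilate T \<Omega> \<and> prime (pfaffian A)}"

definition log_plus :: "real \<Rightarrow> ereal" where
  "log_plus y = (if y > 0 then ereal (max 2 (ln y)) else \<infinity>)"

text \<open>
  Skew matrices over the field with \<open>p\<close> elements, represented by the integral skew matrices whose
  entries above the diagonal lie in \<open>{0..<p}\<close>. For \<open>p = 2\<close> these are the matrices with zero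
  diagonal, so that there are \<open>p ^ (2 n\<^sup>2 - n)\<close> of them for every \<open>p\<close>.
\<close>

definition skew_residues :: "nat \<Rightarrow> (int, 'm::{finite,linorder}) sq_matrix set" where
  "skew_residues p = {A. is_skew A \<and> (\<forall>i j. i < j \<longrightarrow> A $ i $ j \<in> {0..<int p})}"

definition local_factor :: "'m::{finite,linorder} itself \<Rightarrow> nat \<Rightarrow> real" where
  "local_factor _ p =
     (let n = CARD('m) div 2 in
       (1 - real (card {A \<in> skew_residues p :: (int, 'm) sq_matrix set. int p dvd pfaffian A})
              / real p ^ (2 * n\<^sup>2 - n))
       / (1 - 1 / real p))"

definition singular_series :: "'m::{finite,linorder} itself \<Rightarrow> real" where
  "singular_series m = (\<Prod>p. if prime p then local_factor m p else 1)"

end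

theory Submission
  imports Defs "HOL-Number_Theory.Prime_Powers" "HOL-Number_Theory.Cong" "HOL-Real_Asymp.Real_Asymp"
    "HOL-Complex_Analysis.Complex_Analysis"
begin

text \<open>
 Expanding along the first row writes the Pfaffian of a skew matrix as a scalar product \<open>a \<bullet> v\<close>. Here
 \<open>a\<close> is the first row and \<open>v\<close> is the vector of signed sub-Pfaffians of the remaining matrix \<open>B\<close> of odd
 size, which spans the kernel of \<open>B\<close>. An integral vector near the line of \<open>v\<close> is mapped by \<open>B\<close> to a short
 integral vector orthogonal to \<open>v\<close>. Hence, if \<open>v\<close> is primitive and satisfies no short integral relation,
 shifts of \<open>a\<close> by vectors that are short compared with \<open>T\<close> change \<open>a \<bullet> v\<close> by every integer of a long
 interval, and averaging over these shifts reduces the count of primes to the prime number theorem, which is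
 proved by Newman's contour argument. Almost all \<open>B\<close> satisfy no short relation, and the density of those with
 primitive \<open>v\<close> is the singular series, by a sieve for the primes dividing all sub-Pfaffians. Finally the
 cone over \<open>\<Omega>\<close> is approximated by boxes from inside and outside, and away from its apex the logarithm of
 the Pfaffian is asymptotic to \<open>n ln T\<close>.
\<close>

section \<open>The prime number theorem\<close>

text \<open>For fixed \<open>B\<close> the question is how often a linear form with coefficients
  \<open>v\<close>, of order up to \<open>T ^ (n - 1)\<close>, is prime, uniformly in
  \<open>v\<close>. The plain prime number theorem suffices because the shifts cover a fixed
  proportion of the range of the form: moving \<open>a\<close> by \<open>rho * T\<close> moves
  \<open>a \<bullet> v\<close> by about \<open>rho * T\<close> times the length of \<open>v\<close>,
  and the form itself has at most that order. The excluded relations have height at most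
  \<open>K\<close>, where \<open>K\<close> depends on \<open>rho\<close> and the box but not on
  \<open>T\<close>.

  The discarded \<open>B\<close> still carry weights of size \<open>ln T\<close>, so each class must
  save a power of \<open>T\<close>. Kernel vectors with a relation are zeros of a non-zero function
  that is affine in each entry, hence sparse. A non-zero but non-primitive \<open>v\<close> is cheap
  for another reason: the only prime that its form can represent is the common prime divisor.

  The Euler factors come from the same linear form: given \<open>B\<close>, a prime \<open>p\<close>
  divides it with probability \<open>1 / p\<close> unless \<open>p\<close> divides all of
  \<open>v\<close>, so each local factor is the density of \<open>v\<close> not vanishing mod
  \<open>p\<close>.\<close>

definition chebyshev_psi :: "nat => real" where
 "chebyshev_psi n = (\<Sum>k\<in>{1..n}. mangoldt k)"

definition chebyshev_theta :: "nat => real" where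
 "chebyshev_theta n = (\<Sum>k\<in>{1..n}. if prime k then ln (real k) else 0)"

lemma chebyshev_psi_Suc: "chebyshev_psi (Suc n) = chebyshev_psi n + mangoldt (Suc n)" by (simp add: chebyshev_psi_def)

lemma chebyshev_psi_nonneg: "chebyshev_psi n >= 0" unfolding chebyshev_psi_def by (intro sum_nonneg mangoldt_nonneg)

lemma mono_chebyshev_psi: "m <= n ==> chebyshev_psi m <= chebyshev_psi n"
 unfolding chebyshev_psi_def by (intro sum_mono2) (auto intro: mangoldt_nonneg)

text \<open>Legendre's formula, from summing \<open>ln k\<close> as the sum of
  \<open>mangoldt\<close> over the divisors of \<open>k\<close>. The upper end \<open>N\<close> is
  left free so that two factorials can be compared over one index range.\<close>

lemma ln_fact_eq_sum_mangoldt: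
 "n <= N ==> ln (fact n) = (\<Sum>d\<in>{1..N}. mangoldt d * real (n div d))"
proof (induction n)
 case (Suc n)
 have "(\<Sum>d\<in>{1..N}. mangoldt d * real (Suc n div d)) =
    (\<Sum>d\<in>{1..N}. mangoldt d * real (n div d) + (if d dvd Suc n then mangoldt d else 0))"
  by (intro sum.cong) (auto simp: div_Suc algebra_simps)
 also have "... = ln (fact n) + (\<Sum>d\<in>{1..N}. if d dvd Suc n then mangoldt d else 0)" using Suc by (simp add: sum.distrib)
 also have "(\<Sum>d\<in>{1..N}. if d dvd Suc n then mangoldt d else 0) = (\<Sum>d | d dvd Suc n. mangoldt d :: real)"
 proof (rule sum.mono_neutral_cong_right)
  show "{d. d dvd Suc n} <= {1..N}"
  proof
   fix d assume "d \<in> {d. d dvd Suc n}"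
   hence d: "d dvd Suc n" by simp
   have "d ~= 0"
   proof
    assume "d = 0"
    thus False using d by simp
   qed
   moreover have "d <= Suc n" using d by (rule dvd_imp_le) simp
   ultimately show "d \<in> {1..N}" using Suc.prems by auto
  qed
 qed auto
 also have "... = ln (real (Suc n))" using mangoldt_sum[of "Suc n", where 'a = real] by simp
 finally show ?case by (simp add: ln_mult)
qed simp

text \<open>The sum of \<open>mangoldt d * ((2 * m) div d - 2 * (m div d))\<close> is the logarithm
  of the central binomial coefficient, at most \<open>2 * m * ln 2\<close>. Its coefficients are
  never negative and are at least 1 for \<open>m < d <= 2 * m\<close>, so it dominates the increment
  of \<open>chebyshev_psi\<close>.\<close>

lemma chebyshev_psi_double: "chebyshev_psi (2 * m) <= chebyshev_psi m + 2 * real m"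
proof -
 have "chebyshev_psi (2 * m) - chebyshev_psi m = (\<Sum>d\<in>{m + 1..2 * m}. mangoldt d)"
 proof -
  have "{1..2 * m} = {1..m} \<union> {m + 1..2 * m}" "{1..m} \<inter> {m + 1..2 * m} = {}" by auto
  thus ?thesis unfolding chebyshev_psi_def by (simp add: sum.union_disjoint)
 qed
 also have "... <= (\<Sum>d\<in>{m + 1..2 * m}. mangoldt d * (real ((2 * m) div d) - 2 * real (m div d)))"
 proof (rule sum_mono)
  fix d assume d: "d \<in> {m + 1..2 * m}"
  hence "1 <= real ((2 * m) div d) - 2 * real (m div d)" by (auto simp: div_greater_zero_iff Suc_le_eq)
  thus "mangoldt d <= mangoldt d * (real ((2 * m) div d) - 2 * real (m div d))" using mult_left_mono[OF _ mangoldt_nonneg[of d]] by fastforce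
 qed
 also have "... <= (\<Sum>d\<in>{1..2 * m}. mangoldt d * (real ((2 * m) div d) - 2 * real (m div d)))"
 proof (rule sum_mono2)
  fix d assume d: "d \<in> {1..2 * m} - {m + 1..2 * m}"
  have "2 * (m div d) <= (2 * m) div d" using d by (subst less_eq_div_iff_mult_less_eq) auto
  hence "0 <= real ((2 * m) div d) - 2 * real (m div d)" by linarith
  thus "0 <= mangoldt d * (real ((2 * m) div d) - 2 * real (m div d))" by (intro mult_nonneg_nonneg mangoldt_nonneg)
 qed auto
 also have "... = ln (fact (2 * m)) - 2 * ln (fact m)" using ln_fact_eq_sum_mangoldt[of "2 * m" "2 * m"] ln_fact_eq_sum_mangoldt[of m "2 * m"]
  by (simp add: algebra_simps sum_subtractf sum_distrib_left)
 also have "... = ln (real ((2 * m) choose m))"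
 proof -
  have "real ((2 * m) choose m) = fact (2 * m) / (fact m * fact m)" by (subst binomial_fact) auto
  thus ?thesis by (simp add: ln_div ln_mult)
 qed
 also have "... <= ln (2 ^ (2 * m))" using binomial_le_pow2[of "2 * m" m] by simp
 also have "... = 2 * real m * ln 2" by (simp add: ln_realpow)
 also have "... <= 2 * real m" using ln_2_less_1 by (simp add: mult_left_le)
 finally show ?thesis by simp
qed

text \<open>Halving gives \<open>4 * m + 2 * m\<close>, which leaves \<open>2 * m\<close> of the
  allowed \<open>8 * m\<close> to pay for the extra summand, at most \<open>ln (2 * m + 1)\<close>,
  when \<open>n\<close> is odd.\<close>

lemma chebyshev_psi_le: "chebyshev_psi n <= 4 * real n"
proof (induction n rule: less_induct)
 case (less n)
 show ?case
 proof (cases "n = 0")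
  case True
  thus ?thesis by (simp add: chebyshev_psi_def)
 next
  case False
  define m where "m = n div 2"
  have IH: "chebyshev_psi m <= 4 * real m" using False less by (simp add: m_def)
  show ?thesis
  proof (cases "even n")
   case True
   thus ?thesis using chebyshev_psi_double[of m] IH by (simp add: m_def)
  next
   case False
   hence n: "n = Suc (2 * m)" by (simp add: m_def)
   have "mangoldt (Suc (2 * m)) <= ln (real (Suc (2 * m)))" by (rule mangoldt_le) simp
   also have "... <= 2 * real m" using ln_le_minus_one[of "real (Suc (2 * m))"] by simp
   finally show ?thesis using chebyshev_psi_double[of m] IH by (simp add: n chebyshev_psi_Suc)
  qed
 qed
qed

text \<open>Only prime powers \<open>p ^ j\<close> with \<open>j >= 2\<close> separate the two sums.
  They have \<open>p <= sqrt n\<close> and \<open>j <= log 2 n\<close>, and each contributes at most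
  \<open>ln n\<close>.\<close>

lemma chebyshev_psi_minus_theta:
 assumes "n >= 1"
 shows "\<bar>chebyshev_psi n - chebyshev_theta n\<bar> <= sqrt n * (log 2 n + 1) * ln n"
proof -
 define X where "X = {k \<in> {1..n}. primepow k & ~ prime k}"
 have "chebyshev_psi n - chebyshev_theta n = (\<Sum>k\<in>{1..n}. if primepow k & ~ prime k then mangoldt k else 0)"
  unfolding chebyshev_psi_def chebyshev_theta_def sum_subtractf[symmetric] by (intro sum.cong) (auto simp: mangoldt_def)
 also have "... = (\<Sum>k\<in>X. mangoldt k)" unfolding X_def by (rule sum.inter_filter[symmetric]) simp
 finally have eq: "chebyshev_psi n - chebyshev_theta n = (\<Sum>k\<in>X. mangoldt k)" .
 have "(\<Sum>k\<in>X. mangoldt k) <= (\<Sum>k\<in>X. ln (real n))"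
 proof (rule sum_mono)
  fix k assume "k \<in> X"
  hence k: "1 <= k" "k <= n" by (auto simp: X_def)
  hence "mangoldt k <= ln (real k)" by (intro mangoldt_le) auto
  also have "... <= ln (real n)" using k by simp
  finally show "mangoldt k <= ln (real n)" .
 qed
 also have "... = real (card X) * ln n" by simp
 also have "... <= (sqrt n * (log 2 n + 1)) * ln n"
 proof (intro mult_right_mono)
  have "X <= (%(p, j). p ^ j) ` ({1..nat \<lfloor>sqrt n\<rfloor>} \<times> {..nat \<lfloor>log 2 n\<rfloor>})"
  proof
   fix k assume "k \<in> X"
   hence k: "k <= n" "primepow k" "~ prime k" by (auto simp: X_def)
   then obtain p j where pj: "prime p" "j > 0" "k = p ^ j" by (auto simp: primepow_def)
   have "j ~= 1" using pj k by auto
   hence j: "j >= 2" using pj by simp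
   have p2: "p >= 2" using pj prime_ge_2_nat by blast
   have "p ^ 2 <= p ^ j" using j p2 by simp
   hence "real p <= sqrt n" using k pj by (intro real_le_rsqrt) auto
   hence "p <= nat \<lfloor>sqrt n\<rfloor>" by (simp add: le_nat_floor)
   moreover have "2 ^ j <= n" using order_trans[OF power_mono[OF p2, of j]] k(1) pj(3) by simp
   hence "2 powr real j <= real n" by (simp add: powr_realpow)
   hence "real j <= log 2 n" using assms by (subst le_log_iff) auto
   hence "j <= nat \<lfloor>log 2 n\<rfloor>" by (simp add: le_nat_floor)
   ultimately show "k \<in> (%(p, j). p ^ j) ` ({1..nat \<lfloor>sqrt n\<rfloor>} \<times> {..nat \<lfloor>log 2 n\<rfloor>})" using pj p2 by auto
  qed
  hence "card X <= card ((%(p, j). p ^ j) ` ({1..nat \<lfloor>sqrt n\<rfloor>} \<times> {..nat \<lfloor>log 2 n\<rfloor>}))"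
   by (intro card_mono) auto
  also have "... <= card ({1..nat \<lfloor>sqrt n\<rfloor>} \<times> {..nat \<lfloor>log 2 n\<rfloor>})" by (intro card_image_le) auto
  also have "... = nat \<lfloor>sqrt n\<rfloor> * (nat \<lfloor>log 2 n\<rfloor> + 1)" by simp
  finally have "real (card X) <= real (nat \<lfloor>sqrt n\<rfloor> * (nat \<lfloor>log 2 n\<rfloor> + 1))" by (simp only: of_nat_le_iff)
  also have "... = real (nat \<lfloor>sqrt n\<rfloor>) * (real (nat \<lfloor>log 2 n\<rfloor>) + 1)" by (simp only: of_nat_mult of_nat_add of_nat_1)
  also have "... <= sqrt n * (log 2 n + 1)"
  proof -
   have l: "log 2 n >= 0" using assms by simp
   have 1: "real (nat \<lfloor>log 2 n\<rfloor>) + 1 <= log 2 n + 1" using of_nat_floor[OF l] by simp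
   have 3: "0 <= sqrt (real n)" by simp
   have 4: "0 <= real (nat \<lfloor>log 2 n\<rfloor>) + 1" by simp
   show ?thesis by (rule mult_mono[OF of_nat_floor[OF 3] 1 3 4])
  qed
  finally show "real (card X) <= sqrt n * (log 2 n + 1)" .
 next
  show "0 <= ln (real n)" using assms by simp
 qed
 finally have "(\<Sum>k\<in>X. mangoldt k) <= sqrt n * (log 2 n + 1) * ln n" .
 moreover have "(\<Sum>k\<in>X. mangoldt k :: real) >= 0" by (intro sum_nonneg mangoldt_nonneg)
 ultimately show ?thesis unfolding eq by simp
qed

lemma chebyshev_theta_asymp:
 assumes "(%n. chebyshev_psi n / real n) \<longlonglongrightarrow> 1"
 shows "(%n. chebyshev_theta n / real n) \<longlonglongrightarrow> 1"
proof -
 have "(%n. (chebyshev_psi n - chebyshev_theta n) / real n) \<longlonglongrightarrow> 0"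
 proof (rule Lim_null_comparison)
  show "\<forall>\<^sub>F n in sequentially. norm ((chebyshev_psi n - chebyshev_theta n) / real n)
    <= sqrt n * (log 2 n + 1) * ln n / real n" using eventually_ge_at_top[of 1]
  proof eventually_elim
   case (elim n)
   thus ?case using chebyshev_psi_minus_theta[OF elim] by (simp add: divide_right_mono)
  qed
  show "(%n. sqrt (real n) * (log 2 (real n) + 1) * ln (real n) / real n) \<longlonglongrightarrow> 0" by real_asymp
 qed
 from tendsto_diff[OF assms this] show ?thesis by (simp add: diff_divide_distrib)
qed

section \<open>Newman's Tauberian theorem for Dirichlet series with bounded coefficients\<close>

lemma powr_mvt:
 fixes a u v :: real
 assumes "0 < u" "u < v"
 shows "\<exists>xi>u. xi < v & v powr a - u powr a = (v - u) * (a * xi powr (a - 1))"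
 by (rule MVT2[OF assms(2)]) (use assms in "auto intro!: derivative_eq_intros")

text \<open>The bound telescopes in \<open>n\<close>, so the tail of a Dirichlet series with bounded
  coefficients can be summed in closed form.\<close>

lemma powr_le_diff_neg:
 fixes x :: real and n :: nat
 assumes "x > 0" "n >= 1"
 shows "real (Suc n) powr (-1 - x) <= (real n powr (-x) - real (Suc n) powr (-x)) / x"
proof -
 obtain xi where xi: "xi > real n" "xi < real (Suc n)"
  "real (Suc n) powr (-x) - real n powr (-x) = (real (Suc n) - real n) * (-x * xi powr (-x - 1))"
  using powr_mvt[of "real n" "real (Suc n)" "-x"] assms by auto
 have "x * real (Suc n) powr (-x - 1) <= x * xi powr (-x - 1)" using xi assms by (auto intro!: powr_mono2')
 hence "x * real (Suc n) powr (-x - 1) <= real n powr (-x) - real (Suc n) powr (-x)" using xi(3) by simp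
 moreover have e: "-1 - x = -x - 1" by simp
 ultimately show ?thesis unfolding e using assms by (simp add: pos_le_divide_eq mult.commute)
qed

text \<open>Comparison with the integral of \<open>t powr (y - 1)\<close>. For \<open>y < 1\<close>
  the summands decrease and the first term suffices; for \<open>y >= 1\<close> they do not decrease,
  and the last summand has to be added.\<close>

lemma sum_powr_le:
 fixes y :: real
 assumes y: "y > 0"
 shows "(\<Sum>k<N. real (Suc k) powr (y - 1)) <= real N powr y / y + real N powr (y - 1)"
proof (cases "y >= 1")
 case True
 show ?thesis
 proof (induction N)
  case (Suc N)
  have "real N powr (y - 1) <= (real (Suc N) powr y - real N powr y) / y"
  proof (cases "N = 0")
   case True
   thus ?thesis using y by simp
  next
   case False
   obtain xi where xi: "xi > real N" "real (Suc N) powr y - real N powr y = (real (Suc N) - real N) * (y * xi powr (y - 1))"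
    using powr_mvt[of "real N" "real (Suc N)" y] False by auto
   show ?thesis using xi True xi(2) y by (auto intro!: powr_mono2)
  qed
  thus ?case using Suc y by (simp add: diff_divide_distrib)
 qed simp
next
 case False
 have "(\<Sum>k<N. real (Suc k) powr (y - 1)) <= real N powr y / y"
 proof (induction N)
  case (Suc N)
  have "real (Suc N) powr (y - 1) <= (real (Suc N) powr y - real N powr y) / y"
  proof (cases "N = 0")
   case True
   thus ?thesis using y False by simp
  next
   case N: False
   obtain xi where xi: "xi > real N" "xi < real (Suc N)" "real (Suc N) powr y - real N powr y = (real (Suc N) - real N) * (y * xi powr (y - 1))"
    using powr_mvt[of "real N" "real (Suc N)" y] N by auto
   show ?thesis using xi False xi(3) y by (auto intro!: powr_mono2')
  qed
  thus ?case using Suc y by (simp add: diff_divide_distrib)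
 qed simp
 thus ?thesis by (smt (verit) powr_ge_zero)
qed

text \<open>
 A closed path made of the right half circle and a path that returns on the left of the origin
 winds once around the origin, because the logarithms of \<open>z\<close> and \<open>-z\<close> are primitives of \<open>1 / z\<close>
 along the two pieces.
\<close>

lemma Cauchy_half_circle:
 fixes f :: "complex => complex" and R :: real
 defines "C \<equiv> part_circlepath 0 R (-pi/2) (pi/2)"
 assumes R: "R > 0" and S: "convex S" "open S" "f holomorphic_on S" "0 \<in> S"
  and C: "path_image C <= S"
  and p: "valid_path p" "path_image p <= S" "pathstart p = \<i> * R" "pathfinish p = - \<i> * R"
  and p2: "!!z. z \<in> path_image p ==> - z \<notin> \<real>\<^sub>\<le>\<^sub>0"
 shows "(%z. f z / z) contour_integrable_on C" (is ?g1) "(%z. f z / z) contour_integrable_on p"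
  "contour_integral C (%z. f z / z) + contour_integral p (%z. f z / z) = 2 * pi * \<i> * f 0"
proof -
 have ends: "pathstart C = - \<i> * R" "pathfinish C = \<i> * R" by (auto simp: complex_eq_iff Re_exp Im_exp C_def)
 have vC: "valid_path C" by (simp add: C_def)
 have CE: "norm z = R" "Re z >= 0" if "z \<in> path_image C" for z
 proof -
  from that obtain x where x: "x \<in> closed_segment (-pi/2) (pi/2)" "z = of_real R * cis x" unfolding C_def path_image_part_circlepath' by auto
  thus "norm z = R" using R by (simp add: norm_mult)
  have "cos x >= 0" using x by (auto simp: closed_segment_eq_real_ivl intro!: cos_ge_zero)
  thus "Re z >= 0" using x R by simp
 qed
 have C2: "z \<notin> \<real>\<^sub>\<le>\<^sub>0" if "z \<in> path_image C" for z
  using CE[OF that] R by (auto simp: complex_nonpos_Reals_iff norm_complex_def)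
 define gm where "gm = C +++ p"
 have gm: "valid_path gm" "pathfinish gm = pathstart gm" "path_image gm <= S - {0}"
 proof -
  show "valid_path gm" unfolding gm_def using vC p ends by simp
  show "pathfinish gm = pathstart gm" unfolding gm_def using p ends by simp
  have "path_image gm <= path_image C \<union> path_image p" unfolding gm_def by (rule path_image_join_subset)
  moreover have "0 \<notin> path_image C" "0 \<notin> path_image p" using C2[of 0] p2[of 0] by auto
  ultimately show "path_image gm <= S - {0}" using C p(2) by blast
 qed
 have int: "((%z. g z / z) has_contour_integral (2 * pi * \<i> * winding_number gm 0 * g 0)) gm"
  if "g holomorphic_on S" for g using Cauchy_integral_formula_convex_simple[OF S(1) that _ gm(1,3,2)] S by (simp add: interior_open)
 have splitint: "(%z. g z / z) contour_integrable_on C" "(%z. g z / z) contour_integrable_on p"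
  "contour_integral C (%z. g z / z) + contour_integral p (%z. g z / z) = 2 * pi * \<i> * winding_number gm 0 * g 0"
  if "g holomorphic_on S" for g
 proof -
  have i: "(%z. g z / z) contour_integrable_on (C +++ p)" using int[OF that] unfolding gm_def contour_integrable_on_def by blast
  show 1: "(%z. g z / z) contour_integrable_on C" "(%z. g z / z) contour_integrable_on p"
   using contour_integrable_joinD1[OF i vC] contour_integrable_joinD2[OF i p(1)] by auto
  show "contour_integral C (%z. g z / z) + contour_integral p (%z. g z / z) = 2 * pi * \<i> * winding_number gm 0 * g 0"
   using contour_integral_unique[OF int[OF that]] contour_integral_join[OF 1 vC p(1)] by (simp add: gm_def)
 qed
 \<comment> \<open>The winding number of \<open>gm\<close> is not computed geometrically: the Cauchy
   formula for the constant function 1 expresses it by the integrals of \<open>1 / z\<close>, which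
   the two primitives evaluate.\<close>
 have "((%z. 1 / z) has_contour_integral (Ln (pathfinish C) - Ln (pathstart C))) C"
  by (rule contour_integral_primitive[of "- \<real>\<^sub>\<le>\<^sub>0"])
    (use vC C2 in "auto intro!: derivative_eq_intros simp: divide_inverse")
 hence i1: "contour_integral C (%z. 1 / z) = Ln (\<i> * R) - Ln (- \<i> * R)" unfolding ends by (rule contour_integral_unique)
 have "((%z. 1 / z) has_contour_integral (Ln (- pathfinish p) - Ln (- pathstart p))) p"
  by (rule contour_integral_primitive[of "{z. - z \<notin> \<real>\<^sub>\<le>\<^sub>0}"])
    (use p p2 in "auto intro!: derivative_eq_intros simp: divide_inverse")
 hence i2: "contour_integral p (%z. 1 / z) = Ln (\<i> * R) - Ln (- \<i> * R)" unfolding p by (simp add: contour_integral_unique)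
 show ?g1 "(%z. f z / z) contour_integrable_on p"
  "contour_integral C (%z. f z / z) + contour_integral p (%z. f z / z) = 2 * pi * \<i> * f 0"
   using R Ln_times_of_real[of R \<i>] Ln_times_of_real[of R "-\<i>"] splitint(3)[of "%_. 1"] splitint[OF S(3)] unfolding i1 i2 by (simp_all add: mult.commute Ln_of_real)
qed

text \<open>On the circle \<open>1 / z = cnj z / R ^ 2\<close>, so the kernel becomes the real
  number \<open>2 * Re z / R ^ 2\<close>. Its zero on the imaginary axis absorbs the factor
  \<open>1 / Re z\<close> in the bounds for the tail and for the partial sums.\<close>

lemma norm_Newman_kernel:
 assumes "norm z = R" "R > 0"
 shows "norm ((1 + z\<^sup>2 / complex_of_real R ^ 2) / z) = 2 * \<bar>Re z\<bar> / R\<^sup>2"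
proof -
 have z0: "z ~= 0" using assms by auto
 have zz: "z * cnj z = complex_of_real R ^ 2" using assms(1) complex_norm_square[of z] by simp
 have R0: "complex_of_real R ^ 2 ~= 0" using assms(2) by simp
 have "(1 + z\<^sup>2 / complex_of_real R ^ 2) / z = (cnj z + z) / complex_of_real R ^ 2"
  using z0 R0 zz[symmetric] by (simp add: field_simps power2_eq_square)
 also have "cnj z + z = complex_of_real (2 * Re z)" using complex_add_cnj[of z] by (simp add: add.commute)
 finally show ?thesis by (simp add: norm_divide norm_power)
qed

text \<open>The kernel \<open>w z / z\<close> has residue 1 at 0, so \<open>F 0 - S N 0\<close> is a
  contour integral. On the right half circle \<open>F - S N\<close> is a tail. To the left the two
  functions are separated: \<open>S N\<close> is entire and keeps the circle, while \<open>F\<close>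
  is only known slightly beyond the axis and gets the path \<open>p\<close>, whose horizontal sides
  are short and whose vertical side is damped by \<open>N powr z\<close>. The half circles cost a
  multiple of \<open>C / R\<close>, uniformly in \<open>N\<close>.\<close>

lemma Newman_tauberian:
 fixes b :: "nat => real" and F :: "complex => complex"
 assumes C: "C > 0" "!!n. \<bar>b n\<bar> <= C" and A: "open A" "{z. Re z >= 0} <= A" "F holomorphic_on A"
  and F: "!!z. Re z > 0 ==> (%n. of_real (b n) * of_nat (Suc n) powr (- 1 - z)) sums F z"
 shows "(%n. of_real (b n) / of_nat (Suc n)) sums F 0"
proof -
 define S where "S N z = (\<Sum>n<N. complex_of_real (b n) * of_nat (Suc n) powr (- 1 - z))" for N z
 have holS: "S N holomorphic_on X" for N X unfolding S_def by (intro holomorphic_intros)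
 have tail: "norm (F z - S N z) <= C * (real N powr (- Re z) / Re z)" if z: "Re z > 0" and N: "N >= 1" for N z
 proof -
  define g where "g n = C * ((real (N + n) powr (- Re z) - real (N + Suc n) powr (- Re z)) / Re z)" for n
  have "(%n. real (N + n) powr (- Re z)) \<longlonglongrightarrow> 0" using filterlim_compose[OF filterlim_real_sequentially filterlim_add_const_nat_at_top[of N]] z
   by (auto simp: add.commute intro!: tendsto_neg_powr)
  hence "(%n. real (N + n) powr (- Re z) - real (N + Suc n) powr (- Re z)) sums (real (N + 0) powr (- Re z) - 0)" by (rule telescope_sums')
  hence g: "g sums (C * ((real N powr (- Re z) - 0) / Re z))" unfolding g_def by (intro sums_mult sums_divide) simp
  have bnd: "norm (of_real (b (n + N)) * complex_of_nat (Suc (n + N)) powr (- 1 - z)) <= g n" for n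
  proof -
   have "norm (of_real (b (n + N)) * complex_of_nat (Suc (n + N)) powr (- 1 - z)) =
     \<bar>b (n + N)\<bar> * real (Suc (n + N)) powr (- 1 - Re z)" by (simp add: norm_mult norm_powr_real_powr)
   also have "... <= C * ((real (n + N) powr (- Re z) - real (Suc (n + N)) powr (- Re z)) / Re z)"
    using C powr_le_diff_neg[of "Re z" "n + N"] z N by (intro mult_mono) auto
   finally show ?thesis by (simp add: g_def add_ac)
  qed
  have "(%n. of_real (b (n + N)) * complex_of_nat (Suc (n + N)) powr (- 1 - z)) sums (F z - S N z)"
   unfolding S_def by (rule sums_split_initial_segment[OF F[OF z]])
  hence "F z - S N z = (\<Sum>n. of_real (b (n + N)) * complex_of_nat (Suc (n + N)) powr (- 1 - z))" by (rule sums_unique)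
  also have "norm ... <= suminf g" by (rule norm_suminf_le[OF bnd]) (use g sums_summable in blast)
  also have "... = C * (real N powr (- Re z) / Re z)" using sums_unique[OF g] by simp
  finally show ?thesis .
 qed
 have head: "norm (S N z) <= C * (real N powr (- Re z) / (- Re z) + real N powr (- Re z - 1))"
  if "Re z < 0" for N z
 proof -
  have "norm (S N z) <= (\<Sum>n<N. C * real (Suc n) powr (- Re z - 1))" unfolding S_def
  proof (rule sum_norm_le)
   fix n
   have "norm (complex_of_real (b n) * of_nat (Suc n) powr (- 1 - z)) = \<bar>b n\<bar> * real (Suc n) powr (- 1 - Re z)"
    by (simp add: norm_mult norm_powr_real_powr)
   also have "... <= C * real (Suc n) powr (- Re z - 1)"
   proof -
    have "- 1 - Re z = - Re z - 1" by simp
    thus ?thesis using C by (simp only:) (intro mult_right_mono, auto)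
   qed
   finally show "norm (complex_of_real (b n) * of_nat (Suc n) powr (- 1 - z)) <= C * real (Suc n) powr (- Re z - 1)" .
  qed
  also have "... = C * (\<Sum>n<N. real (Suc n) powr (- Re z - 1))" by (simp add: sum_distrib_left)
  also have "... <= C * (real N powr (- Re z) / (- Re z) + real N powr (- Re z - 1))" using sum_powr_le[of "- Re z" N] that C by simp
  finally show ?thesis .
 qed
 have "(%N. S N 0) \<longlonglongrightarrow> F 0"
 proof (rule LIMSEQ_I)
  fix eps :: real assume eps: "eps > 0"
  \<comment> \<open>The half circles contribute \<open>2 * C * pi / R\<close> and
    \<open>4 * C * pi / R\<close>, together at most \<open>eps * pi\<close>.\<close>
  define R where "R = max 1 (6 * C / eps)"
  have R: "R >= 1" "6 * C / R <= eps"
  proof -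
   show "R >= 1" by (simp add: R_def)
   have "6 * C / eps <= R" by (simp add: R_def)
   thus "6 * C / R <= eps" using eps \<open>R >= 1\<close> by (simp add: field_simps)
  qed
  \<comment> \<open>\<open>A\<close> is merely open, so a uniform width \<open>e\<close> to the left
    of the axis comes from the compactness of a segment. The rectangle \<open>U\<close> is then
    convex, as \<open>Cauchy_half_circle\<close> requires.\<close>
  have K0: "compact ((%y. \<i> * of_real y) ` {- (R + 1)..R + 1})" "(%y. \<i> * of_real y) ` {- (R + 1)..R + 1} <= A"
   using A(2) by (auto intro!: compact_continuous_image continuous_intros)
  obtain e where e: "e > 0" "(\<Union>x\<in>(%y. \<i> * of_real y) ` {- (R + 1)..R + 1}. ball x e) <= A"
   using compact_subset_open_imp_ball_epsilon_subset[OF K0(1) A(1) K0(2)] by blast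
  define U where "U = {z. - e < Re z & - (R + 1) < Im z & Im z < R + 1}"
  have U: "convex U" "open U" "U <= A"
  proof -
   have "U = {z. - e < Re z} \<inter> {z. - (R + 1) < Im z} \<inter> {z. Im z < R + 1}" by (auto simp: U_def)
   thus "convex U" "open U"
    by (auto intro!: convex_Int convex_halfspace_Re_gt convex_halfspace_Im_gt convex_halfspace_Im_lt open_halfspace_Re_gt open_halfspace_Im_gt open_halfspace_Im_lt)
   show "U <= A"
   proof
    fix z assume z: "z \<in> U"
    show "z \<in> A"
    proof (cases "Re z >= 0")
     case False
     have "z \<in> ball (\<i> * of_real (Im z)) e" using False z by (auto simp: dist_norm norm_complex_def U_def)
     moreover have "Im z \<in> {- (R + 1)..R + 1}" using z by (simp add: U_def)
     ultimately show ?thesis using e(2) by blast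
    qed (use A(2) in auto)
   qed
  qed
  have holF: "F holomorphic_on U" using A(3) U(3) holomorphic_on_subset by blast
  define Kc where "Kc = cbox (Complex (- e / 2) (- R)) (Complex 0 R)"
  have Kc: "z \<in> Kc \<longleftrightarrow> - e / 2 <= Re z & Re z <= 0 & - R <= Im z & Im z <= R" for z by (auto simp: Kc_def in_cbox_complex_iff)
  have KU: "Kc <= U" using e(1) by (auto simp: Kc U_def)
  define k where "k z = F z * (1 + z\<^sup>2 / complex_of_real R ^ 2)" for z
  have "continuous_on Kc k" unfolding k_def using holomorphic_on_imp_continuous_on[OF holF] KU R(1)
   by (intro continuous_intros) (auto intro: continuous_on_subset)
  hence "bounded (k ` Kc)" by (intro compact_imp_bounded compact_continuous_image) (auto simp: Kc_def)
  then obtain M where M: "M > 0" "!!z. z \<in> Kc ==> norm (k z) <= M" unfolding bounded_pos by auto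
  \<comment> \<open>\<open>dl\<close> is fixed before \<open>N\<close>: the two horizontal sides of
    \<open>p\<close> have length \<open>dl\<close> and cost at most \<open>M / R * dl\<close> each,
    and the integral over the vertical side at real part \<open>- dl\<close> tends to 0 as
    \<open>N\<close> grows.\<close>
  define dl where "dl = min (e / 2) (eps * R / M)"
  have dl: "dl > 0" "dl <= e / 2" "M / R * dl <= eps"
  proof -
   show "dl > 0" using e M eps R by (auto simp: dl_def)
   show "dl <= e / 2" unfolding dl_def by (rule min.cobounded1)
   have "dl <= eps * R / M" by (simp add: dl_def)
   thus "M / R * dl <= eps" using M R by (simp add: field_simps)
  qed
  have "(%N. M * real N powr (- dl) / dl * (2 * R)) \<longlonglongrightarrow> M * 0 / dl * (2 * R)"
   using dl(1) by (intro tendsto_intros tendsto_neg_powr filterlim_real_sequentially) auto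
  hence "\<forall>\<^sub>F N in sequentially. M * real N powr (- dl) / dl * (2 * R) < eps" using eps by (intro order_tendstoD) auto
  then obtain N0 where N0: "!!N. N >= N0 ==> M * real N powr (- dl) / dl * (2 * R) < eps" unfolding eventually_sequentially by blast
  show "\<exists>N0. \<forall>N\<ge>N0. norm (S N 0 - F 0) < eps"
  proof (intro exI allI impI)
   \<comment> \<open>\<open>N >= R\<close> controls the second term of \<open>head\<close>: on the
     left half circle it leads to the factor \<open>1 + y / N\<close> with \<open>y <= R\<close>,
     which is at most 2.\<close>
   fix N assume N: "N >= max (max 1 N0) (nat \<lceil>R\<rceil>)"
   hence N1: "N >= 1" "N >= N0" "real N >= R" by auto
   define w where "w z = of_nat N powr z * (1 + z\<^sup>2 / complex_of_real R ^ 2)" for z :: complex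
   have holw: "w holomorphic_on X" for X unfolding w_def by (intro holomorphic_intros) auto
   have nw: "norm (w z / z) = real N powr Re z * (2 * \<bar>Re z\<bar> / R\<^sup>2)" if "norm z = R" for z
   proof -
    have "w z / z = of_nat N powr z * ((1 + z\<^sup>2 / complex_of_real R ^ 2) / z)" by (simp add: w_def)
    thus ?thesis using norm_Newman_kernel[OF that] R(1) by (simp only: norm_mult) (simp add: norm_powr_real_powr)
   qed
   define Cp where "Cp = part_circlepath 0 R (-pi/2) (pi/2)"
   define Cm where "Cm = part_circlepath 0 R (pi/2) (3*pi/2)"
   define p where "p = linepath (\<i> * R) (\<i> * R - dl) +++ linepath (\<i> * R - dl) (- \<i> * R - dl) +++
    linepath (- \<i> * R - dl) (- \<i> * R)"
   have CpE: "norm z = R" "Re z >= 0" if "z \<in> path_image Cp" for z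
   proof -
    from that obtain x where x: "x \<in> closed_segment (-pi/2) (pi/2)" "z = of_real R * cis x"
     unfolding Cp_def path_image_part_circlepath' by auto
    thus "norm z = R" using R by (simp add: norm_mult)
    have "cos x >= 0" using x by (auto simp: closed_segment_eq_real_ivl intro!: cos_ge_zero)
    thus "Re z >= 0" using x R by simp
   qed
   have CmE: "norm z = R" "Re z <= 0" if "z \<in> path_image Cm" for z
   proof -
    from that obtain x where x: "x \<in> closed_segment (pi/2) (3*pi/2)" "z = of_real R * cis x"
     unfolding Cm_def path_image_part_circlepath' by auto
    thus "norm z = R" using R by (simp add: norm_mult)
    have "x \<in> {pi/2..3*pi/2}" using x by (auto simp: closed_segment_eq_real_ivl)
    hence "cos (x - pi) >= 0" by (intro cos_ge_zero) auto
    thus "Re z <= 0" using x R by (simp add: mult_nonneg_nonpos)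
   qed
   have Imle: "\<bar>Im z\<bar> <= R" if "norm z = R" for z using abs_Im_le_cmod[of z] that by simp
   have CpU: "path_image Cp <= U"
   proof
    fix z assume "z \<in> path_image Cp"
    hence "norm z = R" "Re z >= 0" using CpE by auto
    thus "z \<in> U" using Imle[of z] e(1) by (auto simp: U_def)
   qed
   have cxK: "convex Kc" unfolding Kc_def by simp
   have cxI: "convex {z. Im z = c}" and cxR: "convex {z. Re z = c}" for c by (auto simp: convex_def simp flip: distrib_right)
   have seg1: "closed_segment (\<i> * R) (\<i> * R - dl) <= Kc \<inter> {z. Im z = R}"
    using R dl by (intro closed_segment_subset convex_Int) (auto simp: Kc cxK cxI cxR)
   have seg2: "closed_segment (\<i> * R - dl) (- \<i> * R - dl) <= Kc \<inter> {z. Re z = - dl}"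
    using R dl by (intro closed_segment_subset convex_Int) (auto simp: Kc cxK cxI cxR)
   have seg3: "closed_segment (- \<i> * R - dl) (- \<i> * R) <= Kc \<inter> {z. Im z = - R}"
    using R dl by (intro closed_segment_subset convex_Int) (auto simp: Kc cxK cxI cxR)
   have pE: "z \<in> Kc" "- z \<notin> \<real>\<^sub>\<le>\<^sub>0" if "z \<in> path_image p" for z
   proof -
    show "z \<in> Kc" "- z \<notin> \<real>\<^sub>\<le>\<^sub>0" using that seg1 seg2 seg3 R(1) dl(1) by (auto simp: path_image_join complex_nonpos_Reals_iff p_def)
   qed
   have vp: "valid_path p" "pathstart p = \<i> * R" "pathfinish p = - \<i> * R" unfolding p_def by auto
   have CmEnds: "pathstart Cm = \<i> * R" "pathfinish Cm = - \<i> * R" using cos_3over2_pi sin_3over2_pi by (auto simp: complex_eq_iff Re_exp Im_exp Cm_def)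
   have CmNeg: "- z \<notin> \<real>\<^sub>\<le>\<^sub>0" if "z \<in> path_image Cm" for z
    using CmE[OF that] R by (auto simp: complex_nonpos_Reals_iff norm_complex_def)
   have I1: "(%z. F z * w z / z) contour_integrable_on Cp" "(%z. F z * w z / z) contour_integrable_on p"
    "contour_integral Cp (%z. F z * w z / z) + contour_integral p (%z. F z * w z / z) = 2 * pi * \<i> * (F 0 * w 0)"
    using Cauchy_half_circle[of R U "%z. F z * w z" p, folded Cp_def] R(1) U(1,2) CpU vp pE KU e(1) holomorphic_on_mult[OF holF holw] by (auto simp: U_def)
   have I2: "(%z. S N z * w z / z) contour_integrable_on Cp" "(%z. S N z * w z / z) contour_integrable_on Cm"
    "contour_integral Cp (%z. S N z * w z / z) + contour_integral Cm (%z. S N z * w z / z) = 2 * pi * \<i> * (S N 0 * w 0)"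
    using Cauchy_half_circle[of R UNIV "%z. S N z * w z" Cm, folded Cp_def] R(1) CmEnds CmNeg
     holomorphic_on_mult[OF holS holw] by (auto simp: Cm_def)
   have w0: "w 0 = 1" using N1 by (simp add: w_def)
   have eq: "2 * pi * \<i> * (F 0 - S N 0) = contour_integral Cp (%z. (F z - S N z) * w z / z)
    + contour_integral p (%z. F z * w z / z) - contour_integral Cm (%z. S N z * w z / z)"
   proof -
    have d: "contour_integral Cp (%z. (F z - S N z) * w z / z) =
     contour_integral Cp (%z. F z * w z / z) - contour_integral Cp (%z. S N z * w z / z)"
     using contour_integral_diff[OF I1(1) I2(1)] by (simp add: left_diff_distrib diff_divide_distrib)
    have "2 * pi * \<i> * (F 0 - S N 0) = 2 * pi * \<i> * (F 0 * w 0) - 2 * pi * \<i> * (S N 0 * w 0)" by (simp add: w0 right_diff_distrib)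
    thus ?thesis unfolding I1(3)[symmetric] I2(3)[symmetric] d by simp
   qed
   have B1: "norm (contour_integral Cp (%z. (F z - S N z) * w z / z)) <= (2 * C / R\<^sup>2) * R * \<bar>pi/2 - (-pi/2)\<bar>" unfolding Cp_def
   proof (rule contour_integral_bound_part_circlepath)
    show "(%z. (F z - S N z) * w z / z) contour_integrable_on part_circlepath 0 R (-pi/2) (pi/2)"
     using contour_integrable_diff[OF I1(1) I2(1)] unfolding Cp_def by (simp add: left_diff_distrib diff_divide_distrib)
    fix z assume "z \<in> path_image (part_circlepath 0 R (-pi/2) (pi/2))"
    hence z: "norm z = R" "Re z >= 0" using CpE[of z] by (auto simp: Cp_def)
    have "norm ((F z - S N z) * w z / z) = norm (F z - S N z) * (real N powr Re z * (2 * \<bar>Re z\<bar> / R\<^sup>2))"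
     by (simp only: times_divide_eq_right[symmetric] norm_mult nw[OF z(1)])
    also have "... <= 2 * C / R\<^sup>2"
    proof (cases "Re z = 0")
     case False
     hence "norm (F z - S N z) * (real N powr Re z * (2 * \<bar>Re z\<bar> / R\<^sup>2)) <=
       C * (real N powr (- Re z) / Re z) * (real N powr Re z * (2 * \<bar>Re z\<bar> / R\<^sup>2))"
      using z tail[of z N] N1 by (intro mult_right_mono) auto
     also have "... = 2 * C / R\<^sup>2 * (real N powr (- Re z) * real N powr Re z)" using False z by simp
     also have "real N powr (- Re z) * real N powr Re z = 1" using N1 by (simp flip: powr_add)
     finally show ?thesis by simp
    qed (use C in simp)
    finally show "norm ((F z - S N z) * w z / z) <= 2 * C / R\<^sup>2" .
   qed (use C R in auto)
   have B2: "norm (contour_integral Cm (%z. S N z * w z / z)) <= (4 * C / R\<^sup>2) * R * \<bar>3*pi/2 - pi/2\<bar>" unfolding Cm_def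
   proof (rule contour_integral_bound_part_circlepath)
    show "(%z. S N z * w z / z) contour_integrable_on part_circlepath 0 R (pi/2) (3*pi/2)" using I2(2) by (simp add: Cm_def)
    fix z assume "z \<in> path_image (part_circlepath 0 R (pi/2) (3*pi/2))"
    hence z: "norm z = R" "Re z <= 0" using CmE[of z] by (auto simp: Cm_def)
    have "norm (S N z * w z / z) = norm (S N z) * (real N powr Re z * (2 * \<bar>Re z\<bar> / R\<^sup>2))"
     by (simp only: times_divide_eq_right[symmetric] norm_mult nw[OF z(1)])
    also have "... <= 4 * C / R\<^sup>2"
    proof (cases "Re z = 0")
     case False
     define y where "y = - Re z"
     have y: "y > 0" "y <= R" using False z abs_Re_le_cmod[of z] by (auto simp: y_def)
     have "norm (S N z) * (real N powr Re z * (2 * \<bar>Re z\<bar> / R\<^sup>2)) <=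
       C * (real N powr y / y + real N powr (y - 1)) * (real N powr (- y) * (2 * y / R\<^sup>2))"
     proof -
      have Rez: "Re z = - y" by (simp add: y_def)
      have h: "norm (S N z) <= C * (real N powr y / y + real N powr (y - 1))" using head[of z N] y(1) by (simp add: y_def)
      show ?thesis unfolding Rez using h y C R by (intro mult_mono) auto
     qed
     also have "... = C * (real N powr y * real N powr (- y)) * (1 / y + real N powr (- 1)) * (2 * y / R\<^sup>2)"
      by (simp add: algebra_simps powr_diff)
     also have "real N powr y * real N powr (- y) = 1" using N1 by (simp flip: powr_add)
     also have "C * 1 * (1 / y + real N powr (- 1)) * (2 * y / R\<^sup>2) = 2 * C / R\<^sup>2 * (1 + y / real N)"
      using y N1 by (simp add: field_simps)
     also have "... <= 2 * C / R\<^sup>2 * 2" using y N1 C R by (intro mult_left_mono) auto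
     finally show ?thesis by simp
    qed (use C in simp)
    finally show "norm (S N z * w z / z) <= 4 * C / R\<^sup>2" .
   qed (use C R in auto)
   have pw: "real N powr Re z <= 1" if "Re z <= 0" for z using powr_mono[of "Re z" 0 "real N"] that N1 by simp
   have fw: "norm (F z * w z / z) = norm (k z) * real N powr Re z / norm z" for z
    by (simp add: k_def w_def norm_mult norm_divide norm_powr_real_powr)
   have B3: "norm (contour_integral p (%z. F z * w z / z)) <=
     M / R * dl + (M * real N powr (- dl) / dl * (2 * R) + M / R * dl)"
   proof -
    let ?f = "%z. F z * w z / z"
    define L1 where "L1 = linepath (\<i> * R) (\<i> * R - dl)"
    define L2 where "L2 = linepath (\<i> * R - dl) (- \<i> * R - dl)"
    define L3 where "L3 = linepath (- \<i> * R - dl) (- \<i> * R)"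
    have p: "p = L1 +++ (L2 +++ L3)" by (simp add: p_def L1_def L2_def L3_def)
    have v: "valid_path L1" "valid_path L2" "valid_path L3" "valid_path (L2 +++ L3)" by (auto simp: L1_def L2_def L3_def)
    have i1: "?f contour_integrable_on L1" and i23: "?f contour_integrable_on (L2 +++ L3)" using I1(2) v unfolding p by auto
    have i2: "?f contour_integrable_on L2" and i3: "?f contour_integrable_on L3" using i23 v by auto
    have "contour_integral p ?f = contour_integral L1 ?f + (contour_integral L2 ?f + contour_integral L3 ?f)"
     unfolding p using contour_integral_join[OF i1 i23 v(1,4)] contour_integral_join[OF i2 i3 v(2,3)] by simp
    moreover have subs: "path_image L1 <= path_image p" "path_image L2 <= path_image p" "path_image L3 <= path_image p"
     unfolding p by (auto simp: path_image_join L1_def L2_def L3_def)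
    have "norm (contour_integral L1 ?f) <= M / R * norm ((\<i> * R - dl) - \<i> * R)" unfolding L1_def
    proof (rule contour_integral_bound_linepath)
     fix z assume z: "z \<in> closed_segment (\<i> * R) (\<i> * R - dl)"
     hence zp: "z \<in> path_image p" using subs(1) by (auto simp: L1_def)
     have nz: "R <= norm z" using z seg1 abs_Im_le_cmod[of z] R by force
     have "norm (k z) * real N powr Re z / norm z <= M * 1 / R" using pE(1)[OF zp] M nz R pw[of z] by (intro frac_le mult_mono) (auto simp: Kc)
     thus "norm (?f z) <= M / R" unfolding fw by simp
    qed (use i1 M R in "auto simp: L1_def")
    moreover have "norm (contour_integral L3 ?f) <= M / R * norm (- \<i> * R - (- \<i> * R - dl))" unfolding L3_def
    proof (rule contour_integral_bound_linepath)
     fix z assume z: "z \<in> closed_segment (- \<i> * R - dl) (- \<i> * R)"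
     hence zp: "z \<in> path_image p" using subs(3) by (auto simp: L3_def)
     have nz: "R <= norm z" using z seg3 abs_Im_le_cmod[of z] R by auto
     have "norm (k z) * real N powr Re z / norm z <= M * 1 / R" using pE(1)[OF zp] M nz R pw[of z] by (intro frac_le mult_mono) (auto simp: Kc)
     thus "norm (?f z) <= M / R" unfolding fw by simp
    qed (use i3 M R in "auto simp: L3_def")
    moreover have "norm (contour_integral L2 ?f) <= M * real N powr (- dl) / dl * norm ((- \<i> * R - dl) - (\<i> * R - dl))" unfolding L2_def
    proof (rule contour_integral_bound_linepath)
     fix z assume z: "z \<in> closed_segment (\<i> * R - dl) (- \<i> * R - dl)"
     hence zp: "z \<in> path_image p" using subs(2) by (auto simp: L2_def)
     have Rez: "Re z = - dl" using z seg2 by blast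
     hence nz: "dl <= norm z" using abs_Re_le_cmod[of z] by simp
     show "norm (?f z) <= M * real N powr (- dl) / dl" using pE(1)[OF zp] M nz dl unfolding Rez fw by (intro frac_le mult_right_mono) auto
    qed (use i2 M dl in "auto simp: L2_def")
    moreover have "norm ((\<i> * R - dl) - \<i> * R) = dl" "norm (- \<i> * R - (- \<i> * R - dl)) = dl"
     "norm ((- \<i> * R - dl) - (\<i> * R - dl)) = 2 * R" using dl R by (auto simp: norm_mult)
    ultimately show ?thesis by (smt (verit) norm_triangle_ineq)
   qed
   have "2 * pi * norm (S N 0 - F 0) = norm (2 * pi * \<i> * (F 0 - S N 0))" by (simp add: norm_mult norm_minus_commute)
   also have "... <= (2 * C / R\<^sup>2) * R * pi + (eps + (eps + eps)) + (4 * C / R\<^sup>2) * R * pi"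
    unfolding eq using B1 B2 B3 dl(3) N0[OF N1(2)]
    by (smt (verit) norm_triangle_ineq norm_triangle_ineq4 abs_of_pos pi_gt_zero field_sum_of_halves)
   also have "... = (6 * C / R) * pi + 3 * eps" by (simp add: power2_eq_square)
   also have "... <= eps * pi + 3 * eps" using R(2) by (intro add_right_mono mult_right_mono) auto
   also have "... < eps * pi + pi * eps" using eps pi_gt3 by simp
   finally show "norm (S N 0 - F 0) < eps" using mult_less_cancel_left_pos[OF pi_gt_zero] by simp
  qed
 qed
 moreover have "S N 0 = (\<Sum>n<N. of_real (b n) / of_nat (Suc n))" for N
  unfolding S_def by (intro sum.cong refl) (simp add: powr_minus divide_inverse)
 ultimately show ?thesis unfolding sums_def by simp
qed

section \<open>The zeta function for \<open>Re s > 0\<close> and its logarithmic derivative\<close>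

lemma holomorphic_suminf:
 fixes f :: "nat => complex => complex"
 assumes S: "open S" and hol: "!!n. f n holomorphic_on S"
  and M: "!!x. x \<in> S ==> \<exists>d M. d > 0 & cball x d <= S & summable M & (\<forall>n. \<forall>y\<in>cball x d. norm (f n y) <= M n)"
 shows "(%s. \<Sum>n. f n s) holomorphic_on S"
  and "!!x. x \<in> S ==> (%n. deriv (f n) x) sums deriv (%s. \<Sum>n. f n s) x"
proof -
 have ul: "\<exists>d. 0 < d & cball x d <= S & uniform_limit (cball x d) (%n s. \<Sum>k<n. f k s) (%s. \<Sum>n. f n s) sequentially"
  if x: "x \<in> S" for x using M[OF x] by (auto intro!: Weierstrass_m_test)
 show 1: "(%s. \<Sum>n. f n s) holomorphic_on S" by (rule holomorphic_uniform_sequence[OF S _ ul]) (auto intro!: holomorphic_intros hol)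
 show "(%n. deriv (f n) x) sums deriv (%s. \<Sum>n. f n s) x" if x: "x \<in> S" for x
 proof -
  have d: "((%s. \<Sum>k<n. f k s) has_field_derivative (\<Sum>k<n. deriv (f k) x)) (at x)" if "x \<in> S" for n x
   using hol S that by (intro DERIV_sum holomorphic_derivI) auto
  from has_complex_derivative_uniform_sequence[OF S d ul]
  obtain g' where "!!x. x \<in> S ==> ((%s. \<Sum>n. f n s) has_field_derivative g' x) (at x)"
   "!!x. x \<in> S ==> (%n. \<Sum>k<n. deriv (f k) x) \<longlonglongrightarrow> g' x" by metis
  thus ?thesis using x DERIV_imp_deriv unfolding sums_def by metis
 qed
qed

text \<open>
 Subtracting the telescoping series of \<open>n\<^bsup>1-s\<^esup>\<close> from \<open>(s - 1) \<zeta>(s)\<close> leaves a series that converges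
 for \<open>Re s > 0\<close>.
\<close>

definition zeta_term :: "nat => complex => complex" where
 "zeta_term n s = (s - 1) * of_nat (Suc n) powr (- s) + of_nat (n + 2) powr (1 - s) - of_nat (Suc n) powr (1 - s)"

lemma zeta_term_holomorphic: "zeta_term n holomorphic_on A" unfolding zeta_term_def by (intro holomorphic_intros)

text \<open>\<open>zeta_term n s\<close> is the remainder of the Taylor polynomial of degree 1 for
  \<open>x powr (1 - s)\<close>, taken from \<open>n + 1\<close> to \<open>n + 2\<close>. The second
  derivative gains one power of \<open>n\<close> over the summand
  \<open>(s - 1) * (n + 1) powr (- s)\<close>, which gives convergence for
  \<open>Re s > 0\<close>.\<close>

lemma norm_zeta_term_le:
 assumes "Re s >= -1"
 shows "norm (zeta_term n s) <= norm s * norm (s - 1) * real (Suc n) powr (- Re s - 1)"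
proof -
 define a b where "a = complex_of_nat (Suc n)" and "b = complex_of_nat (n + 2)"
 define f where "f i x = (if i = 0 then x powr (1 - s) else if i = 1 then (1 - s) * x powr (- s)
  else (1 - s) * (- s) * x powr (- s - 1))" for i :: nat and x :: complex
 define T where "T = closed_segment a b"
 have T: "x \<notin> \<real>\<^sub>\<le>\<^sub>0" "x \<in> \<real>" "Re x >= real (Suc n)" if "x \<in> T" for x using that
  by (auto simp: scaleR_conv_of_real algebra_simps complex_nonpos_Reals_iff T_def closed_segment_def a_def b_def)
 have "norm (f 0 b - (\<Sum>i\<le>1. f i a * (b - a) ^ i / fact i))
   <= (norm s * norm (s - 1) * real (Suc n) powr (- Re s - 1)) * norm (b - a) ^ Suc 1 / fact 1"
 proof (rule complex_Taylor[where S = T])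
  fix i :: nat and x assume x: "x \<in> T" and i: "i <= 1"
  have x0: "x ~= 0" using T(1)[OF x] by auto
  show "(f i has_field_derivative f (Suc i) x) (at x within T)"
  proof (cases "i = 0")
   case True
   have "((%x. x powr (1 - s)) has_field_derivative (1 - s) * x powr (1 - s - 1)) (at x within T)"
    using T(1)[OF x] has_field_derivative_powr has_field_derivative_at_within by blast
   thus ?thesis using True by (simp add: f_def[abs_def])
  next
   case False
   hence "i = 1" using i by simp
   have "((%x. (1 - s) * x powr (- s)) has_field_derivative (1 - s) * ((- s) * x powr (- s - 1))) (at x within T)"
    using T(1)[OF x] by (intro DERIV_cmult has_field_derivative_at_within[OF has_field_derivative_powr]) auto
   thus ?thesis using \<open>i = 1\<close> by (simp add: f_def[abs_def] mult.assoc)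
  qed
 next
  fix x assume x: "x \<in> T"
  have "norm (f (Suc 1) x) = norm s * norm (s - 1) * (Re x powr (- Re s - 1))"
   using T[OF x] by (simp add: f_def norm_mult norm_powr_real_powr norm_minus_commute)
  also have "... <= norm s * norm (s - 1) * real (Suc n) powr (- Re s - 1)" using T[OF x] assms by (intro mult_left_mono powr_mono2') auto
  finally show "norm (f (Suc 1) x) <= norm s * norm (s - 1) * real (Suc n) powr (- Re s - 1)" .
 qed (auto simp: T_def)
 moreover have "f 0 b - (\<Sum>i\<le>1. f i a * (b - a) ^ i / fact i) = zeta_term n s"
  unfolding f_def zeta_term_def a_def b_def by (simp add: algebra_simps)
 moreover have "b - a = 1" by (simp add: a_def b_def)
 ultimately show ?thesis by simp
qed

lemma summable_Suc_powr: "a < -1 ==> summable (%n. real (Suc n) powr a)" using summable_real_powr_iff[of a] by (subst summable_Suc_iff) simp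

lemma zeta_term_majorant:
 assumes x: "Re x > 0"
 shows "\<exists>d M. d > 0 & cball x d <= {s. Re s > 0} & summable M & (\<forall>n. \<forall>y\<in>cball x d. norm (zeta_term n y) <= M n)"
proof -
 define d where "d = Re x / 2"
 have cb: "Re y >= d" "norm y <= norm x + d" if "y \<in> cball x d" for y using that abs_Re_le_cmod[of "x - y"] norm_triangle_ineq2[of y x]
  by (auto simp: dist_norm d_def norm_minus_commute)
 define K where "K = (norm x + d) * (norm x + d + 1)"
 have "summable (%n. K * real (Suc n) powr (- d - 1))" using x by (intro summable_mult summable_Suc_powr) (simp add: d_def)
 moreover have "norm (zeta_term n y) <= K * real (Suc n) powr (- d - 1)" if y: "y \<in> cball x d" for n y
 proof -
  have "norm (zeta_term n y) <= norm y * norm (y - 1) * real (Suc n) powr (- Re y - 1)"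
   using cb[OF y] x by (intro norm_zeta_term_le) (auto simp: d_def)
  also have "... <= K * real (Suc n) powr (- d - 1)"
  proof (intro mult_mono)
   show "norm y * norm (y - 1) <= K" using norm_triangle_ineq4[of y 1] cb[OF y] x unfolding K_def by (intro mult_mono) (auto simp: d_def)
   show "real (Suc n) powr (- Re y - 1) <= real (Suc n) powr (- d - 1)" using cb[OF y] by (intro powr_mono) auto
   show "0 <= K" unfolding K_def using x by (simp add: d_def)
  qed auto
  finally show ?thesis .
 qed
 moreover have "d > 0" using x by (simp add: d_def)
 moreover have "cball x d <= {s. Re s > 0}" using cb \<open>d > 0\<close> by fastforce
 ultimately show ?thesis by blast
qed

text \<open>This is \<open>(s - 1) \<zeta>(s)\<close>.\<close>

definition zeta1 :: "complex => complex" where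
 "zeta1 s = 1 + (\<Sum>n. zeta_term n s)"

lemma zeta1_holomorphic: "zeta1 holomorphic_on {s. Re s > 0}" unfolding zeta1_def
 by (intro holomorphic_intros holomorphic_suminf(1) open_halfspace_Re_gt zeta_term_holomorphic zeta_term_majorant) auto

lemma zeta1_1 [simp]: "zeta1 1 = 1"
proof -
 have "zeta_term n 1 = 0" for n
 proof -
  have "complex_of_nat (Suc n) ~= 0" "complex_of_nat (n + 2) ~= 0" by (simp_all only: of_nat_eq_0_iff)
  thus ?thesis by (simp only: zeta_term_def) simp
 qed
 thus ?thesis by (simp add: zeta1_def)
qed

lemma norm_of_nat_powr: "norm (of_nat (Suc n) powr s :: complex) = real (Suc n) powr Re s" by (simp add: norm_powr_real_powr)

lemma summable_Dirichlet:
 assumes "Re s > 1"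
 shows "summable (%n. norm (of_nat (Suc n) powr (- s) :: complex))" (is ?g1)
  "summable (%n. norm (of_real (ln (real (Suc n))) * of_nat (Suc n) powr (- s) :: complex))" (is ?g2)
proof -
 show ?g1 unfolding norm_of_nat_powr using assms by (intro summable_Suc_powr) simp
 define a where "a = (Re s - 1) / 2"
 have a: "a > 0" "a - Re s < -1" using assms by (auto simp: a_def field_simps)
 show ?g2
 proof (rule summable_comparison_test'[where N = 0])
  show "summable (%n. 1 / a * real (Suc n) powr (a - Re s))" using a by (intro summable_mult summable_Suc_powr) auto
  fix n :: nat
  have "norm (norm (of_real (ln (real (Suc n))) * of_nat (Suc n) powr (- s) :: complex)) =
    ln (real (Suc n)) * real (Suc n) powr (- Re s)" by (simp only: norm_mult norm_of_nat_powr) simp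
  also have "... <= (real (Suc n) powr a / a) * real (Suc n) powr (- Re s)"
   using a ln_powr_bound[of "real (Suc n)" a] by (intro mult_right_mono) auto
  also have "... = 1 / a * real (Suc n) powr (a - Re s)" by (simp add: powr_diff powr_minus divide_inverse)
  finally show "norm (norm (of_real (ln (real (Suc n))) * of_nat (Suc n) powr (- s) :: complex)) <= 1 / a * real (Suc n) powr (a - Re s)" .
 qed
qed

text \<open>The differences in \<open>zeta_term\<close> telescope to \<open>- 1\<close> when
  \<open>Re s > 1\<close>; the summand 1 in \<open>zeta1\<close> compensates for it.\<close>

lemma zeta1_eq_sum:
 assumes s: "Re s > 1"
 shows "(%n. (s - 1) * of_nat (Suc n) powr (- s)) sums zeta1 s"
proof -
 have "(%n. of_nat (Suc n) powr (1 - s)) \<longlonglongrightarrow> (0 :: complex)"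
 proof (rule tendsto_norm_zero_cancel)
  have "filterlim (%n. real (Suc n)) at_top sequentially" by (rule filterlim_compose[OF filterlim_real_sequentially filterlim_Suc])
  thus "(%n. norm (of_nat (Suc n) powr (1 - s) :: complex)) \<longlonglongrightarrow> 0"
   unfolding norm_of_nat_powr using s by (intro tendsto_neg_powr) auto
 qed
 hence t: "(%n. of_nat (Suc n) powr (1 - s) - of_nat (Suc (Suc n)) powr (1 - s)) sums (of_nat (Suc 0) powr (1 - s) - 0 :: complex)"
  by (rule telescope_sums')
 obtain d M where M: "d > 0" "summable M" "!!n y. y \<in> cball s d ==> norm (zeta_term n y) <= M n" using zeta_term_majorant[of s] s by auto
 have "summable (%n. zeta_term n s)" by (rule summable_comparison_test'[OF M(2), of 0]) (use M in auto)
 hence "(%n. zeta_term n s) sums (zeta1 s - 1)" unfolding zeta1_def by auto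
 from sums_add[OF this t] show ?thesis by (simp add: zeta_term_def)
qed

text \<open>For \<open>Re s > 1\<close> this is \<open>- \<zeta>' / \<zeta>\<close>, and
  \<open>zeta_ln_sum\<close> below is \<open>- \<zeta>'\<close>.\<close>

definition log_deriv_sum :: "complex => complex" where
 "log_deriv_sum s = (\<Sum>n. mangoldt (Suc n) * of_nat (Suc n) powr (- s))"

definition zeta_sum :: "complex => complex" where
 "zeta_sum s = (\<Sum>n. of_nat (Suc n) powr (- s))"

definition zeta_ln_sum :: "complex => complex" where
 "zeta_ln_sum s = (\<Sum>n. of_real (ln (real (Suc n))) * of_nat (Suc n) powr (- s))"

lemma summable_log_deriv_sum:
 assumes "Re s > 1"
 shows "summable (%n. norm (mangoldt (Suc n) * of_nat (Suc n) powr (- s) :: complex))"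
proof (rule summable_comparison_test'[OF summable_Dirichlet(2)[OF assms], of 0])
 fix n :: nat
 have "mangoldt (Suc n) <= ln (real (Suc n))" by (rule mangoldt_le) simp
 hence "mangoldt (Suc n) * norm (of_nat (Suc n) powr (- s) :: complex)
   <= \<bar>ln (real (Suc n))\<bar> * norm (of_nat (Suc n) powr (- s) :: complex)" by (intro mult_right_mono) auto
 thus "norm (norm (mangoldt (Suc n) * of_nat (Suc n) powr (- s) :: complex))
  <= norm (of_real (ln (real (Suc n))) * of_nat (Suc n) powr (- s) :: complex)"
  by (simp only: norm_mult norm_mangoldt norm_of_real abs_mangoldt real_norm_def abs_mult abs_norm_cancel)
qed

lemma has_sum_positive_nats:
 fixes f :: "nat => complex"
 assumes "summable (%n. norm (f (Suc n)))"
 shows "(f has_sum (\<Sum>n. f (Suc n))) {0<..}"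
proof -
 have "((%n. f (Suc n)) has_sum (\<Sum>n. f (Suc n))) UNIV"
  by (rule norm_summable_imp_has_sum[OF assms summable_sums[OF summable_norm_cancel[OF assms]]])
 moreover have "bij_betw Suc UNIV {0<..}" by (rule bij_betwI[where g = "%n. n - 1"]) auto
 ultimately show ?thesis using has_sum_reindex_bij_betw[of Suc UNIV "{0<..}" f] by blast
qed

text \<open>The Dirichlet convolution of \<open>mangoldt\<close> with 1 is the logarithm. Absolute
  convergence allows the pairs \<open>(d, m)\<close> to be regrouped by their product.\<close>

lemma log_deriv_sum_mult_zeta_sum:
 assumes s: "Re s > 1"
 shows "log_deriv_sum s * zeta_sum s = zeta_ln_sum s"
proof -
 define a where "a n = (of_nat n powr (- s) :: complex)" for n
 define L where "L d = mangoldt d * a d" for d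
 define P where "P = {0<..} - ({} :: nat set)"
 define D where "D = (SIGMA n:P. {d. d dvd n})"
 note sums = summable_Dirichlet[OF s] summable_log_deriv_sum[OF s]
 have ha: "(a has_sum zeta_sum s) P" and hL: "(L has_sum log_deriv_sum s) P"
  and hl: "((%n. of_real (ln (real n)) * a n) has_sum zeta_ln_sum s) P" using has_sum_positive_nats[of a] has_sum_positive_nats[of L]
   has_sum_positive_nats[of "%n. of_real (ln (real n)) * a n"] sums
  unfolding a_def L_def P_def zeta_sum_def log_deriv_sum_def zeta_ln_sum_def by auto
 have abs_a: "(%n. norm (a n)) summable_on P" and abs_L: "(%n. norm (L n)) summable_on P"
 proof -
  have *: "(%n. norm (f n)) summable_on P" if "summable (%n. norm (f (Suc n)))" for f :: "nat => complex"
  proof -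
   have "(%n. complex_of_real (norm (f n))) summable_on P" using has_sum_positive_nats[of "%n. complex_of_real (norm (f n))"] that
    unfolding P_def summable_on_def by auto
   hence "(%n. Re (complex_of_real (norm (f n)))) summable_on P" by (rule summable_on_Re)
   thus ?thesis by simp
  qed
  show "(%n. norm (a n)) summable_on P" "(%n. norm (L n)) summable_on P" using sums by (auto intro!: * simp: a_def L_def)
 qed
 have "(%x. norm (case x of (d, m) => L d * a m)) summable_on P \<times> P"
 proof (rule Infinite_Sum.abs_summable_on_Sigma_iff[THEN iffD2], intro conjI ballI)
  show "(%y. norm (case (x, y) of (d, m) => L d * a m)) summable_on P" for x using abs_a by (simp add: norm_mult summable_on_cmult_right)
  have "(%x. infsum (%y. norm (case (x, y) of (d, m) => L d * a m)) P) = (%x. norm (L x) * infsum (%y. norm (a y)) P)"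
   using abs_a by (simp add: norm_mult infsum_cmult_right)
  hence e: "infsum (%y. norm (case (x, y) of (d, m) => L d * a m)) P = norm (L x) * infsum (%y. norm (a y)) P" for x by (rule fun_cong)
  have "(%x. norm (norm (L x) * infsum (%y. norm (a y)) P)) summable_on P" using abs_L by (simp add: infsum_nonneg summable_on_cmult_left)
  thus "(%x. norm (infsum (%y. norm (case (x, y) of (d, m) => L d * a m)) P)) summable_on P" unfolding e .
 qed
 hence "((%(d, m). L d * a m) has_sum (log_deriv_sum s * zeta_sum s)) (P \<times> P)"
  using abs_summable_summable[of "%(d, m). L d * a m"] has_sum_cmult_right[OF ha] has_sum_cmult_left[OF hL]
  by (intro has_sum_SigmaI[where g = "%d. L d * zeta_sum s"]) auto
 moreover have "((%(d, m). L d * a m) has_sum (log_deriv_sum s * zeta_sum s)) (P \<times> P) \<longleftrightarrow>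
   ((%(n, d). mangoldt d * a n) has_sum (log_deriv_sum s * zeta_sum s)) D"
 proof (rule has_sum_reindex_bij_witness[of _ "%(n, d). (d, n div d)" "%(d, m). (d * m, d)"])
  fix x assume x: "x \<in> P \<times> P"
  obtain d m where dm: "x = (d, m)" "d > 0" "m > 0" using x by (cases x) (auto simp: P_def)
  show "(case (case x of (d, m) => (d * m, d)) of (n, d) => mangoldt d * a n) = (case x of (d, m) => L d * a m)" using powr_times_real[of "of_nat d" "of_nat m" "-s"]
   by (auto simp: dm L_def a_def)
 qed (auto simp: P_def D_def elim!: dvdE)
 ultimately have "((%(n, d). mangoldt d * a n) has_sum (log_deriv_sum s * zeta_sum s)) D" by blast
 hence "((%n. \<Sum>d | d dvd n. mangoldt d * a n) has_sum (log_deriv_sum s * zeta_sum s)) P"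
  unfolding D_def by (rule has_sum_SigmaD) (auto simp: P_def)
 hence "((%n. of_real (ln (real n)) * a n) has_sum (log_deriv_sum s * zeta_sum s)) P" by (rule has_sum_cong[THEN iffD1, rotated])
    (auto simp: P_def mangoldt_sum simp flip: sum_distrib_right)
 thus ?thesis using hl has_sum_unique by blast
qed

lemma zeta_sum_deriv:
 assumes s: "Re s > 1"
 shows "(zeta_sum has_field_derivative - zeta_ln_sum s) (at s)"
proof -
 define S where "S = {s. Re s > 1}"
 have S: "open S" "s \<in> S" using s open_halfspace_Re_gt by (auto simp: S_def)
 have M: "\<exists>d M. d > 0 & cball x d <= S & summable M & (\<forall>n. \<forall>y\<in>cball x d. norm (of_nat (Suc n) powr (- y) :: complex) <= M n)"
  if "x \<in> S" for x
 proof -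
  define d where "d = (Re x - 1) / 2"
  have d: "d > 0" using that by (simp add: d_def S_def)
  have cb: "Re y >= 1 + d" if "y \<in> cball x d" for y
  proof -
   have "Re x - Re y <= d" using that abs_Re_le_cmod[of "x - y"] by (simp add: dist_norm)
   moreover have "Re x = 1 + 2 * d" by (simp add: d_def field_simps)
   ultimately show ?thesis by linarith
  qed
  show ?thesis
  proof (intro exI conjI allI ballI)
   show "d > 0" by fact
   show "cball x d <= S" using cb d by (fastforce simp: S_def)
   show "summable (%n. real (Suc n) powr (- (1 + d)))" using d by (intro summable_Suc_powr) auto
   fix n y assume "y \<in> cball x d"
   thus "norm (of_nat (Suc n) powr (- y) :: complex) <= real (Suc n) powr (- (1 + d))"
    unfolding norm_of_nat_powr using cb[of y] by (intro powr_mono) auto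
  qed
 qed
 have hol: "(%s. of_nat (Suc n) powr (- s) :: complex) holomorphic_on S" for n by (intro holomorphic_intros)
 have *: "zeta_sum holomorphic_on S" "(%n. deriv (%s. of_nat (Suc n) powr (- s) :: complex) s) sums deriv zeta_sum s"
  using holomorphic_suminf[of S "%n s. of_nat (Suc n) powr (- s)", OF S(1) hol M] S(2) unfolding zeta_sum_def[abs_def] by blast+
 have "deriv (%s. of_nat (Suc n) powr (- s) :: complex) s = - (of_real (ln (real (Suc n))) * of_nat (Suc n) powr (- s))" for n
 proof (rule DERIV_imp_deriv)
  have n0: "complex_of_nat (Suc n) ~= 0" by (simp only: of_nat_eq_0_iff)
  have "((%s. of_nat (Suc n) powr (- s) :: complex) has_field_derivative (Ln (of_nat (Suc n)) * of_nat (Suc n) powr (- s)) * (- 1)) (at s)"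
   by (rule DERIV_chain2[where g = uminus, OF has_field_derivative_powr_right[OF n0]]) (auto intro!: derivative_eq_intros)
  moreover have "Ln (of_nat (Suc n)) = of_real (ln (real (Suc n)))" by (rule Ln_of_nat) simp
  ultimately show "((%s. of_nat (Suc n) powr (- s) :: complex) has_field_derivative - (of_real (ln (real (Suc n))) * of_nat (Suc n) powr (- s))) (at s)"
   by simp
 qed
 hence "(%n. - (of_real (ln (real (Suc n))) * of_nat (Suc n) powr (- s))) sums deriv zeta_sum s" using *(2) by simp
 moreover have "(%n. - (of_real (ln (real (Suc n))) * of_nat (Suc n) powr (- s) :: complex)) sums (- zeta_ln_sum s)"
  unfolding zeta_ln_sum_def by (intro sums_minus summable_sums summable_norm_cancel[OF summable_Dirichlet(2)[OF s]])
 ultimately have "deriv zeta_sum s = - zeta_ln_sum s" by (rule sums_unique2)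
 moreover have "(zeta_sum has_field_derivative deriv zeta_sum s) (at s)" by (rule holomorphic_derivI[OF *(1) S])
 ultimately show ?thesis by simp
qed

lemma zeta1_eq_zeta_sum:
 assumes s: "Re s > 1"
 shows "zeta1 s = (s - 1) * zeta_sum s"
proof -
 have "(%n. (s - 1) * of_nat (Suc n) powr (- s)) sums ((s - 1) * zeta_sum s)"
  unfolding zeta_sum_def by (intro sums_mult summable_sums summable_norm_cancel[OF summable_Dirichlet(1)[OF s]])
 thus ?thesis using zeta1_eq_sum[OF s] sums_unique2 by blast
qed

text \<open>The formula for the logarithmic derivative is cleared of denominators, so that it can be
  used before \<open>zeta1\<close> is known to have no zeros.\<close>

lemma log_deriv_sum_zeta1:
 assumes s: "Re s > 1"
 shows "(s - 1) * log_deriv_sum s * zeta1 s = zeta1 s - (s - 1) * deriv zeta1 s"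
proof -
 have "((%s. (s - 1) * zeta_sum s) has_field_derivative (1 * zeta_sum s + (- zeta_ln_sum s) * (s - 1))) (at s)"
  by (rule DERIV_mult) (auto intro!: derivative_eq_intros zeta_sum_deriv s)
 hence "(zeta1 has_field_derivative (1 * zeta_sum s + (- zeta_ln_sum s) * (s - 1))) (at s)"
  by (rule has_field_derivative_transform_within_open[OF _ open_halfspace_Re_gt[of 1]])
    (use s zeta1_eq_zeta_sum in auto)
 hence d: "deriv zeta1 s = zeta_sum s - log_deriv_sum s * zeta_sum s * (s - 1)"
  using log_deriv_sum_mult_zeta_sum[OF s] by (simp add: DERIV_imp_deriv)
 show ?thesis unfolding d zeta1_eq_zeta_sum[OF s] by (simp add: algebra_simps)
qed

section \<open>Non-vanishing of zeta for \<open>Re s >= 1\<close>\<close>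

lemma at_right_shift: "((%sg. f (s0 + complex_of_real sg)) \<longlongrightarrow> f s0) (at_right 0)" if "isCont f s0"
proof -
 have "((%sg. s0 + complex_of_real sg) \<longlongrightarrow> s0 + complex_of_real 0) (at_right 0)" by (intro tendsto_intros)
 thus ?thesis using isCont_tendsto_compose[OF that] by simp
qed

text \<open>\<open>m\<close> is the order of the zero of \<open>zeta1\<close> at \<open>s0\<close>.\<close>

lemma log_deriv_sum_limit:
 assumes s0: "Re s0 >= 1"
 shows "\<exists>m. (m = 0 --> zeta1 s0 ~= 0) &
  ((%sg. of_real sg * log_deriv_sum (s0 + of_real sg)) \<longlongrightarrow> (if s0 = 1 then 1 else - of_nat m)) (at_right 0)"
proof -
 define S where "S = {s. Re s > 0}"
 have S: "open S" "s0 \<in> S" "connected S" "zeta1 holomorphic_on S" using s0 zeta1_holomorphic open_halfspace_Re_gt by (auto simp: S_def)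
 have holg': "deriv zeta1 holomorphic_on S" using S holomorphic_deriv by blast
 have ev: "\<forall>\<^sub>F sg in at_right 0. sg > (0::real)" by (rule eventually_at_right_less)
 have Re1: "Re (s0 + of_real sg) > 1" if "sg > 0" for sg using that s0 by simp
 have cont: "isCont f s0" if "f holomorphic_on S" for f using that S continuous_on_eq_continuous_at holomorphic_on_imp_continuous_on by blast
 show ?thesis
 proof (cases "zeta1 s0 = 0")
  case nz: False
  have z: "((%sg. zeta1 (s0 + of_real sg)) \<longlongrightarrow> zeta1 s0) (at_right 0)"
   "((%sg. deriv zeta1 (s0 + of_real sg)) \<longlongrightarrow> deriv zeta1 s0) (at_right 0)" using at_right_shift cont S(4) holg' by blast+
  have evnz: "\<forall>\<^sub>F sg in at_right 0. zeta1 (s0 + of_real sg) ~= 0" using z(1) nz by (rule tendsto_imp_eventually_ne)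
  have "((%sg. of_real sg * log_deriv_sum (s0 + of_real sg)) \<longlongrightarrow> (if s0 = 1 then 1 else - of_nat 0)) (at_right 0)"
  proof (cases "s0 = 1")
   case True
   have "((%sg. (zeta1 (s0 + of_real sg) - of_real sg * deriv zeta1 (s0 + of_real sg)) / zeta1 (s0 + of_real sg))
     \<longlongrightarrow> (zeta1 s0 - of_real 0 * deriv zeta1 s0) / zeta1 s0) (at_right 0)" by (intro tendsto_intros z nz)
   moreover have "\<forall>\<^sub>F sg in at_right 0. (zeta1 (s0 + of_real sg) - of_real sg * deriv zeta1 (s0 + of_real sg)) / zeta1 (s0 + of_real sg)
     = of_real sg * log_deriv_sum (s0 + of_real sg)" using ev evnz
   proof eventually_elim
    case (elim sg)
    thus ?case using log_deriv_sum_zeta1[OF Re1[OF elim(1)]] True by (simp add: field_simps)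
   qed
   ultimately show ?thesis using True nz by (simp add: tendsto_cong)
  next
   case False
   have "((%sg. of_real sg * ((zeta1 (s0 + of_real sg) - (s0 + of_real sg - 1) * deriv zeta1 (s0 + of_real sg)) /
     ((s0 + of_real sg - 1) * zeta1 (s0 + of_real sg))))
     \<longlongrightarrow> of_real 0 * ((zeta1 s0 - (s0 + of_real 0 - 1) * deriv zeta1 s0) / ((s0 + of_real 0 - 1) * zeta1 s0))) (at_right 0)"
    by (intro tendsto_intros z) (use nz False in auto)
   moreover have "\<forall>\<^sub>F sg in at_right 0. of_real sg * ((zeta1 (s0 + of_real sg) - (s0 + of_real sg - 1) * deriv zeta1 (s0 + of_real sg)) /
     ((s0 + of_real sg - 1) * zeta1 (s0 + of_real sg))) = of_real sg * log_deriv_sum (s0 + of_real sg)" using ev evnz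
   proof eventually_elim
    case (elim sg)
    show ?case using Re1[OF elim(1)] elim(2) unfolding log_deriv_sum_zeta1[OF Re1[OF elim(1)], symmetric] by (auto simp: complex_eq_iff)
   qed
   ultimately show ?thesis using False by (simp add: tendsto_cong)
  qed
  thus ?thesis using nz by blast
 next
  case z: True
  hence s01: "s0 ~= 1" by auto
  have "~ zeta1 constant_on S"
  proof
   assume "zeta1 constant_on S"
   moreover have "1 \<in> S" by (simp add: S_def)
   ultimately have "zeta1 1 = zeta1 s0" using S(2) unfolding constant_on_def by metis
   thus False using z by simp
  qed
  then obtain h r m where h: "0 < m" "0 < r" "ball s0 r <= S" "h holomorphic_on ball s0 r"
   "!!w. w \<in> ball s0 r ==> zeta1 w = (w - s0) ^ m * h w" "!!w. w \<in> ball s0 r ==> h w ~= 0"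
   using holomorphic_factor_zero_nonconstant[OF S(4,1,3,2) z] by metis
  have h': "deriv h holomorphic_on ball s0 r" using h(4) holomorphic_deriv by blast
  have conth: "isCont f s0" if "f holomorphic_on ball s0 r" for f
   using that h(2) continuous_on_eq_continuous_at[OF open_ball] holomorphic_on_imp_continuous_on centre_in_ball by blast
  have l: "((%sg. h (s0 + of_real sg)) \<longlongrightarrow> h s0) (at_right 0)"
   "((%sg. deriv h (s0 + of_real sg)) \<longlongrightarrow> deriv h s0) (at_right 0)" using at_right_shift conth h(4) h' by blast+
  have hs0: "h s0 ~= 0" using h by simp
  have evr: "\<forall>\<^sub>F sg in at_right 0. sg < r" by (rule order_tendstoD(2)[OF tendsto_ident_at h(2)])
  have "((%sg. (of_real sg * h (s0 + of_real sg) - (s0 + of_real sg - 1) * (of_nat m * h (s0 + of_real sg) + of_real sg * deriv h (s0 + of_real sg)))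
    / ((s0 + of_real sg - 1) * h (s0 + of_real sg))) \<longlongrightarrow>
    (of_real 0 * h s0 - (s0 + of_real 0 - 1) * (of_nat m * h s0 + of_real 0 * deriv h s0)) / ((s0 + of_real 0 - 1) * h s0)) (at_right 0)"
   by (intro tendsto_intros l) (use hs0 s01 in auto)
  moreover have "(of_real 0 * h s0 - (s0 + of_real 0 - 1) * (of_nat m * h s0 + of_real 0 * deriv h s0)) / ((s0 + of_real 0 - 1) * h s0) = - of_nat m"
   using hs0 s01 by simp
  moreover have "\<forall>\<^sub>F sg in at_right 0. (of_real sg * h (s0 + of_real sg) - (s0 + of_real sg - 1) * (of_nat m * h (s0 + of_real sg) + of_real sg * deriv h (s0 + of_real sg)))
    / ((s0 + of_real sg - 1) * h (s0 + of_real sg)) = of_real sg * log_deriv_sum (s0 + of_real sg)" using ev evr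
  proof eventually_elim
   case (elim sg)
   define s where "s = s0 + of_real sg"
   define t where "t = complex_of_real sg"
   have sb: "s \<in> ball s0 r" using elim by (simp add: s_def dist_norm)
   have t0: "t ~= 0" using elim by (simp add: t_def)
   have st: "s - s0 = t" by (simp add: s_def t_def)
   have "((%w. (w - s0) ^ m * h w) has_field_derivative (of_nat m * (s - s0) ^ (m - 1) * h s + deriv h s * (s - s0) ^ m)) (at s)" using h(4) sb holomorphic_derivI
    by (auto intro!: derivative_eq_intros)
   hence "(zeta1 has_field_derivative (of_nat m * (s - s0) ^ (m - 1) * h s + deriv h s * (s - s0) ^ m)) (at s)"
    by (rule has_field_derivative_transform_within_open[OF _ open_ball sb]) (use h(5) in auto)
   hence d: "deriv zeta1 s = of_nat m * t ^ (m - 1) * h s + deriv h s * t ^ m" unfolding st by (rule DERIV_imp_deriv)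
   have tm: "t ^ m = t * t ^ (m - 1)" using h(1) by (simp add: power_eq_if)
   have s1: "s - 1 ~= 0" using Re1[OF elim(1)] by (auto simp: complex_eq_iff s_def)
   \<comment> \<open>With \<open>zeta1 = t ^ m * h\<close> near \<open>s0\<close>, both sides of the
     identity for the logarithmic derivative carry the factor \<open>t ^ (m - 1)\<close>. Cancelling
     it leaves an expression that is continuous at \<open>t = 0\<close>.\<close>
   have "t ^ (m - 1) * ((s - 1) * h s * (t * log_deriv_sum s)) =
     t ^ (m - 1) * (t * h s - (s - 1) * (of_nat m * h s + t * deriv h s))" using log_deriv_sum_zeta1[OF Re1[OF elim(1)], folded s_def] h(5)[OF sb] st by (auto simp: algebra_simps d tm)
   hence "(s - 1) * h s * (t * log_deriv_sum s) = t * h s - (s - 1) * (of_nat m * h s + t * deriv h s)" using t0 by simp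
   hence "(t * h s - (s - 1) * (of_nat m * h s + t * deriv h s)) / ((s - 1) * h s) = t * log_deriv_sum s"
    using s1 h(6)[OF sb] by (metis mult_eq_0_iff nonzero_mult_div_cancel_left)
   thus ?case unfolding s_def t_def .
  qed
  ultimately show ?thesis using h(1) s01 by (intro exI[of _ m]) (auto simp: tendsto_cong)
 qed
qed

text \<open>Termwise this is Mertens's identity
  \<open>3 + 4 * cos a + cos (2 * a) = 2 * (1 + cos a) ^ 2\<close> with
  \<open>a = t * ln (n + 1)\<close>, weighted by the non-negative \<open>mangoldt\<close>.\<close>

lemma log_deriv_sum_3_4_1:
 assumes "x > 1"
 shows "3 * Re (log_deriv_sum (of_real x)) + 4 * Re (log_deriv_sum (of_real x + \<i> * of_real t))
  + Re (log_deriv_sum (of_real x + \<i> * of_real (2 * t))) >= 0"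
proof -
 define f where "f u n = Re (mangoldt (Suc n) * of_nat (Suc n) powr (- (of_real x + \<i> * of_real u)) :: complex)" for u n
 have f: "f u sums Re (log_deriv_sum (of_real x + \<i> * of_real u))" for u unfolding f_def log_deriv_sum_def using assms
  by (intro sums_Re summable_sums summable_norm_cancel[OF summable_log_deriv_sum]) simp
 have feq: "f u n = mangoldt (Suc n) * (real (Suc n) powr (- x) * cos (u * ln (real (Suc n))))" for u n
 proof -
  have n0: "complex_of_nat (Suc n) ~= 0" by (simp only: of_nat_eq_0_iff)
  have "Ln (of_nat (Suc n)) = of_real (ln (real (Suc n)))" by (rule Ln_of_nat) simp
  thus ?thesis using n0 by (auto simp: Re_exp f_def powr_def)
 qed
 have sm: "(%n. 3 * f 0 n + 4 * f t n + f (2 * t) n) sums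
  (3 * Re (log_deriv_sum (of_real x + \<i> * of_real 0)) + 4 * Re (log_deriv_sum (of_real x + \<i> * of_real t))
  + Re (log_deriv_sum (of_real x + \<i> * of_real (2 * t))))" by (intro sums_add sums_mult f)
 have nn: "3 * f 0 n + 4 * f t n + f (2 * t) n >= 0" for n
 proof -
  define c where "c = cos (t * ln (real (Suc n)))"
  define P where "P = real (Suc n) powr (- x)"
  define M where "M = (mangoldt (Suc n) :: real)"
  have e: "f 0 n = M * P" "f t n = M * (P * c)" "f (2 * t) n = M * (P * (2 * c\<^sup>2 - 1))" using cos_double_cos[of "t * ln (real (Suc n))"]
   by (auto simp: c_def mult.assoc feq M_def P_def)
  have "3 * f 0 n + 4 * f t n + f (2 * t) n = mangoldt (Suc n) * (real (Suc n) powr (- x) * (2 * (1 + c)\<^sup>2))"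
   unfolding e M_def[symmetric] P_def[symmetric] by (simp add: algebra_simps power2_eq_square)
  also have "... >= 0" by (intro mult_nonneg_nonneg mangoldt_nonneg) auto
  finally show ?thesis .
 qed
 have "0 <= 3 * Re (log_deriv_sum (of_real x + \<i> * of_real 0)) + 4 * Re (log_deriv_sum (of_real x + \<i> * of_real t))
  + Re (log_deriv_sum (of_real x + \<i> * of_real (2 * t)))" by (rule sums_le[OF nn sums_zero sm])
 thus ?thesis by simp
qed

text \<open>Multiplying the 3-4-1 inequality by \<open>sg\<close> and letting \<open>sg\<close> tend
  to 0 gives \<open>3 - 4 * m - m' >= 0\<close> for the orders \<open>m\<close> at
  \<open>1 + \<i> * t\<close> and \<open>m'\<close> at \<open>1 + 2 * \<i> * t\<close>, so
  \<open>m = 0\<close>. To the right of the line the series stays bounded, and the same limit forces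
  \<open>m = 0\<close>.\<close>

lemma zeta1_nonzero:
 assumes "Re s0 >= 1"
 shows "zeta1 s0 ~= 0"
proof (cases "s0 = 1")
 case s01: False
 from log_deriv_sum_limit[OF assms] obtain m where mm: "(m = 0 --> zeta1 s0 ~= 0) &
  ((%sg. of_real sg * log_deriv_sum (s0 + of_real sg)) \<longlongrightarrow> (if s0 = 1 then 1 else - of_nat m)) (at_right 0)" by (rule exE)
 have m: "m = 0 --> zeta1 s0 ~= 0"
  "((%sg. of_real sg * log_deriv_sum (s0 + of_real sg)) \<longlongrightarrow> - of_nat m) (at_right 0)"
  using conjunct1[OF mm] conjunct2[OF mm] unfolding if_not_P[OF s01] .
 have ev: "\<forall>\<^sub>F sg in at_right 0. sg > (0::real)" by (rule eventually_at_right_less)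
 show ?thesis
 proof (cases "Re s0 = 1")
  case True
  define t where "t = Im s0"
  have t: "t ~= 0" "s0 = 1 + \<i> * of_real t" using True s01 by (auto simp: t_def complex_eq_iff)
  have n1: "1 + \<i> * of_real (2 * t) ~= 1" using t by simp
  have "Re (1 + \<i> * of_real (2 * t)) >= 1" by simp
  from log_deriv_sum_limit[OF this, unfolded if_not_P[OF n1]] obtain m' where
   "(m' = 0 --> zeta1 (1 + \<i> * of_real (2 * t)) ~= 0) &
   ((%sg. of_real sg * log_deriv_sum (1 + \<i> * of_real (2 * t) + of_real sg)) \<longlongrightarrow> - of_nat m') (at_right 0)" by (rule exE)
  note m' = conjunct2[OF this]
  have 1: "((%sg. of_real sg * log_deriv_sum (1 + of_real sg)) \<longlongrightarrow> 1) (at_right 0)" using log_deriv_sum_limit[of 1] by simp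
  have "((%sg. 3 * Re (of_real sg * log_deriv_sum (1 + of_real sg)) + 4 * Re (of_real sg * log_deriv_sum (s0 + of_real sg))
    + Re (of_real sg * log_deriv_sum (1 + \<i> * of_real (2 * t) + of_real sg))) \<longlongrightarrow>
    3 * Re 1 + 4 * Re (- of_nat m) + Re (- of_nat m')) (at_right 0)" by (intro tendsto_add tendsto_mult tendsto_const tendsto_Re 1 m(2) m')
  moreover have "\<forall>\<^sub>F sg in at_right 0. 3 * Re (of_real sg * log_deriv_sum (1 + of_real sg)) + 4 * Re (of_real sg * log_deriv_sum (s0 + of_real sg))
    + Re (of_real sg * log_deriv_sum (1 + \<i> * of_real (2 * t) + of_real sg)) >= 0" using ev
  proof eventually_elim
   case (elim sg)
   have e: "complex_of_real (1 + sg) = 1 + of_real sg" "of_real (1 + sg) + \<i> * of_real t = s0 + of_real sg"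
    "of_real (1 + sg) + \<i> * of_real (2 * t) = 1 + \<i> * of_real (2 * t) + of_real sg" using t by auto
   have "0 <= sg * (3 * Re (log_deriv_sum (1 + of_real sg)) + 4 * Re (log_deriv_sum (s0 + of_real sg))
    + Re (log_deriv_sum (1 + \<i> * of_real (2 * t) + of_real sg)))"
   proof (rule mult_nonneg_nonneg)
    show "0 <= 3 * Re (log_deriv_sum (1 + of_real sg)) + 4 * Re (log_deriv_sum (s0 + of_real sg))
     + Re (log_deriv_sum (1 + \<i> * of_real (2 * t) + of_real sg))" using log_deriv_sum_3_4_1[of "1 + sg" t] elim unfolding e(2,3) by simp
   qed (use elim in simp)
   thus ?case by (simp add: distrib_left)
  qed
  ultimately have "0 <= 3 * Re 1 + 4 * Re (- of_nat m) + Re (- of_nat m')" by (rule tendsto_lowerbound) simp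
  thus ?thesis using m by simp
 next
  case False
  hence x0: "Re s0 > 1" using assms by simp
  define B where "B = (\<Sum>n. mangoldt (Suc n) * real (Suc n) powr (- Re s0))"
  have sB: "summable (%n. mangoldt (Suc n) * real (Suc n) powr (- Re s0))"
   using summable_log_deriv_sum[OF x0] by (simp add: norm_mult norm_powr_real_powr)
  have nB: "norm (log_deriv_sum (s0 + of_real sg)) <= B" if "sg > 0" for sg unfolding log_deriv_sum_def B_def
  proof (rule norm_suminf_le[OF _ sB])
   fix n
   have "norm (mangoldt (Suc n) * of_nat (Suc n) powr (- (s0 + of_real sg)) :: complex) =
    mangoldt (Suc n) * real (Suc n) powr (- Re s0 - sg)" by (simp only: norm_mult norm_of_nat_powr) simp
   also have "... <= mangoldt (Suc n) * real (Suc n) powr (- Re s0)" using that by (intro mult_left_mono powr_mono mangoldt_nonneg) auto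
   finally show "norm (mangoldt (Suc n) * of_nat (Suc n) powr (- (s0 + of_real sg)) :: complex) <=
    mangoldt (Suc n) * real (Suc n) powr (- Re s0)" .
  qed
  have e1: "\<forall>\<^sub>F sg in at_right 0. norm (of_real sg * log_deriv_sum (s0 + of_real sg)) <= sg * B" using ev
  proof eventually_elim
   case (elim sg)
   thus ?case using mult_left_mono[OF nB[OF elim], of sg] by (simp add: norm_mult)
  qed
  have e2: "((%sg. sg * B) \<longlongrightarrow> 0 * B) (at_right 0)" by (intro tendsto_intros)
  have "((%sg. of_real sg * log_deriv_sum (s0 + of_real sg)) \<longlongrightarrow> 0) (at_right 0)"
   by (rule Lim_null_comparison[OF e1]) (use e2 in simp)
  from tendsto_unique[OF trivial_limit_at_right_real m(2) this] have "- complex_of_nat m = 0" .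
  thus ?thesis using m by simp
 qed
qed simp

text \<open>
 Replacing the von Mangoldt function by its summatory function moves the logarithmic derivative to a Dirichlet series with
 bounded coefficients, up to a series that converges for \<open>Re s > 0\<close>.
\<close>

definition psi_error_sum :: "complex => complex" where
 "psi_error_sum s = (\<Sum>n. of_real (chebyshev_psi (Suc n)) * zeta_term n (s + 1))"

lemma norm_psi_term_le:
 assumes "Re s > 0"
 shows "norm (of_real (chebyshev_psi (Suc n)) * zeta_term n (s + 1)) <=
  4 * (norm (s + 1) * norm s) * real (Suc n) powr (- Re s - 1)"
proof -
 have "norm (of_real (chebyshev_psi (Suc n)) * zeta_term n (s + 1)) = chebyshev_psi (Suc n) * norm (zeta_term n (s + 1))"
  using chebyshev_psi_nonneg by (simp add: norm_mult)
 also have "... <= (4 * real (Suc n)) * (norm (s + 1) * norm (s + 1 - 1) * real (Suc n) powr (- Re (s + 1) - 1))"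
  using assms chebyshev_psi_le[of "Suc n"] by (intro mult_mono norm_zeta_term_le) auto
 also have "... = 4 * (norm (s + 1) * norm s) * (real (Suc n) powr 1 * real (Suc n) powr (- Re s - 2))"
 proof -
  have "- Re (s + 1) - 1 = - Re s - 2" "s + 1 - 1 = s" by simp_all
  thus ?thesis by (simp only: powr_one) simp
 qed
 also have "real (Suc n) powr 1 * real (Suc n) powr (- Re s - 2) = real (Suc n) powr (- Re s - 1)"
 proof -
  have "1 + (- Re s - 2) = - Re s - 1" by simp
  thus ?thesis unfolding powr_add[symmetric] by (simp only:)
 qed
 finally show ?thesis .
qed

lemma psi_error_sum_holomorphic: "psi_error_sum holomorphic_on {s. Re s > 0}" unfolding psi_error_sum_def
proof (rule holomorphic_suminf(1))
 show "open {s. 0 < Re s}" by (rule open_halfspace_Re_gt)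
 show "(%s. of_real (chebyshev_psi (Suc n)) * zeta_term n (s + 1)) holomorphic_on {s. 0 < Re s}" for n
  unfolding zeta_term_def by (intro holomorphic_intros)
 fix x assume "x \<in> {s. 0 < Re s}"
 hence x: "Re x > 0" by simp
 define d where "d = Re x / 2"
 have cb: "Re y >= d" "norm y <= norm x + d" if "y \<in> cball x d" for y using that abs_Re_le_cmod[of "x - y"] norm_triangle_ineq2[of y x]
  by (auto simp: dist_norm d_def norm_minus_commute)
 have d0: "d > 0" using x by (simp add: d_def)
 define K where "K = 4 * ((norm x + d + 1) * (norm x + d))"
 show "\<exists>d M. 0 < d & cball x d <= {s. 0 < Re s} & summable M &
  (\<forall>n. \<forall>y\<in>cball x d. norm (of_real (chebyshev_psi (Suc n)) * zeta_term n (y + 1)) <= M n)"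
 proof (intro exI conjI allI ballI)
  show "0 < d" by fact
  show "cball x d <= {s. 0 < Re s}" using cb d0 by fastforce
  show "summable (%n. K * real (Suc n) powr (- d - 1))" using d0 by (intro summable_mult summable_Suc_powr) simp
  fix n y assume y: "y \<in> cball x d"
  have "norm (of_real (chebyshev_psi (Suc n)) * zeta_term n (y + 1)) <=
   4 * (norm (y + 1) * norm y) * real (Suc n) powr (- Re y - 1)" using cb[OF y] d0 by (intro norm_psi_term_le) auto
  also have "... <= K * real (Suc n) powr (- d - 1)"
  proof (rule mult_mono)
   show "4 * (norm (y + 1) * norm y) <= K" using norm_triangle_ineq[of y 1] cb(2)[OF y] cb[OF y] d0 unfolding K_def by (intro mult_mono) auto
   show "real (Suc n) powr (- Re y - 1) <= real (Suc n) powr (- d - 1)" using cb[OF y] by (intro powr_mono) auto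
   show "0 <= K" unfolding K_def using d0 by simp
  qed auto
  finally show "norm (of_real (chebyshev_psi (Suc n)) * zeta_term n (y + 1)) <= K * real (Suc n) powr (- d - 1)" .
 qed
qed

text \<open>Summation by parts, with a boundary term that vanishes in the limit by Chebyshev's
  bound. Replacing each difference of powers by its leading term costs exactly
  \<open>zeta_term n (s + 1)\<close>.\<close>

lemma psi_sum:
 assumes s: "Re s > 1"
 shows "(%n. s * (of_real (chebyshev_psi (Suc n)) * of_nat (Suc n) powr (- 1 - s))) sums (log_deriv_sum s + psi_error_sum s)"
proof -
 define u where "u n = (of_nat (Suc n) powr (- s) :: complex)" for n
 have part: "(\<Sum>n<N. mangoldt (Suc n) * u n) =
  (\<Sum>n<N. of_real (chebyshev_psi (Suc n)) * (u n - u (Suc n))) + of_real (chebyshev_psi N) * u N" for N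
  by (induction N) (simp_all add: chebyshev_psi_def[of 0] chebyshev_psi_Suc algebra_simps)
 have "(%N. \<Sum>n<N. mangoldt (Suc n) * u n) \<longlonglongrightarrow> log_deriv_sum s"
  using summable_sums[OF summable_norm_cancel[OF summable_log_deriv_sum[OF s]]] unfolding sums_def log_deriv_sum_def u_def .
 moreover have "(%N. of_real (chebyshev_psi N) * u N) \<longlonglongrightarrow> 0"
 proof (rule Lim_null_comparison)
  show "\<forall>\<^sub>F N in sequentially. norm (of_real (chebyshev_psi N) * u N) <= 4 * real (Suc N) powr (1 - Re s)"
  proof (rule always_eventually, rule allI)
   fix N
   have "norm (of_real (chebyshev_psi N) * u N) = chebyshev_psi N * real (Suc N) powr (- Re s)"
    unfolding u_def norm_mult norm_of_nat_powr using chebyshev_psi_nonneg by simp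
   also have "... <= (4 * real (Suc N)) * real (Suc N) powr (- Re s)" using chebyshev_psi_le[of N] by simp
   also have "... = 4 * (real (Suc N) powr 1 * real (Suc N) powr (- Re s))" by simp
   also have "real (Suc N) powr 1 * real (Suc N) powr (- Re s) = real (Suc N) powr (1 - Re s)" unfolding powr_add[symmetric] by simp
   finally show "norm (of_real (chebyshev_psi N) * u N) <= 4 * real (Suc N) powr (1 - Re s)" .
  qed
  have "filterlim (%n. real (Suc n)) at_top sequentially" by (rule filterlim_compose[OF filterlim_real_sequentially filterlim_Suc])
  hence "(%N. real (Suc N) powr (1 - Re s)) \<longlonglongrightarrow> 0" using s by (intro tendsto_neg_powr) auto
  from tendsto_mult_left[OF this, of 4] show "(%N. 4 * real (Suc N) powr (1 - Re s)) \<longlonglongrightarrow> 0" by simp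
 qed
 ultimately have "(%N. (\<Sum>n<N. mangoldt (Suc n) * u n) - of_real (chebyshev_psi N) * u N) \<longlonglongrightarrow> log_deriv_sum s - 0"
  by (rule tendsto_diff)
 hence 1: "(%n. of_real (chebyshev_psi (Suc n)) * (u n - u (Suc n))) sums log_deriv_sum s" unfolding sums_def part by simp
 have 2: "(%n. of_real (chebyshev_psi (Suc n)) * zeta_term n (s + 1)) sums psi_error_sum s" using s unfolding psi_error_sum_def
  by (force intro: summable_comparison_test'[of _ 0] summable_mult summable_Suc_powr norm_psi_term_le)
 have "of_real (chebyshev_psi (Suc n)) * (u n - u (Suc n)) + of_real (chebyshev_psi (Suc n)) * zeta_term n (s + 1) =
  s * (of_real (chebyshev_psi (Suc n)) * of_nat (Suc n) powr (- 1 - s))" for n by (auto simp: zeta_term_def u_def algebra_simps)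
 with sums_add[OF 1 2] show ?thesis by simp
qed

text \<open>An excess \<open>f N >= (1 + eta) * N\<close> persists by monotonicity: half of it
  survives for the next \<open>eta * N / 2\<close> integers, so this block of the series is at least
  a constant times \<open>eta ^ 2\<close>, against the Cauchy criterion. A deficit is propagated to
  the left in the same way.\<close>

lemma tendsto_1_if_summable_error:
 fixes f :: "nat => real"
 assumes mono: "!!m n. m <= n ==> f m <= f n" and sm: "summable (%n. (f (Suc n) - real (Suc n)) / (real (Suc n))\<^sup>2)"
 shows "(%n. f n / real n) \<longlonglongrightarrow> 1"
proof (rule LIMSEQ_I)
 fix r :: real assume r: "r > 0"
 define eta where "eta = min 1 r"
 have eta: "0 < eta" "eta <= 1" "eta <= r" using r by (auto simp: eta_def)
 define a where "a n = (f n - real n) / (real n)\<^sup>2" for n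
 have "summable a" using sm summable_Suc_iff[of a] by (simp add: a_def)
 then obtain N0 where N0: "!!m n. m >= N0 ==> norm (sum a {m..<n}) < eta\<^sup>2 / 32"
  unfolding summable_Cauchy using eta(1) by (metis divide_pos_pos zero_less_numeral zero_less_power)
 show "\<exists>no. \<forall>n\<ge>no. norm (f n / real n - 1) < r"
 proof (intro exI allI impI)
  fix N assume N: "N >= max (2 * N0) (nat \<lceil>4 / eta\<rceil>)"
  hence N1: "N >= 2 * N0" "real N >= 4 / eta" by auto
  hence etaN: "eta * real N >= 4" using eta by (simp add: field_simps)
  have Npos: "real N > 0" using etaN eta by (metis less_le_trans zero_less_mult_pos zero_less_numeral)
  define k where "k = nat \<lfloor>eta * real N / 2\<rfloor>"
  have k: "real k <= eta * real N / 2" "real k >= eta * real N / 4"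
  proof -
   have "real k = of_int \<lfloor>eta * real N / 2\<rfloor>" using etaN by (simp add: k_def)
   thus "real k <= eta * real N / 2" "real k >= eta * real N / 4" using etaN by linarith+
  qed
  have kN: "real k <= real N / 2" using k(1) mult_right_mono[OF eta(2), of "real N"] by linarith
  have "f N < (1 + eta) * real N"
  proof (rule ccontr)
   assume "~ f N < (1 + eta) * real N"
   hence fN: "f N >= (1 + eta) * real N" by simp
   have "eta\<^sup>2 / 32 = (eta * real N / 4) * (eta / (8 * real N))" using Npos by (simp add: power2_eq_square)
   also have "... <= real k * (eta / (8 * real N))" using k(2) eta by (intro mult_right_mono) auto
   also have "... = (\<Sum>n\<in>{N..<N + k}. eta / (8 * real N))" by simp
   also have "... <= sum a {N..<N + k}"
   proof (rule sum_mono)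
    fix n assume n: "n \<in> {N..<N + k}"
    hence n1: "real n <= real N + real k" "n >= N" by auto
    have "f n >= f N" using mono n1 by simp
    hence num: "f n - real n >= eta * real N / 2" using fN n1(1) k(1) by (simp add: algebra_simps)
    have den: "(real n)\<^sup>2 <= (2 * real N)\<^sup>2" using n1 kN by (intro power_mono) auto
    have "eta / (8 * real N) = (eta * real N / 2) / (2 * real N)\<^sup>2" by (simp add: power2_eq_square)
    also have "... <= (f n - real n) / (real n)\<^sup>2"
    proof (rule frac_le)
     show "0 <= f n - real n" using num mult_pos_pos[OF eta(1) Npos] by linarith
    qed (use num den Npos n1 in auto)
    finally show "eta / (8 * real N) <= a n" by (simp add: a_def)
   qed
   also have "... < eta\<^sup>2 / 32" using N0[of N "N + k"] N1(1) by simp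
   finally show False by simp
  qed
  moreover have "f N > (1 - eta) * real N"
  proof (rule ccontr)
   assume "~ f N > (1 - eta) * real N"
   hence fN: "f N <= (1 - eta) * real N" by simp
   have kN': "k <= N" using kN by linarith
   have "(\<Sum>n\<in>{N - k..<N}. eta / (2 * real N)) <= (\<Sum>n\<in>{N - k..<N}. - a n)"
   proof (rule sum_mono)
    fix n assume n: "n \<in> {N - k..<N}"
    hence n1: "real n >= real N - real k" "n <= N" by auto
    hence npos: "real n > 0" using kN Npos by linarith
    have "f n <= f N" using mono n1 by simp
    hence num: "real n - f n >= eta * real N / 2" using fN n1(1) k(1) by (simp add: algebra_simps)
    have den: "(real n)\<^sup>2 <= (real N)\<^sup>2" using n1 by simp
    have "eta / (2 * real N) = (eta * real N / 2) / (real N)\<^sup>2" by (simp add: power2_eq_square)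
    also have "... <= (real n - f n) / (real n)\<^sup>2"
    proof (rule frac_le)
     show "0 <= real n - f n" using num mult_pos_pos[OF eta(1) Npos] by linarith
    qed (use num den npos in auto)
    finally show "eta / (2 * real N) <= - a n" by (simp add: a_def minus_divide_left)
   qed
   moreover have "(\<Sum>n\<in>{N - k..<N}. eta / (2 * real N)) = real k * (eta / (2 * real N))" using kN' by simp
   moreover have "real k * (eta / (2 * real N)) >= (eta * real N / 4) * (eta / (2 * real N))" using k(2) eta by (intro mult_right_mono) auto
   moreover have "(eta * real N / 4) * (eta / (2 * real N)) = eta\<^sup>2 / 8" using Npos by (simp add: power2_eq_square)
   moreover have "norm (sum a {N - k..<N}) < eta\<^sup>2 / 32"
   proof (rule N0)
    have "real (N - k) >= real N / 2" using kN kN' by simp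
    moreover have "real N >= 2 * real N0" using N1(1) by linarith
    ultimately show "N0 <= N - k" by linarith
   qed
   moreover have "eta\<^sup>2 > 0" using eta by simp
   moreover have "(\<Sum>n\<in>{N - k..<N}. - a n) <= norm (sum a {N - k..<N})" by (simp add: sum_negf)
   ultimately show False by linarith
  qed
  ultimately have "\<bar>f N - real N\<bar> < r * real N" using mult_right_mono[OF eta(3), of "real N"] by (simp add: algebra_simps)
  moreover have "f N / real N - 1 = (f N - real N) / real N" using Npos by (simp add: diff_divide_distrib)
  ultimately show "norm (f N / real N - 1) < r" using Npos by (simp add: pos_divide_less_eq)
 qed
qed

text \<open>The coefficients \<open>b n\<close> are bounded by Chebyshev's estimate, and their
  Dirichlet series continues across \<open>Re z = 0\<close> because \<open>zeta1\<close> has no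
  zeros with real part at least 1. Newman's theorem gives convergence at 0, and the monotonicity of
  \<open>chebyshev_psi\<close> turns this into an asymptotic.\<close>

theorem prime_number_theorem: "(%n. chebyshev_theta n / real n) \<longlonglongrightarrow> 1"
proof -
 define b where "b n = chebyshev_psi (Suc n) / real (Suc n) - 1" for n
 \<comment> \<open>The series of the \<open>b n\<close> is \<open>(D + K) / s - Z\<close>, in which
   \<open>D\<close> and \<open>Z\<close> have poles at \<open>s = 1\<close>. By
   \<open>1 / ((s - 1) * s) = 1 / (s - 1) - 1 / s\<close> these combine to
   \<open>- (zeta1 s - 1) / (s - 1)\<close>, whose singularity is removable; \<open>q\<close> fills
   it in.\<close>
 define q where "q s = (if s = 1 then deriv zeta1 1 else (zeta1 s - 1) / (s - 1))" for s
 define A where "A = {z. Re z > -1} \<inter> {z. Re z > - 1 & zeta1 (z + 1) ~= 0}"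
 define F where "F z = (psi_error_sum (z + 1) - deriv zeta1 (z + 1) / zeta1 (z + 1) - 1) / (z + 1) - q (z + 1)" for z
 define S where "S = {s. Re s > 0}"
 have S: "open S" unfolding S_def by (rule open_halfspace_Re_gt)
 have hol: "zeta1 holomorphic_on S" "deriv zeta1 holomorphic_on S" "psi_error_sum holomorphic_on S" "q holomorphic_on S"
 proof -
  show z: "zeta1 holomorphic_on S" unfolding S_def by (rule zeta1_holomorphic)
  show "deriv zeta1 holomorphic_on S" by (rule holomorphic_deriv[OF z S])
  show "psi_error_sum holomorphic_on S" unfolding S_def by (rule psi_error_sum_holomorphic)
  have z1: "(%s. zeta1 s - 1) holomorphic_on S" by (intro holomorphic_intros z)
  show "q holomorphic_on S"
  proof (rule pole_theorem_open_0[OF z1 S, where a = 1])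
   show "q 1 = deriv (%s. zeta1 s - 1) 1" using z S holomorphic_on_imp_differentiable_at by (auto simp: S_def q_def)
  qed (auto simp: q_def)
 qed
 have shift: "(%z. f (z + 1)) holomorphic_on {z. Re z > -1}" if "f holomorphic_on S" for f
 proof -
  have "(f \<circ> (%z. z + 1)) holomorphic_on {z. Re z > -1}"
   by (rule holomorphic_on_compose_gen[OF _ that]) (auto intro!: holomorphic_intros simp: S_def)
  thus ?thesis by (simp add: o_def)
 qed
 have "open ({z. Re z > -1} \<inter> (%z. zeta1 (z + 1)) -` (- {0}))"
  by (auto intro!: holomorphic_on_imp_continuous_on[OF shift[OF hol(1)]] continuous_open_preimage open_halfspace_Re_gt)
 moreover have "{z. Re z > -1} \<inter> (%z. zeta1 (z + 1)) -` (- {0}) = A" by (auto simp: A_def)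
 ultimately have oA: "open A" by simp
 have subA: "{z. Re z >= 0} <= A" using zeta1_nonzero by (auto simp: A_def)
 have holF: "F holomorphic_on A"
 proof -
  have *: "(%z. f (z + 1)) holomorphic_on A" if "f holomorphic_on S" for f using shift[OF that] by (rule holomorphic_on_subset) (auto simp: A_def)
  have "z + 1 ~= 0" if "z \<in> A" for z using that by (auto simp: A_def complex_eq_iff)
  thus ?thesis unfolding F_def by (intro holomorphic_intros * hol) (auto simp: A_def)
 qed
 have "(%n. of_real (b n) * of_nat (Suc n) powr (- 1 - z)) sums F z" if z: "Re z > 0" for z
 proof -
  define s where "s = z + 1"
  have s: "Re s > 1" using z by (simp add: s_def)
  have s0: "s ~= 0" "s ~= 1" using s by auto
  have g0: "zeta1 s ~= 0" using zeta1_nonzero s by simp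
  define D K g g' Z where "D = log_deriv_sum s" and "K = psi_error_sum s" and "g = zeta1 s" and "g' = deriv zeta1 s"
   and "Z = zeta_sum s"
  have "(%n. of_real (chebyshev_psi (Suc n)) * of_nat (Suc n) powr (- 1 - s)) sums ((D + K) / s)"
   using sums_divide[OF psi_sum[OF s], of s] s0 unfolding D_def K_def by simp
  moreover have "(%n. of_nat (Suc n) powr (- s)) sums Z"
   unfolding Z_def zeta_sum_def by (rule summable_sums[OF summable_norm_cancel[OF summable_Dirichlet(1)[OF s]]])
  ultimately have "(%n. of_real (chebyshev_psi (Suc n)) * of_nat (Suc n) powr (- 1 - s) - of_nat (Suc n) powr (- s)) sums ((D + K) / s - Z)"
   by (rule sums_diff)
  moreover have "of_real (chebyshev_psi (Suc n)) * of_nat (Suc n) powr (- 1 - s) - of_nat (Suc n) powr (- s) =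
   complex_of_real (b n) * of_nat (Suc n) powr (- 1 - z)" for n
  proof -
   have n0: "complex_of_nat (Suc n) ~= 0" by (simp only: of_nat_eq_0_iff)
   define w where "w = (of_nat (Suc n) powr (- 1 - z) :: complex)"
   have e: "- 1 - s = (- 1 - z) - 1" "- s = - 1 - z" by (simp_all add: s_def)
   have "of_nat (Suc n) powr (- 1 - s) = w / complex_of_nat (Suc n)" unfolding e(1) w_def by (subst powr_diff) simp
   moreover have "of_nat (Suc n) powr (- s) = w" unfolding e(2) w_def ..
   moreover have "complex_of_real (b n) = of_real (chebyshev_psi (Suc n)) / of_nat (Suc n) - 1" unfolding b_def by simp
   ultimately show ?thesis unfolding w_def[symmetric] by (simp only: left_diff_distrib) simp
  qed
  moreover have "(D + K) / s - Z = F z"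
  proof -
   have "(s - 1) * D * g = g - (s - 1) * g'" unfolding D_def g_def g'_def by (rule log_deriv_sum_zeta1[OF s])
   hence D: "D = 1 / (s - 1) - g' / g" using g0 s0 unfolding g_def[symmetric] by (simp add: field_simps)
   have Z: "Z = g / (s - 1)" using zeta1_eq_zeta_sum[OF s] s0 by (simp add: Z_def g_def)
   have "F z = (K - g' / g - 1) / s - (g - 1) / (s - 1)" unfolding F_def s_def[symmetric] K_def g_def g'_def q_def using s0 by simp
   also have "... = (D + K) / s - Z"
   proof -
    have "1 / (s - 1) / s = 1 / (s - 1) - 1 / s" using s0 by (simp add: divide_simps)
    thus ?thesis unfolding D Z by (simp add: diff_divide_distrib add_divide_distrib)
   qed
   finally show ?thesis by simp
  qed
  ultimately show ?thesis by simp
 qed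
 moreover have "\<bar>b n\<bar> <= 4" for n
 proof -
  have "chebyshev_psi (Suc n) / real (Suc n) <= 4" using chebyshev_psi_le[of "Suc n"] by (simp add: divide_le_eq)
  moreover have "chebyshev_psi (Suc n) / real (Suc n) >= 0" using chebyshev_psi_nonneg by simp
  ultimately show ?thesis unfolding b_def by simp
 qed
 ultimately have "(%n. complex_of_real (b n) / of_nat (Suc n)) sums F 0" using Newman_tauberian[of 4 b A F] oA subA holF by auto
 hence "(%n. Re (complex_of_real (b n) / of_nat (Suc n))) sums Re (F 0)" by (rule sums_Re)
 hence "summable (%n. Re (complex_of_real (b n) / of_nat (Suc n)))" by (rule sums_summable)
 moreover have "Re (complex_of_real (b n) / of_nat (Suc n)) = (chebyshev_psi (Suc n) - real (Suc n)) / (real (Suc n))\<^sup>2" for n unfolding b_def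
  by (simp add: field_simps power2_eq_square)
 ultimately show ?thesis by (auto intro!: tendsto_1_if_summable_error mono_chebyshev_psi chebyshev_theta_asymp)
qed

section \<open>Pfaffians and kernel vectors\<close>

text \<open>The sign of moving \<open>y\<close> to the front of \<open>S\<close>.\<close>

definition pos_sign :: "'m::linorder set => 'm => 'a::comm_ring_1" where
 "pos_sign S y = (- 1) ^ card {z \<in> S. z < y}"

lemma pos_sign_mult_self [simp]: "pos_sign S y * pos_sign S y = 1" by (simp add: pos_sign_def)

lemma pos_sign_mult_self' [simp]: "pos_sign S y * (pos_sign S y * x) = x" by (simp flip: mult.assoc)

lemma pos_sign_remove:
 assumes "finite S" "x \<in> S"
 shows "pos_sign (S - {x}) y = (if x < y then - pos_sign S y else pos_sign S y)"
proof (cases "x < y")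
 case True
 have "{z \<in> S. z < y} = insert x {z \<in> S - {x}. z < y}" using assms True by auto
 thus ?thesis using assms True by (simp add: pos_sign_def)
next
 case False
 hence "{z \<in> S. z < y} = {z \<in> S - {x}. z < y}" by auto
 thus ?thesis using False by (simp add: pos_sign_def)
qed

text \<open>The Pfaffian of the submatrix on an index set, by expansion along the smallest index.\<close>

function pf :: "('m::linorder => 'm => 'a::comm_ring_1) => 'm set => 'a" where
 "pf F S = (if S = {} | infinite S then 1
   else (\<Sum>y\<in>S - {Min S}. F (Min S) y * pos_sign (S - {Min S}) y * pf F (S - {Min S, y})))" by pat_completeness auto

termination by (relation "Wellfounded.measure (card \<circ> snd)") (auto intro!: psubset_card_mono)

declare pf.simps [simp del]

lemma pf_empty [simp]: "pf F {} = 1" by (simp add: pf.simps)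

lemma pf_Min:
 assumes "finite S" "S ~= {}"
 shows "pf F S = (\<Sum>y\<in>S - {Min S}. F (Min S) y * pos_sign (S - {Min S}) y * pf F (S - {Min S, y}))" using assms by (subst pf.simps) simp

lemma sum_swap_remove:
 assumes "finite J"
 shows "(\<Sum>y\<in>J. \<Sum>z\<in>J - {y}. h y z) = (\<Sum>z\<in>J. \<Sum>y\<in>J - {z}. h y z)"
proof -
 have "(\<Sum>y\<in>J. \<Sum>z\<in>J - {y}. h y z) = (\<Sum>y\<in>J. \<Sum>z\<in>J. if y ~= z then h y z else 0)"
  using assms by (intro sum.mono_neutral_cong_left) auto
 also have "... = (\<Sum>z\<in>J. \<Sum>y\<in>J. if y ~= z then h y z else 0)" by (rule sum.swap)
 also have "... = (\<Sum>z\<in>J. \<Sum>y\<in>J - {z}. h y z)" using assms by (intro sum.mono_neutral_cong_right) auto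
 finally show ?thesis .
qed

text \<open>Expansion along \<open>Min S\<close> followed, inductively, by row \<open>i\<close>
  leads to the same double sum over \<open>y\<close> and \<open>z\<close> as expansion along row
  \<open>i\<close> followed by \<open>Min S\<close>. Only the entry joining \<open>Min S\<close> and
  \<open>i\<close> stands apart, and there skewness matches the two sides.\<close>

lemma pf_expand:
 fixes F :: "'m::linorder => 'm => 'a::comm_ring_1"
 assumes "finite S" "i \<in> S" and skew: "!!a b. F b a = - F a b"
 shows "pf F S = pos_sign S i * (\<Sum>y\<in>S - {i}. F i y * pos_sign (S - {i}) y * pf F (S - {i, y}))" using assms(1,2)
proof (induction "card S" arbitrary: S rule: less_induct)
 case less
 note fin = less.prems(1) and iS = less.prems(2)
 define f where "f = Min S"
 have fS: "f \<in> S" "!!y. y \<in> S ==> f <= y" using fin iS by (auto simp: f_def intro!: Min_in)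
 show ?case
 proof (cases "i = f")
  case True
  have "{z \<in> S. z < i} = {}" using fS True by (auto simp: not_less)
  hence "pos_sign S i = (1::'a)" by (simp only: pos_sign_def) simp
  moreover have "pf F S = (\<Sum>y\<in>S - {f}. F f y * pos_sign (S - {f}) y * pf F (S - {f, y}))"
   unfolding f_def using fin iS by (intro pf_Min) auto
  ultimately show ?thesis by (simp only: True mult_1)
 next
  case False
  hence fi: "f < i" using fS iS by fastforce
  define J where "J = S - {f, i}"
  have finJ: "finite J" using fin by (simp add: J_def)
  \<comment> \<open>The common summand. Each conditional factor -1 records whether the deletion of
    one index changes the position of another, which brings both orders of expansion into one
    form.\<close>
  define g where "g y z = - F f y * F i z *
   (pos_sign S y * pos_sign S i * pos_sign S z *
    (if y < i then -1 else 1) * (if i < z then -1 else 1) * (if y < z then -1 else 1)) *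
    pf F (S - {f, i, y, z})" for y z
  have f_lt: "f < y" if "y \<in> J" for y using that fS by (auto simp: J_def order.strict_iff_order)
  have 1: "pos_sign (S - {f}) y = - (pos_sign S y :: 'a)" if "f < y" for y using that fin fS by (simp add: pos_sign_remove)
  have L: "F f y * pos_sign (S - {f}) y * pf F (S - {f, y}) = (\<Sum>z\<in>J - {y}. g y z)"
   if y: "y \<in> J" for y
  proof -
   have yS: "y \<in> S" "y ~= f" "y ~= i" using y by (auto simp: J_def)
   have c: "card (S - {f, y}) < card S" using fin fS by (intro psubset_card_mono) auto
   have "pf F (S - {f, y}) = pos_sign (S - {f, y}) i *
    (\<Sum>z\<in>S - {f, y} - {i}. F i z * pos_sign (S - {f, y} - {i}) z * pf F (S - {f, y} - {i, z}))"
    by (rule less.hyps[OF c]) (use fin iS yS fi in auto)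
   also have "S - {f, y} - {i} = J - {y}" by (auto simp: J_def)
   finally have "F f y * pos_sign (S - {f}) y * pf F (S - {f, y}) =
    (\<Sum>z\<in>J - {y}. F f y * pos_sign (S - {f}) y * pos_sign (S - {f, y}) i *
     (F i z * pos_sign (J - {y}) z * pf F (S - {f, y} - {i, z})))" by (simp add: sum_distrib_left mult.assoc)
   also have "... = (\<Sum>z\<in>J - {y}. g y z)"
   proof (intro sum.cong refl)
    fix z assume z: "z \<in> J - {y}"
    have e1: "pos_sign (S - {f, y}) i = (if y < i then 1 else -1) * (pos_sign S i :: 'a)"
    proof -
     have "S - {f, y} = S - {f} - {y}" by auto
     thus ?thesis using fin fS yS fi by simp (simp add: pos_sign_remove)
    qed
    have e2: "pos_sign (J - {y}) z =
     (if y < z then -1 else 1) * ((if i < z then 1 else -1) * (pos_sign S z :: 'a))"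
    proof -
     have "J - {y} = S - {f} - {i} - {y}" by (auto simp: J_def)
     moreover have "f < z" using f_lt z by blast
     ultimately show ?thesis using fin fS(1) iS yS fi by simp (simp add: pos_sign_remove)
    qed
    have e3: "S - {f, y} - {i, z} = S - {f, i, y, z}" by auto
    have e4: "pos_sign (S - {f}) y = - (pos_sign S y :: 'a)" using 1 f_lt y by blast
    show "F f y * pos_sign (S - {f}) y * pos_sign (S - {f, y}) i *
     (F i z * pos_sign (J - {y}) z * pf F (S - {f, y} - {i, z})) = g y z" unfolding g_def e1 e2 e3 e4 by simp
   qed
   finally show ?thesis .
  qed
  have R: "pos_sign S i * (F i z * pos_sign (S - {i}) z * pf F (S - {i, z})) = (\<Sum>y\<in>J - {z}. g y z)"
   if z: "z \<in> J" for z
  proof -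
   have zS: "z \<in> S" "z ~= f" "z ~= i" using z by (auto simp: J_def)
   have m: "Min (S - {i, z}) = f" using fin fS zS False by (intro Min_eqI) auto
   have "pf F (S - {i, z}) = (\<Sum>y\<in>S - {i, z} - {f}. F f y *
     pos_sign (S - {i, z} - {f}) y * pf F (S - {i, z} - {f, y}))" by (subst pf_Min, (use fin fS(1) zS False in auto)[2]) (simp only: m)
   also have "S - {i, z} - {f} = J - {z}" by (auto simp: J_def)
   finally have "pos_sign S i * (F i z * pos_sign (S - {i}) z * pf F (S - {i, z})) =
    (\<Sum>y\<in>J - {z}. pos_sign S i * (F i z * pos_sign (S - {i}) z *
     (F f y * pos_sign (J - {z}) y * pf F (S - {i, z} - {f, y}))))" by (simp add: sum_distrib_left)
   also have "... = (\<Sum>y\<in>J - {z}. g y z)"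
   proof (intro sum.cong refl)
    fix y assume y: "y \<in> J - {z}"
    hence yS: "y \<in> S" "y ~= i" "y ~= z" "f < y" using f_lt by (auto simp: J_def)
    have e1: "pos_sign (S - {i}) z = (if i < z then -1 else 1) * (pos_sign S z :: 'a)" using fin iS by (simp add: pos_sign_remove)
    have e2: "pos_sign (J - {z}) y =
     (if y < z then 1 else -1) * ((if y < i then -1 else 1) * (pos_sign S y :: 'a))"
    proof -
     have "J - {z} = S - {f} - {i} - {z}" by (auto simp: J_def)
     moreover have "(i < y) = (~ y < i)" "(z < y) = (~ y < z)" using yS by auto
     ultimately show ?thesis using fin fS(1) iS yS zS fi by simp (simp add: pos_sign_remove)
    qed
    have e3: "S - {i, z} - {f, y} = S - {f, i, y, z}" by auto
    show "pos_sign S i * (F i z * pos_sign (S - {i}) z *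
     (F f y * pos_sign (J - {z}) y * pf F (S - {i, z} - {f, y}))) = g y z" unfolding g_def e1 e2 e3 by simp
   qed
   finally show ?thesis .
  qed
  have "pf F S = (\<Sum>y\<in>S - {f}. F f y * pos_sign (S - {f}) y * pf F (S - {f, y}))" unfolding f_def using fin iS by (intro pf_Min) auto
  also have "... = F f i * pos_sign (S - {f}) i * pf F (S - {f, i}) +
    (\<Sum>y\<in>J. F f y * pos_sign (S - {f}) y * pf F (S - {f, y}))"
  proof -
   have "S - {f} - {i} = J" by (auto simp: J_def)
   thus ?thesis using fin iS False by (subst sum.remove[of _ i]) auto
  qed
  also have "(\<Sum>y\<in>J. F f y * pos_sign (S - {f}) y * pf F (S - {f, y})) = (\<Sum>y\<in>J. \<Sum>z\<in>J - {y}. g y z)"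
   by (intro sum.cong refl L)
  also have "... = (\<Sum>z\<in>J. \<Sum>y\<in>J - {z}. g y z)" by (rule sum_swap_remove[OF finJ])
  also have "... = (\<Sum>z\<in>J. pos_sign S i * (F i z * pos_sign (S - {i}) z * pf F (S - {i, z})))" by (intro sum.cong refl R[symmetric])
  also have "F f i * pos_sign (S - {f}) i * pf F (S - {f, i}) =
    pos_sign S i * (F i f * pos_sign (S - {i}) f * pf F (S - {i, f}))"
  proof -
   have "{z \<in> S - {i}. z < f} = {}" using fS by (auto simp: not_less)
   hence "pos_sign (S - {i}) f = (1::'a)" by (simp only: pos_sign_def) simp
   moreover have "S - {i, f} = S - {f, i}" by auto
   ultimately show ?thesis using 1[OF fi] skew[of i f] by simp
  qed
  also have "pos_sign S i * (F i f * pos_sign (S - {i}) f * pf F (S - {i, f})) +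
    (\<Sum>z\<in>J. pos_sign S i * (F i z * pos_sign (S - {i}) z * pf F (S - {i, z}))) =
    (\<Sum>z\<in>S - {i}. pos_sign S i * (F i z * pos_sign (S - {i}) z * pf F (S - {i, z})))"
  proof -
   have "S - {i} - {f} = J" by (auto simp: J_def)
   thus ?thesis using fin fS False by (subst sum.remove[of "S - {i}" f]) auto
  qed
  finally show ?thesis by (simp add: sum_distrib_left)
 qed
qed

text \<open>
 For an index set of odd size this is the kernel vector given by the signed sub-Pfaffians.
\<close>

definition pf_vec :: "('m::linorder => 'm => 'a::comm_ring_1) => 'm set => 'm => 'a" where
 "pf_vec F S y = pos_sign S y * pf F (S - {y})"

lemma pf_insert_eq_dot:
 assumes "finite S" "i \<notin> S" and "!!a b. F b a = - F a b"
 shows "pf F (insert i S) = pos_sign (insert i S) i * (\<Sum>y\<in>S. F i y * pf_vec F S y)"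
proof -
 have e: "insert i S - {i} = S" "!!y. insert i S - {i, y} = S - {y}" using assms(2) by auto
 have "pf F (insert i S) = pos_sign (insert i S) i * (\<Sum>y\<in>insert i S - {i}.
   F i y * pos_sign (insert i S - {i}) y * pf F (insert i S - {i, y}))" by (rule pf_expand[where F = F, OF _ _ assms(3)]) (use assms(1) in auto)
 thus ?thesis unfolding e by (simp only: pf_vec_def mult.assoc)
qed

text \<open>The sum is the formal expansion of a Pfaffian with the index \<open>i\<close> repeated.
  Expanding \<open>pf_vec\<close> along row \<open>i\<close> once more gives summands antisymmetric
  in \<open>y\<close> and \<open>z\<close>, so the sum equals its own negative; characteristic 0
  allows the division by 2.\<close>

lemma row_dot_pf_vec:
 fixes F :: "'m::linorder => 'm => 'a::{idom,ring_char_0}"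
 assumes fin: "finite S" and iS: "i \<in> S" and skew: "!!a b. F b a = - F a b"
 shows "(\<Sum>y\<in>S. F i y * pf_vec F S y) = 0"
proof -
 have "F i i + F i i = 0" by (subst skew) (rule left_minus)
 hence Fii: "F i i = 0" by simp
 define J where "J = S - {i}"
 have finJ: "finite J" using fin by (simp add: J_def)
 define g where "g y z = F i y * F i z * (pos_sign S y * pos_sign S i * pos_sign S z *
   (if y < i then -1 else 1) * (if i < z then -1 else 1) * (if y < z then -1 else 1)) *
   pf F (S - {i, y, z})" for y z
 have anti: "g z y = - g y z" if "y \<in> J" "z \<in> J" "y ~= z" for y z
 proof -
  have e: "S - {i, z, y} = S - {i, y, z}" by auto
  show ?thesis using that unfolding g_def e by (auto simp: J_def)
 qed
 have L: "F i y * pf_vec F S y = (\<Sum>z\<in>J - {y}. g y z)" if y: "y \<in> J" for y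
 proof -
  have yS: "y \<in> S" "y ~= i" using y by (auto simp: J_def)
  have "pf F (S - {y}) = pos_sign (S - {y}) i *
   (\<Sum>z\<in>S - {y} - {i}. F i z * pos_sign (S - {y} - {i}) z * pf F (S - {y} - {i, z}))"
   by (rule pf_expand[where F = F, OF _ _ skew]) (use fin iS yS in auto)
  also have "S - {y} - {i} = J - {y}" by (auto simp: J_def)
  finally have "F i y * pf_vec F S y = (\<Sum>z\<in>J - {y}. F i y * (pos_sign S y * (pos_sign (S - {y}) i *
   (F i z * pos_sign (J - {y}) z * pf F (S - {y} - {i, z})))))" by (simp add: pf_vec_def sum_distrib_left)
  also have "... = (\<Sum>z\<in>J - {y}. g y z)"
  proof (intro sum.cong refl)
   fix z assume z: "z \<in> J - {y}"
   have e1: "pos_sign (S - {y}) i = (if y < i then -1 else 1) * (pos_sign S i :: 'a)" using fin yS by (simp add: pos_sign_remove)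
   have e2: "pos_sign (J - {y}) z =
    (if y < z then -1 else 1) * ((if i < z then -1 else 1) * (pos_sign S z :: 'a))" using fin iS yS by (auto simp: J_def pos_sign_remove)
   have e3: "S - {y} - {i, z} = S - {i, y, z}" by auto
   show "F i y * (pos_sign S y * (pos_sign (S - {y}) i *
    (F i z * pos_sign (J - {y}) z * pf F (S - {y} - {i, z})))) = g y z" unfolding g_def e1 e2 e3 by simp
  qed
  finally show ?thesis .
 qed
 have "(\<Sum>y\<in>S. F i y * pf_vec F S y) = (\<Sum>y\<in>J. F i y * pf_vec F S y)"
  using fin iS Fii unfolding J_def by (subst sum.remove[of _ i]) auto
 also have "... = (\<Sum>y\<in>J. \<Sum>z\<in>J - {y}. g y z)" by (intro sum.cong refl L)
 finally have X: "(\<Sum>y\<in>S. F i y * pf_vec F S y) = (\<Sum>y\<in>J. \<Sum>z\<in>J - {y}. g y z)" .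
 have "(\<Sum>y\<in>J. \<Sum>z\<in>J - {y}. g y z) = (\<Sum>z\<in>J. \<Sum>y\<in>J - {z}. g y z)" by (rule sum_swap_remove[OF finJ])
 also have "... = (\<Sum>z\<in>J. \<Sum>y\<in>J - {z}. - g z y)" by (intro sum.cong anti) auto
 also have "... = - (\<Sum>y\<in>J. \<Sum>z\<in>J - {y}. g y z)" by (simp add: sum_negf)
 finally show ?thesis using X by simp
qed

text \<open>Cramer's rule for Pfaffians: weighting the rows other than \<open>i\<close> by
  \<open>pf_vec F (S - {i})\<close> annihilates every column except column \<open>i\<close>, and
  there leaves \<open>w i\<close> times the Pfaffian up to sign.\<close>

lemma pf_nonzero_kernel_trivial:
 fixes F :: "'m::linorder => 'm => real"
 assumes fin: "finite S" and skew: "!!a b. F b a = - F a b" and nz: "pf F S ~= 0"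
  and ker: "!!i. i \<in> S ==> (\<Sum>y\<in>S. F i y * w y) = 0" and iS: "i \<in> S"
 shows "w i = 0"
proof -
 define J where "J = S - {i}"
 have SJ: "S = insert i J" "i \<notin> J" "finite J" using iS fin by (auto simp: J_def)
 have "0 = (\<Sum>z\<in>J. (\<Sum>j\<in>S. F z j * w j) * pf_vec F J z)" using ker SJ by simp
 also have "... = (\<Sum>j\<in>S. - w j * (\<Sum>z\<in>J. F j z * pf_vec F J z))"
 proof -
  have "(\<Sum>z\<in>J. (\<Sum>j\<in>S. F z j * w j) * pf_vec F J z) = (\<Sum>z\<in>J. \<Sum>j\<in>S. - w j * (F j z * pf_vec F J z))"
   unfolding sum_distrib_right by (intro sum.cong refl) (subst skew, simp)
  also have "... = (\<Sum>j\<in>S. \<Sum>z\<in>J. - w j * (F j z * pf_vec F J z))" by (rule sum.swap)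
  finally show ?thesis by (simp only: sum_distrib_left)
 qed
 also have "... = - w i * (\<Sum>z\<in>J. F i z * pf_vec F J z)" using row_dot_pf_vec[where F = F, OF SJ(3) _ skew] SJ by simp
 finally show ?thesis using nz pf_insert_eq_dot[where F = F, OF SJ(3,2) skew] SJ(1) by auto
qed

text \<open>A non-zero component at \<open>y0\<close> means a non-zero Pfaffian on
  \<open>S - {y0}\<close>. After subtracting the multiple of \<open>pf_vec\<close> with the same
  component at \<open>y0\<close>, what remains lies in a trivial kernel.\<close>

lemma pf_vec_spans_kernel:
 fixes F :: "'m::linorder => 'm => real"
 assumes fin: "finite S" and skew: "!!a b. F b a = - F a b" and "y0 \<in> S" "pf_vec F S y0 ~= 0"
  and ker: "!!i. i \<in> S ==> (\<Sum>y\<in>S. F i y * w y) = 0"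
 shows "\<exists>c. \<forall>y\<in>S. w y = c * pf_vec F S y"
proof -
 define c where "c = w y0 / pf_vec F S y0"
 define w' where "w' y = w y - c * pf_vec F S y" for y
 have w0: "w' y0 = 0" using assms(4) by (simp add: w'_def c_def)
 have "w' i = 0" if "i \<in> S - {y0}" for i
 proof (rule pf_nonzero_kernel_trivial[where F = F, OF _ skew _ _ that])
  show "finite (S - {y0})" "pf F (S - {y0}) ~= 0" using fin assms(4) by (auto simp: pf_vec_def)
  fix j assume j: "j \<in> S - {y0}"
  have "(\<Sum>y\<in>S - {y0}. F j y * w' y) = (\<Sum>y\<in>S. F j y * w' y)" using fin assms(3) w0 by (subst sum.remove[of S y0]) auto
  also have "... = (\<Sum>y\<in>S. F j y * w y) - c * (\<Sum>y\<in>S. F j y * pf_vec F S y)"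
   by (simp add: w'_def algebra_simps sum_subtractf sum_distrib_left)
  also have "... = 0" using ker[of j] row_dot_pf_vec[where F = F and i = j, OF fin _ skew] j by simp
  finally show "(\<Sum>y\<in>S - {y0}. F j y * w' y) = 0" .
 qed
 thus ?thesis using w0 by (auto simp: w'_def)
qed

text \<open>
 A kernel vector comes from a maximal index set with non-zero Pfaffian, enlarged by one index.
\<close>

lemma pf_zero_imp_kernel:
 fixes F :: "'m::linorder => 'm => real"
 assumes fin: "finite S" and skew: "!!a b. F b a = - F a b" and z: "pf F S = 0" and ev: "even (card S)"
 shows "\<exists>w. (\<exists>y\<in>S. w y ~= 0) & (\<forall>i\<in>S. (\<Sum>y\<in>S. F i y * w y) = 0)"
proof -
 define X where "X = {R. R <= S & pf F R ~= 0}"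
 have "finite X" "{} \<in> X" using fin by (auto simp: X_def)
 hence "Max (card ` X) \<in> card ` X" by (intro Max_in) auto
 then obtain R where R: "Max (card ` X) = card R" "R \<in> X" by auto
 have Rmax: "card R' <= card R" if "R' \<in> X" for R' unfolding R(1)[symmetric] using that \<open>finite X\<close> by simp
 have "R \<subset> S" using R(2) z unfolding X_def by blast
 then obtain i where i: "i \<in> S" "i \<notin> R" by blast
 define Q where "Q = insert i R"
 have finR: "finite R" using \<open>R \<subset> S\<close> fin finite_subset by blast
 have finQ: "finite Q" "Q <= S" using i \<open>R \<subset> S\<close> finR by (auto simp: Q_def)
 have vi: "pf_vec F Q i ~= 0" using i R(2) by (auto simp: Q_def pf_vec_def pos_sign_def X_def)
 define w where "w y = (if y \<in> Q then pf_vec F Q y else 0)" for y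
 have red: "(\<Sum>y\<in>S. F r y * w y) = (\<Sum>y\<in>Q. F r y * pf_vec F Q y)" for r
  using fin finQ unfolding w_def by (intro sum.mono_neutral_cong_right) auto
 have "(\<Sum>y\<in>S. F r y * w y) = 0" if "r \<in> S" for r
 proof (cases "r \<in> Q")
  case True
  thus ?thesis unfolding red by (intro row_dot_pf_vec[where F = F] finQ(1) skew)
 next
  case False
  have "card (insert r Q) > card R" using i finR by (simp add: Q_def card_insert_if)
  thus ?thesis using Rmax[of "insert r Q"] that finQ pf_insert_eq_dot[where F = F, OF finQ(1) False skew] by (auto simp: pos_sign_def X_def red)
 qed
 moreover have "w i ~= 0" using vi by (simp add: w_def Q_def)
 ultimately show ?thesis using i by blast
qed

section \<open>The recursive Pfaffian as a signed sum over matchings\<close>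

definition matching_sum :: "nat => (nat => nat => 'a::comm_ring_1) => 'a" where
 "matching_sum n f =
   (\<Sum>sg\<in>matching_perms n. of_int (sign sg) * (\<Prod>i<n. f (sg (2 * i)) (sg (2 * i + 1))))"

text \<open>The increasing enumeration of the numbers other than 0 and \<open>j + 1\<close>.\<close>

definition skip_two :: "nat => nat => nat" where
 "skip_two j a = (if a < j then a + 1 else a + 2)"

text \<open>The matching that pairs \<open>0\<close> with \<open>j + 1\<close> and matches the remaining numbers as in \<open>tau\<close>.\<close>

definition pair_first :: "nat => (nat => nat) => nat => nat" where
 "pair_first j tau i = (if i = 0 then 0 else if i = 1 then j + 1 else skip_two j (tau (i - 2)))"

definition shift_two :: "(nat => nat) => nat => nat" where
 "shift_two tau i = (if i < 2 then i else tau (i - 2) + 2)"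

lemma skip_two_less_iff [simp]: "skip_two j a < skip_two j b \<longleftrightarrow> a < b" by (auto simp: skip_two_def)

lemma skip_two_eq_iff [simp]: "skip_two j a = skip_two j b \<longleftrightarrow> a = b" by (auto simp: skip_two_def)

lemma pair_first_decomp: "pair_first j tau = pair_first j (%k. k) \<circ> shift_two tau" by (auto simp: pair_first_def shift_two_def)

text \<open>Raising \<open>j\<close> by one composes with an adjacent transposition, which changes
  the sign once.\<close>

lemma pair_first_id:
 "j <= m ==> pair_first j (%k. k) permutes {..<m + 2} & sign (pair_first j (%k. k)) = (- 1) ^ j"
proof (induction j)
 case 0
 have e: "pair_first 0 (%k. k) = id" by (auto simp: pair_first_def skip_two_def fun_eq_iff)
 show ?case unfolding e using permutes_id[of "{..<m + 2}"] sign_id by (metis power_0)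
next
 case (Suc j)
 define t where "t = Transposition.transpose (j + 1) (j + 2)"
 have eq: "pair_first (Suc j) (%k. k) = t \<circ> pair_first j (%k. k)"
 proof
  fix x
  consider "x = 0" | "x = 1" | "x >= 2" "x - 2 < j" | "x >= 2" "x - 2 = j" | "x >= 2" "x - 2 > j" by linarith
  thus "pair_first (Suc j) (%k. k) x = (t \<circ> pair_first j (%k. k)) x" by cases (auto simp: pair_first_def skip_two_def t_def)
 qed
 have t: "t permutes {..<m + 2}" unfolding t_def using Suc.prems by (intro permutes_swap_id) auto
 have "permutation t" "permutation (pair_first j (%k. k))" using t Suc permutes_imp_permutation[OF finite_lessThan] by auto
 hence "sign (pair_first (Suc j) (%k. k)) = sign t * sign (pair_first j (%k. k))" unfolding eq by (rule sign_compose)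
 moreover have "t \<circ> pair_first j (%k. k) permutes {..<m + 2}" using Suc t permutes_compose by auto
 moreover have "sign t = - 1" by (simp add: t_def sign_swap_id)
 moreover have "sign (pair_first j (%k. k)) = (- 1) ^ j" using Suc by simp
 ultimately show ?case unfolding eq by (metis power_Suc)
qed

lemma shift_two_permutes:
 assumes "tau permutes {..<m}"
 shows "shift_two tau permutes {..<m + 2} & sign (shift_two tau) = sign tau" using assms finite_lessThan
proof (induction tau rule: permutes_induct)
 case id
 have e: "shift_two id = id" by (auto simp: shift_two_def fun_eq_iff)
 show ?case unfolding e using permutes_id[of "{..<m + 2}"] by blast
next
 case (swap a b tau)
 have eq: "shift_two (Transposition.transpose a b \<circ> tau) = Transposition.transpose (a + 2) (b + 2) \<circ> shift_two tau"
  by (auto simp: shift_two_def Transposition.transpose_def)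
 have t: "Transposition.transpose (a + 2) (b + 2) permutes {..<m + 2}" using swap by (intro permutes_swap_id) auto
 have "permutation (Transposition.transpose (a + 2) (b + 2))" "permutation (shift_two tau)" "permutation (Transposition.transpose a b)"
  "permutation tau" using t swap permutes_imp_permutation[OF finite_lessThan] permutation_swap_id by auto
 hence "sign (shift_two (Transposition.transpose a b \<circ> tau)) = sign (Transposition.transpose a b \<circ> tau)"
  unfolding eq using swap by (simp add: sign_compose sign_swap_id)
 moreover have "Transposition.transpose (a + 2) (b + 2) \<circ> shift_two tau permutes {..<m + 2}" using swap t permutes_compose by blast
 ultimately show ?case unfolding eq by blast
qed

lemma pair_first_permutes:
 assumes "tau permutes {..<m}" "j <= m"
 shows "pair_first j tau permutes {..<m + 2}" (is ?g1) "sign (pair_first j tau) = (- 1) ^ j * sign tau" (is ?g2)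
proof -
 note p = pair_first_id[OF assms(2)] shift_two_permutes[OF assms(1)]
 show ?g1 unfolding pair_first_decomp[of j tau] using p permutes_compose by blast
 show ?g2 using p permutes_imp_permutation[OF finite_lessThan] by (auto simp: sign_compose pair_first_decomp[of j tau])
qed

lemma pair_first_matching:
 assumes "tau \<in> matching_perms n" "j < 2 * n + 1"
 shows "pair_first j tau \<in> matching_perms (Suc n)"
proof -
 have 1: "pair_first j tau permutes {..<2 * Suc n}" using pair_first_permutes(1)[of tau "2 * n" j] assms by (auto simp: matching_perms_def)
 have 2: "pair_first j tau (2 * i) < pair_first j tau (2 * i + 1)" if "i < Suc n" for i
  using that assms by (cases i) (auto simp: pair_first_def matching_perms_def)
 have 3: "pair_first j tau (2 * i) < pair_first j tau (2 * k)" if "k < Suc n" "i < k" for i k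
 proof (cases k)
  case (Suc k')
  show ?thesis
  proof (cases i)
   case 0
   thus ?thesis using Suc by (simp add: pair_first_def skip_two_def)
  next
   case (Suc i')
   thus ?thesis using that \<open>k = Suc k'\<close> assms(1) Suc by (auto simp: matching_perms_def pair_first_def)
  qed
 qed (use that in simp)
 show ?thesis using 1 2 3 by (auto simp: matching_perms_def)
qed

text \<open>At any place other than 0, the ordering conditions would require a value below 0, so
  \<open>sg 0 = 0\<close>. Undoing the pairing of 0 with \<open>sg 1\<close> by \<open>inv c\<close>
  leaves a permutation that fixes 0 and 1, and shifting it by two gives the smaller
  matching.\<close>

lemma matching_perms_Suc_cases:
 assumes "sg \<in> matching_perms (Suc n)"
 obtains j tau where "j < 2 * n + 1" "tau \<in> matching_perms n" "sg = pair_first j tau"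
proof -
 have per: "sg permutes {..<2 * n + 2}" using assms by (auto simp: matching_perms_def)
 have m2: "sg (2 * i) < sg (2 * i + 1)" if "i < Suc n" for i using assms that by (auto simp: matching_perms_def)
 have m3: "sg (2 * i) < sg (2 * k)" if "k < Suc n" "i < k" for i k using assms that by (auto simp: matching_perms_def)
 have s0: "sg 0 = 0"
 proof -
  obtain i where i: "sg i = 0" using permutes_surj[OF per] by (metis surjD)
  hence "i < 2 * n + 2" using permutes_in_image[OF per, of i] by auto
  show ?thesis
  proof (cases "even i")
   case True
   then obtain k where k: "i = 2 * k" by blast
   show ?thesis
   proof (cases "k = 0")
    case False
    hence "sg (2 * 0) < sg (2 * k)" using \<open>i < 2 * n + 2\<close> k by (intro m3) auto
    thus ?thesis using i k by simp
   qed (use i k in simp)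
  next
   case False
   then obtain k where k: "i = 2 * k + 1" using oddE by blast
   hence "sg (2 * k) < sg (2 * k + 1)" using \<open>i < 2 * n + 2\<close> by (intro m2) auto
   thus ?thesis using i k by simp
  qed
 qed
 define j where "j = sg 1 - 1"
 have s1: "sg 1 = j + 1" using m2[of 0] s0 by (simp add: j_def)
 have j: "j < 2 * n + 1" using permutes_in_image[OF per, of 1] s1 by simp
 define c where "c = pair_first j (%k. k)"
 have c: "c permutes {..<2 * n + 2}" using pair_first_id[of j "2 * n"] j by (auto simp: c_def)
 define rho where "rho = inv c \<circ> sg"
 have rho: "rho permutes {..<2 * n + 2}" unfolding rho_def using per c permutes_inv permutes_compose by blast
 have "c 0 = 0" "c 1 = j + 1" by (auto simp: c_def pair_first_def)
 hence rho01: "rho 0 = 0" "rho 1 = 1" unfolding rho_def using s0 s1 permutes_inverses(2)[OF c] by (metis comp_apply)+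
 have inj: "rho x = rho y \<longleftrightarrow> x = y" for x y using permutes_inj[OF rho] by (auto dest: injD)
 have ge2: "rho (i + 2) >= 2" for i
 proof -
  have "rho (i + 2) ~= rho 0" "rho (i + 2) ~= rho 1" unfolding inj by auto
  thus ?thesis using rho01 by linarith
 qed
 define tau where "tau i = rho (i + 2) - 2" for i
 have tau2: "tau i + 2 = rho (i + 2)" for i using ge2[of i] by (simp add: tau_def)
 have pertau: "tau permutes {..<2 * n}" unfolding permutes_def
 proof (intro conjI allI impI)
  fix x assume "x \<notin> {..<2 * n}"
  thus "tau x = x" using permutes_not_in[OF rho, of "x + 2"] by (simp add: tau_def)
 next
  fix y
  obtain x where x: "rho x = y + 2" using permutes_surj[OF rho] by (metis surjD)
  have "x ~= 0" "x ~= 1" using x rho01 by (metis add_2_eq_Suc' nat.distinct(1), metis One_nat_def add_2_eq_Suc' nat.distinct(1) nat.inject)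
  hence "x = (x - 2) + 2" by simp
  hence "tau (x - 2) = y" using x tau2[of "x - 2"] by simp
  moreover have "x' = x''" if "tau x' = y" "tau x'' = y" for x' x'' using tau2[of x'] tau2[of x''] that by (auto simp: inj)
  ultimately show "\<exists>!x. tau x = y" by blast
 qed
 have "shift_two tau i = rho i" for i
 proof (cases "i < 2")
  case True
  hence "i = 0 | i = 1" by auto
  thus ?thesis using rho01 by (auto simp: shift_two_def)
 next
  case False
  hence "i = (i - 2) + 2" by simp
  thus ?thesis using tau2[of "i - 2"] by (simp add: shift_two_def)
 qed
 hence "shift_two tau = rho" by blast
 moreover have "c \<circ> rho = sg" unfolding rho_def using permutes_inverses(1)[OF c] by auto
 ultimately have sg: "sg = pair_first j tau" using pair_first_decomp[of j tau] by (simp add: c_def)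
 have "tau (2 * i) < tau (2 * i + 1)" if "i < n" for i using m2[of "Suc i"] that by (simp add: sg pair_first_def)
 moreover have "tau (2 * i) < tau (2 * k)" if "k < n" "i < k" for i k using m3[of "Suc k" "Suc i"] that by (simp add: sg pair_first_def)
 ultimately have "tau \<in> matching_perms n" using pertau by (auto simp: matching_perms_def)
 thus thesis using that j sg by blast
qed

lemma bij_betw_pair_first:
 "bij_betw (%(j, tau). pair_first j tau) ({..<2 * n + 1} \<times> matching_perms n) (matching_perms (Suc n))"
proof (rule bij_betw_imageI)
 show "inj_on (%(j, tau). pair_first j tau) ({..<2 * n + 1} \<times> matching_perms n)"
 proof (rule inj_onI, clarify, intro conjI)
  fix j tau j' tau'
  assume e: "pair_first j tau = pair_first j' tau'"
  show j: "j = j'" using fun_cong[OF e, of 1] by (simp add: pair_first_def)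
  show "tau = tau'"
  proof
   fix i show "tau i = tau' i" using fun_cong[OF e, of "i + 2"] j by (simp add: pair_first_def)
  qed
 qed
 show "(%(j, tau). pair_first j tau) ` ({..<2 * n + 1} \<times> matching_perms n) = matching_perms (Suc n)"
  using pair_first_matching by (fastforce elim: matching_perms_Suc_cases)
qed

lemma matching_sum_Suc:
 "matching_sum (Suc n) f =
   (\<Sum>j<2 * n + 1. (- 1) ^ j * f 0 (j + 1) * matching_sum n (%a b. f (skip_two j a) (skip_two j b)))"
proof -
 have "matching_sum (Suc n) f = (\<Sum>(j, tau)\<in>{..<2 * n + 1} \<times> matching_perms n.
   of_int (sign (pair_first j tau)) * (\<Prod>i<Suc n. f (pair_first j tau (2 * i)) (pair_first j tau (2 * i + 1))))" unfolding matching_sum_def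
  by (subst sum.reindex_bij_betw[OF bij_betw_pair_first, symmetric]) (simp add: case_prod_unfold)
 also have "... = (\<Sum>(j, tau)\<in>{..<2 * n + 1} \<times> matching_perms n. (- 1) ^ j * f 0 (j + 1) *
   (of_int (sign tau) * (\<Prod>i<n. f (skip_two j (tau (2 * i))) (skip_two j (tau (2 * i + 1))))))"
 proof (intro sum.cong refl, clarify)
  fix j tau assume t: "tau \<in> matching_perms n" and j: "j < 2 * n + 1"
  have "sign (pair_first j tau) = (- 1) ^ j * sign tau" using pair_first_permutes(2)[of tau "2 * n" j] j t by (auto simp: matching_perms_def)
  moreover have "(\<Prod>i<Suc n. f (pair_first j tau (2 * i)) (pair_first j tau (2 * i + 1))) =
   f 0 (j + 1) * (\<Prod>i<n. f (skip_two j (tau (2 * i))) (skip_two j (tau (2 * i + 1))))"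
   unfolding prod.lessThan_Suc_shift by (simp add: pair_first_def)
  ultimately show "of_int (sign (pair_first j tau)) *
    (\<Prod>i<Suc n. f (pair_first j tau (2 * i)) (pair_first j tau (2 * i + 1))) =
   (- 1) ^ j * f 0 (j + 1) *
    (of_int (sign tau) * (\<Prod>i<n. f (skip_two j (tau (2 * i))) (skip_two j (tau (2 * i + 1)))))" by simp
 qed
 also have "... = (\<Sum>j<2 * n + 1. \<Sum>tau\<in>matching_perms n. (- 1) ^ j * f 0 (j + 1) *
   (of_int (sign tau) * (\<Prod>i<n. f (skip_two j (tau (2 * i))) (skip_two j (tau (2 * i + 1))))))" by (rule sum.cartesian_product[symmetric])
 finally show ?thesis by (simp add: matching_sum_def sum_distrib_left)
qed

lemma skip_two_image:
 assumes "j < 2 * n + 1"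
 shows "{..<2 * Suc n} - {0, j + 1} = skip_two j ` {..<2 * n}"
proof (intro equalityI subsetI)
 fix x assume "x \<in> {..<2 * Suc n} - {0, j + 1}"
 hence "x = skip_two j (if x < j + 1 then x - 1 else x - 2)"
  "(if x < j + 1 then x - 1 else x - 2) < 2 * n" using assms by (auto simp: skip_two_def)
 thus "x \<in> skip_two j ` {..<2 * n}" by blast
qed (auto simp: skip_two_def split: if_splits)

text \<open>Both sides split off the pair that contains the smallest index, with sign
  \<open>(- 1) ^ j\<close> for the partner \<open>e (j + 1)\<close>. An arbitrary increasing
  \<open>e\<close> lets the induction pass to \<open>e \<circ> skip_two j\<close>.\<close>

lemma pf_eq_matching_sum:
 fixes e :: "nat => 'm::linorder" and F :: "'m => 'm => 'a::comm_ring_1"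
 assumes "strict_mono_on {..<2 * n} e"
 shows "pf F (e ` {..<2 * n}) = matching_sum n (%a b. F (e a) (e b))" using assms
proof (induction n arbitrary: e)
 case 0
 show ?case by (auto simp: matching_perms_def matching_sum_def)
next
 case (Suc n)
 have less: "e a < e b \<longleftrightarrow> a < b" if "a < 2 * Suc n" "b < 2 * Suc n" for a b
  using strict_mono_on_less[OF Suc.prems, of a b] that by simp
 define S where "S = e ` {..<2 * Suc n}"
 have fin: "finite S" "S ~= {}" by (auto simp: S_def)
 have inj: "inj_on e {..<2 * Suc n}" using Suc.prems strict_mono_on_imp_inj_on by blast
 have minS: "Min S = e 0"
 proof (rule Min_eqI)
  show "e 0 <= y" if "y \<in> S" for y
  proof -
   obtain a where a: "a < 2 * Suc n" "y = e a" using \<open>y \<in> S\<close> unfolding S_def by blast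
   thus ?thesis using less[of a 0] by simp
  qed
 qed (auto simp: S_def)
 have S1: "S - {e 0} = (%j. e (j + 1)) ` {..<2 * n + 1}"
 proof -
  have "S - {e 0} = e ` ({..<2 * Suc n} - {0})" unfolding S_def by (subst inj_on_image_set_diff[OF inj]) auto
  also have "{..<2 * Suc n} - {0} = (%j. j + 1) ` {..<2 * n + 1}"
  proof (intro equalityI subsetI)
   fix x assume "x \<in> {..<2 * Suc n} - {0}"
   hence "x = (x - 1) + 1" "x - 1 \<in> {..<2 * n + 1}" by auto
   thus "x \<in> (%j. j + 1) ` {..<2 * n + 1}" by blast
  qed auto
  finally show ?thesis by auto
 qed
 have inj1: "inj_on (%j. e (j + 1)) {..<2 * n + 1}" by (rule inj_onI) (use inj in "auto dest: inj_onD")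
 have ps: "pos_sign (S - {e 0}) (e (j + 1)) = ((- 1) ^ j :: 'a)" if "j < 2 * n + 1" for j
 proof -
  have "{z \<in> S - {e 0}. z < e (j + 1)} = (%i. e (i + 1)) ` {..<j}"
  proof (intro equalityI subsetI)
   fix z assume "z \<in> {z \<in> S - {e 0}. z < e (j + 1)}"
   then obtain i where i: "z = e (i + 1)" "i < 2 * n + 1" "e (i + 1) < e (j + 1)" unfolding S1 by blast
   thus "z \<in> (%i. e (i + 1)) ` {..<j}" using less[of "i + 1" "j + 1"] that i by simp
  next
   fix z assume "z \<in> (%i. e (i + 1)) ` {..<j}"
   then obtain i where i: "i < j" "z = e (i + 1)" by blast
   thus "z \<in> {z \<in> S - {e 0}. z < e (j + 1)}" unfolding S1 using less[of "i + 1" "j + 1"] that by auto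
  qed
  moreover have "inj_on (%i. e (i + 1)) {..<j}" using inj1 that by (auto intro: inj_on_subset)
  ultimately show ?thesis by (simp add: pos_sign_def card_image)
 qed
 have rest: "pf F (S - {e 0, e (j + 1)}) = matching_sum n (%a b. F (e (skip_two j a)) (e (skip_two j b)))"
  if "j < 2 * n + 1" for j
 proof -
  have "S - {e 0, e (j + 1)} = e ` ({..<2 * Suc n} - {0, j + 1})" unfolding S_def using that by (subst inj_on_image_set_diff[OF inj]) auto
  also have "... = (e \<circ> skip_two j) ` {..<2 * n}" using skip_two_image[OF that] by auto
  finally have eq: "S - {e 0, e (j + 1)} = (e \<circ> skip_two j) ` {..<2 * n}" .
  have "strict_mono_on {..<2 * n} (e \<circ> skip_two j)"
  proof (rule strict_mono_onI)
   fix r s assume rs: "r \<in> {..<2 * n}" "s \<in> {..<2 * n}" "r < s"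
   thus "(e \<circ> skip_two j) r < (e \<circ> skip_two j) s" using less rs by (auto simp: skip_two_def)
  qed
  thus ?thesis unfolding eq using Suc.IH[of "e \<circ> skip_two j"] by (simp only: o_def)
 qed
 have "pf F S = (\<Sum>y\<in>S - {e 0}. F (e 0) y * pos_sign (S - {e 0}) y * pf F (S - {e 0, y}))" using pf_Min[OF fin, of F] unfolding minS .
 also have "... = (\<Sum>j<2 * n + 1. F (e 0) (e (j + 1)) * pos_sign (S - {e 0}) (e (j + 1)) * pf F (S - {e 0, e (j + 1)}))"
  by (subst (1) S1) (simp only: sum.reindex[OF inj1] o_def)
 also have "... = (\<Sum>j<2 * n + 1. (- 1) ^ j * F (e 0) (e (j + 1)) *
   matching_sum n (%a b. F (e (skip_two j a)) (e (skip_two j b))))" by (intro sum.cong refl) (simp only: lessThan_iff ps rest, simp only: mult_ac)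
 also have "... = matching_sum (Suc n) (%a b. F (e a) (e b))" by (simp only: matching_sum_Suc)
 finally show ?case unfolding S_def .
qed

lemma pfaffian_eq_pf:
 fixes A :: "('a::comm_ring_1, 'm::{finite,linorder}) sq_matrix"
 assumes "CARD('m) = 2 * n"
 shows "pfaffian A = pf (%i j. A $ i $ j) UNIV"
proof -
 let ?l = "sorted_list_of_set (UNIV :: 'm set)"
 have len: "length ?l = 2 * n" using assms by simp
 have sm: "strict_mono_on {..<2 * n} (nth_index :: nat => 'm)"
 proof (rule strict_mono_onI)
  fix r s assume "r \<in> {..<2 * n}" "s \<in> {..<2 * n}" "r < s"
  moreover have "sorted_wrt (<) ?l" by simp
  ultimately show "nth_index r < (nth_index s :: 'm)" using sorted_wrt_nth_less[of "(<)" ?l r s] len by (simp add: nth_index_def)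
 qed
 have "nth_index ` {..<2 * n} = (UNIV :: 'm set)"
 proof -
  have "set ?l = nth_index ` {..<2 * n}" unfolding set_conv_nth nth_index_def len by auto
  thus ?thesis by simp
 qed
 thus ?thesis using pf_eq_matching_sum[OF sm, of "%i j. A $ i $ j"] assms by (simp add: pfaffian_def matching_sum_def)
qed

section \<open>Integral vectors near a subspace\<close>

definition int_vecs :: "(real^'m::finite) set" where
 "int_vecs = {x. \<forall>i. x $ i \<in> \<int>}"

lemma int_vecs_diff: "x \<in> int_vecs ==> y \<in> int_vecs ==> x - y \<in> int_vecs"
 and int_vecs_scale: "x \<in> int_vecs ==> c \<in> \<int> ==> c *\<^sub>R x \<in> int_vecs" by (auto simp: int_vecs_def)

lemma axis_int_vecs: "axis i 1 \<in> int_vecs" by (auto simp: int_vecs_def axis_def)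

text \<open>
 A lattice all of whose vectors outside a subspace stay away from it has a dual lattice that is
 dense modulo that subspace. The subspace is enlarged by one almost closest lattice vector at a time.
\<close>

lemma int_vec_near_dual_point:
 fixes V :: "(real^'m::finite) set"
 assumes "subspace V" and "CARD('m) - dim V = d" and "dl > 0"
  and "!!w x. w \<in> int_vecs ==> w \<notin> V ==> x \<in> V ==> norm (w - x) >= dl"
  and "y \<in> V" and "!!x. x \<in> int_vecs ==> x \<in> V ==> y \<bullet> x \<in> \<int>"
 shows "\<exists>e\<in>int_vecs. (\<forall>x\<in>V. (e - y) \<bullet> x = 0) & norm (e - y) <= 2 ^ d / dl" using assms
proof (induction d arbitrary: V dl y)
 case 0
 have "dim V = DIM(real^'m)" using dim_subset_UNIV[of V] 0 by simp
 hence V: "V = UNIV" using 0(1) dim_eq_full span_eq_iff by metis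
 show ?case using 0(6)[OF axis_int_vecs] V 0 unfolding int_vecs_def by (simp add: inner_axis)
next
 case (Suc d)
 note sub = Suc.prems(1)
 define X where "X = {norm (w - x) | w x. w \<in> int_vecs & w \<notin> V & x \<in> V}"
 define d0 where "d0 = Inf X"
 have "\<exists>i. axis i 1 \<notin> V"
 proof (rule ccontr)
  assume "~ ?thesis"
  hence "Basis <= V" by (auto simp: Basis_vec_def)
  hence "span V = UNIV" by (metis span_Basis span_mono top.extremum_uniqueI)
  hence "dim V = CARD('m)" by (metis dim_eq_full DIM_cart DIM_real mult.right_neutral)
  thus False using Suc.prems(2) by simp
 qed
 then obtain i0 :: 'm where i0: "axis i0 1 \<notin> V" by blast
 have Xne: "X ~= {}" using i0 axis_int_vecs subspace_0[OF sub] unfolding X_def by blast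
 have Xge: "!!r. r \<in> X ==> r >= dl" using Suc.prems(4) unfolding X_def by blast
 have bdd: "bdd_below X" using Xge by (meson bdd_belowI)
 have d0: "d0 >= dl" unfolding d0_def by (rule cInf_greatest[OF Xne Xge])
 hence d0p: "d0 > 0" using Suc.prems(3) by simp
 have d0le: "norm (w - x) >= d0" if "w \<in> int_vecs" "w \<notin> V" "x \<in> V" for w x
  unfolding d0_def by (rule cInf_lower[OF _ bdd]) (use that X_def in blast)
 \<comment> \<open>The infimum \<open>d0\<close> need not be attained, and 10 percent of slack is
   affordable: the enlarged subspace keeps the distance \<open>8/10 * d0\<close> because
   \<open>1 - (1/2) ^ 2 * (11/10) ^ 2 >= (8/10) ^ 2\<close>, and the bounds close up because
   \<open>5/4 * 2 ^ d + 1/2 <= 2 ^ Suc d\<close>.\<close>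
 have "\<exists>r\<in>X. r < 11/10 * d0" using cInf_lessD[OF Xne, of "11/10 * d0"] d0p d0_def by auto
 then obtain w x where w: "w \<in> int_vecs" "w \<notin> V" "x \<in> V" "norm (w - x) < 11/10 * d0" unfolding X_def by blast
 obtain p q where pq: "p \<in> span V" "!!z. z \<in> span V ==> orthogonal q z" "w = p + q" using orthogonal_subspace_decomp_exists[of V w] by blast
 have spV: "span V = V" using sub by simp
 have pV: "p \<in> V" using pq(1) spV by simp
 have qV: "q \<bullet> z = 0" if "z \<in> V" for z using pq(2)[of z] that spV by (simp add: orthogonal_def)
 have q_ge: "norm q >= d0" using d0le[OF w(1,2) pV] pq(3) by simp
 have q_le: "norm q < 11/10 * d0"
 proof -
  have "w - x = q + (p - x)" using pq(3) by simp
  moreover have "q \<bullet> (p - x) = 0" using qV pV w(3) sub by (simp add: subspace_diff)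
  ultimately have "norm (w - x) ^ 2 = norm q ^ 2 + norm (p - x) ^ 2" by (simp add: power2_norm_eq_inner inner_simps inner_commute)
  hence "norm q ^ 2 <= norm (w - x) ^ 2" by simp
  thus ?thesis using w(4) by simp
 qed
 have qq: "q \<bullet> q > 0" using q_ge d0p by auto
 have qw: "q \<bullet> w = q \<bullet> q" using pq(3) qV[OF pV] by (simp add: inner_simps)
 define V' where "V' = span (insert w V)"
 have subV': "subspace V'" unfolding V'_def by simp
 have VV': "V <= V'" "w \<in> V'" unfolding V'_def by (auto intro: span_base)
 have qV': "q \<in> V'" using pq(3) subspace_diff[OF subV' VV'(2) subsetD[OF VV'(1) pV]] by simp
 have V'E: "\<exists>v0 c. v0 \<in> V & z = v0 + c *\<^sub>R w" if "z \<in> V'" for z using \<open>z \<in> V'\<close> spV by (auto simp: V'_def span_insert)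
 have "w \<notin> span V" using w(2) unfolding spV .
 hence dimV': "CARD('m) - dim V' = d" using Suc.prems(2) unfolding V'_def by (simp add: dim_insert)
 \<comment> \<open>\<open>y\<close> is moved along \<open>q\<close>, orthogonally to
   \<open>V\<close>, just far enough for its product with \<open>w\<close> to become the nearest
   integer. The move has length at most \<open>1 / (2 * norm q)\<close>.\<close>
 define c0 where "c0 = (of_int (round (y \<bullet> w)) - y \<bullet> w) / (q \<bullet> q)"
 define y' where "y' = y + c0 *\<^sub>R q"
 have y'w: "y' \<bullet> w = of_int (round (y \<bullet> w))" using qq qw by (simp add: y'_def c0_def inner_simps)
 \<comment> \<open>Subtracting the nearest multiple of \<open>w\<close> leaves an integral vector at
   distance at most \<open>norm q / 2 < d0\<close> from \<open>V\<close>, which therefore lies in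
   \<open>V\<close>. So the integral vectors of \<open>V'\<close> are those of \<open>V\<close> plus
   multiples of \<open>w\<close>, and \<open>y'\<close> has integral products with all of
   them.\<close>
 have red: "x - of_int a *\<^sub>R w \<in> V"
  if "x \<in> int_vecs" "x = v0 + c *\<^sub>R w" "v0 \<in> V" "a = round c" for x v0 c a
 proof (rule ccontr)
  assume "x - of_int a *\<^sub>R w \<notin> V"
  moreover have "x - of_int a *\<^sub>R w \<in> int_vecs" using that w(1) by (auto intro!: int_vecs_diff int_vecs_scale)
  moreover have "v0 + (c - of_int a) *\<^sub>R p \<in> V" using that(3) pV sub by (auto intro!: subspace_add subspace_scale)
  ultimately have "d0 <= norm (x - of_int a *\<^sub>R w - (v0 + (c - of_int a) *\<^sub>R p))" using d0le by blast
  also have "x - of_int a *\<^sub>R w - (v0 + (c - of_int a) *\<^sub>R p) = (c - of_int a) *\<^sub>R q"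
   using that(2) pq(3) by (simp add: algebra_simps)
  also have "norm ... = \<bar>c - of_int a\<bar> * norm q" by simp
  also have "... <= 1/2 * norm q" using of_int_round_abs_le[of c] that(4) by (intro mult_right_mono) (auto simp: abs_minus_commute)
  finally show False using q_le d0p by simp
 qed
 have "\<exists>e\<in>int_vecs. (\<forall>x\<in>V'. (e - y') \<bullet> x = 0) & norm (e - y') <= 2 ^ d / (8/10 * dl)"
 proof (rule Suc.IH[OF subV' dimV'])
  show "0 < 8/10 * dl" using Suc.prems(3) by simp
  show "y' \<in> V'" unfolding y'_def using VV' qV' Suc.prems(5) subV' by (auto intro!: subspace_add subspace_scale)
  show "y' \<bullet> x \<in> \<int>" if x: "x \<in> int_vecs" "x \<in> V'" for x
  proof -
   obtain v0 c where vc: "v0 \<in> V" "x = v0 + c *\<^sub>R w" using V'E[OF x(2)] by blast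
   define u where "u = x - of_int (round c) *\<^sub>R w"
   have u: "u \<in> V" "u \<in> int_vecs" using red[OF x(1) vc(2,1) refl] x(1) w(1) unfolding u_def by (auto intro!: int_vecs_diff int_vecs_scale)
   have "y' \<bullet> u \<in> \<int>" using qV[OF u(1)] Suc.prems(6)[OF u(2,1)] by (simp add: y'_def inner_simps)
   moreover have "y' \<bullet> x = y' \<bullet> u + of_int (round c) * (y' \<bullet> w)" unfolding u_def by (simp add: inner_simps)
   ultimately show ?thesis using y'w by auto
  qed
  show "8/10 * dl <= norm (x - z)" if x: "x \<in> int_vecs" "x \<notin> V'" "z \<in> V'" for x z
  proof -
   have spV': "span V' = V'" using subV' by simp
   obtain z0 r where zr: "z0 \<in> span V'" "!!z. z \<in> span V' ==> orthogonal r z" "x = z0 + r"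
    using orthogonal_subspace_decomp_exists[of V' x] by blast
   have rV: "r \<bullet> z = 0" if "z \<in> V'" for z using zr(2)[of z] that spV' by (simp add: orthogonal_def)
   have z0: "z0 \<in> V'" using zr(1) spV' by simp
   obtain v0 c where vc: "v0 \<in> V" "z0 = v0 + c *\<^sub>R w" using V'E[OF z0] by blast
   define a where "a = round c"
   have aw: "of_int a *\<^sub>R w \<in> V'" using VV' subV' by (simp add: subspace_scale)
   have "x - of_int a *\<^sub>R w \<notin> V"
   proof
    assume "x - of_int a *\<^sub>R w \<in> V"
    hence "(x - of_int a *\<^sub>R w) + of_int a *\<^sub>R w \<in> V'" using VV' aw subV' by (intro subspace_add) auto
    thus False using x(2) by simp
   qed
   moreover have "x - of_int a *\<^sub>R w \<in> int_vecs" using x(1) w(1) by (auto intro!: int_vecs_diff int_vecs_scale)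
   moreover have "v0 + (c - of_int a) *\<^sub>R p \<in> V" using vc(1) pV sub by (auto intro!: subspace_add subspace_scale)
   ultimately have "d0 <= norm (x - of_int a *\<^sub>R w - (v0 + (c - of_int a) *\<^sub>R p))" using d0le by blast
   also have "x - of_int a *\<^sub>R w - (v0 + (c - of_int a) *\<^sub>R p) = r + (c - of_int a) *\<^sub>R q"
    using vc(2) zr(3) pq(3) by (simp add: algebra_simps)
   finally have "d0 ^ 2 <= norm (r + (c - of_int a) *\<^sub>R q) ^ 2" using d0p by simp
   also have "... = norm r ^ 2 + (c - of_int a)^2 * norm q ^ 2" unfolding power2_norm_eq_inner using rV[OF qV']
    by (simp add: inner_simps inner_commute power2_eq_square)
   also have "... <= norm r ^ 2 + (1/2)^2 * (11/10 * d0)^2"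
   proof -
    have "\<bar>c - of_int a\<bar> <= 1/2" using of_int_round_abs_le[of c] a_def by (simp add: abs_minus_commute)
    hence "\<bar>c - of_int a\<bar>^2 <= (1/2)^2" by (intro power_mono) auto
    moreover have "norm q ^ 2 <= (11/10 * d0)^2" using q_le by (intro power_mono) auto
    ultimately show ?thesis by (intro add_left_mono mult_mono) auto
   qed
   finally have "norm r ^ 2 >= d0^2 - (1/2)^2 * (11/10 * d0)^2" by simp
   moreover have "(8/10 * d0)^2 <= d0^2 - (1/2)^2 * (11/10 * d0)^2" by (simp add: power2_eq_square)
   ultimately have "norm r ^ 2 >= (8/10 * d0)^2" by linarith
   hence "norm r >= 8/10 * d0" by (rule power2_le_imp_le) simp
   moreover have "norm r <= norm (x - z)"
   proof -
    have "z0 - z \<in> V'" using z0 x(3) subV' by (simp add: subspace_diff)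
    moreover have "x - z = r + (z0 - z)" using zr(3) by simp
    ultimately have "norm (x - z) ^ 2 = norm r ^ 2 + norm (z0 - z) ^ 2" using rV[of "z0 - z"]
     by (simp add: power2_norm_eq_inner inner_simps inner_commute)
    hence "norm r ^ 2 <= norm (x - z) ^ 2" by simp
    thus ?thesis by simp
   qed
   ultimately show ?thesis using d0 by linarith
  qed
 qed
 then obtain e where e: "e \<in> int_vecs" "!!x. x \<in> V' ==> (e - y') \<bullet> x = 0"
  "norm (e - y') <= 2 ^ d / (8/10 * dl)" by blast
 have "(e - y) \<bullet> x = 0" if "x \<in> V" for x using e(2)[of x] VV' that qV[OF that] by (auto simp: y'_def inner_simps)
 moreover have "norm (e - y) <= 2 ^ Suc d / dl"
 proof -
  have "e - y = (e - y') + c0 *\<^sub>R q" by (simp add: y'_def)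
  hence "norm (e - y) <= norm (e - y') + norm (c0 *\<^sub>R q)" by (metis norm_triangle_ineq)
  also have "norm (c0 *\<^sub>R q) = \<bar>of_int (round (y \<bullet> w)) - y \<bullet> w\<bar> / norm q"
   unfolding c0_def by (simp add: dot_square_norm power2_eq_square)
  also have "... <= (1/2) / dl" using of_int_round_abs_le[of "y \<bullet> w"] q_ge d0 Suc.prems(3) by (intro frac_le) auto
  also have "norm (e - y') + (1/2) / dl <= 2 ^ d / (8/10 * dl) + (1/2) / dl" using e(3) by simp
  also have "... = (5/4 * 2 ^ d + 1/2) / dl" using Suc.prems(3) by (simp add: field_simps)
  also have "... <= 2 ^ Suc d / dl"
  proof -
   have "(1::real) <= 2 ^ d" by simp
   hence "5/4 * 2 ^ d + 1/2 <= (2 ^ Suc d :: real)" unfolding power_Suc by linarith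
   thus ?thesis using Suc.prems(3) by (intro divide_right_mono) auto
  qed
  finally show ?thesis by simp
 qed
 ultimately show ?case using e(1) by blast
qed

section \<open>Counting lattice points in boxes\<close>

text \<open>Degree at most one in each coordinate of \<open>E\<close> separately; the Pfaffian has
  this form because no entry occurs twice in a matching.\<close>

definition affine_in :: "'e set => (('e => int) => int) => bool" where
 "affine_in E G \<longleftrightarrow>
   (\<forall>x. \<forall>e\<in>E. \<forall>t. G (x(e := t)) = G (x(e := 0)) + t * (G (x(e := 1)) - G (x(e := 0))))"

lemma affine_in_restrict:
 assumes "affine_in (insert e E) G" "e \<notin> E"
 shows "affine_in E (%x. G (x(e := s)))" (is ?g1) "affine_in E (%x. G (x(e := 1)) - G (x(e := 0)))" (is ?g2)
proof -
 have tw: "x(a := t, e := s) = x(e := s, a := t)" if "a \<in> E" for x :: "'a => int" and a t s using that assms(2) by auto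
 have *: "G (x(a := t, e := s)) = G (x(a := 0, e := s)) + t * (G (x(a := 1, e := s)) - G (x(a := 0, e := s)))"
  if "a \<in> E" for x a t s using assms(1) that unfolding tw[OF that] affine_in_def by blast
 show ?g1 unfolding affine_in_def using * by blast
 show ?g2 unfolding affine_in_def
 proof (intro allI ballI)
  fix x a t assume a: "a \<in> E"
  show "G (x(a := t, e := 1)) - G (x(a := t, e := 0)) = G (x(a := 0, e := 1)) - G (x(a := 0, e := 0)) +
    t * (G (x(a := 1, e := 1)) - G (x(a := 1, e := 0)) - (G (x(a := 0, e := 1)) - G (x(a := 0, e := 0))))"
   by (subst (1 2) *[OF a]) (simp add: algebra_simps)
 qed
qed

text \<open>The Schwartz-Zippel bound for multi-affine functions, one coordinate at a time. If the
  slope \<open>F1\<close> is not identically zero, then outside its zeros at most one value of the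
  new coordinate works; otherwise \<open>G\<close> does not depend on that coordinate and the
  induction applies to \<open>F0\<close>.\<close>

lemma card_zeros_affine_in:
 assumes "finite E" "affine_in E G" "finite X" "G (override_on z x0 E) ~= 0"
 shows "card {x \<in> PiE E (%_. X). G (override_on z x E) = 0} <= card E * card X ^ (card E - 1)" using assms
proof (induction E arbitrary: G x0 rule: finite_induct)
 case empty
 thus ?case by simp
next
 case (insert e E)
 define F0 where "F0 x = G (x(e := 0))" for x
 define F1 where "F1 x = G (x(e := 1)) - G (x(e := 0))" for x
 let ?M = "card X"
 have aff: "affine_in E F0" "affine_in E F1" unfolding F0_def[abs_def] F1_def[abs_def]
  by (rule affine_in_restrict[OF insert.prems(1) insert.hyps(2)])+
 have ov: "override_on z (x(e := t)) (insert e E) = (override_on z x E)(e := t)" for x t by (auto simp: override_on_def)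
 have G: "G (y(e := t)) = F0 y + t * F1 y" for y t using insert.prems(1) unfolding affine_in_def F0_def F1_def by blast
 have upd: "F0 (y(e := t)) = F0 y" "F1 (y(e := t)) = F1 y" for y t by (auto simp: F0_def F1_def)
 have pow: "b * ?M <= card E * ?M ^ card E" if b: "b <= card E * ?M ^ (card E - 1)" for b
 proof (cases "card E = 0")
  case False
  hence "?M ^ (card E - 1) * ?M = ?M ^ card E" by (metis power_minus_mult neq0_conv)
  thus ?thesis using mult_right_mono[OF b, of ?M] by (simp add: mult.assoc)
 qed (use b in simp)
 define P where "P = PiE E (%_. X)"
 have finP: "finite P" "card P = ?M ^ card E" using insert by (auto simp: P_def finite_PiE card_PiE)
 define Z where "Z x = {t \<in> X. F0 (override_on z x E) + t * F1 (override_on z x E) = 0}" for x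
 have finZ: "finite (Z x)" "card (Z x) <= ?M" for x using insert.prems(2) by (auto simp: Z_def intro: card_mono)
 have "{x \<in> PiE (insert e E) (%_. X). G (override_on z x (insert e E)) = 0} <=
    (%(x, t). x(e := t)) ` (SIGMA x:P. Z x)" by (auto simp: ov G Z_def PiE_insert_eq P_def)
 hence "card {x \<in> PiE (insert e E) (%_. X). G (override_on z x (insert e E)) = 0} <= card (SIGMA x:P. Z x)"
  using finP finZ by (meson card_image_le card_mono finite_SigmaI finite_imageI le_trans)
 also have "... = (\<Sum>x\<in>P. card (Z x))" using finP finZ by simp
 also have "... <= (card E + 1) * ?M ^ card E"
 proof (cases "\<exists>x1. F1 (override_on z x1 E) ~= 0")
  case True
  then obtain x1 where x1: "F1 (override_on z x1 E) ~= 0" by blast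
  define B where "B = {x \<in> P. F1 (override_on z x E) = 0}"
  have B: "card B * ?M <= card E * ?M ^ card E" unfolding B_def P_def by (rule pow) (rule insert.IH[OF aff(2) insert.prems(2) x1])
  have "(\<Sum>x\<in>P. card (Z x)) = (\<Sum>x\<in>P - B. card (Z x)) + (\<Sum>x\<in>B. card (Z x))"
   using finP by (intro sum.subset_diff) (auto simp: B_def)
  also have "(\<Sum>x\<in>B. card (Z x)) <= card B * ?M" using sum_bounded_above[of B "%x. card (Z x)" ?M] finZ by simp
  also note B
  also have "(\<Sum>x\<in>P - B. card (Z x)) <= (\<Sum>x\<in>P - B. 1)"
  proof (rule sum_mono)
   fix x assume "x \<in> P - B"
   hence nz: "F1 (override_on z x E) ~= 0" by (auto simp: B_def)
   have "t = t'" if t: "t \<in> Z x" "t' \<in> Z x" for t t'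
   proof -
    have "F0 (override_on z x E) + t * F1 (override_on z x E) = 0"
     "F0 (override_on z x E) + t' * F1 (override_on z x E) = 0" using t by (auto simp: Z_def)
    hence "t * F1 (override_on z x E) = t' * F1 (override_on z x E)" by linarith
    thus ?thesis using nz by auto
   qed
   thus "card (Z x) <= 1" using card_le_Suc0_iff_eq[OF finZ(1)] by simp
  qed
  also have "(\<Sum>x\<in>P - B. 1) <= ?M ^ card E" using card_mono[of P "P - B"] finP by simp
  finally show ?thesis by simp
 next
  case False
  have "override_on z x0 (insert e E) = (override_on z x0 E)(e := x0 e)" using ov[of x0 "x0 e"] by simp
  hence nz: "F0 (override_on z x0 E) ~= 0" using insert.prems(3) False by (simp only: G) simp
  define B where "B = {x \<in> P. F0 (override_on z x E) = 0}"
  have B: "card B * ?M <= card E * ?M ^ card E" unfolding B_def P_def by (rule pow) (rule insert.IH[OF aff(1) insert.prems(2) nz])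
  have "(\<Sum>x\<in>P. card (Z x)) = (\<Sum>x\<in>P - B. card (Z x)) + (\<Sum>x\<in>B. card (Z x))"
   using finP by (intro sum.subset_diff) (auto simp: B_def)
  also have "(\<Sum>x\<in>P - B. card (Z x)) = 0" using False by (intro sum.neutral) (auto simp: B_def Z_def)
  also have "(\<Sum>x\<in>B. card (Z x)) <= card B * ?M" using sum_bounded_above[of B "%x. card (Z x)" ?M] finZ by simp
  also note B
  finally show ?thesis by simp
 qed
 finally show ?case using insert.hyps by simp
qed

section \<open>Pfaffians as functions of the entries above the diagonal\<close>

definition pairs :: "'m::linorder set => ('m \<times> 'm) set" where
 "pairs S = {(i, j). i \<in> S & j \<in> S & i < j}"

definition skew_fun :: "('m::linorder \<times> 'm => 'a::ring_1) => 'm => 'm => 'a" where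
 "skew_fun x i j = (if i < j then x (i, j) else if j < i then - x (j, i) else 0)"

abbreviation subpf :: "('m::linorder \<times> 'm => 'a::comm_ring_1) => 'm set => 'a" where
 "subpf x S \<equiv> pf (skew_fun x) S"

abbreviation kervec :: "('m::linorder \<times> 'm => 'a::comm_ring_1) => 'm set => 'm => 'a" where
 "kervec x S \<equiv> pf_vec (skew_fun x) S"

lemma skew_fun_skew: "skew_fun x b a = - skew_fun x a b" by (auto simp: skew_fun_def)

lemma finite_pairs: "finite S ==> finite (pairs S)" by (rule finite_subset[of _ "S \<times> S"]) (auto simp: pairs_def)

lemma pf_cong:
 assumes "!!i j. i \<in> S ==> j \<in> S ==> F i j = G i j"
 shows "pf F S = pf G S"
proof (cases "finite S")
 case True
 thus ?thesis using assms
 proof (induction "card S" arbitrary: S rule: less_induct)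
  case less
  show ?case
  proof (cases "S = {}")
   case False
   have m: "Min S \<in> S" using False less.prems by simp
   have "F (Min S) y * pos_sign (S - {Min S}) y * pf F (S - {Min S, y}) =
      G (Min S) y * pos_sign (S - {Min S}) y * pf G (S - {Min S, y})" if "y \<in> S - {Min S}" for y
   proof -
    have "pf F (S - {Min S, y}) = pf G (S - {Min S, y})" using m less.prems by (auto intro!: psubset_card_mono less.hyps)
    moreover have "F (Min S) y = G (Min S) y" using m that less.prems by auto
    ultimately show ?thesis by simp
   qed
   thus ?thesis unfolding pf_Min[OF less.prems(1) False] by simp
  qed simp
 qed
qed (simp add: pf.simps)

lemma skew_fun_cong:
 assumes "!!e. e \<in> pairs S ==> x e = y e" "i \<in> S" "j \<in> S"
 shows "skew_fun x i j = skew_fun y i j" using assms by (auto simp: skew_fun_def pairs_def)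

lemma subpf_cong: "(!!e. e \<in> pairs S ==> x e = y e) ==> subpf x S = subpf y S" by (intro pf_cong skew_fun_cong)

lemma pairs_mono: "S <= S' ==> pairs S <= pairs S'" by (auto simp: pairs_def)

lemma kervec_cong: "(!!e. e \<in> pairs S ==> x e = y e) ==> kervec x S z = kervec y S z"
 unfolding pf_vec_def using pairs_mono[of "S - {z}" S] by (intro arg_cong2[where f = "(*)"] subpf_cong) auto

lemma real_of_int_pf:
 fixes F :: "'m::linorder => 'm => int"
 shows "real_of_int (pf F S) = pf (%i j. real_of_int (F i j)) S"
proof (cases "finite S")
 case True
 thus ?thesis
 proof (induction "card S" arbitrary: S rule: less_induct)
  case less
  show ?case
  proof (cases "S = {}")
   case False
   have m: "Min S \<in> S" using False less.prems by simp
   have IH: "real_of_int (pf F (S - {Min S, y})) = pf (%i j. real_of_int (F i j)) (S - {Min S, y})" for y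
   proof (rule less.hyps)
    show "card (S - {Min S, y}) < card S" using m less.prems by (intro psubset_card_mono) auto
   qed (use less.prems in auto)
   show ?thesis unfolding pf_Min[OF less.prems(1) False] by (simp add: IH pos_sign_def)
  qed simp
 qed
qed (simp add: pf.simps)

lemma real_kervec: "real_of_int (kervec x S y) = kervec (%e. real_of_int (x e)) S y"
proof -
 have "(%i j. real_of_int (skew_fun x i j)) = skew_fun (%e. real_of_int (x e))" by (auto simp: skew_fun_def fun_eq_iff)
 thus ?thesis unfolding pf_vec_def by (simp add: real_of_int_pf pos_sign_def)
qed

lemma pf_cong_mod:
 fixes F G :: "'m::linorder => 'm => int"
 assumes "!!i j. i \<in> S ==> j \<in> S ==> [F i j = G i j] (mod M)"
 shows "[pf F S = pf G S] (mod M)"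
proof (cases "finite S")
 case True
 thus ?thesis using assms
 proof (induction "card S" arbitrary: S rule: less_induct)
  case less
  show ?case
  proof (cases "S = {}")
   case False
   have m: "Min S \<in> S" using False less.prems by simp
   have "[F (Min S) y * pos_sign (S - {Min S}) y * pf F (S - {Min S, y}) =
      G (Min S) y * pos_sign (S - {Min S}) y * pf G (S - {Min S, y})] (mod M)" if "y \<in> S - {Min S}" for y
   proof -
    have "[pf F (S - {Min S, y}) = pf G (S - {Min S, y})] (mod M)" using m less.prems by (auto intro!: psubset_card_mono less.hyps)
    moreover have "[F (Min S) y = G (Min S) y] (mod M)" using m that less.prems by auto
    ultimately show ?thesis by (intro cong_mult cong_refl)
   qed
   thus ?thesis unfolding pf_Min[OF less.prems(1) False] by (intro cong_sum) auto
  qed simp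
 qed
qed (simp add: pf.simps)

lemma kervec_cong_mod:
 fixes x y :: "'m::linorder \<times> 'm => int"
 assumes "!!e. e \<in> pairs S ==> [x e = y e] (mod M)"
 shows "[kervec x S z = kervec y S z] (mod M)"
proof -
 have "[skew_fun x i j = skew_fun y i j] (mod M)" if "i \<in> S - {z}" "j \<in> S - {z}" for i j
  using that assms by (auto simp: skew_fun_def pairs_def cong_minus_minus_iff)
 thus ?thesis unfolding pf_vec_def by (intro cong_mult cong_refl pf_cong_mod)
qed

lemma abs_pf_le:
 fixes F :: "'m::linorder => 'm => real"
 assumes "finite S" "!!i j. i \<in> S ==> j \<in> S ==> \<bar>F i j\<bar> <= N" "N >= 0"
 shows "\<bar>pf F S\<bar> <= fact (card S) * N ^ (card S div 2)" using assms(1,2)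
proof (induction "card S" arbitrary: S rule: less_induct)
 case less
 show ?case
 proof (cases "S = {}")
  case False
  have m: "Min S \<in> S" using False less.prems by simp
  have c1: "card (S - {Min S}) = card S - 1" "card S >= 1" using m less.prems by (auto simp: Suc_le_eq card_gt_0_iff)
  have "\<bar>pf F S\<bar> <= (\<Sum>y\<in>S - {Min S}. \<bar>F (Min S) y * pos_sign (S - {Min S}) y * pf F (S - {Min S, y})\<bar>)"
   unfolding pf_Min[OF less.prems(1) False] by simp
  also have "... <= (\<Sum>y\<in>S - {Min S}. fact (card S - 1) * N ^ (card S div 2))"
  proof (rule sum_mono)
   fix y assume y: "y \<in> S - {Min S}"
   have c2: "card (S - {Min S, y}) = card S - 2" using m y by auto
   have c4: "card S >= 2" using m y less.prems card_mono[of S "{Min S, y}"] by auto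
   hence c3: "Suc ((card S - 2) div 2) = card S div 2" by simp
   have "\<bar>pf F (S - {Min S, y})\<bar> <= fact (card (S - {Min S, y})) * N ^ (card (S - {Min S, y}) div 2)"
    using less.hyps[of "S - {Min S, y}"] c2 c4 less.prems by auto
   hence IH: "\<bar>pf F (S - {Min S, y})\<bar> <= fact (card S - 2) * N ^ ((card S - 2) div 2)" unfolding c2 .
   have "\<bar>F (Min S) y * pos_sign (S - {Min S}) y * pf F (S - {Min S, y})\<bar> = \<bar>F (Min S) y\<bar> * \<bar>pf F (S - {Min S, y})\<bar>"
    by (simp add: abs_mult pos_sign_def)
   also have "... <= N * (fact (card S - 1) * N ^ ((card S - 2) div 2))"
   proof (rule mult_mono)
    have "fact (card S - 2) * N ^ ((card S - 2) div 2) <= fact (card S - 1) * N ^ ((card S - 2) div 2)" using assms(3) by (auto intro!: fact_mono mult_right_mono)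
    thus "\<bar>pf F (S - {Min S, y})\<bar> <= fact (card S - 1) * N ^ ((card S - 2) div 2)" using IH by linarith
   qed (use m y less.prems assms(3) in auto)
   also have "... = fact (card S - 1) * N ^ (card S div 2)" unfolding c3[symmetric] by simp
   finally show "\<bar>F (Min S) y * pos_sign (S - {Min S}) y * pf F (S - {Min S, y})\<bar> <= fact (card S - 1) * N ^ (card S div 2)" .
  qed
  also have "... = real (card S - 1) * fact (card S - 1) * N ^ (card S div 2)" using c1 by simp
  also have "... <= fact (card S) * N ^ (card S div 2)" using c1 assms(3) fact_reduce[of "card S", where 'a = real] by (intro mult_right_mono) auto
  finally show ?thesis .
 qed simp
qed

lemma abs_kervec_le:
 fixes x :: "'m::linorder \<times> 'm => real"
 assumes S: "finite S" "card S = Suc (2 * m)" "z \<in> S" and x: "!!e. e \<in> pairs S ==> \<bar>x e\<bar> <= N" and N: "N >= 0"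
 shows "\<bar>kervec x S z\<bar> <= fact (2 * m) * N ^ m"
proof -
 have c: "card (S - {z}) = 2 * m" using S by simp
 have "\<bar>subpf x (S - {z})\<bar> <= fact (card (S - {z})) * N ^ (card (S - {z}) div 2)"
  by (rule abs_pf_le) (use S x N in "auto simp: skew_fun_def pairs_def")
 thus ?thesis unfolding c by (simp add: pf_vec_def abs_mult pos_sign_def)
qed

lemma pf_scale:
 fixes t :: "'a::comm_ring_1"
 assumes "finite S" "even (card S)"
 shows "pf (%i j. t * F i j) S = t ^ (card S div 2) * pf F S" using assms
proof (induction "card S" arbitrary: S rule: less_induct)
 case less
 show ?case
 proof (cases "S = {}")
  case False
  have m: "Min S \<in> S" using False less.prems by simp
  have "t * F (Min S) y * pos_sign (S - {Min S}) y * pf (%i j. t * F i j) (S - {Min S, y}) =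
    t ^ (card S div 2) * (F (Min S) y * pos_sign (S - {Min S}) y * pf F (S - {Min S, y}))"
   if y: "y \<in> S - {Min S}" for y
  proof -
   have c2: "card (S - {Min S, y}) = card S - 2" using m y by auto
   have c4: "card S >= 2" using m y less.prems card_mono[of S "{Min S, y}"] by auto
   hence c3: "Suc ((card S - 2) div 2) = card S div 2" by presburger
   show ?thesis using less.hyps[of "S - {Min S, y}"] c2 c4 less.prems unfolding c3[symmetric] by simp
  qed
  thus ?thesis unfolding pf_Min[OF less.prems(1) False] sum_distrib_left by simp
 qed simp
qed

lemma affine_in_const: "affine_in E (%_. c)" by (simp add: affine_in_def)

lemma affine_in_sum: "(!!y. y \<in> Y ==> affine_in E (G y)) ==> affine_in E (%x. \<Sum>y\<in>Y. G y x)"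
 unfolding affine_in_def sum_subtractf[symmetric] sum_distrib_left sum.distrib[symmetric] by (intro allI ballI sum.cong refl) blast

lemma affine_in_cmult: "affine_in E G ==> affine_in E (%x. c * G x)" unfolding affine_in_def
proof (intro allI ballI)
 fix x e t assume "\<forall>x. \<forall>e\<in>E. \<forall>t. G (x(e := t)) = G (x(e := 0)) + t * (G (x(e := 1)) - G (x(e := 0)))" "e \<in> E"
 hence "G (x(e := t)) = G (x(e := 0)) + t * (G (x(e := 1)) - G (x(e := 0)))" by blast
 thus "c * G (x(e := t)) = c * G (x(e := 0)) + t * (c * G (x(e := 1)) - c * G (x(e := 0)))" by simp (simp add: algebra_simps)
qed

lemma affine_in_mult_coord:
 assumes "affine_in E G" "!!x t. G (x(e := t)) = G x"
 shows "affine_in E (%x. x e * G x)" unfolding affine_in_def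
proof (intro allI ballI)
 fix x a t assume a: "a \<in> E"
 show "(x(a := t)) e * G (x(a := t)) = (x(a := 0)) e * G (x(a := 0)) +
  t * ((x(a := 1)) e * G (x(a := 1)) - (x(a := 0)) e * G (x(a := 0)))"
 proof (cases "a = e")
  case True
  thus ?thesis using assms(2) by simp
 next
  case False
  have "G (x(a := t)) = G (x(a := 0)) + t * (G (x(a := 1)) - G (x(a := 0)))" using assms(1) a unfolding affine_in_def by blast
  moreover have "(x(a := s)) e = x e" for s using False by simp
  ultimately show ?thesis by simp (simp add: algebra_simps)
 qed
qed

lemma affine_in_subpf:
 fixes S :: "'m::linorder set"
 assumes "finite S"
 shows "affine_in E (%x. subpf x S)" using assms
proof (induction "card S" arbitrary: S rule: less_induct)
 case less
 show ?case
 proof (cases "S = {}")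
  case True
  thus ?thesis by (simp add: affine_in_const)
 next
  case False
  define f where "f = Min S"
  have fS: "f \<in> S" "!!y. y \<in> S ==> f <= y" using False less.prems by (auto simp: f_def)
  have "affine_in E (%x. \<Sum>y\<in>S - {f}. pos_sign (S - {f}) y * (x (f, y) * subpf x (S - {f, y})))"
  proof (intro affine_in_sum affine_in_cmult affine_in_mult_coord)
   fix y assume y: "y \<in> S - {f}"
   show "affine_in E (%x. subpf x (S - {f, y}))" using fS less.prems by (auto intro!: psubset_card_mono less.hyps)
   fix x t show "subpf (x((f, y) := t)) (S - {f, y}) = subpf x (S - {f, y})" by (rule subpf_cong) (auto simp: pairs_def)
  qed
  moreover have "(%x. subpf x S) = (%x. \<Sum>y\<in>S - {f}. pos_sign (S - {f}) y * (x (f, y) * subpf x (S - {f, y}) :: int))"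
  proof
   fix x :: "'m \<times> 'm => int"
   have "skew_fun x f y = x (f, y)" if "y \<in> S - {f}" for y using that fS by (auto simp: skew_fun_def order.strict_iff_order)
   thus "subpf x S = (\<Sum>y\<in>S - {f}. pos_sign (S - {f}) y * (x (f, y) * subpf x (S - {f, y})))"
    unfolding pf_Min[OF less.prems False] f_def[symmetric] by (intro sum.cong refl) simp
  qed
  ultimately show ?thesis by simp
 qed
qed

lemma affine_in_dot_kervec: "finite S ==> affine_in E (%x. \<Sum>y\<in>S. u y * kervec x S y)"
 unfolding pf_vec_def by (intro affine_in_sum affine_in_cmult affine_in_subpf) auto

text \<open>Joining the smallest index to a single \<open>y\<close> leaves only one term in the
  expansion, a smaller Pfaffian with free entries.\<close>

lemma exists_subpf_nonzero:
 assumes "finite S" "even (card S)"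
 shows "\<exists>x :: 'm::linorder \<times> 'm => int. subpf x S ~= 0" using assms
proof (induction "card S" arbitrary: S rule: less_induct)
 case less
 show ?case
 proof (cases "S = {}")
  case False
  define f where "f = Min S"
  have fS: "f \<in> S" "!!y. y \<in> S ==> f <= y" using False less.prems by (auto simp: f_def)
  have "card S ~= 1" using less.prems by auto
  hence "S - {f} ~= {}" using fS(1) by (metis Diff_eq_empty_iff card_1_singleton_iff One_nat_def subset_singletonD empty_iff)
  then obtain y where y: "y \<in> S" "y ~= f" by blast
  have c2: "card (S - {f, y}) = card S - 2" using fS y by simp
  have "card S >= 2" using fS y less.prems card_mono[of S "{f, y}"] by auto
  then obtain x where x: "subpf x (S - {f, y}) ~= (0::int)" using less.hyps[of "S - {f, y}"] c2 less.prems by auto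
  define x' where "x' e = (if fst e = f then (if snd e = y then 1 else 0) else x e)" for e
  have "subpf x' S = (\<Sum>z\<in>S - {f}. skew_fun x' f z * pos_sign (S - {f}) z * subpf x' (S - {f, z}))"
   unfolding f_def using less.prems False by (intro pf_Min)
  also have "... = (\<Sum>z\<in>S - {f}. if z = y then pos_sign (S - {f}) y * subpf x' (S - {f, y}) else 0)"
  proof (intro sum.cong refl)
   fix z assume z: "z \<in> S - {f}"
   thus "skew_fun x' f z * pos_sign (S - {f}) z * subpf x' (S - {f, z}) =
    (if z = y then pos_sign (S - {f}) y * subpf x' (S - {f, y}) else 0)" using fS by (auto simp: order.strict_iff_order skew_fun_def x'_def)
  qed
  also have "... = pos_sign (S - {f}) y * subpf x' (S - {f, y})" using y less.prems by simp
  also have "subpf x' (S - {f, y}) = subpf x (S - {f, y})" by (rule subpf_cong) (auto simp: pairs_def x'_def)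
  finally have "subpf x' S ~= 0" using x by (simp add: pos_sign_def)
  thus ?thesis by blast
 qed simp
qed

text \<open>A zero row at \<open>y0\<close> kills every component of the kernel vector except the
  one at \<open>y0\<close>, which is a Pfaffian without that row and can be made non-zero.\<close>

lemma exists_dot_kervec_nonzero:
 fixes S :: "'m::linorder set" and u :: "'m => int"
 assumes S: "finite S" "odd (card S)" and u: "y0 \<in> S" "u y0 ~= 0"
 shows "\<exists>x. (\<Sum>y\<in>S. u y * kervec x S y) ~= 0"
proof -
 have "even (card (S - {y0}))" using S u by simp
 then obtain x where x: "subpf x (S - {y0}) ~= (0::int)" using exists_subpf_nonzero[of "S - {y0}"] S by auto
 define x' where "x' e = (if fst e = y0 | snd e = y0 then 0 else x e)" for e
 have z: "skew_fun x' y0 j = 0" for j by (auto simp: skew_fun_def x'_def)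
 have "kervec x' S y = 0" if y: "y \<in> S" "y ~= y0" for y
 proof -
  have "subpf x' (S - {y}) = pos_sign (S - {y}) y0 * (\<Sum>j\<in>S - {y} - {y0}. skew_fun x' y0 j *
   pos_sign (S - {y} - {y0}) j * subpf x' (S - {y} - {y0, j}))"
   by (rule pf_expand[where F = "skew_fun x'", OF _ _ skew_fun_skew]) (use S u y in auto)
  also have "... = 0" unfolding z by simp
  finally show ?thesis by (simp add: pf_vec_def)
 qed
 hence "(\<Sum>y\<in>S. u y * kervec x' S y) = u y0 * kervec x' S y0" using S u by (subst sum.remove[of _ y0]) auto
 moreover have "subpf x' (S - {y0}) = subpf x (S - {y0})" by (rule subpf_cong) (auto simp: pairs_def x'_def)
 ultimately have "(\<Sum>y\<in>S. u y * kervec x' S y) ~= 0" using x u by (simp add: pf_vec_def pos_sign_def)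
 thus ?thesis by blast
qed

text \<open>The relation is multi-affine in the entries and not identically zero, so the
  Schwartz-Zippel bound applies: a fixed relation costs one power of the side length.\<close>

lemma card_dot_kervec_zero_le:
 fixes S :: "'m::linorder set" and u :: "'m => int"
 assumes S: "finite S" "odd (card S)" and u: "y0 \<in> S" "u y0 ~= 0" and X: "finite X"
 shows "card {x \<in> PiE (pairs S) (%_. X). (\<Sum>y\<in>S. u y * kervec x S y) = 0}
  <= card (pairs S) * card X ^ (card (pairs S) - 1)"
proof -
 obtain x0 where x0: "(\<Sum>y\<in>S. u y * kervec x0 S y) ~= 0" using exists_dot_kervec_nonzero[of S y0 u] S u by blast
 have ov: "(\<Sum>y\<in>S. u y * kervec (override_on z x (pairs S)) S y) = (\<Sum>y\<in>S. u y * kervec x S y)" for z x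
  by (intro sum.cong arg_cong2[where f = "(*)"] kervec_cong) auto
 show ?thesis using card_zeros_affine_in[OF finite_pairs[OF S(1)] affine_in_dot_kervec[OF S(1)] X, of u undefined x0] x0 unfolding ov by blast
qed

text \<open>Two components become linear forms in disjoint rows, with the kernel vector of
  \<open>S2\<close> as their common coefficients. This drives the inductions that remove two indices
  at a time.\<close>

lemma kervec_first_two:
 fixes x :: "'m::linorder \<times> 'm => int"
 assumes S2: "finite S2" "f1 < f2" "\<forall>y\<in>S2. f2 < y" and S: "S = insert f1 (insert f2 S2)"
 shows "kervec x S f1 = (\<Sum>y\<in>S2. x (f2, y) * kervec x S2 y)" (is ?g1)
  and "kervec x S f2 = - (\<Sum>y\<in>S2. x (f1, y) * kervec x S2 y)" (is ?g2)
proof -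
 have n: "f1 \<notin> S2" "f2 \<notin> S2" "f1 ~= f2" using S2(2,3) by auto
 have sk: "skew_fun x f2 y = x (f2, y)" "skew_fun x f1 y = x (f1, y)" if "y \<in> S2" for y using S2(3) S2(2) that by (auto simp: skew_fun_def)
 have e1: "{z \<in> insert f2 S2. z < f2} = {}" "{z \<in> S. z < f1} = {}"
  "{z \<in> insert f1 S2. z < f1} = {}" "{z \<in> S. z < f2} = {f1}" using S2(2,3) by (force simp: S)+
 have p: "pos_sign (insert f2 S2) f2 = (1::int)" "pos_sign S f1 = (1::int)" "pos_sign (insert f1 S2) f1 = (1::int)"
  "pos_sign S f2 = (-1::int)" unfolding pos_sign_def e1 by simp_all
 have d: "S - {f1} = insert f2 S2" "S - {f2} = insert f1 S2" using n by (auto simp: S)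
 show ?g1 unfolding pf_vec_def[of _ S] d p pf_insert_eq_dot[where F = "skew_fun x", OF S2(1) n(2) skew_fun_skew] using sk by simp
 show ?g2 unfolding pf_vec_def[of _ S] d p pf_insert_eq_dot[where F = "skew_fun x", OF S2(1) n(1) skew_fun_skew] using sk by simp
qed

section \<open>Counting in products by fibres and in residue classes\<close>

lemma card_PiE_fiber:
 fixes X :: "'e => 'a set"
 assumes "finite R" "e \<in> R" "!!i. i \<in> R ==> finite (X i)"
 shows "card {r \<in> PiE R X. P r} = (\<Sum>b\<in>PiE (R - {e}) X. card {t \<in> X e. P (b(e := t))})"
proof -
 let ?S = "SIGMA b:PiE (R - {e}) X. {t \<in> X e. P (b(e := t))}"
 have "bij_betw (%(b, t). b(e := t)) ?S {r \<in> PiE R X. P r}" using assms(2)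
  by (auto simp: PiE_def extensional_def Pi_def fun_eq_iff intro!: bij_betwI[where g = "%r. (r(e := undefined), r e)"])
 hence "card {r \<in> PiE R X. P r} = card ?S" by (rule bij_betw_same_card[symmetric])
 also have "... = (\<Sum>b\<in>PiE (R - {e}) X. card {t \<in> X e. P (b(e := t))})" using assms by (intro card_SigmaI finite_PiE) auto
 finally show ?thesis .
qed

lemma card_PiE_fiber_le:
 fixes X :: "'e => 'a set"
 assumes "finite R" "e \<in> R" "!!i. i \<in> R ==> finite (X i)"
  and "!!b. b \<in> PiE (R - {e}) X ==> card {t \<in> X e. P (b(e := t))} <= K"
 shows "card {r \<in> PiE R X. P r} <= K * (\<Prod>i\<in>R - {e}. card (X i))"
proof -
 have "card {r \<in> PiE R X. P r} = (\<Sum>b\<in>PiE (R - {e}) X. card {t \<in> X e. P (b(e := t))})"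
  by (rule card_PiE_fiber) (use assms(1-3) in auto)
 also have "... <= (\<Sum>b\<in>PiE (R - {e}) X. K)" by (rule sum_mono) (rule assms(4))
 finally have "card {r \<in> PiE R X. P r} <= (\<Sum>b\<in>PiE (R - {e}) X. K)" .
 thus ?thesis using assms(1) by (simp add: card_PiE mult.commute)
qed

definition glue :: "'e set => 'e set => ('e => 'a) => ('e => 'a) => 'e => 'a" where
 "glue A B r c e = (if e \<in> A then r e else if e \<in> B then c e else undefined)"

lemma card_PiE_Un:
 fixes X :: "'e => 'a set"
 assumes "finite A" "finite B" "A \<inter> B = {}" "!!i. i \<in> A \<union> B ==> finite (X i)"
 shows "card {x \<in> PiE (A \<union> B) X. P x} = (\<Sum>c\<in>PiE B X. card {r \<in> PiE A X. P (glue A B r c)})"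
proof -
 let ?S = "SIGMA c:PiE B X. {r \<in> PiE A X. P (glue A B r c)}"
 have "bij_betw (%(c, r). glue A B r c) ?S {x \<in> PiE (A \<union> B) X. P x}"
 proof (rule bij_betwI[where g = "%x. (restrict x B, restrict x A)"])
  show "(%(c, r). glue A B r c) \<in> ?S \<rightarrow> {x \<in> PiE (A \<union> B) X. P x}" by (auto simp: glue_def)
  have "glue A B (restrict x A) (restrict x B) = x" if "x \<in> PiE (A \<union> B) X" for x using that by (auto simp: glue_def fun_eq_iff)
  thus "(%x. (restrict x B, restrict x A)) \<in> {x \<in> PiE (A \<union> B) X. P x} \<rightarrow> ?S" by auto
 next
  fix q assume "q \<in> ?S"
  then obtain c r where q: "q = (c, r)" "c \<in> PiE B X" "r \<in> PiE A X" by auto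
  show "(restrict (case q of (c, r) => glue A B r c) B, restrict (case q of (c, r) => glue A B r c) A) = q" using q(2,3) assms(3) q
   by (auto simp: PiE_def extensional_def glue_def fun_eq_iff restrict_def)
 next
  fix x assume "x \<in> {x \<in> PiE (A \<union> B) X. P x}"
  thus "(case (restrict x B, restrict x A) of (c, r) => glue A B r c) = x" by (auto simp: glue_def fun_eq_iff)
 qed
 hence "card {x \<in> PiE (A \<union> B) X. P x} = card ?S" by (rule bij_betw_same_card[symmetric])
 also have "... = (\<Sum>c\<in>PiE B X. card {r \<in> PiE A X. P (glue A B r c)})"
 proof (rule card_SigmaI)
  have "finite (PiE A X)" using assms by (intro finite_PiE) auto
  thus "\<forall>c\<in>PiE B X. finite {r \<in> PiE A X. P (glue A B r c)}" by simp
 qed (use assms in "auto intro!: finite_PiE")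
 finally show ?thesis .
qed

lemma card_PiE_Un_le:
 fixes X :: "'e => 'a set"
 assumes "finite A" "finite B" "A \<inter> B = {}" "!!i. i \<in> A \<union> B ==> finite (X i)"
  and "!!c. c \<in> PiE B X ==> card {r \<in> PiE A X. P (glue A B r c)} <= K"
 shows "card {x \<in> PiE (A \<union> B) X. P x} <= (\<Prod>i\<in>B. card (X i)) * K"
proof -
 have "card {x \<in> PiE (A \<union> B) X. P x} = (\<Sum>c\<in>PiE B X. card {r \<in> PiE A X. P (glue A B r c)})"
  by (rule card_PiE_Un) (use assms(1-4) in auto)
 also have "... <= (\<Sum>c\<in>PiE B X. K)" by (rule sum_mono) (rule assms(5))
 finally have "card {x \<in> PiE (A \<union> B) X. P x} <= (\<Sum>c\<in>PiE B X. K)" .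
 thus ?thesis using assms(2) by (simp add: card_PiE)
qed

lemma card_int_interval_mod:
 fixes u w :: real and r M :: int
 assumes "M > 0"
 shows "card {t \<in> {\<lceil>u\<rceil>..<\<lceil>w\<rceil>}. [t = r] (mod M)} = nat (\<lceil>(w - r) / M\<rceil> - \<lceil>(u - r) / M\<rceil>)"
proof -
 have "bij_betw (%q. r + M * q) {\<lceil>(u - r) / M\<rceil>..<\<lceil>(w - r) / M\<rceil>} {t \<in> {\<lceil>u\<rceil>..<\<lceil>w\<rceil>}. [t = r] (mod M)}"
 proof (rule bij_betwI')
  fix q q' show "(r + M * q = r + M * q') = (q = q')" using assms by simp
 next
  fix q assume "q \<in> {\<lceil>(u - r) / M\<rceil>..<\<lceil>(w - r) / M\<rceil>}"
  hence "u <= r + M * q" "r + M * q < w" using assms by (auto simp: ceiling_le_iff less_ceiling_iff field_simps)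
  moreover have "real_of_int (r + M * q) = r + M * q" by simp
  ultimately show "r + M * q \<in> {t \<in> {\<lceil>u\<rceil>..<\<lceil>w\<rceil>}. [t = r] (mod M)}" by (auto simp: cong_def ceiling_le_iff less_ceiling_iff)
 next
  fix t assume t: "t \<in> {t \<in> {\<lceil>u\<rceil>..<\<lceil>w\<rceil>}. [t = r] (mod M)}"
  hence "[r = t] (mod M)" by (simp add: cong_sym)
  then obtain q where q: "t = r + M * q" unfolding cong_iff_lin by auto
  show "\<exists>q\<in>{\<lceil>(u - r) / M\<rceil>..<\<lceil>(w - r) / M\<rceil>}. t = r + M * q" using t assms q
   by (auto simp: ceiling_le_iff less_ceiling_iff field_simps q)
 qed
 thus ?thesis using bij_betw_same_card by fastforce
qed

lemma card_int_interval_mod_bounds: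
 fixes u w :: real and r M :: int
 assumes "M > 0" "u <= w"
 shows "\<bar>real (card {t \<in> {\<lceil>u\<rceil>..<\<lceil>w\<rceil>}. [t = r] (mod M)}) - (w - u) / M\<bar> <= 1"
proof -
 have "\<lceil>(u - r) / M\<rceil> <= \<lceil>(w - r) / M\<rceil>" using assms by (auto intro!: divide_right_mono ceiling_mono)
 hence "real (card {t \<in> {\<lceil>u\<rceil>..<\<lceil>w\<rceil>}. [t = r] (mod M)}) = \<lceil>(w - r) / M\<rceil> - \<lceil>(u - r) / M\<rceil>"
  unfolding card_int_interval_mod[OF assms(1)] by simp
 moreover have "(w - u) / M = (w - r) / M - (u - r) / M" by (simp add: diff_divide_distrib)
 ultimately show ?thesis by linarith
qed

lemma card_symmetric_interval_mod_le:
 assumes "p > 0" "N >= 0"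
 shows "real (card {t \<in> {- N..N}. [t = r] (mod p)}) <= (2 * real_of_int N + 1) / p + 1"
  using card_int_interval_mod_bounds[OF assms(1), of "real_of_int (- N)" "real_of_int (N + 1)" r] assms(2) unfolding ceiling_of_int by simp

lemma card_lin_eq_le:
 fixes w :: "'e => int"
 assumes "finite R" "e \<in> R" "w e ~= 0" "!!i. i \<in> R ==> finite (X i)"
 shows "card {a \<in> PiE R X. (\<Sum>y\<in>R. a y * w y) = c} <= (\<Prod>i\<in>R - {e}. card (X i))"
proof -
 have "card {a \<in> PiE R X. (\<Sum>y\<in>R. a y * w y) = c} <= 1 * (\<Prod>i\<in>R - {e}. card (X i))"
 proof (rule card_PiE_fiber_le[OF assms(1,2,4)])
  fix b
  have s: "(\<Sum>y\<in>R. (b(e := t)) y * w y) = t * w e + (\<Sum>y\<in>R - {e}. b y * w y)" for t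
   using assms(1,2) by (subst sum.remove[of _ e]) auto
  define Y where "Y = {t \<in> X e. t * w e + (\<Sum>y\<in>R - {e}. b y * w y) = c}"
  have fin: "finite Y" using assms(4)[OF assms(2)] by (simp add: Y_def)
  have "t = t'" if "t \<in> Y" "t' \<in> Y" for t t' using that assms(3) by (auto simp: Y_def)
  hence "card Y <= Suc 0" unfolding card_le_Suc0_iff_eq[OF fin] by blast
  hence "card {t \<in> X e. (\<Sum>y\<in>R. (b(e := t)) y * w y) = c} <= Suc 0" unfolding s Y_def .
  thus "card {t \<in> X e. (\<Sum>y\<in>R. (b(e := t)) y * w y) = c} <= 1" by simp
 qed
 thus ?thesis by simp
qed

text \<open>\<open>w e\<close> is invertible mod \<open>p\<close>, so the divisibility can be solved
  for the coordinate \<open>e\<close>.\<close>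

lemma lin_dvd_iff_cong:
 fixes w :: "'e => int" and p :: int
 assumes p: "prime p" and R: "finite R" "e \<in> R" and w: "~ p dvd w e"
 shows "\<exists>c. \<forall>t. p dvd (\<Sum>y\<in>R. (b(e := t)) y * w y) \<longleftrightarrow> [t = c] (mod p)"
proof -
 have s: "(\<Sum>y\<in>R. (b(e := t)) y * w y) = t * w e + (\<Sum>y\<in>R - {e}. b y * w y)" for t using R by (subst sum.remove[of _ e]) auto
 define s0 where "s0 = (\<Sum>y\<in>R - {e}. b y * w y)"
 have cop: "coprime (w e) p" using p w by (simp add: prime_imp_coprime coprime_commute)
 then obtain i where i: "[w e * i = 1] (mod p)" using coprime_iff_invertible_int by blast
 show ?thesis
 proof (intro exI allI)
  fix t
  have "p dvd t * w e + s0 \<longleftrightarrow> [t * w e = - s0] (mod p)" by (simp add: cong_iff_dvd_diff)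
  also have "... \<longleftrightarrow> [t * w e = (- s0 * i) * w e] (mod p)"
  proof -
   have "[(- s0 * i) * w e = - s0 * 1] (mod p)" using cong_scalar_left[OF i, of "- s0"] by (simp add: mult_ac)
   thus ?thesis by (metis cong_trans cong_sym mult.right_neutral)
  qed
  also have "... \<longleftrightarrow> [t = - s0 * i] (mod p)" by (rule cong_mult_rcancel[OF cop])
  finally show "p dvd (\<Sum>y\<in>R. (b(e := t)) y * w y) \<longleftrightarrow> [t = - s0 * i] (mod p)" unfolding s s0_def .
 qed
qed

lemma card_lin_dvd_le:
 fixes w :: "'e => int" and p :: int
 assumes p: "prime p" and R: "finite R" "e \<in> R" and w: "~ p dvd w e" and X: "finite X"
  and K: "!!c. card {t \<in> X. [t = c] (mod p)} <= K"
 shows "card {a \<in> PiE R (%_. X). p dvd (\<Sum>y\<in>R. a y * w y)} <= K * card X ^ (card R - 1)"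
proof -
 have "card {a \<in> PiE R (%_. X). p dvd (\<Sum>y\<in>R. a y * w y)} <= K * (\<Prod>i\<in>R - {e}. card X)"
 proof (rule card_PiE_fiber_le[OF R])
  fix b
  obtain c where c: "!!t. p dvd (\<Sum>y\<in>R. (b(e := t)) y * w y) \<longleftrightarrow> [t = c] (mod p)"
   using lin_dvd_iff_cong[where w = w and b = b, OF p R w] by metis
  show "card {t \<in> X. p dvd (\<Sum>y\<in>R. (b(e := t)) y * w y)} <= K" unfolding c by (rule K)
 qed (use X in auto)
 thus ?thesis using R by simp
qed

lemma card_residue_class:
 fixes p c :: int
 assumes "p > 0"
 shows "card {t \<in> {0..<p}. [t = c] (mod p)} = 1"
proof -
 have "{t \<in> {0..<p}. [t = c] (mod p)} = {c mod p}" using assms by (auto simp: cong_def)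
 thus ?thesis by simp
qed

lemma card_lin_dvd_residues:
 fixes w :: "'e => int" and p :: int
 assumes p: "prime p" and R: "finite R" "e \<in> R" and w: "~ p dvd w e"
 shows "card {a \<in> PiE R (%_. {0..<p}). p dvd (\<Sum>y\<in>R. a y * w y)} = nat p ^ (card R - 1)"
proof -
 have p0: "p > 0" using p by (simp add: prime_gt_0_int)
 have "card {a \<in> PiE R (%_. {0..<p}). p dvd (\<Sum>y\<in>R. a y * w y)} = (\<Sum>b\<in>PiE (R - {e}) (%_. {0..<p}). 1)"
  unfolding card_PiE_fiber[OF R, of "%_. {0..<p}", simplified]
 proof (intro sum.cong refl)
  fix b
  obtain c where c: "!!t. p dvd (\<Sum>y\<in>R. (b(e := t)) y * w y) \<longleftrightarrow> [t = c] (mod p)"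
   using lin_dvd_iff_cong[where w = w and b = b, OF p R w] by metis
  show "card {t. 0 <= t & t < p & p dvd (\<Sum>y\<in>R. (b(e := t)) y * w y)} = 1" using card_residue_class[OF p0] unfolding c by simp
 qed
 also have "... = nat p ^ (card R - 1)" using R by (simp add: card_PiE)
 finally show ?thesis .
qed

section \<open>Density of primitive kernel vectors\<close>

definition residue_boxes :: "int => 'm::linorder set => ('m \<times> 'm => int) set" where
 "residue_boxes M S = PiE (pairs S) (%_. {0..<M})"

definition kervec_density :: "int => 'm::linorder set => real" where
 "kervec_density p S =
   real (card {x \<in> residue_boxes p S. ~ (\<forall>y\<in>S. p dvd kervec x S y)}) / real_of_int p ^ card (pairs S)"

lemma finite_residue_boxes: "finite S ==> finite (residue_boxes M S)" unfolding residue_boxes_def by (intro finite_PiE finite_pairs) auto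

lemma card_residue_boxes: "finite S ==> M >= 0 ==> real (card (residue_boxes M S)) = real_of_int M ^ card (pairs S)"
 unfolding residue_boxes_def by (simp add: card_PiE finite_pairs)

lemma kervec_density_le_1:
 assumes "finite S" "p > 0"
 shows "kervec_density p S <= 1"
proof -
 have "card {x \<in> residue_boxes p S. ~ (\<forall>y\<in>S. p dvd kervec x S y)} <= card (residue_boxes p S)"
  using finite_residue_boxes[OF assms(1)] by (intro card_mono) auto
 thus ?thesis using card_residue_boxes[OF assms(1), of p] assms(2) by (simp add: kervec_density_def)
qed

text \<open>
 The two linear forms \<open>\<Sum>y. x (f1, y) * w y\<close> and \<open>\<Sum>y. x (f2, y) * w y\<close> use disjoint coordinates.
\<close>

lemma card_two_lin_dvd_le:
 fixes w :: "'m::linorder => int" and p :: int and f1 f2 :: 'm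
 assumes p: "prime p" and R: "finite R" "finite S2" "f1 ~= f2" "{f1, f2} \<times> S2 <= R" and y0: "y0 \<in> S2" "~ p dvd w y0"
  and X: "finite X" and K: "!!c. card {t \<in> X. [t = c] (mod p)} <= K"
 shows "card {r \<in> PiE R (%_. X). p dvd (\<Sum>y\<in>S2. r (f1, y) * w y) & p dvd (\<Sum>y\<in>S2. r (f2, y) * w y)}
  <= K\<^sup>2 * card X ^ (card R - 2)"
proof -
 define e1 e2 where "e1 = (f1, y0)" and "e2 = (f2, y0)"
 have e: "e1 \<in> R" "e2 \<in> R" "e1 ~= e2" using R y0 by (auto simp: e1_def e2_def)
 have fib: "\<exists>c. \<forall>t. p dvd (\<Sum>y\<in>S2. (b((f, y0) := t)) (f, y) * w y) \<longleftrightarrow> [t = c] (mod p)" for b :: "'m \<times> 'm => int" and f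
 proof -
  have *: "(\<Sum>y\<in>S2. (b((f, y0) := t)) (f, y) * w y) = (\<Sum>y\<in>S2. ((%y. b (f, y))(y0 := t)) y * w y)" for t by simp
  show ?thesis unfolding * by (rule lin_dvd_iff_cong[where w = w, OF p R(2) y0])
 qed
 have "card {r \<in> PiE R (%_. X). p dvd (\<Sum>y\<in>S2. r (f1, y) * w y) & p dvd (\<Sum>y\<in>S2. r (f2, y) * w y)} =
  (\<Sum>b\<in>PiE (R - {e1}) (%_. X). card {t \<in> X. p dvd (\<Sum>y\<in>S2. (b(e1 := t)) (f1, y) * w y) & p dvd (\<Sum>y\<in>S2. (b(e1 := t)) (f2, y) * w y)})"
  by (rule card_PiE_fiber) (use R e X in auto)
 also have "... <= (\<Sum>b\<in>PiE (R - {e1}) (%_. X). if p dvd (\<Sum>y\<in>S2. b (f2, y) * w y) then K else 0)"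
 proof (rule sum_mono)
  fix b :: "'m \<times> 'm => int"
  have 2: "(\<Sum>y\<in>S2. (b(e1 := t)) (f2, y) * w y) = (\<Sum>y\<in>S2. b (f2, y) * w y)" for t
   using R(3) by (intro sum.cong) (auto simp: e1_def)
  obtain c where c: "!!t. p dvd (\<Sum>y\<in>S2. (b(e1 := t)) (f1, y) * w y) \<longleftrightarrow> [t = c] (mod p)"
   using fib[of b f1] unfolding e1_def by blast
  show "card {t \<in> X. p dvd (\<Sum>y\<in>S2. (b(e1 := t)) (f1, y) * w y) & p dvd (\<Sum>y\<in>S2. (b(e1 := t)) (f2, y) * w y)}
   <= (if p dvd (\<Sum>y\<in>S2. b (f2, y) * w y) then K else 0)" unfolding 2 c using K[of c] by simp
 qed
 also have "... = K * card {b \<in> PiE (R - {e1}) (%_. X). p dvd (\<Sum>y\<in>S2. b (f2, y) * w y)}"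
 proof -
  have "finite (PiE (R - {e1}) (%_. X))" using R X by (intro finite_PiE) auto
  hence "(\<Sum>b\<in>PiE (R - {e1}) (%_. X). if p dvd (\<Sum>y\<in>S2. b (f2, y) * w y) then K else 0) =
   (\<Sum>b | b \<in> PiE (R - {e1}) (%_. X) & p dvd (\<Sum>y\<in>S2. b (f2, y) * w y). K)" by (rule sum.inter_filter[symmetric])
  thus ?thesis by simp
 qed
 also have "card {b \<in> PiE (R - {e1}) (%_. X). p dvd (\<Sum>y\<in>S2. b (f2, y) * w y)} <= K * (\<Prod>i\<in>R - {e1} - {e2}. card X)"
 proof (rule card_PiE_fiber_le)
  fix b :: "'m \<times> 'm => int"
  obtain c where c: "!!t. p dvd (\<Sum>y\<in>S2. (b(e2 := t)) (f2, y) * w y) \<longleftrightarrow> [t = c] (mod p)"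
   using fib[of b f2] unfolding e2_def by blast
  show "card {t \<in> X. p dvd (\<Sum>y\<in>S2. (b(e2 := t)) (f2, y) * w y)} <= K" unfolding c by (rule K)
 qed (use R e X in auto)
 also have "(\<Prod>i\<in>R - {e1} - {e2}. card X) = card X ^ (card R - 2)" using R e by (simp add: numeral_2_eq_2)
 finally show ?thesis by (simp add: power2_eq_square)
qed

lemma odd_set_cases:
 fixes S :: "'m::linorder set"
 assumes "finite S" "card S = Suc (2 * Suc m)"
 obtains f1 f2 S2 where "S = insert f1 (insert f2 S2)" "f1 < f2" "\<forall>y\<in>S2. f2 < y" "finite S2"
  "card S2 = Suc (2 * m)" "pairs S = (pairs S - pairs S2) \<union> pairs S2" "{f1, f2} \<times> S2 <= pairs S - pairs S2"
proof -
 have ne: "S ~= {}" using assms by auto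
 define f1 where "f1 = Min S"
 have f1: "f1 \<in> S" "!!y. y \<in> S ==> f1 <= y" using assms ne by (auto simp: f1_def)
 define S1 where "S1 = S - {f1}"
 have S1: "finite S1" "card S1 = 2 * Suc m" using assms f1 by (auto simp: S1_def)
 have ne1: "S1 ~= {}" using S1 by auto
 define f2 where "f2 = Min S1"
 have f2: "f2 \<in> S1" "!!y. y \<in> S1 ==> f2 <= y" using S1 ne1 by (auto simp: f2_def)
 define S2 where "S2 = S1 - {f2}"
 have "S = insert f1 (insert f2 S2)" using f1 f2 by (auto simp: S1_def S2_def)
 moreover have f12: "f1 < f2" using f1(2)[of f2] f2(1) by (auto simp: S1_def)
 moreover have gt: "\<forall>y\<in>S2. f2 < y" using f2(2) by (force simp: S2_def)
 moreover have "finite S2" "card S2 = Suc (2 * m)" using S1 f2 by (auto simp: S2_def)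
 moreover have "pairs S = (pairs S - pairs S2) \<union> pairs S2" using pairs_mono[of S2 S] by (auto simp: S2_def S1_def)
 moreover have "{f1, f2} \<times> S2 <= pairs S - pairs S2" using gt f12 f1 f2 by (force simp: S2_def S1_def pairs_def)
 ultimately show thesis by (rule that)
qed

text \<open>Once the kernel vector of \<open>S2\<close> is non-zero mod \<open>p\<close>, the
  components at \<open>f1\<close> and \<open>f2\<close> are non-trivial linear forms in separate
  rows, and both vanish with probability at most \<open>1 / p ^ 2\<close>.\<close>

lemma kervec_density_step:
 fixes S :: "'m::linorder set"
 assumes p: "prime p" and S: "S = insert f1 (insert f2 S2)" "f1 < f2" "\<forall>y\<in>S2. f2 < y" "finite S2"
  "pairs S = (pairs S - pairs S2) \<union> pairs S2" "{f1, f2} \<times> S2 <= pairs S - pairs S2" "S2 ~= {}"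
 shows "kervec_density p S >= (1 - 1 / real_of_int p ^ 2) * kervec_density p S2"
proof -
 define R where "R = pairs S - pairs S2"
 define X where "X = {0..<p}"
 have p1: "p > 1" using p prime_gt_1_int by blast
 have finS: "finite S" using S by simp
 have finR: "finite R" "finite (pairs S2)" "R \<inter> pairs S2 = {}" using finite_pairs[OF finS] finite_pairs[OF S(4)] by (auto simp: R_def)
 have pS: "pairs S = R \<union> pairs S2" using S(5) by (simp add: R_def)
 have cR: "card R >= 2"
 proof -
  obtain y where "y \<in> S2" using S(7) by blast
  hence "card {(f1, y), (f2, y)} <= card R" using S(6) finR by (auto simp: R_def intro!: card_mono)
  thus ?thesis using S(2) by simp
 qed
 have cX: "card X = nat p" by (simp add: X_def)
 have glue2: "kervec (glue R (pairs S2) r c) S2 y = kervec c S2 y" for r c :: "'m \<times> 'm => int" and y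
  by (rule kervec_cong) (use finR in "auto simp: glue_def")
 have glue1: "kervec (glue R (pairs S2) r c) S f1 = (\<Sum>y\<in>S2. r (f2, y) * kervec c S2 y)"
  "kervec (glue R (pairs S2) r c) S f2 = - (\<Sum>y\<in>S2. r (f1, y) * kervec c S2 y)" for r c :: "'m \<times> 'm => int"
 proof -
  have *: "glue R (pairs S2) r c (f, y) = r (f, y)" if "f \<in> {f1, f2}" "y \<in> S2" for f y using that S(6) by (auto simp: glue_def R_def)
  show "kervec (glue R (pairs S2) r c) S f1 = (\<Sum>y\<in>S2. r (f2, y) * kervec c S2 y)"
   unfolding kervec_first_two(1)[OF S(4,2,3,1)] glue2 by (intro sum.cong refl) (simp add: *)
  show "kervec (glue R (pairs S2) r c) S f2 = - (\<Sum>y\<in>S2. r (f1, y) * kervec c S2 y)"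
   unfolding kervec_first_two(2)[OF S(4,2,3,1)] glue2 by (intro arg_cong[where f = uminus]) (simp add: *)
 qed
 define G where "G = {c \<in> PiE (pairs S2) (%_. X). ~ (\<forall>y\<in>S2. p dvd kervec c S2 y)}"
 have finG: "finite G" "G <= PiE (pairs S2) (%_. X)" using finite_PiE[of "pairs S2" "%_. X"] finR by (auto simp: G_def X_def)
 have "real (card G) * (real_of_int p ^ card R - real_of_int p ^ (card R - 2)) =
   (\<Sum>c\<in>G. real_of_int p ^ card R - real_of_int p ^ (card R - 2))" by simp
 also have "... <= (\<Sum>c\<in>G. real (card {r \<in> PiE R (%_. X). ~ (\<forall>y\<in>S. p dvd kervec (glue R (pairs S2) r c) S y)}))"
 proof (rule sum_mono)
  fix c assume c: "c \<in> G"
  then obtain y0 where y0: "y0 \<in> S2" "~ p dvd kervec c S2 y0" by (auto simp: G_def)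
  define Bad where "Bad = {r \<in> PiE R (%_. X). p dvd (\<Sum>y\<in>S2. r (f1, y) * kervec c S2 y) & p dvd (\<Sum>y\<in>S2. r (f2, y) * kervec c S2 y)}"
  have fin: "finite (PiE R (%_. X))" using finR by (intro finite_PiE) (auto simp: X_def)
  have "card Bad <= 1\<^sup>2 * card X ^ (card R - 2)" unfolding Bad_def
   by (rule card_two_lin_dvd_le[where w = "kervec c S2", OF p finR(1) S(4) _ _ y0])
     (use S(2,6) card_residue_class p1 in "auto simp: R_def X_def")
  hence "real (card Bad) <= real (nat p ^ (card R - 2))" by (simp add: cX)
  also have "... = real_of_int p ^ (card R - 2)" using p1 by simp
  finally have bad: "real (card Bad) <= real_of_int p ^ (card R - 2)" .
  have "PiE R (%_. X) - Bad <= {r \<in> PiE R (%_. X). ~ (\<forall>y\<in>S. p dvd kervec (glue R (pairs S2) r c) S y)}"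
  proof
   fix r assume r: "r \<in> PiE R (%_. X) - Bad"
   have "~ (p dvd kervec (glue R (pairs S2) r c) S f1 & p dvd kervec (glue R (pairs S2) r c) S f2)" using r unfolding glue1 Bad_def by auto
   thus "r \<in> {r \<in> PiE R (%_. X). ~ (\<forall>y\<in>S. p dvd kervec (glue R (pairs S2) r c) S y)}" using r S(1) by blast
  qed
  hence "card (PiE R (%_. X) - Bad) <= card {r \<in> PiE R (%_. X). ~ (\<forall>y\<in>S. p dvd kervec (glue R (pairs S2) r c) S y)}"
   using fin by (intro card_mono) auto
  moreover have "card (PiE R (%_. X)) = card (PiE R (%_. X) - Bad) + card Bad"
  proof -
   have "card (PiE R (%_. X) - Bad) = card (PiE R (%_. X)) - card Bad" "card Bad <= card (PiE R (%_. X))"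
    using fin by (auto simp: Bad_def intro!: card_Diff_subset card_mono)
   thus ?thesis by simp
  qed
  moreover have "real (card (PiE R (%_. X))) = real_of_int p ^ card R" using finR p1 by (simp add: card_PiE cX)
  ultimately show "real_of_int p ^ card R - real_of_int p ^ (card R - 2) <=
   real (card {r \<in> PiE R (%_. X). ~ (\<forall>y\<in>S. p dvd kervec (glue R (pairs S2) r c) S y)})" using bad by linarith
 qed
 also have "... <= (\<Sum>c\<in>PiE (pairs S2) (%_. X). real (card {r \<in> PiE R (%_. X). ~ (\<forall>y\<in>S. p dvd kervec (glue R (pairs S2) r c) S y)}))"
  using finR by (intro sum_mono2 finG) (auto intro!: finite_PiE simp: X_def)
 also have "... = real (card {x \<in> PiE (R \<union> pairs S2) (%_. X). ~ (\<forall>y\<in>S. p dvd kervec x S y)})"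
  using finR by (subst card_PiE_Un) (auto simp: X_def)
 finally have main: "real (card G) * (real_of_int p ^ card R - real_of_int p ^ (card R - 2)) <=
  real (card {x \<in> residue_boxes p S. ~ (\<forall>y\<in>S. p dvd kervec x S y)})" unfolding residue_boxes_def pS X_def .
 have cS: "card (pairs S) = card R + card (pairs S2)" unfolding pS using finR by (simp add: card_Un_disjoint)
 have "(1 - 1 / real_of_int p ^ 2) * kervec_density p S2 =
  (1 - 1 / real_of_int p ^ 2) * (real (card G) / real_of_int p ^ card (pairs S2))" by (simp add: kervec_density_def residue_boxes_def G_def X_def)
 also have "... = real (card G) * (real_of_int p ^ card R - real_of_int p ^ (card R - 2)) / real_of_int p ^ card (pairs S)"
 proof -
  have "real_of_int p ^ card R = real_of_int p ^ 2 * real_of_int p ^ (card R - 2)" using cR by (metis le_add_diff_inverse power_add)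
  thus ?thesis unfolding cS power_add using p1 by (simp add: field_simps)
 qed
 also have "... <= kervec_density p S" unfolding kervec_density_def using main p1 by (intro divide_right_mono) auto
 finally show ?thesis .
qed

lemma pairs_singleton [simp]: "pairs {a} = {}" by (auto simp: pairs_def)

text \<open>Iteration of the step, two indices at a time. The loss at \<open>p\<close> is of order
  \<open>1 / p ^ 2\<close>, which later makes the Euler product converge to a positive
  value.\<close>

lemma kervec_density_ge:
 fixes S :: "'m::linorder set"
 assumes p: "prime p" and S: "finite S" "card S = Suc (2 * m)"
 shows "kervec_density p S >= (1 - 1 / real_of_int p ^ 2) ^ m" using S
proof (induction m arbitrary: S)
 case 0
 then obtain a where a: "S = {a}" using card_1_singletonE by auto
 have p1: "p > 1" using p prime_gt_1_int by blast
 have "kervec x {a} a = 1" for x :: "'m \<times> 'm => int"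
 proof -
  have "{z \<in> {a}. z < a} = {}" by auto
  thus ?thesis by (simp only: pf_vec_def pos_sign_def) simp
 qed
 thus ?case using p1 card_residue_boxes[of S p] 0(1) unfolding a by (simp add: kervec_density_def)
next
 case (Suc m)
 obtain f1 f2 S2 where S2: "S = insert f1 (insert f2 S2)" "f1 < f2" "\<forall>y\<in>S2. f2 < y" "finite S2"
  "card S2 = Suc (2 * m)" "pairs S = (pairs S - pairs S2) \<union> pairs S2" "{f1, f2} \<times> S2 <= pairs S - pairs S2"
  using odd_set_cases[OF Suc.prems] by metis
 have "S2 ~= {}" using S2(5) by auto
 have p1: "p > 1" using p prime_gt_1_int by blast
 hence "(1 - 1 / real_of_int p ^ 2) * (1 - 1 / real_of_int p ^ 2) ^ m <= (1 - 1 / real_of_int p ^ 2) * kervec_density p S2" using Suc.IH[OF S2(4,5)]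
  by (intro mult_left_mono) auto
 also have "... <= kervec_density p S" by (rule kervec_density_step[OF p S2(1-4,6,7)]) fact
 finally show ?case by simp
qed

text \<open>What a sieve by the primes up to \<open>z\<close> fails to detect. The zero kernel
  vector is divisible by every prime and is counted separately by
  \<open>card_kervec_zero_le\<close>.\<close>

definition sieve_tail :: "int => int => 'm::linorder set => ('m \<times> 'm => int) set" where
 "sieve_tail N z S = {x \<in> PiE (pairs S) (%_. {- N..N}). (\<exists>y\<in>S. kervec x S y ~= 0) &
   (\<exists>p. prime p & p > z & (\<forall>y\<in>S. p dvd kervec x S y))}"

lemma prod_primes_dvd_int:
 assumes "finite A" "!!p. p \<in> A ==> prime p & p dvd (q::int)"
 shows "(\<Prod>p\<in>A. p) dvd q" using assms
proof (induction A rule: finite_induct)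
 case (insert a A)
 have "coprime a (\<Prod>p\<in>A. p)" using insert.hyps insert.prems by (auto intro!: prod_coprime_right primes_coprime)
 thus ?case using insert by (simp add: divides_mult)
qed simp

text \<open>\<open>k + F + 1\<close> distinct primes above \<open>N\<close> have a product of at
  least \<open>(N + 1) ^ (k + F + 1)\<close>, which exceeds \<open>F * N ^ k\<close> because
  \<open>2 ^ (F + 1) > F\<close>.\<close>

lemma card_large_primes_le:
 fixes q N :: int
 assumes q: "q ~= 0" and N: "N >= 1" and b: "real_of_int \<bar>q\<bar> <= real F * real_of_int N ^ k"
 shows "finite {p. prime p & p > N & p dvd q}" "card {p. prime p & p > N & p dvd q} <= k + F"
proof -
 let ?A = "{p. prime p & p > N & p dvd q}"
 have "?A <= {- \<bar>q\<bar>..\<bar>q\<bar>}"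
 proof
  fix p assume "p \<in> ?A"
  thus "p \<in> {- \<bar>q\<bar>..\<bar>q\<bar>}" using dvd_imp_le_int[OF q, of p] by auto
 qed
 thus fin: "finite ?A" by (rule finite_subset) simp
 show "card ?A <= k + F"
 proof (rule ccontr)
  assume "~ card ?A <= k + F"
  hence c: "card ?A >= k + (F + 1)" by simp
  have "\<bar>\<Prod>p\<in>?A. p\<bar> <= \<bar>q\<bar>" using q dvd_imp_le_int by (auto intro!: prod_primes_dvd_int[OF fin])
  moreover have "(\<Prod>p\<in>?A. N + 1) <= (\<Prod>p\<in>?A. p)" using N by (intro prod_mono) auto
  ultimately have "(N + 1) ^ card ?A <= \<bar>q\<bar>" by simp
  hence "real_of_int ((N + 1) ^ card ?A) <= real_of_int \<bar>q\<bar>" by (simp only: of_int_le_iff)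
  hence "real_of_int (N + 1) ^ card ?A <= real F * real_of_int (N + 1) ^ k"
  proof -
   have "real F * real_of_int N ^ k <= real F * real_of_int (N + 1) ^ k" using N by (intro mult_left_mono power_mono) auto
   thus ?thesis using \<open>real_of_int ((N + 1) ^ card ?A) <= real_of_int \<bar>q\<bar>\<close> b by simp
  qed
  moreover have "real_of_int (N + 1) ^ (k + (F + 1)) <= real_of_int (N + 1) ^ card ?A" using c N by (intro power_increasing) auto
  ultimately have "real_of_int (N + 1) ^ (F + 1) * real_of_int (N + 1) ^ k <= real F * real_of_int (N + 1) ^ k"
   unfolding power_add[of _ k "F + 1"] by (simp only: mult.commute[of _ "real_of_int (N + 1) ^ k"])
  hence "real_of_int (N + 1) ^ (F + 1) <= real F" using N by simp
  moreover have "(2::real) ^ (F + 1) <= real_of_int (N + 1) ^ (F + 1)" using N by (intro power_mono) auto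
  moreover have "real F < 2 ^ F" by simp
  ultimately show False by simp
 qed
qed

lemma sum_inverse_squares_le:
 assumes "z >= (1::int)"
 shows "(\<Sum>p\<in>{z<..N}. 1 / real_of_int p ^ 2) <= 1 / z"
proof (cases "z <= N")
 case True
 hence "(\<Sum>p\<in>{z<..N}. 1 / real_of_int p ^ 2) <= 1 / z - 1 / N"
 proof (induction N rule: int_ge_induct)
  case (step N)
  have "{z<..N + 1} = insert (N + 1) {z<..N}" using step by auto
  hence "(\<Sum>p\<in>{z<..N + 1}. 1 / real_of_int p ^ 2) <= 1 / real_of_int (N + 1) ^ 2 + (1 / z - 1 / N)" using step by simp
  also have "1 / real_of_int (N + 1) ^ 2 <= 1 / N - 1 / (N + 1)"
  proof -
   have N: "real_of_int N > 0" using step assms by simp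
   have "1 / real_of_int N - 1 / (real_of_int N + 1) = 1 / (real_of_int N * (real_of_int N + 1))" using N by (simp add: field_simps)
   moreover have "1 / (real_of_int N + 1) ^ 2 <= 1 / (real_of_int N * (real_of_int N + 1))"
    using N by (intro divide_left_mono) (auto simp: power2_eq_square)
   ultimately show ?thesis by simp
  qed
  finally show ?case by simp
 qed simp
 moreover have "1 / real_of_int N >= 0" using True assms by simp
 ultimately show ?thesis by linarith
qed (use assms in simp)

lemma card_symmetric_residue_le:
 assumes "0 < p" "N >= 1"
 shows "p <= N ==> card {t \<in> {- N..N}. [t = r] (mod p)} <= nat \<lfloor>4 * real_of_int N / p\<rfloor>"
  and "p > N ==> card {t \<in> {- N..N}. [t = r] (mod p)} <= 4"
proof -
 have b: "real (card {t \<in> {- N..N}. [t = r] (mod p)}) <= (2 * real_of_int N + 1) / p + 1"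
  using card_symmetric_interval_mod_le[of p N r] assms by simp
 show "card {t \<in> {- N..N}. [t = r] (mod p)} <= nat \<lfloor>4 * real_of_int N / p\<rfloor>" if "p <= N" using assms that b
  by (auto simp: field_simps intro!: divide_right_mono le_nat_floor)
 show "card {t \<in> {- N..N}. [t = r] (mod p)} <= 4" if "p > N"
 proof -
  have "(2 * real_of_int N + 1) / p <= 3" using that assms by (simp add: field_simps)
  thus ?thesis using b by linarith
 qed
qed

text \<open>
 The number of rows for which a large prime divides both linear forms: primes up to \<open>N\<close> are treated
 by a union bound, and only boundedly many larger primes can divide the second form.
\<close>

lemma card_rows_large_prime_le:
 fixes w :: "'m::linorder => int" and N z :: int and f1 f2 :: 'm
 assumes N: "N >= 1" and z: "z >= 1" and R: "finite R" "finite S2" "f1 ~= f2" "{f1, f2} \<times> S2 <= R"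
  and w: "\<exists>y\<in>S2. w y ~= 0"
  and bnd: "!!r. r \<in> PiE R (%_. {- N..N}) ==> real_of_int \<bar>\<Sum>y\<in>S2. r (f2, y) * w y\<bar> <= real F * real_of_int N ^ k"
 shows "real (card {r \<in> PiE R (%_. {- N..N}). \<exists>p. prime p & p > z & (\<exists>y\<in>S2. ~ p dvd w y) &
    p dvd (\<Sum>y\<in>S2. r (f1, y) * w y) & p dvd (\<Sum>y\<in>S2. r (f2, y) * w y)})
  <= 3 ^ card R * (17 + 4 * real (k + F)) * (1 / z + 1 / N) * real_of_int N ^ card R"
proof -
 define X where "X = {- N..N}"
 define Q where "Q = PiE R (%_. X)"
 define L where "L f r = (\<Sum>y\<in>S2. r (f, y) * w y)" for f and r :: "'m \<times> 'm => int"
 have cX: "real (card X) <= 3 * real_of_int N" "real (card X) >= 0" using N by (auto simp: X_def)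
 have finX: "finite X" by (simp add: X_def)
 have finQ: "finite Q" unfolding Q_def using R finX by (intro finite_PiE) auto
 obtain y0 where y0: "y0 \<in> S2" "w y0 ~= 0" using w by blast
 have "{(f1, y0), (f2, y0)} <= R" using R y0 by auto
 hence "card {(f1, y0), (f2, y0)} <= card R" using R by (intro card_mono)
 hence cR: "card R >= 2" using R(3) by simp
 define D where "D = card R"
 have pw: "real (card X) ^ j <= 3 ^ D * real_of_int N ^ j" if "j <= D" for j
 proof -
  have "real (card X) ^ j <= (3 * real_of_int N) ^ j" using cX by (intro power_mono) auto
  also have "... = 3 ^ j * real_of_int N ^ j" by simp
  also have "... <= 3 ^ D * real_of_int N ^ j" using that N by simp
  finally show ?thesis .
 qed
 have DN: "real_of_int N ^ (D - 1) = (1 / N) * real_of_int N ^ D" "real_of_int N ^ 2 * real_of_int N ^ (D - 2) = real_of_int N ^ D"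
 proof -
  have "D = Suc (D - 1)" "D = 2 + (D - 2)" using cR by (auto simp: D_def)
  thus "real_of_int N ^ (D - 1) = (1 / N) * real_of_int N ^ D" "real_of_int N ^ 2 * real_of_int N ^ (D - 2) = real_of_int N ^ D"
   using N by (metis (no_types, lifting) nonzero_mult_div_cancel_left of_int_eq_0_iff power_Suc times_divide_eq_left mult_1 not_one_le_zero, metis power_add)
 qed
 \<comment> \<open>\<open>A1\<close> is set apart because every prime divides 0. \<open>A2 p\<close>
   serves the primes up to \<open>N\<close>, each at a cost of order \<open>1 / p ^ 2\<close>. For
   \<open>A3\<close> everything except the row of \<open>f1\<close> is fixed first: then at most
   \<open>k + F\<close> primes remain, and each confines the row of \<open>f1\<close> to a
   proportion of order \<open>1 / N\<close>.\<close>
 define A1 where "A1 = {r \<in> Q. L f2 r = 0}"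
 define A2 where "A2 p = {r \<in> Q. p dvd L f1 r & p dvd L f2 r}" for p
 define A3 where "A3 = {r \<in> Q. L f2 r ~= 0 & (\<exists>p. prime p & p > N & (\<exists>y\<in>S2. ~ p dvd w y) & p dvd L f1 r & p dvd L f2 r)}"
 define P where "P = {p \<in> {z<..N}. prime p & (\<exists>y\<in>S2. ~ p dvd w y)}"
 have finP: "finite P" unfolding P_def by (rule finite_subset[of _ "{z<..N}"]) auto
 have sub: "{r \<in> PiE R (%_. {- N..N}). \<exists>p. prime p & p > z & (\<exists>y\<in>S2. ~ p dvd w y) &
    p dvd (\<Sum>y\<in>S2. r (f1, y) * w y) & p dvd (\<Sum>y\<in>S2. r (f2, y) * w y)} <= A1 \<union> (\<Union>p\<in>P. A2 p) \<union> A3"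
 proof
  fix r assume "r \<in> {r \<in> PiE R (%_. {- N..N}). \<exists>p. prime p & p > z & (\<exists>y\<in>S2. ~ p dvd w y) &
    p dvd (\<Sum>y\<in>S2. r (f1, y) * w y) & p dvd (\<Sum>y\<in>S2. r (f2, y) * w y)}"
  then obtain p where r: "r \<in> Q" and p: "prime p" "p > z" "\<exists>y\<in>S2. ~ p dvd w y" "p dvd L f1 r" "p dvd L f2 r"
   by (auto simp: Q_def X_def L_def)
  show "r \<in> A1 \<union> (\<Union>p\<in>P. A2 p) \<union> A3"
  proof (cases "p <= N")
   case True
   thus ?thesis using p r by (auto simp: P_def A2_def)
  next
   case False
   thus ?thesis using p r by (auto simp: A1_def A3_def)
  qed
 qed
 have c1: "real (card A1) <= 3 ^ D * ((1 / N) * real_of_int N ^ D)"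
 proof -
  define w' where "w' e = (if fst e = f2 & snd e \<in> S2 then w (snd e) else 0)" for e :: "'m \<times> 'm"
  have "(\<Sum>e\<in>R. r e * w' e) = L f2 r" for r
  proof -
   have "(\<Sum>e\<in>R. r e * w' e) = (\<Sum>e\<in>Pair f2 ` S2. r e * w' e)" using R by (intro sum.mono_neutral_right) (auto simp: w'_def)
   also have "... = L f2 r" unfolding L_def by (subst sum.reindex) (auto simp: inj_on_def w'_def)
   finally show ?thesis .
  qed
  hence "card A1 <= (\<Prod>i\<in>R - {(f2, y0)}. card X)" using card_lin_eq_le[of R "(f2, y0)" w' "%_. X" 0] R y0 finX by (auto simp: A1_def Q_def w'_def)
  also have "... = card X ^ (D - 1)" using R(4) y0(1) by (auto simp: D_def)
  finally have "real (card A1) <= real (card X) ^ (D - 1)" by simp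
  thus ?thesis using pw[of "D - 1"] unfolding DN(1) by linarith
 qed
 have c2: "real (card (A2 p)) <= 16 * 3 ^ D * real_of_int N ^ D * (1 / real_of_int p ^ 2)" if p: "p \<in> P" for p
 proof -
  obtain y1 where y1: "y1 \<in> S2" "~ p dvd w y1" using p by (auto simp: P_def)
  have pp: "prime p" "p <= N" "p > 0" using p z by (auto simp: P_def)
  define K where "K = nat \<lfloor>4 * real_of_int N / p\<rfloor>"
  have "card (A2 p) <= K\<^sup>2 * card X ^ (card R - 2)" unfolding A2_def Q_def L_def
   by (rule card_two_lin_dvd_le[where w = w, OF pp(1) R y1 finX])
     (use card_symmetric_residue_le(1)[OF pp(3) N pp(2)] in "simp add: K_def X_def")
  hence "real (card (A2 p)) <= real K ^ 2 * real (card X) ^ (D - 2)" unfolding D_def by (metis of_nat_le_iff of_nat_mult of_nat_power)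
  also have "... <= (4 * real_of_int N / p) ^ 2 * (3 ^ D * real_of_int N ^ (D - 2))"
  proof (intro mult_mono power_mono)
   show "real K <= 4 * real_of_int N / p" using N pp unfolding K_def by simp
  qed (use pw[of "D - 2"] in auto)
  also have "... = 16 * 3 ^ D * (real_of_int N ^ 2 * real_of_int N ^ (D - 2)) * (1 / real_of_int p ^ 2)" by (simp add: power_divide)
  finally show ?thesis unfolding DN(2) .
 qed
 have c2': "real (card (\<Union>p\<in>P. A2 p)) <= 16 * 3 ^ D * real_of_int N ^ D * (1 / z)"
 proof -
  have finP: "finite P" by (rule finP)
  have "real (card (\<Union>p\<in>P. A2 p)) <= (\<Sum>p\<in>P. real (card (A2 p)))"
   using card_UN_le[OF finP, of A2] by (metis of_nat_le_iff of_nat_sum)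
  also have "... <= (\<Sum>p\<in>P. 16 * 3 ^ D * real_of_int N ^ D * (1 / real_of_int p ^ 2))" by (rule sum_mono) (rule c2)
  also have "... = 16 * 3 ^ D * real_of_int N ^ D * (\<Sum>p\<in>P. 1 / real_of_int p ^ 2)" by (simp add: sum_distrib_left)
  also have "... <= 16 * 3 ^ D * real_of_int N ^ D * (1 / z)"
  proof (rule mult_left_mono)
   have "(\<Sum>p\<in>P. 1 / real_of_int p ^ 2) <= (\<Sum>p\<in>{z<..N}. 1 / real_of_int p ^ 2)" by (intro sum_mono2) (auto simp: P_def)
   thus "(\<Sum>p\<in>P. 1 / real_of_int p ^ 2) <= 1 / z" using sum_inverse_squares_le[OF z, of N] by linarith
  qed (use N in auto)
  finally show ?thesis .
 qed
 have c3: "real (card A3) <= 4 * real (k + F) * (3 ^ D * ((1 / N) * real_of_int N ^ D))"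
 proof -
  define R1 where "R1 = Pair f1 ` S2"
  define R2 where "R2 = R - R1"
  have R12: "finite R1" "finite R2" "R1 \<inter> R2 = {}" "R = R1 \<union> R2" using R by (auto simp: R1_def R2_def)
  have cR1: "card R1 = card S2" unfolding R1_def by (rule card_image) (auto simp: inj_on_def)
  have "card A3 <= (\<Prod>i\<in>R2. card X) * ((k + F) * (4 * card X ^ (card R1 - 1)))" unfolding A3_def Q_def R12(4)
  proof (rule card_PiE_Un_le[OF R12(1-3)])
   fix c :: "'m \<times> 'm => int" assume c: "c \<in> PiE R2 (%_. X)"
   define q where "q = (\<Sum>y\<in>S2. c (f2, y) * w y)"
   have L2: "L f2 (glue R1 R2 s c) = q" for s unfolding L_def q_def using R by (intro sum.cong) (auto simp: glue_def R1_def R2_def)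
   have L1: "L f1 (glue R1 R2 s c) = (\<Sum>e\<in>R1. s e * w (snd e))" for s
    unfolding L_def R1_def by (subst sum.reindex) (auto simp: glue_def inj_on_def)
   show "card {s \<in> PiE R1 (%_. X). L f2 (glue R1 R2 s c) ~= 0 & (\<exists>p. prime p & p > N & (\<exists>y\<in>S2. ~ p dvd w y) &
     p dvd L f1 (glue R1 R2 s c) & p dvd L f2 (glue R1 R2 s c))} <= (k + F) * (4 * card X ^ (card R1 - 1))"
    (is "card ?B <= _")
   proof (cases "q = 0")
    case False
    define Pq where "Pq = {p. prime p & p > N & p dvd q}"
    \<comment> \<open>\<open>q\<close> does not involve the row of \<open>f1\<close>, so that row
      may be filled with zeros to read off the size bound.\<close>
    define r0 where "r0 = glue R1 R2 (%_. 0) c"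
    have "r0 \<in> PiE R (%_. {- N..N})" using c N R12 by (auto simp: r0_def glue_def X_def)
    hence "real_of_int \<bar>q\<bar> <= real F * real_of_int N ^ k" using bnd[of r0] L2 unfolding L_def r0_def by simp
    hence Pq: "finite Pq" "card Pq <= k + F" unfolding Pq_def using card_large_primes_le[OF False N] by blast+
    define B where "B p = {s \<in> PiE R1 (%_. X). p dvd (\<Sum>e\<in>R1. s e * w (snd e))}" for p
    define Pq' where "Pq' = {p \<in> Pq. \<exists>y\<in>S2. ~ p dvd w y}"
    have Pq': "finite Pq'" "card Pq' <= card Pq" using Pq by (auto simp: Pq'_def intro!: card_mono)
    have "?B <= (\<Union>p\<in>Pq'. B p)" unfolding L1 L2 by (auto simp: B_def Pq_def Pq'_def)
    moreover have finB: "finite (B p)" for p using R12 finX finite_PiE[of R1 "%_. X"] by (auto simp: B_def)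
    ultimately have "card ?B <= card (\<Union>p\<in>Pq'. B p)" using Pq' by (intro card_mono) auto
    also have "... <= (\<Sum>p\<in>Pq'. card (B p))" by (rule card_UN_le[OF Pq'(1)])
    also have "... <= (\<Sum>p\<in>Pq'. 4 * card X ^ (card R1 - 1))"
    proof (rule sum_mono)
     fix p assume p: "p \<in> Pq'"
     then obtain y1 where y1: "y1 \<in> S2" "~ p dvd w y1" by (auto simp: Pq'_def)
     have pp: "prime p" "p > N" "p > 0" using p N by (auto simp: Pq'_def Pq_def)
     show "card (B p) <= 4 * card X ^ (card R1 - 1)" unfolding B_def
      by (rule card_lin_dvd_le[where w = "%e. w (snd e)" and e = "(f1, y1)", OF pp(1) R12(1) _ _ finX])
        (use y1 card_symmetric_residue_le(2)[OF pp(3) N pp(2)] in "auto simp: R1_def X_def")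
    qed
    also have "... = card Pq' * (4 * card X ^ (card R1 - 1))" by simp
    also have "... <= (k + F) * (4 * card X ^ (card R1 - 1))" using Pq Pq' by simp
    finally show ?thesis .
   qed (simp add: L2)
  qed (use finX in auto)
  also have "... = 4 * (k + F) * card X ^ (D - 1)"
  proof -
   have "card R1 >= 1" using y0 cR1 R by (simp add: Suc_le_eq card_gt_0_iff) blast
   moreover have "D = card R1 + card R2" unfolding D_def using R12 by (simp add: card_Un_disjoint)
   ultimately have "D - 1 = card R2 + (card R1 - 1)" by simp
   thus ?thesis by (simp add: power_add)
  qed
  finally have "real (card A3) <= 4 * real (k + F) * real (card X) ^ (D - 1)"
  proof -
   assume "card A3 <= 4 * (k + F) * card X ^ (D - 1)"
   hence "real (card A3) <= real (4 * (k + F) * card X ^ (D - 1))" by (simp only: of_nat_le_iff)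
   thus ?thesis by simp
  qed
  also have "... <= 4 * real (k + F) * (3 ^ D * real_of_int N ^ (D - 1))" using pw[of "D - 1"] by (intro mult_left_mono) auto
  finally show ?thesis unfolding DN(1) .
 qed
 have "card {r \<in> PiE R (%_. {- N..N}). \<exists>p. prime p & p > z & (\<exists>y\<in>S2. ~ p dvd w y) &
    p dvd (\<Sum>y\<in>S2. r (f1, y) * w y) & p dvd (\<Sum>y\<in>S2. r (f2, y) * w y)} <= card (A1 \<union> (\<Union>p\<in>P. A2 p) \<union> A3)"
  using finQ finP by (intro card_mono[OF _ sub]) (auto simp: A1_def A2_def A3_def)
 also have "... <= card A1 + card (\<Union>p\<in>P. A2 p) + card A3"
  using card_Un_le[of "A1 \<union> (\<Union>p\<in>P. A2 p)" A3] card_Un_le[of A1 "\<Union>p\<in>P. A2 p"] by linarith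
 finally have "real (card {r \<in> PiE R (%_. {- N..N}). \<exists>p. prime p & p > z & (\<exists>y\<in>S2. ~ p dvd w y) &
    p dvd (\<Sum>y\<in>S2. r (f1, y) * w y) & p dvd (\<Sum>y\<in>S2. r (f2, y) * w y)})
   <= 3 ^ D * ((1 / N) * real_of_int N ^ D) + 16 * 3 ^ D * real_of_int N ^ D * (1 / z) + 4 * real (k + F) * (3 ^ D * ((1 / N) * real_of_int N ^ D))"
  using c1 c2' c3 by linarith
 also have "... = 3 ^ D * real_of_int N ^ D * ((1 + 4 * real (k + F)) * (1 / N) + 16 * (1 / z))" by (simp add: algebra_simps)
 also have "... <= 3 ^ D * real_of_int N ^ D * ((17 + 4 * real (k + F)) * (1 / N) + (17 + 4 * real (k + F)) * (1 / z))"
  using N z by (intro mult_left_mono add_mono mult_right_mono) auto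
 also have "... = 3 ^ D * (17 + 4 * real (k + F)) * (1 / z + 1 / N) * real_of_int N ^ D" by (simp add: algebra_simps)
 finally show ?thesis unfolding D_def .
qed

lemma card_kervec_zero_le:
 fixes S :: "'m::linorder set"
 assumes "finite S" "odd (card S)" "finite X"
 shows "card {x \<in> PiE (pairs S) (%_. X). \<forall>y\<in>S. kervec x S y = (0::int)} <= card (pairs S) * card X ^ (card (pairs S) - 1)"
proof -
 have "S ~= {}" using assms by auto
 then obtain y0 where y0: "y0 \<in> S" by blast
 define u where "u y = (if y = y0 then 1 else 0 :: int)" for y
 have "card {x \<in> PiE (pairs S) (%_. X). \<forall>y\<in>S. kervec x S y = (0::int)} <=
  card {x \<in> PiE (pairs S) (%_. X). (\<Sum>y\<in>S. u y * kervec x S y) = 0}" using assms finite_PiE[OF finite_pairs[OF assms(1)], of "%_. X"] by (intro card_mono) auto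
 also have "... <= card (pairs S) * card X ^ (card (pairs S) - 1)" by (rule card_dot_kervec_zero_le[OF assms(1,2) y0 _ assms(3)]) (simp add: u_def)
 finally show ?thesis .
qed

text \<open>A sieve of Ekedahl type, by induction on the number of index pairs removed. The entries
  \<open>c\<close> on \<open>S2\<close> have kernel vector zero (\<open>Z0\<close>), lie in the
  smaller tail (\<open>Z1\<close>, by induction), or are such that no prime above \<open>z\<close>
  divides their whole kernel vector. In the last case the row count applies; in the first two
  \<open>c\<close> itself is rare.\<close>

lemma card_sieve_tail_le:
 fixes S :: "'m::linorder set"
 assumes "finite S" "card S = Suc (2 * m)"
 shows "\<exists>C>0. \<forall>N\<ge>1. \<forall>z\<ge>1. real (card (sieve_tail N z S)) <= C * (1 / z + 1 / N) * real_of_int N ^ card (pairs S)"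
 using assms
proof (induction m arbitrary: S)
 case 0
 then obtain a where a: "S = {a}" using card_1_singletonE by auto
 have k1: "kervec x {a} a = 1" for x :: "'m \<times> 'm => int"
 proof -
  have "{z \<in> {a}. z < a} = {}" by auto
  thus ?thesis by (simp only: pf_vec_def pos_sign_def) simp
 qed
 have "sieve_tail N z S = {}" for N z
 proof -
  have "~ p dvd 1" if "prime p" for p :: int using that not_prime_unit by blast
  thus ?thesis unfolding sieve_tail_def a by (auto simp: k1)
 qed
 thus ?case by (intro exI[of _ 1]) auto
next
 case (Suc m)
 obtain f1 f2 S2 where S2: "S = insert f1 (insert f2 S2)" "f1 < f2" "\<forall>y\<in>S2. f2 < y" "finite S2"
  "card S2 = Suc (2 * m)" "pairs S = (pairs S - pairs S2) \<union> pairs S2" "{f1, f2} \<times> S2 <= pairs S - pairs S2"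
  using odd_set_cases[OF Suc.prems] by metis
 obtain C2 where C2: "C2 > 0" "!!N z. N >= 1 ==> z >= 1 ==> real (card (sieve_tail N z S2)) <= C2 * (1 / z + 1 / N) * real_of_int N ^ card (pairs S2)"
  using Suc.IH[OF S2(4,5)] by blast
 define R where "R = pairs S - pairs S2"
 define D D2 where "D = card R" and "D2 = card (pairs S2)"
 have finS: "finite S" using S2 by simp
 have finR: "finite R" "finite (pairs S2)" "R \<inter> pairs S2 = {}" using finite_pairs[OF finS] finite_pairs[OF S2(4)] by (auto simp: R_def)
 have pS: "pairs S = R \<union> pairs S2" using S2(6) by (simp add: R_def)
 have cS: "card (pairs S) = D + D2" unfolding pS D_def D2_def using finR by (simp add: card_Un_disjoint)
 define F :: nat where "F = fact (2 * Suc m)"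
 define k where "k = Suc m"
 define K where "K = 3 ^ D * (17 + 4 * real (k + F))"
 \<comment> \<open>\<open>3 ^ (D + D2)\<close> comes from \<open>card {- N..N} <= 3 * N\<close>; the
   three summands belong to \<open>Z0\<close>, \<open>Z1\<close> and the remaining
   \<open>c\<close>.\<close>
 define C where "C = 3 ^ (D + D2) * (real D2 + C2 + K)"
 have K0: "K > 0" by (simp add: K_def)
 have glue2: "kervec (glue R (pairs S2) r c) S2 y = kervec c S2 y" for r c :: "'m \<times> 'm => int" and y
  by (rule kervec_cong) (use finR in "auto simp: glue_def")
 have glue1: "kervec (glue R (pairs S2) r c) S f1 = (\<Sum>y\<in>S2. r (f2, y) * kervec c S2 y)"
  "kervec (glue R (pairs S2) r c) S f2 = - (\<Sum>y\<in>S2. r (f1, y) * kervec c S2 y)" for r c :: "'m \<times> 'm => int"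
 proof -
  have *: "glue R (pairs S2) r c (f, y) = r (f, y)" if "f \<in> {f1, f2}" "y \<in> S2" for f y using that S2(7) by (auto simp: glue_def R_def)
  show "kervec (glue R (pairs S2) r c) S f1 = (\<Sum>y\<in>S2. r (f2, y) * kervec c S2 y)"
   unfolding kervec_first_two(1)[OF S2(4,2,3,1)] glue2 by (intro sum.cong refl) (simp add: *)
  show "kervec (glue R (pairs S2) r c) S f2 = - (\<Sum>y\<in>S2. r (f1, y) * kervec c S2 y)"
   unfolding kervec_first_two(2)[OF S2(4,2,3,1)] glue2 by (intro arg_cong[where f = uminus]) (simp add: *)
 qed
 show ?case
 proof (intro exI conjI allI impI)
  show "C > 0" unfolding C_def using C2(1) K0 by simp
  fix N z :: int assume N: "N >= 1" and z: "z >= 1"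
  define X where "X = {- N..N}"
  have finX: "finite X" by (simp add: X_def)
  have cX: "real (card X) <= 3 * real_of_int N" using N by (simp add: X_def)
  have pw: "real (card X) ^ j <= 3 ^ j * real_of_int N ^ j" for j using cX by (subst power_mult_distrib[symmetric]) (intro power_mono, auto)
  define eps where "eps = 1 / real_of_int z + 1 / real_of_int N"
  have eps: "eps > 0" "eps >= 1 / N" using N z by (auto simp: eps_def intro!: add_pos_pos)
  define P where "P x \<longleftrightarrow> (\<exists>y\<in>S. kervec x S y ~= 0) & (\<exists>p. prime p & p > z & (\<forall>y\<in>S. p dvd kervec x S y))" for x :: "'m \<times> 'm => int"
  define g where "g c = real (card {r \<in> PiE R (%_. X). P (glue R (pairs S2) r c)})" for c
  define Q where "Q = PiE (pairs S2) (%_. X)"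
  have finQ: "finite Q" "real (card Q) <= 3 ^ D2 * real_of_int N ^ D2"
   using finR finX pw[of D2] by (auto simp: Q_def D2_def card_PiE intro!: finite_PiE)
  define Z0 where "Z0 = {c \<in> Q. \<forall>y\<in>S2. kervec c S2 y = 0}"
  define Z1 where "Z1 = sieve_tail N z S2"
  have Z1Q: "Z1 <= Q" by (auto simp: Z1_def sieve_tail_def Q_def X_def)
  have gle: "g c <= 3 ^ D * real_of_int N ^ D" for c
  proof -
   have "card {r \<in> PiE R (%_. X). P (glue R (pairs S2) r c)} <= card (PiE R (%_. X))"
    using finR finX finite_PiE[of R "%_. X"] by (intro card_mono) auto
   also have "... = card X ^ D" using finR by (simp add: card_PiE D_def)
   finally have "g c <= real (card X) ^ D" unfolding g_def by simp
   thus ?thesis using pw[of D] by linarith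
  qed
  have good: "g c <= K * eps * real_of_int N ^ D" if c: "c \<in> Q - Z0 - Z1" for c
  proof -
   have cQ: "c \<in> PiE (pairs S2) (%_. X)" using c by (simp add: Q_def)
   define w where "w = kervec c S2"
   have w: "\<exists>y\<in>S2. w y ~= 0" using c by (auto simp: Z0_def w_def)
   have np: "\<exists>y\<in>S2. ~ p dvd w y" if "prime p" "p > z" for p using c w that unfolding Z1_def sieve_tail_def Q_def X_def w_def by blast
   have "{r \<in> PiE R (%_. X). P (glue R (pairs S2) r c)} <= {r \<in> PiE R (%_. {- N..N}). \<exists>p. prime p & p > z &
     (\<exists>y\<in>S2. ~ p dvd w y) & p dvd (\<Sum>y\<in>S2. r (f1, y) * w y) & p dvd (\<Sum>y\<in>S2. r (f2, y) * w y)}"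
   proof
    fix r assume r: "r \<in> {r \<in> PiE R (%_. X). P (glue R (pairs S2) r c)}"
    then obtain p where p: "prime p" "p > z" "!!y. y \<in> S ==> p dvd kervec (glue R (pairs S2) r c) S y" unfolding P_def by blast
    have "p dvd (\<Sum>y\<in>S2. r (f1, y) * w y)" using p(3)[of f2] S2(1) unfolding glue1 w_def by simp
    moreover have "p dvd (\<Sum>y\<in>S2. r (f2, y) * w y)" using p(3)[of f1] S2(1) unfolding glue1 w_def by simp
    ultimately show "r \<in> {r \<in> PiE R (%_. {- N..N}). \<exists>p. prime p & p > z &
     (\<exists>y\<in>S2. ~ p dvd w y) & p dvd (\<Sum>y\<in>S2. r (f1, y) * w y) & p dvd (\<Sum>y\<in>S2. r (f2, y) * w y)}"
     using r p(1,2) np[OF p(1,2)] unfolding X_def by blast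
   qed
   hence "g c <= real (card {r \<in> PiE R (%_. {- N..N}). \<exists>p. prime p & p > z &
     (\<exists>y\<in>S2. ~ p dvd w y) & p dvd (\<Sum>y\<in>S2. r (f1, y) * w y) & p dvd (\<Sum>y\<in>S2. r (f2, y) * w y)})" using finR finite_PiE[of R "%_. {- N..N}"] by (auto simp: g_def intro!: card_mono)
   also have "... <= 3 ^ card R * (17 + 4 * real (k + F)) * (1 / z + 1 / N) * real_of_int N ^ card R"
   proof (rule card_rows_large_prime_le[OF N z finR(1) S2(4) _ _ w])
    show "f1 ~= f2" "{f1, f2} \<times> S2 <= R" using S2(2,7) by (auto simp: R_def)
    fix r :: "'m \<times> 'm => int" assume r: "r \<in> PiE R (%_. {- N..N})"
    define x where "x = glue R (pairs S2) r c"
    have xN: "\<bar>x e\<bar> <= N" if "e \<in> pairs S" for e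
    proof (cases "e \<in> R")
     case True
     hence "r e \<in> {- N..N}" "x e = r e" using r by (auto simp: x_def glue_def)
     thus ?thesis by auto
    next
     case False
     hence "c e \<in> X" "x e = c e" using that pS cQ False by (auto simp: x_def glue_def)
     thus ?thesis by (simp add: abs_le_iff X_def)
    qed
    have "\<bar>kervec (%e. real_of_int (x e)) S f1\<bar> <= fact (2 * Suc m) * real_of_int N ^ Suc m"
    proof (rule abs_kervec_le[OF finS Suc.prems(2)])
     show "f1 \<in> S" using S2 by simp
     show "\<bar>real_of_int (x e)\<bar> <= real_of_int N" if "e \<in> pairs S" for e using xN[OF that] by simp
    qed (use N in simp)
    hence "\<bar>real_of_int (kervec x S f1)\<bar> <= real F * real_of_int N ^ k" unfolding real_kervec k_def F_def of_nat_fact .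
    thus "real_of_int \<bar>\<Sum>y\<in>S2. r (f2, y) * w y\<bar> <= real F * real_of_int N ^ k" unfolding x_def glue1 w_def by simp
   qed
   finally show ?thesis unfolding K_def D_def eps_def .
  qed
  have cZ0: "real (card Z0) <= real D2 * 3 ^ D2 * ((1 / N) * real_of_int N ^ D2)"
  proof (cases "D2 = 0")
   case True
   show ?thesis using card_kervec_zero_le[OF S2(4) _ finX] S2(5) True by (simp add: Z0_def Q_def D2_def)
  next
   case False
   have "card Z0 <= D2 * card X ^ (D2 - 1)" using card_kervec_zero_le[OF S2(4) _ finX] S2(5) by (simp add: Z0_def Q_def D2_def)
   hence "real (card Z0) <= real (D2 * card X ^ (D2 - 1))" by (simp only: of_nat_le_iff)
   also have "... = real D2 * real (card X) ^ (D2 - 1)" by simp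
   also have "... <= real D2 * (3 ^ (D2 - 1) * real_of_int N ^ (D2 - 1))" using pw by (intro mult_left_mono) auto
   also have "... <= real D2 * (3 ^ D2 * real_of_int N ^ (D2 - 1))" using N by (intro mult_left_mono) auto
   also have "real_of_int N ^ (D2 - 1) = (1 / N) * real_of_int N ^ D2" using False N by (simp add: power_eq_if)
   finally show ?thesis by simp
  qed
  have "real (card (sieve_tail N z S)) = (\<Sum>c\<in>Q. g c)"
  proof -
   have "sieve_tail N z S = {x \<in> PiE (R \<union> pairs S2) (%_. X). P x}" unfolding sieve_tail_def pS[symmetric] P_def X_def ..
   moreover have "card {x \<in> PiE (R \<union> pairs S2) (%_. X). P x} = (\<Sum>c\<in>PiE (pairs S2) (%_. X). card {r \<in> PiE R (%_. X). P (glue R (pairs S2) r c)})"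
    by (rule card_PiE_Un) (use finR finX in auto)
   ultimately show ?thesis by (simp add: g_def Q_def)
  qed
  also have "... <= (\<Sum>c\<in>Z0. g c) + (\<Sum>c\<in>Z1. g c) + (\<Sum>c\<in>Q - Z0 - Z1. g c)"
  proof -
   have fin: "finite Z0" "finite Z1" using finQ Z1Q finite_subset by (auto simp: Z0_def)
   have g0: "g c >= 0" for c by (simp add: g_def)
   have "Q = (Z0 \<union> Z1) \<union> (Q - Z0 - Z1)" using Z1Q by (auto simp: Z0_def)
   hence "(\<Sum>c\<in>Q. g c) = (\<Sum>c\<in>(Z0 \<union> Z1) \<union> (Q - Z0 - Z1). g c)" by simp
   also have "... = (\<Sum>c\<in>Z0 \<union> Z1. g c) + (\<Sum>c\<in>Q - Z0 - Z1. g c)" using fin finQ by (intro sum.union_disjoint) auto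
   finally have "(\<Sum>c\<in>Q. g c) = (\<Sum>c\<in>Z0 \<union> Z1. g c) + (\<Sum>c\<in>Q - Z0 - Z1. g c)" .
   moreover have "(\<Sum>c\<in>Z0 \<union> Z1. g c) <= (\<Sum>c\<in>Z0. g c) + (\<Sum>c\<in>Z1. g c)"
    using sum.union_inter[OF fin, of g] sum_nonneg[of "Z0 \<inter> Z1" g, OF g0] by linarith
   ultimately show ?thesis by linarith
  qed
  also have "(\<Sum>c\<in>Z0. g c) <= real (card Z0) * (3 ^ D * real_of_int N ^ D)" by (rule sum_bounded_above) (rule gle)
  also have "... <= (real D2 * 3 ^ D2 * ((1 / N) * real_of_int N ^ D2)) * (3 ^ D * real_of_int N ^ D)" using cZ0 N by (intro mult_right_mono) auto
  also have "... <= (real D2 * 3 ^ D2 * (eps * real_of_int N ^ D2)) * (3 ^ D * real_of_int N ^ D)"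
   using eps(2) N by (intro mult_right_mono mult_left_mono) auto
  also have "(\<Sum>c\<in>Z1. g c) <= real (card Z1) * (3 ^ D * real_of_int N ^ D)" by (rule sum_bounded_above) (rule gle)
  also have "... <= (C2 * eps * real_of_int N ^ D2) * (3 ^ D * real_of_int N ^ D)" using C2(2)[OF N z] N unfolding Z1_def eps_def D2_def by simp
  also have "... <= (C2 * eps * real_of_int N ^ D2) * (3 ^ (D + D2) * real_of_int N ^ D)" using C2(1) eps N by simp
  also have "(\<Sum>c\<in>Q - Z0 - Z1. g c) <= real (card (Q - Z0 - Z1)) * (K * eps * real_of_int N ^ D)" by (rule sum_bounded_above) (rule good)
  also have "... <= (3 ^ D2 * real_of_int N ^ D2) * (K * eps * real_of_int N ^ D)"
  proof (rule mult_right_mono)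
   have "card (Q - Z0 - Z1) <= card Q" using finQ by (intro card_mono) auto
   thus "real (card (Q - Z0 - Z1)) <= 3 ^ D2 * real_of_int N ^ D2" using finQ(2) by linarith
  qed (use K0 eps N in auto)
  also have "... <= (3 ^ (D + D2) * real_of_int N ^ D2) * (K * eps * real_of_int N ^ D)" using K0 eps N by simp
  finally have "real (card (sieve_tail N z S)) <=
   (real D2 * 3 ^ D2 * (eps * real_of_int N ^ D2)) * (3 ^ D * real_of_int N ^ D) +
   (C2 * eps * real_of_int N ^ D2) * (3 ^ (D + D2) * real_of_int N ^ D) +
   (3 ^ (D + D2) * real_of_int N ^ D2) * (K * eps * real_of_int N ^ D)" by simp
  also have "... = C * eps * real_of_int N ^ (D + D2)" unfolding C_def by (simp add: power_add algebra_simps)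
  finally show "real (card (sieve_tail N z S)) <= C * (1 / z + 1 / N) * real_of_int N ^ card (pairs S)" unfolding cS eps_def .
 qed
qed

section \<open>The limiting density of primitive kernel vectors\<close>

definition kervec_primitive :: "('m::linorder \<times> 'm => int) => 'm set => bool" where
 "kervec_primitive x S \<longleftrightarrow> (\<forall>p. prime p --> ~ (\<forall>y\<in>S. p dvd kervec x S y))"

text \<open>The Chinese remainder theorem, coordinate by coordinate, for conditions that depend only
  on the residues.\<close>

lemma card_residues_mult:
 fixes M1 M2 :: int and g1 g2 :: "('e => int) => bool"
 assumes E: "finite E" and M: "M1 > 0" "M2 > 0" "coprime M1 M2"
  and g1: "!!x x'. (!!e. e \<in> E ==> [x e = x' e] (mod M1)) ==> g1 x = g1 x'"
  and g2: "!!x x'. (!!e. e \<in> E ==> [x e = x' e] (mod M2)) ==> g2 x = g2 x'"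
 shows "card {x \<in> PiE E (%_. {0..<M1 * M2}). g1 x & g2 x} =
  card {x \<in> PiE E (%_. {0..<M1}). g1 x} * card {x \<in> PiE E (%_. {0..<M2}). g2 x}"
proof -
 define P where "P M = PiE E (%_. {0..<M :: int})" for M
 define f where "f x = (restrict (%e. x e mod M1) E, restrict (%e. x e mod M2) E)" for x :: "'e => int"
 have finP: "finite (P M)" for M unfolding P_def using E by (intro finite_PiE) auto
 have inj: "inj_on f (P (M1 * M2))"
 proof (rule inj_onI)
  fix x x' assume x: "x \<in> P (M1 * M2)" "x' \<in> P (M1 * M2)" and eq: "f x = f x'"
  show "x = x'"
  proof (rule PiE_ext[OF x[unfolded P_def]])
   fix e assume e: "e \<in> E"
   have "x e mod M1 = x' e mod M1" "x e mod M2 = x' e mod M2" using eq e unfolding f_def by (auto simp: fun_eq_iff split: if_splits)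
   hence "[x e = x' e] (mod M1 * M2)" using M(3) by (intro coprime_cong_mult) (auto simp: cong_def)
   moreover have "x e \<in> {0..<M1 * M2}" "x' e \<in> {0..<M1 * M2}" using x e by (auto simp: P_def)
   ultimately show "x e = x' e" by (simp add: cong_def)
  qed
 qed
 have im: "f ` P (M1 * M2) = P M1 \<times> P M2"
 proof (rule card_subset_eq)
  show "f ` P (M1 * M2) <= P M1 \<times> P M2" using M by (auto simp: f_def P_def)
  show "card (f ` P (M1 * M2)) = card (P M1 \<times> P M2)" using E M card_image[OF inj]
   by (auto simp: card_PiE nat_mult_distrib power_mult_distrib card_cartesian_product P_def)
 qed (use finP in auto)
 have g1f: "g1 (fst (f x)) = g1 x" and g2f: "g2 (snd (f x)) = g2 x" for x by (auto simp: f_def intro!: g1 g2)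
 have "f ` {x \<in> P (M1 * M2). g1 x & g2 x} = {x \<in> P M1. g1 x} \<times> {x \<in> P M2. g2 x}"
 proof (intro equalityI subsetI)
  fix q assume "q \<in> {x \<in> P M1. g1 x} \<times> {x \<in> P M2. g2 x}"
  hence q: "q \<in> P M1 \<times> P M2" "g1 (fst q)" "g2 (snd q)" by auto
  then obtain x where "x \<in> P (M1 * M2)" "q = f x" using im by blast
  thus "q \<in> f ` {x \<in> P (M1 * M2). g1 x & g2 x}" using q g1f g2f by auto
 next
  fix q assume "q \<in> f ` {x \<in> P (M1 * M2). g1 x & g2 x}"
  then obtain x where x: "x \<in> P (M1 * M2)" "g1 x" "g2 x" "q = f x" by blast
  hence "f x \<in> P M1 \<times> P M2" using im by blast
  thus "q \<in> {x \<in> P M1. g1 x} \<times> {x \<in> P M2. g2 x}" using x g1f g2f by (auto simp: mem_Times_iff)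
 qed
 thus ?thesis using card_image[OF inj_on_subset[OF inj], of "{x \<in> P (M1 * M2). g1 x & g2 x}"] by (simp add: card_cartesian_product P_def)
qed

lemma kervec_dvd_cong:
 fixes x x' :: "'m::linorder \<times> 'm => int"
 assumes "!!e. e \<in> pairs S ==> [x e = x' e] (mod M)" "p dvd M"
 shows "p dvd kervec x S y \<longleftrightarrow> p dvd kervec x' S y"
proof -
 have "[kervec x S y = kervec x' S y] (mod p)" using kervec_cong_mod[OF assms(1)] assms(2) by (rule cong_dvd_modulus)
 thus ?thesis by (rule cong_dvd_iff)
qed

lemma card_residues_sieved:
 fixes S :: "'m::linorder set"
 assumes S: "finite S" and A: "finite A" "\<forall>p\<in>A. prime (p::int)"
 shows "real (card {x \<in> residue_boxes (\<Prod>A) S. \<forall>p\<in>A. ~ (\<forall>y\<in>S. p dvd kervec x S y)}) =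
  (\<Prod>p\<in>A. kervec_density p S) * real_of_int (\<Prod>A) ^ card (pairs S)" using A
proof (induction A rule: finite_induct)
 case empty
 thus ?case using card_residue_boxes[OF S, of 1] by simp
next
 case (insert a A)
 have ap: "prime a" "a > 0" using insert by (auto simp: prime_gt_0_int)
 have pos: "\<Prod>A > 0" using insert by (intro prod_pos) (auto simp: prime_gt_0_int)
 have cop: "coprime a (\<Prod>A)" using insert.hyps insert ap by (auto intro!: prod_coprime_right primes_coprime)
 have "card {x \<in> residue_boxes (a * \<Prod>A) S. ~ (\<forall>y\<in>S. a dvd kervec x S y) & (\<forall>p\<in>A. ~ (\<forall>y\<in>S. p dvd kervec x S y))} =
  card {x \<in> residue_boxes a S. ~ (\<forall>y\<in>S. a dvd kervec x S y)} * card {x \<in> residue_boxes (\<Prod>A) S. \<forall>p\<in>A. ~ (\<forall>y\<in>S. p dvd kervec x S y)}"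
  unfolding residue_boxes_def
 proof (rule card_residues_mult[OF finite_pairs[OF S] ap(2) pos cop])
  fix x x' :: "'m \<times> 'm => int"
  assume "!!e. e \<in> pairs S ==> [x e = x' e] (mod a)"
  hence "a dvd kervec x S y \<longleftrightarrow> a dvd kervec x' S y" for y by (rule kervec_dvd_cong) auto
  thus "(~ (\<forall>y\<in>S. a dvd kervec x S y)) = (~ (\<forall>y\<in>S. a dvd kervec x' S y))" by simp
 next
  fix x x' :: "'m \<times> 'm => int"
  assume *: "!!e. e \<in> pairs S ==> [x e = x' e] (mod \<Prod>A)"
  have "p dvd kervec x S y \<longleftrightarrow> p dvd kervec x' S y" if "p \<in> A" for p y
   using * by (rule kervec_dvd_cong) (use insert that in "auto intro: dvd_prodI")
  thus "(\<forall>p\<in>A. ~ (\<forall>y\<in>S. p dvd kervec x S y)) = (\<forall>p\<in>A. ~ (\<forall>y\<in>S. p dvd kervec x' S y))" by simp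
 qed
 moreover have "real (card {x \<in> residue_boxes a S. ~ (\<forall>y\<in>S. a dvd kervec x S y)}) = kervec_density a S * real_of_int a ^ card (pairs S)"
  using ap by (simp add: kervec_density_def)
 moreover have "\<Prod>(insert a A) = a * \<Prod>A" using insert by simp
 moreover have "{x \<in> residue_boxes (a * \<Prod>A) S. \<forall>p\<in>insert a A. ~ (\<forall>y\<in>S. p dvd kervec x S y)} =
  {x \<in> residue_boxes (a * \<Prod>A) S. ~ (\<forall>y\<in>S. a dvd kervec x S y) & (\<forall>p\<in>A. ~ (\<forall>y\<in>S. p dvd kervec x S y))}" by auto
 moreover have "real (card {x \<in> residue_boxes (\<Prod>A) S. \<forall>p\<in>A. ~ (\<forall>y\<in>S. p dvd kervec x S y)}) =
  (\<Prod>p\<in>A. kervec_density p S) * real_of_int (\<Prod>A) ^ card (pairs S)" using insert by auto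
 moreover have "(\<Prod>p\<in>insert a A. kervec_density p S) = kervec_density a S * (\<Prod>p\<in>A. kervec_density p S)" using insert by simp
 ultimately show ?case by (simp only: of_int_mult power_mult_distrib) simp
qed

text \<open>The side at \<open>e\<close> consists of the integers \<open>t\<close> with
  \<open>T * l e <= t < T * h e\<close>. Half-open sides make the boxes of different grid cells
  disjoint.\<close>

definition int_box :: "real => ('e => real) => ('e => real) => 'e set => ('e => int) set" where
 "int_box T l h E = PiE E (%e. {\<lceil>T * l e\<rceil>..<\<lceil>T * h e\<rceil>})"

lemma finite_int_box: "finite E ==> finite (int_box T l h E)" unfolding int_box_def by (intro finite_PiE) auto

lemma int_box_iff: "x \<in> int_box T l h E \<longleftrightarrow> x \<in> extensional E & (\<forall>e\<in>E. T * l e <= x e & x e < T * h e)"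
 by (auto simp: int_box_def PiE_iff ceiling_le_iff less_ceiling_iff)

lemma tendsto_card_interval_mod:
 fixes r M :: int
 assumes "M > 0" "a <= b"
 shows "((%T. real (card {t \<in> {\<lceil>T * a\<rceil>..<\<lceil>T * b\<rceil>}. [t = r] (mod M)}) / T) \<longlongrightarrow> (b - a) / M) at_top"
proof (rule LIM_zero_cancel, rule Lim_null_comparison)
 show "((%T::real. 1 / T) \<longlongrightarrow> 0) at_top" by real_asymp
 show "\<forall>\<^sub>F T in at_top. norm (real (card {t \<in> {\<lceil>T * a\<rceil>..<\<lceil>T * b\<rceil>}. [t = r] (mod M)}) / T - (b - a) / M) <= 1 / T"
  using eventually_gt_at_top[of 0]
 proof eventually_elim
  case (elim T)
  have "\<bar>real (card {t \<in> {\<lceil>T * a\<rceil>..<\<lceil>T * b\<rceil>}. [t = r] (mod M)}) - (T * b - T * a) / M\<bar> <= 1"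
   using elim assms by (intro card_int_interval_mod_bounds) auto
  hence "\<bar>real (card {t \<in> {\<lceil>T * a\<rceil>..<\<lceil>T * b\<rceil>}. [t = r] (mod M)}) - (T * b - T * a) / M\<bar> / T <= 1 / T"
   using elim by (intro divide_right_mono) auto
  also have "\<bar>real (card {t \<in> {\<lceil>T * a\<rceil>..<\<lceil>T * b\<rceil>}. [t = r] (mod M)}) - (T * b - T * a) / M\<bar> / T =
   \<bar>(real (card {t \<in> {\<lceil>T * a\<rceil>..<\<lceil>T * b\<rceil>}. [t = r] (mod M)}) - (T * b - T * a) / M) / T\<bar>" using elim by simp
  also have "(real (card {t \<in> {\<lceil>T * a\<rceil>..<\<lceil>T * b\<rceil>}. [t = r] (mod M)}) - (T * b - T * a) / M) / T =
   real (card {t \<in> {\<lceil>T * a\<rceil>..<\<lceil>T * b\<rceil>}. [t = r] (mod M)}) / T - (b - a) / M"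
   using elim by (simp add: diff_divide_distrib)
  finally show ?case by simp
 qed
qed

text \<open>The box splits into the residue classes mod \<open>M\<close> on which \<open>g\<close>
  holds, and each class is a product of one-dimensional progressions, of size
  \<open>T * (h e - l e) / M\<close> up to a bounded error.\<close>

lemma tendsto_card_box_periodic:
 fixes M :: int and E :: "'e set"
 assumes E: "finite E" and M: "M > 0" and lh: "!!e. e \<in> E ==> l e <= h e"
  and g: "!!x x'. (!!e. e \<in> E ==> [x e = x' e] (mod M)) ==> g x = g x'"
 shows "((%T. real (card {x \<in> int_box T l h E. g x}) / T ^ card E) \<longlongrightarrow>
  real (card {x \<in> PiE E (%_. {0..<M}). g x}) / real_of_int M ^ card E * (\<Prod>e\<in>E. h e - l e)) at_top"
proof -
 define Rg where "Rg = {x \<in> PiE E (%_. {0..<M}). g x}"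
 have finR: "finite Rg" using E finite_PiE[of E "%_. {0..<M}"] by (simp add: Rg_def)
 define cnt where "cnt T r e = card {t \<in> {\<lceil>T * l e\<rceil>..<\<lceil>T * h e\<rceil>}. [t = r] (mod M)}" for T r e
 have eq: "card {x \<in> int_box T l h E. g x} = (\<Sum>r\<in>Rg. \<Prod>e\<in>E. cnt T (r e) e)" for T
 proof -
  define F where "F r = PiE E (%e. {t \<in> {\<lceil>T * l e\<rceil>..<\<lceil>T * h e\<rceil>}. [t = r e] (mod M)})" for r
  have "{x \<in> int_box T l h E. g x} = (\<Union>r\<in>Rg. F r)"
  proof (intro equalityI subsetI)
   fix x assume x: "x \<in> {x \<in> int_box T l h E. g x}"
   define r where "r = restrict (%e. x e mod M) E"
   have "r \<in> Rg"
   proof -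
    have "g r = g x" by (rule g) (auto simp: r_def)
    thus ?thesis using x M by (auto simp: Rg_def r_def)
   qed
   moreover have "x \<in> F r" using x by (auto simp: F_def int_box_def r_def)
   ultimately show "x \<in> (\<Union>r\<in>Rg. F r)" by blast
  next
   fix x assume "x \<in> (\<Union>r\<in>Rg. F r)"
   then obtain r where r: "r \<in> Rg" "x \<in> F r" by blast
   have "g x = g r" by (rule g) (use r in "auto simp: F_def")
   thus "x \<in> {x \<in> int_box T l h E. g x}" using r by (auto simp: F_def int_box_def Rg_def)
  qed
  moreover have "card (\<Union>r\<in>Rg. F r) = (\<Sum>r\<in>Rg. card (F r))"
  proof (rule card_UN_disjoint[OF finR])
   have "finite {t \<in> {\<lceil>T * l e\<rceil>..<\<lceil>T * h e\<rceil>}. [t = r e] (mod M)}" for r :: "'e => int" and e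
    by (rule finite_subset[of _ "{\<lceil>T * l e\<rceil>..<\<lceil>T * h e\<rceil>}"]) auto
   thus "\<forall>r\<in>Rg. finite (F r)" unfolding F_def by (intro ballI finite_PiE E)
   show "\<forall>r\<in>Rg. \<forall>r'\<in>Rg. r ~= r' --> F r \<inter> F r' = {}"
   proof (intro ballI impI, rule ccontr)
    fix r r' assume r: "r \<in> Rg" "r' \<in> Rg" "r ~= r'" "F r \<inter> F r' ~= {}"
    then obtain x where x: "x \<in> F r" "x \<in> F r'" by blast
    have "r = r'"
    proof (rule PiE_ext)
     show "r \<in> PiE E (%_. {0..<M})" "r' \<in> PiE E (%_. {0..<M})" using r by (auto simp: Rg_def)
     fix e assume e: "e \<in> E"
     have "[r e = r' e] (mod M)" using x e unfolding F_def by (auto simp: PiE_iff cong_def)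
     moreover have "r e \<in> {0..<M}" "r' e \<in> {0..<M}" using r e by (auto simp: Rg_def)
     ultimately show "r e = r' e" by (simp add: cong_def)
    qed
    thus False using r by blast
   qed
  qed
  ultimately show ?thesis using E by (simp add: F_def card_PiE cnt_def)
 qed
 have "((%T. \<Sum>r\<in>Rg. \<Prod>e\<in>E. real (cnt T (r e) e) / T) \<longlongrightarrow> (\<Sum>r\<in>Rg. \<Prod>e\<in>E. (h e - l e) / M)) at_top"
  unfolding cnt_def by (intro tendsto_sum tendsto_prod tendsto_card_interval_mod M lh)
 moreover have "(\<Sum>r\<in>Rg. \<Prod>e\<in>E. (h e - l e) / M) = real (card Rg) / real_of_int M ^ card E * (\<Prod>e\<in>E. h e - l e)"
  by (simp add: prod_dividef)
 moreover have "(\<Sum>r\<in>Rg. \<Prod>e\<in>E. real (cnt T (r e) e) / T) = real (card {x \<in> int_box T l h E. g x}) / T ^ card E" for T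
  unfolding eq by (simp add: prod_dividef sum_divide_distrib)
 ultimately show ?thesis unfolding Rg_def by simp
qed

definition kervec_series :: "'m::linorder set => nat => real" where
 "kervec_series S p = (if prime p then kervec_density (int p) S else 1)"

lemma kervec_series_bounds:
 fixes S :: "'m::linorder set"
 assumes "finite S" "card S = Suc (2 * m)"
 shows "0 < kervec_series S p" "kervec_series S p <= 1" "norm (kervec_series S p - 1) <= real m * (1 / real p ^ 2)" (is ?g1)
proof -
 have le: "kervec_series S p <= 1" using kervec_density_le_1[OF assms(1), of "int p"] by (auto simp: kervec_series_def prime_gt_0_nat)
 show "kervec_series S p <= 1" by fact
 show "0 < kervec_series S p"
 proof (cases "prime p")
  case True
  have "0 < (1 - 1 / real p ^ 2) ^ m" using True prime_gt_1_nat by simp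
  also have "... <= kervec_density (int p) S" using kervec_density_ge[of "int p", OF _ assms] True by simp
  finally show ?thesis by (simp add: kervec_series_def)
 qed (simp add: kervec_series_def)
 show ?g1
 proof (cases "prime p")
  case True
  have "real p > 1" using True prime_gt_1_nat by simp
  hence x: "1 / real p ^ 2 <= 1" by simp
  hence "1 + real m * (- (1 / real p ^ 2)) <= (1 + - (1 / real p ^ 2)) ^ m" by (intro Bernoulli_inequality) simp
  also have "... <= kervec_density (int p) S" using kervec_density_ge[of "int p", OF _ assms] True by simp
  finally show ?thesis using le by (simp add: kervec_series_def)
 qed (simp add: kervec_series_def)
qed

text \<open>Summability of \<open>1 / p ^ 2\<close> gives absolute convergence; all factors are
  positive, so the product is not 0.\<close>

lemma kervec_series_converges:
 fixes S :: "'m::linorder set"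
 assumes "finite S" "card S = Suc (2 * m)"
 shows "(%z. \<Prod>p\<le>z. kervec_series S p) \<longlonglongrightarrow> prodinf (kervec_series S)" "prodinf (kervec_series S) > 0" (is ?g1)
proof -
 have "summable (%p. real m * (1 / real p ^ 2))"
  using inverse_power_summable[of 2, where 'a = real] by (intro summable_mult) (simp add: divide_inverse)
 hence "summable (%p. norm (kervec_series S p - 1))" by (rule summable_comparison_test'[where N = 0]) (use kervec_series_bounds(3)[OF assms] in auto)
 hence conv: "convergent_prod (kervec_series S)" by (intro abs_convergent_prod_imp_convergent_prod summable_imp_abs_convergent_prod)
 thus lim: "(%z. \<Prod>p\<le>z. kervec_series S p) \<longlonglongrightarrow> prodinf (kervec_series S)" by (rule convergent_prod_LIMSEQ)
 have "prodinf (kervec_series S) ~= 0"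
  using conv kervec_series_bounds(1)[OF assms] by (intro prodinf_nonzero) (auto simp: less_imp_neq[THEN not_sym])
 moreover have "prodinf (kervec_series S) >= 0" by (rule tendsto_lowerbound[OF lim])
   (auto intro!: always_eventually less_imp_le[OF prod_pos] kervec_series_bounds(1)[OF assms])
 ultimately show ?g1 by simp
qed

lemma prod_kervec_series:
 "(\<Prod>p\<le>z. kervec_series S p) = (\<Prod>p\<in>int ` {p. p <= z & prime p}. kervec_density p S)"
proof -
 have "(\<Prod>p\<in>int ` {p. p <= z & prime p}. kervec_density p S) = (\<Prod>p\<in>{p. p <= z & prime p}. kervec_density (int p) S)"
  by (subst prod.reindex) auto
 also have "... = (\<Prod>p\<le>z. kervec_series S p)" unfolding kervec_series_def by (intro prod.mono_neutral_cong_left) auto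
 finally show ?thesis by simp
qed

text \<open>Exchange of the limits in the sieve level \<open>z\<close> and in \<open>T\<close>: the
  error is a part that is small in \<open>z\<close> independently of \<open>T\<close> plus a part
  that is small in \<open>T\<close>.\<close>

lemma tendsto_approximation:
 fixes f :: "'a => real"
 assumes u: "!!z::nat. z >= 1 ==> (u z \<longlongrightarrow> a z) F" and a: "a \<longlonglongrightarrow> L" and b: "b \<longlonglongrightarrow> 0" and g: "(g \<longlongrightarrow> 0) F"
  and le: "!!z. z >= 1 ==> eventually (%T. \<bar>f T - u z T\<bar> <= b z + g T) F"
 shows "(f \<longlongrightarrow> L) F"
proof (rule tendstoI)
 fix e :: real assume e: "e > 0"
 have "\<forall>\<^sub>F z in sequentially. dist (a z) L < e / 4" using a e by (intro tendstoD) auto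
 moreover have "\<forall>\<^sub>F z in sequentially. dist (b z) 0 < e / 4" using b e by (intro tendstoD) auto
 ultimately have "\<forall>\<^sub>F z in sequentially. z >= 1 & dist (a z) L < e / 4 & dist (b z) 0 < e / 4"
  using eventually_ge_at_top[of 1] by eventually_elim auto
 then obtain z where z: "z >= 1" "dist (a z) L < e / 4" "dist (b z) 0 < e / 4" using eventually_happens'[OF sequentially_bot] by blast
 have "\<forall>\<^sub>F T in F. dist (u z T) (a z) < e / 4" using u[OF z(1)] e by (intro tendstoD) auto
 moreover have "\<forall>\<^sub>F T in F. dist (g T) 0 < e / 4" using g e by (intro tendstoD) auto
 ultimately show "\<forall>\<^sub>F T in F. dist (f T) L < e" using le[OF z(1)]
 proof eventually_elim
  case (elim T)
  thus ?case using z unfolding dist_real_def by linarith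
 qed
qed

text \<open>Sieving by the primes up to \<open>z\<close> is a periodic condition of known density.
  What it admits beyond the primitive vectors has kernel vector zero or lies in
  \<open>sieve_tail\<close>, a proportion of order \<open>1 / z + 1 / T\<close>.\<close>

lemma tendsto_card_kervec_primitive:
 fixes S :: "'m::linorder set" and l h :: "'m \<times> 'm => real"
 assumes S: "finite S" "card S = Suc (2 * m)" and lh: "!!e. e \<in> pairs S ==> l e <= h e"
 shows "((%T. real (card {x \<in> int_box T l h (pairs S). kervec_primitive x S}) / T ^ card (pairs S)) \<longlongrightarrow>
  prodinf (kervec_series S) * (\<Prod>e\<in>pairs S. h e - l e)) at_top"
proof -
 define E where "E = pairs S"
 define d where "d = card E"
 have fE: "finite E" using finite_pairs[OF S(1)] by (simp add: E_def)
 define R where "R = 1 + (\<Sum>e\<in>E. \<bar>l e\<bar> + \<bar>h e\<bar>)"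
 have R1: "R >= 1" unfolding R_def by (simp add: sum_nonneg)
 have Rb: "\<bar>l e\<bar> <= R" "\<bar>h e\<bar> <= R" if "e \<in> E" for e
 proof -
  have "\<bar>l e\<bar> + \<bar>h e\<bar> <= (\<Sum>e\<in>E. \<bar>l e\<bar> + \<bar>h e\<bar>)" by (rule member_le_sum) (use that fE in auto)
  thus "\<bar>l e\<bar> <= R" "\<bar>h e\<bar> <= R" unfolding R_def by auto
 qed
 obtain C where C: "C > 0" "!!N z. N >= 1 ==> z >= 1 ==> real (card (sieve_tail N z S)) <= C * (1 / z + 1 / N) * real_of_int N ^ d"
  using card_sieve_tail_le[OF S] unfolding d_def E_def by blast
 define U where "U z T = {x \<in> int_box T l h E. \<forall>p\<in>int ` {p. p <= z & prime p}. ~ (\<forall>y\<in>S. p dvd kervec x S y)}" for z T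
 \<comment> \<open>For \<open>N = \<lceil>R * T\<rceil>\<close> one has
   \<open>N <= 2 * R * T\<close> and \<open>2 * N + 1 <= 5 * R * T\<close>. \<open>K1\<close>
   belongs to the vanishing kernel vectors, \<open>K2\<close> to \<open>sieve_tail\<close>.\<close>
 define K1 where "K1 = real d * (5 * R) ^ (d - 1)"
 define K2 where "K2 = C * (2 * R) ^ d"
 have lim: "((%T. real (card (U z T)) / T ^ d) \<longlongrightarrow> (\<Prod>p\<le>z. kervec_series S p) * (\<Prod>e\<in>E. h e - l e)) at_top" for z
 proof -
  define A where "A = int ` {p. p <= z & prime p}"
  have A: "finite A" "\<forall>p\<in>A. prime p" by (auto simp: A_def)
  have M: "\<Prod>A > 0" using A by (intro prod_pos) (auto simp: prime_gt_0_int)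
  have "((%T. real (card {x \<in> int_box T l h E. \<forall>p\<in>A. ~ (\<forall>y\<in>S. p dvd kervec x S y)}) / T ^ card E) \<longlongrightarrow>
   real (card {x \<in> PiE E (%_. {0..<\<Prod>A}). \<forall>p\<in>A. ~ (\<forall>y\<in>S. p dvd kervec x S y)}) / real_of_int (\<Prod>A) ^ card E * (\<Prod>e\<in>E. h e - l e)) at_top"
  proof (rule tendsto_card_box_periodic[OF fE M])
   show "l e <= h e" if "e \<in> E" for e using that lh by (simp add: E_def)
   fix x x' :: "'m \<times> 'm => int"
   assume *: "!!e. e \<in> E ==> [x e = x' e] (mod \<Prod>A)"
   have "p dvd kervec x S y \<longleftrightarrow> p dvd kervec x' S y" if "p \<in> A" for p y
    using *[unfolded E_def] by (rule kervec_dvd_cong) (use A that in "auto intro: dvd_prodI")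
   thus "(\<forall>p\<in>A. ~ (\<forall>y\<in>S. p dvd kervec x S y)) = (\<forall>p\<in>A. ~ (\<forall>y\<in>S. p dvd kervec x' S y))" by simp
  qed
  moreover have "real (card {x \<in> PiE E (%_. {0..<\<Prod>A}). \<forall>p\<in>A. ~ (\<forall>y\<in>S. p dvd kervec x S y)}) =
   (\<Prod>p\<in>A. kervec_density p S) * real_of_int (\<Prod>A) ^ card E"
   using card_residues_sieved[OF S(1) A] unfolding residue_boxes_def E_def .
  moreover have "real_of_int (\<Prod>A) ^ card E ~= 0" using M by (metis of_int_eq_0_iff power_not_zero less_irrefl)
  hence "(\<Prod>p\<in>A. kervec_density p S) * real_of_int (\<Prod>A) ^ card E / real_of_int (\<Prod>A) ^ card E = (\<Prod>p\<in>A. kervec_density p S)"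
   by simp
  ultimately show ?thesis unfolding U_def prod_kervec_series d_def A_def[symmetric] by (simp only:)
 qed
 show ?thesis unfolding E_def[symmetric] d_def[symmetric]
 proof (rule tendsto_approximation[where u = "%z T. real (card (U z T)) / T ^ d"
    and a = "%z. (\<Prod>p\<le>z. kervec_series S p) * (\<Prod>e\<in>E. h e - l e)" and b = "%z. K2 / real z" and g = "%T. (K1 + K2) / T"])
  show "(%z. (\<Prod>p\<le>z. kervec_series S p) * (\<Prod>e\<in>E. h e - l e)) \<longlonglongrightarrow> prodinf (kervec_series S) * (\<Prod>e\<in>E. h e - l e)"
   by (intro tendsto_mult_right kervec_series_converges[OF S])
  show "(%z. K2 / real z) \<longlonglongrightarrow> 0" by real_asymp
  show "((%T. (K1 + K2) / T) \<longlongrightarrow> 0) at_top" by real_asymp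
 next
  fix z :: nat assume z: "z >= 1"
  show "\<forall>\<^sub>F T in at_top. \<bar>real (card {x \<in> int_box T l h E. kervec_primitive x S}) / T ^ d - real (card (U z T)) / T ^ d\<bar>
    <= K2 / real z + (K1 + K2) / T" using eventually_ge_at_top[of 1]
  proof eventually_elim
   case (elim T)
   define Q where "Q = {x \<in> int_box T l h E. kervec_primitive x S}"
   define N where "N = \<lceil>R * T\<rceil>"
   have RT: "R * T >= T" "T >= 1" "R * T >= 1" using R1 elim mult_right_mono[of 1 R T] by linarith+
   have N: "real_of_int N >= R * T" "real_of_int N <= 2 * R * T" "N >= 1" unfolding N_def using RT by linarith+
   have finU: "finite (U z T)" using finite_int_box[OF fE] by (simp add: U_def)
   have QU: "Q <= U z T" unfolding Q_def U_def kervec_primitive_def by auto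
   have box: "x \<in> PiE E (%_. {- N..N})" if "x \<in> int_box T l h E" for x
   proof -
    have "\<bar>x e\<bar> <= N" if "e \<in> E" for e
    proof -
     have "T * l e <= x e" "x e < T * h e" using \<open>x \<in> int_box T l h E\<close> that by (auto simp: int_box_iff)
     moreover have "\<bar>T * l e\<bar> <= R * T" "\<bar>T * h e\<bar> <= R * T" using Rb[OF that] elim by (auto simp: abs_mult)
     ultimately show ?thesis using N(1) by linarith
    qed
    hence "x e \<in> {- N..N}" if "e \<in> E" for e using that[THEN \<open>!!e. e \<in> E ==> \<bar>x e\<bar> <= N\<close>] unfolding atLeastAtMost_iff by linarith
    thus ?thesis using that by (auto simp: int_box_def)
   qed
   have sub: "U z T - Q <= {x \<in> PiE E (%_. {- N..N}). \<forall>y\<in>S. kervec x S y = 0} \<union> sieve_tail N (int z) S" (is "_ <= ?Z \<union> _")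
   proof
    fix x assume x: "x \<in> U z T - Q"
    hence xb: "x \<in> int_box T l h E" by (simp add: U_def)
    then obtain p where p: "prime p" "\<forall>y\<in>S. p dvd kervec x S y" using x by (auto simp: Q_def kervec_primitive_def)
    have "p > int z"
    proof (rule ccontr)
     assume "~ p > int z"
     moreover have pn: "prime (nat p)" "p = int (nat p)" using iffD1[OF prime_int_nat_transfer p(1)] by simp_all
     ultimately have "nat p \<in> {p. p <= z & prime p}" by simp
     hence "p \<in> int ` {p. p <= z & prime p}" using pn(2) by blast
     thus False using x p(2) by (auto simp: U_def)
    qed
    hence *: "\<exists>p. prime p & p > int z & (\<forall>y\<in>S. p dvd kervec x S y)" using p by auto
    show "x \<in> ?Z \<union> sieve_tail N (int z) S"
    proof (cases "\<forall>y\<in>S. kervec x S y = 0")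
     case True
     thus ?thesis using box[OF xb] by simp
    next
     case False
     thus ?thesis using box[OF xb] * unfolding sieve_tail_def E_def by simp
    qed
   qed
   have finZ: "finite (PiE E (%_. {- N..N}))" by (intro finite_PiE fE) auto
   have "card (U z T - Q) <= card ?Z + card (sieve_tail N (int z) S)"
   proof (rule order_trans[OF card_mono[OF _ sub] card_Un_le])
    show "finite (?Z \<union> sieve_tail N (int z) S)" using finZ by (auto simp: sieve_tail_def E_def)
   qed
   also have "card ?Z <= d * card {- N..N} ^ (d - 1)" using card_kervec_zero_le[OF S(1), of "{- N..N}"] S(2) unfolding d_def E_def by simp
   finally have "real (card (U z T - Q)) <= real (d * card {- N..N} ^ (d - 1) + card (sieve_tail N (int z) S))" by (simp only: of_nat_le_iff)
   also have "... = real d * (2 * real_of_int N + 1) ^ (d - 1) + real (card (sieve_tail N (int z) S))" using N(3) by simp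
   also have "... <= real d * (5 * R * T) ^ (d - 1) + C * (1 / z + 1 / T) * (2 * R * T) ^ d"
   proof (intro add_mono mult_left_mono power_mono)
    have "real (card (sieve_tail N (int z) S)) <= C * (1 / z + 1 / N) * real_of_int N ^ d" using C(2)[of N "int z"] N z by simp
    also have "... <= C * (1 / z + 1 / T) * (2 * R * T) ^ d"
    proof (intro mult_mono power_mono mult_left_mono add_mono)
     show "1 / real_of_int N <= 1 / T" using N(1) RT by (intro divide_left_mono) (linarith | simp)+
    qed (use N C RT in auto)
    finally show "real (card (sieve_tail N (int z) S)) <= C * (1 / z + 1 / T) * (2 * R * T) ^ d" .
    show "2 * real_of_int N + 1 <= 5 * R * T" using N RT by linarith
   qed (use N in auto)
   also have "real d * (5 * R * T) ^ (d - 1) = K1 / T * T ^ d"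
   proof (cases "d = 0")
    case False
    hence "T ^ d = T * T ^ (d - 1)" by (metis power_minus_mult mult.commute neq0_conv)
    thus ?thesis using RT by (simp add: K1_def power_mult_distrib)
   qed (simp add: K1_def)
   also have "K1 / T * T ^ d + C * (1 / z + 1 / T) * (2 * R * T) ^ d = (K2 / z + (K1 + K2) / T) * T ^ d"
    by (simp add: K2_def algebra_simps add_divide_distrib)
   finally have "real (card (U z T - Q)) / T ^ d <= K2 / z + (K1 + K2) / T" using RT by (simp add: divide_le_eq)
   moreover have "real (card (U z T - Q)) = real (card (U z T)) - real (card Q)"
    using finU QU by (simp add: card_Diff_subset finite_subset card_mono)
   moreover have "real (card Q) <= real (card (U z T))" using finU QU by (simp add: card_mono)
   hence "real (card Q) / T ^ d <= real (card (U z T)) / T ^ d" using RT by (intro divide_right_mono) auto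
   ultimately show ?case unfolding Q_def[symmetric] by (simp add: diff_divide_distrib)
  qed
 qed (use lim in blast)
qed

section \<open>Coordinates of skew matrices and the local factors\<close>

lemma card_pairs_UNIV:
 assumes "CARD('m::{finite,linorder}) = 2 * n"
 shows "card (pairs (UNIV :: 'm set)) = 2 * n\<^sup>2 - n"
proof -
 let ?P = "pairs (UNIV :: 'm set)" and ?D = "range (%x::'m. (x, x))"
 have U: "(UNIV :: ('m \<times> 'm) set) = ?P \<union> (prod.swap ` ?P \<union> ?D)" by (auto simp: pairs_def intro!: equalityI subsetI)
 have "card (UNIV :: ('m \<times> 'm) set) = card ?P + (card (prod.swap ` ?P) + card ?D)"
  unfolding U by (subst card_Un_disjoint | (force simp: pairs_def)[1])+
 moreover have "card (prod.swap ` ?P) = card ?P" by (intro card_image) auto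
 moreover have "card ?D = CARD('m)" by (intro card_image) (auto simp: inj_on_def)
 ultimately show ?thesis using assms by (simp add: power2_eq_square)
qed

definition skew_mat :: "('m::{finite,linorder} \<times> 'm => 'a::ring_1) => ('a, 'm) sq_matrix" where
 "skew_mat x = (\<chi> i j. skew_fun x i j)"

definition upper_coords :: "('a, 'm::{finite,linorder}) sq_matrix => 'm \<times> 'm => 'a" where
 "upper_coords A = restrict (%(i, j). A $ i $ j) (pairs UNIV)"

lemma is_skew_iff: "is_skew A \<longleftrightarrow> (\<forall>i j. A $ i $ j = - A $ j $ i)"
 by (auto simp: is_skew_def Finite_Cartesian_Product.transpose_def vec_eq_iff)

lemma is_skew_skew_mat: "is_skew (skew_mat x)" by (auto simp: is_skew_iff skew_mat_def skew_fun_def)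

lemma upper_coords_skew_mat: "x \<in> extensional (pairs UNIV) ==> upper_coords (skew_mat x) = x"
 by (auto simp: upper_coords_def skew_mat_def skew_fun_def pairs_def extensional_def)

lemma skew_mat_upper_coords:
 fixes A :: "('a::linordered_idom, 'm::{finite,linorder}) sq_matrix"
 assumes "is_skew A"
 shows "skew_mat (upper_coords A) = A"
proof -
 have "skew_fun (upper_coords A) i j = A $ i $ j" for i j
 proof -
  have sk: "A $ i $ j = - A $ j $ i" "A $ i $ i = - A $ i $ i" using assms unfolding is_skew_iff by blast+
  consider "i < j" | "j < i" | "i = j" by force
  thus ?thesis
  proof cases
   case 3
   thus ?thesis using sk(2) by (simp add: skew_fun_def)
  qed (use sk(1) in "simp_all add: skew_fun_def upper_coords_def pairs_def")
 qed
 thus ?thesis by (simp add: skew_mat_def)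
qed

lemma pfaffian_skew_mat:
 assumes "CARD('m::{finite,linorder}) = 2 * n"
 shows "pfaffian (skew_mat (x :: 'm \<times> 'm => 'a::comm_ring_1)) = subpf x UNIV"
 unfolding pfaffian_eq_pf[OF assms] skew_mat_def by (intro pf_cong) simp

lemma pairs_UNIV_first:
 fixes f0 :: "'m::{finite,linorder}"
 assumes "\<forall>y. f0 <= y"
 shows "pairs UNIV = Pair f0 ` (UNIV - {f0}) \<union> pairs (UNIV - {f0})" "Pair f0 ` (UNIV - {f0}) \<inter> pairs (UNIV - {f0}) = {}"
 using assms by (auto simp: pairs_def less_le intro: order.antisym)

lemma subpf_UNIV_first_row:
 fixes f0 :: "'m::{finite,linorder}" and x :: "'m \<times> 'm => 'a::comm_ring_1"
 assumes "\<forall>y. f0 <= y"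
 shows "subpf x UNIV = (\<Sum>y\<in>UNIV - {f0}. x (f0, y) * kervec x (UNIV - {f0}) y)"
proof -
 have ins: "insert f0 (UNIV - {f0}) = UNIV" by auto
 have "subpf x (insert f0 (UNIV - {f0})) =
  pos_sign (insert f0 (UNIV - {f0})) f0 * (\<Sum>y\<in>UNIV - {f0}. skew_fun x f0 y * kervec x (UNIV - {f0}) y)"
  by (rule pf_insert_eq_dot) (auto intro: skew_fun_skew)
 moreover have "pos_sign UNIV f0 = (1 :: 'a)"
 proof -
  have "{z \<in> UNIV. z < f0} = {}" using assms by (auto simp: not_less)
  thus ?thesis unfolding pos_sign_def by simp
 qed
 moreover have "(\<Sum>y\<in>UNIV - {f0}. skew_fun x f0 y * kervec x (UNIV - {f0}) y) = (\<Sum>y\<in>UNIV - {f0}. x (f0, y) * kervec x (UNIV - {f0}) y)"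
  by (intro sum.cong) (use assms in "auto simp: skew_fun_def less_le")
 ultimately show ?thesis by simp
qed

text \<open>Given the matrix without its first row, the Pfaffian is a linear form in that row:
  \<open>p\<close> divides it with probability \<open>1 / p\<close> if the kernel vector is non-zero
  mod \<open>p\<close>, and always otherwise. So the numerator of the local factor is the density
  times \<open>1 - 1 / p\<close>, and the denominator cancels.\<close>

lemma local_factor_eq_kervec_density:
 fixes f0 :: "'m::{finite,linorder}"
 assumes n: "CARD('m) = 2 * n" and f0: "\<forall>y. f0 <= y" and p: "prime p"
 shows "local_factor TYPE('m) p = kervec_density (int p) (UNIV - {f0})"
proof -
 define I where "I = UNIV - {f0}"
 define A where "A = Pair f0 ` I"
 define q where "q = int p"
 define r where "r = real p"
 have q: "prime q" "q > 0" using p by (auto simp: q_def prime_gt_0_nat)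
 have r1: "r > 1" using p prime_gt_1_nat by (auto simp: r_def)
 have AB: "pairs UNIV = A \<union> pairs I" "A \<inter> pairs I = {}" using pairs_UNIV_first[OF f0] by (auto simp: A_def I_def)
 have Dn: "card (pairs (UNIV :: 'm set)) = 2 * n\<^sup>2 - n" by (rule card_pairs_UNIV[OF n])
 have cI: "card I = 2 * n - 1" using n by (simp add: I_def)
 have n0: "n > 0" using n by (cases n) auto
 have cA: "card A = card I" unfolding A_def by (intro card_image) (auto simp: inj_on_def)
 have cD: "2 * n\<^sup>2 - n = card I + card (pairs I)" using Dn AB card_Un_disjoint[of A "pairs I"] cA by simp
 define X where "X = PiE (pairs (UNIV :: 'm set)) (%_. {0..<q})"
 have bij: "bij_betw upper_coords {M \<in> skew_residues p :: (int, 'm) sq_matrix set. int p dvd pfaffian M} {x \<in> X. q dvd subpf x UNIV}"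
 proof (rule bij_betwI[where g = skew_mat])
  show "upper_coords \<in> {M \<in> skew_residues p :: (int, 'm) sq_matrix set. int p dvd pfaffian M} \<rightarrow> {x \<in> X. q dvd subpf x UNIV}"
  proof
   fix M :: "(int, 'm) sq_matrix" assume M: "M \<in> {M \<in> skew_residues p. int p dvd pfaffian M}"
   hence sk: "is_skew M" by (simp add: skew_residues_def)
   have "upper_coords M \<in> X" using M unfolding X_def q_def by (auto simp: upper_coords_def skew_residues_def pairs_def)
   moreover have "q dvd subpf (upper_coords M) UNIV"
    using M pfaffian_skew_mat[OF n, of "upper_coords M"] skew_mat_upper_coords[OF sk] by (simp add: q_def)
   ultimately show "upper_coords M \<in> {x \<in> X. q dvd subpf x UNIV}" by simp
  qed
  show "skew_mat \<in> {x \<in> X. q dvd subpf x UNIV} \<rightarrow> {M \<in> skew_residues p :: (int, 'm) sq_matrix set. int p dvd pfaffian M}"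
  proof
   fix x :: "'m \<times> 'm => int" assume x: "x \<in> {x \<in> X. q dvd subpf x UNIV}"
   have "skew_mat x $ i $ j \<in> {0..<q}" if "i < j" for i j using x that by (auto simp: X_def pairs_def skew_mat_def skew_fun_def)
   thus "skew_mat x \<in> {M \<in> skew_residues p. int p dvd pfaffian M}"
    using x pfaffian_skew_mat[OF n, of x] is_skew_skew_mat[of x] by (simp add: skew_residues_def q_def)
  qed
 qed (auto simp: skew_mat_upper_coords upper_coords_skew_mat skew_residues_def X_def PiE_def)
 have row: "subpf (glue A (pairs I) a c) UNIV = (\<Sum>e\<in>A. a e * kervec c I (snd e))" for a c :: "'m \<times> 'm => int"
 proof -
  have "kervec (glue A (pairs I) a c) I y = kervec c I y" for y by (rule kervec_cong) (use AB in "auto simp: glue_def")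
  hence "subpf (glue A (pairs I) a c) UNIV = (\<Sum>y\<in>I. a (f0, y) * kervec c I y)"
   unfolding subpf_UNIV_first_row[OF f0] I_def[symmetric] by (intro sum.cong) (auto simp: glue_def A_def)
  also have "... = (\<Sum>e\<in>A. a e * kervec c I (snd e))" unfolding A_def by (subst sum.reindex) (auto simp: inj_on_def)
  finally show ?thesis .
 qed
 define Y where "Y = residue_boxes q I"
 define good where "good c \<longleftrightarrow> ~ (\<forall>y\<in>I. q dvd kervec c I y)" for c
 have cnt: "card {a \<in> PiE A (%_. {0..<q}). q dvd subpf (glue A (pairs I) a c) UNIV} =
  (if good c then p ^ (card I - 1) else p ^ card I)" for c
 proof (cases "good c")
  case True
  then obtain y where y: "y \<in> I" "~ q dvd kervec c I y" by (auto simp: good_def)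
  have "card {a \<in> PiE A (%_. {0..<q}). q dvd (\<Sum>e\<in>A. a e * kervec c I (snd e))} = nat q ^ (card A - 1)"
   using y by (intro card_lin_dvd_residues[OF q(1), where e = "(f0, y)"]) (auto simp: A_def)
  thus ?thesis using True unfolding row cA by (simp add: q_def)
 next
  case False
  have "q dvd (\<Sum>e\<in>A. a e * kervec c I (snd e))" for a by (intro dvd_sum) (use False in "auto simp: good_def A_def")
  thus ?thesis using False unfolding row by (simp add: card_PiE cA q_def)
 qed
 have "card {x \<in> X. q dvd subpf x UNIV} = (\<Sum>c\<in>Y. card {a \<in> PiE A (%_. {0..<q}). q dvd subpf (glue A (pairs I) a c) UNIV})"
  unfolding X_def Y_def residue_boxes_def AB(1) using AB(2) by (intro card_PiE_Un) auto
 also have "real ... = (\<Sum>c\<in>Y. (if good c then r ^ (card I - 1) else r ^ card I))" unfolding cnt r_def by (auto intro!: sum.cong)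
 also have "... = (\<Sum>c\<in>Y. r ^ card I - (if good c then r ^ card I - r ^ (card I - 1) else 0))" by (intro sum.cong) auto
 also have "... = real (card Y) * r ^ card I - real (card {c \<in> Y. good c}) * (r ^ card I - r ^ (card I - 1))"
  using finite_residue_boxes[of I q] by (simp add: sum_subtractf sum.If_cases Y_def Int_def)
 also have "real (card Y) = r ^ card (pairs I)" using card_residue_boxes[of I q] q unfolding Y_def r_def by (simp add: q_def)
 also have "real (card {c \<in> Y. good c}) = kervec_density q I * r ^ card (pairs I)"
  unfolding kervec_density_def Y_def good_def r_def using r1 by (simp add: q_def r_def)
 also have "r ^ card I - r ^ (card I - 1) = r ^ card I * (1 - 1 / r)"
 proof -
  have "card I > 0" using cI n0 by simp
  hence "r ^ card I = r * r ^ (card I - 1)" by (metis power_minus_mult mult.commute)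
  thus ?thesis using r1 by (simp add: field_simps)
 qed
 finally have "real (card {x \<in> X. q dvd subpf x UNIV}) = r ^ (2 * n\<^sup>2 - n) * (1 - kervec_density q I * (1 - 1 / r))"
  unfolding cD by (simp add: power_add algebra_simps)
 hence "real (card {x \<in> X. q dvd subpf x UNIV}) / r ^ (2 * n\<^sup>2 - n) = 1 - kervec_density q I * (1 - 1 / r)" using r1 by simp
 moreover have "1 - 1 / r ~= 0" using r1 by simp
 moreover have "CARD('m) div 2 = n" using n by simp
 ultimately show ?thesis
  unfolding local_factor_def I_def[symmetric] r_def[symmetric] by (simp add: q_def[symmetric] bij_betw_same_card[OF bij[folded q_def]])
qed

lemma singular_series_eq_prodinf:
 fixes f0 :: "'m::{finite,linorder}"
 assumes "CARD('m) = 2 * n" and "\<forall>y. f0 <= y"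
 shows "singular_series TYPE('m) = prodinf (kervec_series (UNIV - {f0}))"
proof -
 have "kervec_series (UNIV - {f0}) = (%p. if prime p then local_factor TYPE('m) p else 1)"
  using local_factor_eq_kervec_density[OF assms] by (auto simp: kervec_series_def)
 thus ?thesis unfolding singular_series_def by simp
qed

section \<open>Primes represented by the Pfaffian in a box\<close>

text \<open>Logarithmic weights give the primes mean density 1, so that sums for different kernel
  vectors can be compared without logarithms; \<open>log_sandwich\<close> removes the weight at the
  end.\<close>

definition prime_weight :: "int => real" where
 "prime_weight m = (if prime m then ln (real_of_int m) else 0)"

lemma prime_weight_nonneg: "prime_weight m >= 0" unfolding prime_weight_def using prime_ge_1_int[of m] by auto

lemma prime_weight_nonpos_arg: "m <= 0 ==> prime_weight m = 0" unfolding prime_weight_def using prime_gt_0_int[of m] by auto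

lemma prime_weight_int: "prime_weight (int k) = (if prime k then ln (real k) else 0)" unfolding prime_weight_def by simp

lemma chebyshev_theta_near:
 assumes "eta > 0"
 shows "\<exists>C\<ge>0. \<forall>n. \<bar>chebyshev_theta n - real n\<bar> <= eta * real n + C"
proof -
 have "\<forall>\<^sub>F n in sequentially. dist (chebyshev_theta n / real n) 1 < eta" using prime_number_theorem assms by (rule tendstoD)
 then obtain N0 where N0: "!!n. n >= N0 ==> dist (chebyshev_theta n / real n) 1 < eta" unfolding eventually_sequentially by blast
 define C where "C = (\<Sum>n<Suc N0. \<bar>chebyshev_theta n - real n\<bar>)"
 have C0: "C >= 0" unfolding C_def by simp
 have "\<bar>chebyshev_theta n - real n\<bar> <= eta * real n + C" for n
 proof (cases "n < Suc N0")
  case True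
  hence "\<bar>chebyshev_theta n - real n\<bar> <= C"
   unfolding C_def by (intro member_le_sum[where f = "%n. \<bar>chebyshev_theta n - real n\<bar>"]) auto
  thus ?thesis using assms by (simp add: add_increasing)
 next
  case False
  hence n: "real n > 0" "n >= N0" by auto
  hence "\<bar>chebyshev_theta n / real n - 1\<bar> * real n <= eta * real n"
   using N0[OF n(2)] by (intro mult_right_mono) (auto simp: dist_real_def)
  moreover have "\<bar>chebyshev_theta n / real n - 1\<bar> * real n = \<bar>(chebyshev_theta n / real n - 1) * real n\<bar>"
   by (simp add: abs_mult)
  moreover have "(chebyshev_theta n / real n - 1) * real n = chebyshev_theta n - real n" using n by (simp add: field_simps)
  ultimately show ?thesis using C0 by simp
 qed
 thus ?thesis using C0 by blast
qed

text \<open>Truncated subtraction is correct here: for \<open>x = 0\<close> the last term is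
  \<open>chebyshev_theta 0\<close>, and 0 carries no weight.\<close>

lemma sum_prime_weight_interval:
 "(\<Sum>j<H. prime_weight (int x + int j)) = chebyshev_theta (x + H - 1) - chebyshev_theta (x - 1)"
proof (induction H)
 case (Suc H)
 have "chebyshev_theta (x + Suc H - 1) = chebyshev_theta (x + H - 1) + prime_weight (int x + int H)"
 proof (cases "x + H")
  case (Suc k)
  have "chebyshev_theta (Suc k) = chebyshev_theta k + prime_weight (int (Suc k))" unfolding prime_weight_int chebyshev_theta_def by simp
  thus ?thesis using Suc by (simp flip: of_nat_add)
 qed (simp add: chebyshev_theta_def prime_weight_def)
 thus ?case using Suc by simp
qed simp

text \<open>The distance from 0 is at most a fixed multiple of the length \<open>H\<close>, so the
  difference of two values of \<open>chebyshev_theta\<close> has an error of a small multiple of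
  \<open>H\<close>. For \<open>x < 0\<close> only the upper bound survives, since the numbers up to
  0 carry no weight.\<close>

lemma sum_prime_weight_short_interval:
 assumes "eps > 0" "c > 0"
 shows "\<exists>H0. \<forall>H\<ge>H0. \<forall>x. \<bar>real_of_int x\<bar> <= c * real H -->
  (\<Sum>j<H. prime_weight (x + int j)) <= (1 + eps) * real H &
  (x >= 0 --> (\<Sum>j<H. prime_weight (x + int j)) >= (1 - eps) * real H)"
proof -
 \<comment> \<open>The two end points add up to at most \<open>(2 * c + 1) * H\<close>, so their
   errors use up half of \<open>eps * H\<close>; the other half absorbs the constants through
   \<open>H0\<close>.\<close>
 define eta where "eta = eps / (2 * (2 * c + 1))"
 have eta: "eta > 0" "eta * (2 * c + 1) = eps / 2" using assms by (auto simp: eta_def field_simps)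
 obtain C where C: "C >= 0" "!!n. \<bar>chebyshev_theta n - real n\<bar> <= eta * real n + C" using chebyshev_theta_near[OF eta(1)] by blast
 define H0 where "H0 = nat \<lceil>2 * (2 * C + 1) / eps\<rceil> + 1"
 have key: "\<bar>(\<Sum>j<H. prime_weight (int x + int j)) - real H\<bar> <= eps * real H"
  if H: "H >= H0" and x: "real x <= c * real H" for H x
 proof -
  have "2 * (2 * C + 1) / eps <= real H" using H unfolding H0_def by linarith
  hence HC: "2 * C + 1 <= eps / 2 * real H" using assms by (simp add: field_simps)
  have H1: "H >= 1" using H unfolding H0_def by simp
  define a b where "a = x + H - 1" and "b = x - 1"
  have ab: "real a = real x + real H - 1" "\<bar>real a - real b - real H\<bar> <= 1" "real b <= real x" using H1 unfolding a_def b_def by auto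
  have "\<bar>(chebyshev_theta a - chebyshev_theta b) - real H\<bar> <= eta * real a + eta * real b + 2 * C + 1"
   using C(2)[of a] C(2)[of b] ab(2) by linarith
  also have "eta * real a + eta * real b = eta * (real a + real b)" by (simp add: algebra_simps)
  also have "... <= eta * ((2 * c + 1) * real H)"
  proof (intro mult_left_mono)
   show "real a + real b <= (2 * c + 1) * real H" using ab x by (simp add: algebra_simps)
  qed (use eta in auto)
  also have "eta * ((2 * c + 1) * real H) = eps / 2 * real H" using eta(2) by auto
  finally have "\<bar>(chebyshev_theta a - chebyshev_theta b) - real H\<bar> <= eps * real H" using HC by linarith
  thus ?thesis unfolding sum_prime_weight_interval a_def b_def .
 qed
 show ?thesis
 proof (intro exI[of _ H0] allI impI conjI)
  fix H x assume H: "H >= H0" and x: "\<bar>real_of_int x\<bar> <= c * real H"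
  show "(\<Sum>j<H. prime_weight (x + int j)) >= (1 - eps) * real H" if "x >= 0"
  proof -
   have "\<bar>(\<Sum>j<H. prime_weight (int (nat x) + int j)) - real H\<bar> <= eps * real H" using H x by (intro key) auto
   thus ?thesis using that by (auto simp: left_diff_distrib)
  qed
  have "\<bar>(\<Sum>j<H. prime_weight (int (nat x) + int j)) - real H\<bar> <= eps * real H" using H x by (intro key) auto
  hence *: "(\<Sum>j<H. prime_weight (int (nat x) + int j)) <= (1 + eps) * real H" by (simp only: distrib_right)
  show "(\<Sum>j<H. prime_weight (x + int j)) <= (1 + eps) * real H"
  proof (cases "x >= 0")
   case False
   \<comment> \<open>The part up to 0 has weight 0; what remains is no heavier than the interval of
     length \<open>H\<close> that starts at 0.\<close>
   define t where "t = nat (- x)"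
   have xt: "x = - int t" using False by (simp add: t_def)
   have "(\<Sum>j<H. prime_weight (x + int j)) = (\<Sum>j\<in>{t..<H}. prime_weight (x + int j))"
    by (rule sum.mono_neutral_right) (auto simp: xt intro!: prime_weight_nonpos_arg)
   also have "... = (\<Sum>j\<in>{t..<H}. prime_weight (int (j - t)))" by (intro sum.cong) (auto simp: xt)
   also have "... = (\<Sum>i\<in>(%j. j - t) ` {t..<H}. prime_weight (int i))" by (subst sum.reindex) (auto simp: inj_on_def)
   also have "... <= (\<Sum>i<H. prime_weight (int i))" by (intro sum_mono2) (auto simp: prime_weight_nonneg)
   also have "... <= (1 + eps) * real H" using * False by simp
   finally show ?thesis .
  qed (use * in simp)
 qed
qed

text \<open>\<open>K\<close> will be independent of \<open>T\<close>, so only boundedly many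
  relations \<open>u\<close> on \<open>S\<close> have to be excluded.\<close>

definition kervec_related :: "int => ('m::linorder \<times> 'm => int) => 'm set => bool" where
 "kervec_related K x S \<longleftrightarrow> (\<exists>u. (\<forall>y\<in>S. \<bar>u y\<bar> <= K) & (\<exists>y\<in>S. u y ~= 0) & (\<Sum>y\<in>S. u y * kervec x S y) = 0)"

lemma kervec_nonzero_of_unrelated:
 assumes "~ kervec_related K x S" "K >= 1" "S ~= {}" "finite S"
 shows "\<exists>y\<in>S. kervec x S y ~= 0"
proof (rule ccontr)
 assume "~ (\<exists>y\<in>S. kervec x S y ~= 0)"
 hence "kervec_related K x S" unfolding kervec_related_def using assms by (intro exI[of _ "%_. 1"]) auto
 thus False using assms by blast
qed

text \<open>A denominator of \<open>c\<close> would have to divide every component of a primitive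
  vector. So the integral points on the line of the kernel vector are its integral
  multiples.\<close>

lemma multiplier_integral:
 assumes "kervec_primitive x S" "y0 \<in> S" "kervec x S y0 ~= 0" "!!y. y \<in> S ==> c * real_of_int (kervec x S y) \<in> \<int>"
 shows "c \<in> \<int>"
proof -
 have "c * real_of_int (kervec x S y0) / real_of_int (kervec x S y0) \<in> \<rat>"
  using assms(4)[OF assms(2)] by (intro Rats_divide) (auto simp: Ints_subset_Rats[THEN subsetD])
 hence "c \<in> \<rat>" using assms(3) by simp
 then obtain a b where ab: "b > 0" "coprime a b" "c = of_int a / of_int b" by (rule Rats_cases')
 have dv: "b dvd kervec x S y" if yS: "y \<in> S" for y
 proof -
  obtain z where z: "c * real_of_int (kervec x S y) = of_int z" using assms(4)[OF yS] Ints_cases by blast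
  hence "real_of_int (a * kervec x S y) = real_of_int (z * b)" using ab by (simp add: field_simps)
  hence "a * kervec x S y = z * b" by (simp only: of_int_eq_iff)
  hence "b dvd a * kervec x S y" by simp
  thus ?thesis using ab(2) by (simp add: coprime_commute coprime_dvd_mult_right_iff)
 qed
 have "b = 1"
 proof (rule ccontr)
  assume "b ~= 1"
  then obtain p where "prime p" "p dvd b" using ab(1) prime_divisor_exists[of b] by auto
  thus False using dv assms(1) unfolding kervec_primitive_def by (meson dvd_trans)
 qed
 thus ?thesis using ab by simp
qed

lemma int_vecs_components: "w \<in> int_vecs ==> \<exists>z. \<forall>i. w $ i = real_of_int (z i)"
 unfolding int_vecs_def by (auto simp: Ints_def intro!: choice)

text \<open>An integral vector \<open>w\<close> close to the line spanned by the kernel vector \<open>v\<close> of the skew matrix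
 \<open>x\<close> gives the short integral vector \<open>x w\<close>, which is orthogonal to \<open>v\<close>. So without short
 relations the line is isolated among the integral vectors, and the dual lattice is dense.\<close>

lemma unrelated_imp_line_isolated:
 fixes I :: "'m::{finite,linorder} set" and x :: "'m \<times> 'm => int" and vv w :: "(real, 'm) vec" and N c dl :: real and K :: int
 assumes I: "I ~= {}" and x: "!!e. e \<in> pairs I ==> \<bar>real_of_int (x e)\<bar> <= N" and N: "N > 0"
  and nrel: "~ kervec_related K x I" and K: "K >= 1" and dl: "dl <= 1" "dl * (card I * N) <= K"
  and vv: "vv = (\<chi> i. if i \<in> I then real_of_int (kervec x I i) else 0)"
  and w: "w \<in> int_vecs" "norm (w - c *\<^sub>R vv) < dl"
 shows "\<exists>c'. w = c' *\<^sub>R vv"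
proof -
 let ?v = "kervec x I"
 obtain z where z: "!!i. w $ i = real_of_int (z i)" using int_vecs_components[OF w(1)] by blast
 have comp: "\<bar>w $ i - c * vv $ i\<bar> <= dl" for i using component_le_norm_cart[of "w - c *\<^sub>R vv" i] w(2) by simp
 \<comment> \<open>Outside \<open>I\<close> the entries of \<open>w\<close> are integers of absolute
   value below \<open>dl <= 1\<close>.\<close>
 have out: "w $ i = 0" if "i \<notin> I" for i using component_le_norm_cart[of "w - c *\<^sub>R vv" i] w(2) dl(1) that by (auto simp: vv z)
 define u where "u i = (\<Sum>j\<in>I. skew_fun x i j * z j)" for i
 have Fv: "(\<Sum>j\<in>I. skew_fun x i j * ?v j) = 0" if "i \<in> I" for i using that by (intro row_dot_pf_vec) (auto intro: skew_fun_skew)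
 have ub: "\<bar>u i\<bar> <= K" if i: "i \<in> I" for i
 proof -
  have "real_of_int (u i) = (\<Sum>j\<in>I. real_of_int (skew_fun x i j) * w $ j)" unfolding u_def z by simp
  also have "... = (\<Sum>j\<in>I. real_of_int (skew_fun x i j) * (w $ j - c * vv $ j)) + c * (\<Sum>j\<in>I. real_of_int (skew_fun x i j) * vv $ j)"
   by (simp add: sum_distrib_left sum.distrib[symmetric] algebra_simps)
  also have "(\<Sum>j\<in>I. real_of_int (skew_fun x i j) * vv $ j) = real_of_int (\<Sum>j\<in>I. skew_fun x i j * ?v j)" by (simp add: vv)
  finally have "\<bar>real_of_int (u i)\<bar> <= (\<Sum>j\<in>I. \<bar>real_of_int (skew_fun x i j) * (w $ j - c * vv $ j)\<bar>)" using Fv[OF i] by simp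
  also have "... <= (\<Sum>j\<in>I. N * dl)"
  proof (intro sum_mono)
   fix j assume j: "j \<in> I"
   show "\<bar>real_of_int (skew_fun x i j) * (w $ j - c * vv $ j)\<bar> <= N * dl" using x[of "(i, j)"] x[of "(j, i)"] i j N comp[of j]
    by (auto simp: skew_fun_def pairs_def abs_mult intro!: mult_mono)
  qed
  also have "... = dl * (card I * N)" by simp
  finally show ?thesis using dl(2) by linarith
 qed
 have "(\<Sum>i\<in>I. u i * ?v i) = (\<Sum>i\<in>I. \<Sum>j\<in>I. skew_fun x i j * z j * ?v i)" unfolding u_def by (simp add: sum_distrib_right)
 also have "... = (\<Sum>j\<in>I. \<Sum>i\<in>I. skew_fun x i j * z j * ?v i)" by (rule sum.swap)
 also have "... = (\<Sum>j\<in>I. - z j * (\<Sum>i\<in>I. skew_fun x j i * ?v i))"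
  unfolding sum_distrib_left by (intro sum.cong refl) (subst skew_fun_skew, simp)
 also have "... = 0" by (intro sum.neutral) (use Fv in simp)
 finally have uv: "(\<Sum>i\<in>I. u i * ?v i) = 0" .
 have u0: "u i = 0" if "i \<in> I" for i using nrel ub uv that unfolding kervec_related_def by blast
 obtain y0 where y0: "y0 \<in> I" "?v y0 ~= 0" using kervec_nonzero_of_unrelated[OF nrel K I] by auto
 have "\<exists>c'. \<forall>y\<in>I. w $ y = c' * kervec (%e. real_of_int (x e)) I y"
 proof (rule pf_vec_spans_kernel)
  show "skew_fun (%e. real_of_int (x e)) b a = - skew_fun (%e. real_of_int (x e)) a b" for a b by (rule skew_fun_skew)
  show "kervec (%e. real_of_int (x e)) I y0 ~= 0" using y0 by (simp flip: real_kervec)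
  fix i assume "i \<in> I"
  hence "real_of_int (u i) = 0" using u0 by simp
  moreover have "real_of_int (skew_fun x i j) = skew_fun (%e. real_of_int (x e)) i j" for j by (simp add: skew_fun_def)
  ultimately show "(\<Sum>y\<in>I. skew_fun (%e. real_of_int (x e)) i y * w $ y) = 0" by (simp add: u_def z)
 qed (use y0 in auto)
 then obtain c' where c': "!!y. y \<in> I ==> w $ y = c' * real_of_int (?v y)" by (auto simp: real_kervec)
 show ?thesis using c' out unfolding vec_eq_iff by (auto simp: vv)
qed

text \<open>The real vector \<open>(j / L ^ 2) *\<^sub>R vv\<close> has product \<open>j\<close>
  with the kernel vector, and by primitivity its products with all integral points of the line are
  integers. Density of the dual lattice rounds it to an integral vector with the same product, at a
  cost inverse to the isolation distance \<open>dl\<close>.\<close>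

lemma kervec_shift_exists:
 fixes I :: "'m::{finite,linorder} set" and x :: "'m \<times> 'm => int" and N :: real and K :: int
 assumes I: "I ~= {}" and x: "!!e. e \<in> pairs I ==> \<bar>real_of_int (x e)\<bar> <= N" and N: "N > 0"
  and prim: "kervec_primitive x I" and nrel: "~ kervec_related K x I" and K: "1 <= K" "K <= card I * N"
 shows "\<exists>e. (\<Sum>y\<in>I. e y * kervec x I y) = int j &
   (\<forall>y\<in>I. \<bar>real_of_int (e y)\<bar> <= real j / L2_set (%y. real_of_int (kervec x I y)) I + 2 ^ CARD('m) * (card I * N) / K)"
proof -
 let ?v = "kervec x I"
 define vv :: "(real, 'm) vec" where "vv = (\<chi> i. if i \<in> I then real_of_int (?v i) else 0)"
 obtain y0 where y0: "y0 \<in> I" "?v y0 ~= 0" using kervec_nonzero_of_unrelated[OF nrel K(1) I] by auto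
 have cI: "real (card I) * N > 0" using I N by (simp add: card_gt_0_iff)
 \<comment> \<open>The largest distance that \<open>unrelated_imp_line_isolated\<close> admits for
   relations of height \<open>K\<close>; the hypothesis \<open>K <= card I * N\<close> makes it at
   most 1.\<close>
 define dl where "dl = K / (card I * N)"
 have dl: "dl > 0" "dl <= 1" "dl * (card I * N) <= K" using K cI N I by (auto simp: dl_def)
 define L where "L = L2_set (%y. real_of_int (?v y)) I"
 have L: "norm vv = L" by (auto simp: vv_def L_def norm_vec_def L2_set_def intro!: sum.mono_neutral_cong_right)
 have "vv $ y0 ~= 0" using y0 by (simp add: vv_def)
 hence vv0: "vv ~= 0" by auto
 hence L0: "L > 0" using L by auto
 define y where "y = (real j / L\<^sup>2) *\<^sub>R vv"
 have V: "x \<in> span {vv} \<longleftrightarrow> (\<exists>c. x = c *\<^sub>R vv)" for x by (auto simp: span_singleton)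
 have "\<exists>e\<in>int_vecs. (\<forall>x\<in>span {vv}. (e - y) \<bullet> x = 0) & norm (e - y) <= 2 ^ (CARD('m) - dim (span {vv})) / dl"
 proof (rule int_vec_near_dual_point[OF subspace_span refl dl(1)])
  show "y \<in> span {vv}" unfolding V y_def by blast
  show "norm (w - x') >= dl" if w: "w \<in> int_vecs" "w \<notin> span {vv}" "x' \<in> span {vv}" for w x'
  proof (rule ccontr)
   assume "~ norm (w - x') >= dl"
   moreover obtain c where "x' = c *\<^sub>R vv" using w(3) V by blast
   ultimately have "norm (w - c *\<^sub>R vv) < dl" by simp
   hence "\<exists>c'. w = c' *\<^sub>R vv"
    using I x N nrel K(1) dl(2,3) vv_def w(1) by (intro unrelated_imp_line_isolated[where x = x and N = N and K = K])
   thus False using w(2) V by blast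
  qed
  show "y \<bullet> x' \<in> \<int>" if x': "x' \<in> int_vecs" "x' \<in> span {vv}" for x'
  proof -
   obtain c where c: "x' = c *\<^sub>R vv" using x'(2) V by blast
   have "c \<in> \<int>"
   proof (rule multiplier_integral[OF prim y0])
    fix i assume "i \<in> I"
    thus "c * real_of_int (?v i) \<in> \<int>" using x'(1) unfolding int_vecs_def c by (auto simp: vv_def dest: spec[of _ i])
   qed
   moreover have "y \<bullet> x' = real j * c" using L0 by (simp add: y_def c dot_square_norm L)
   ultimately show ?thesis by simp
  qed
 qed
 then obtain e where e: "e \<in> int_vecs" "!!x. x \<in> span {vv} ==> (e - y) \<bullet> x = 0"
  "norm (e - y) <= 2 ^ (CARD('m) - dim (span {vv})) / dl" by blast
 obtain z where z: "!!i. e $ i = real_of_int (z i)" using int_vecs_components[OF e(1)] by blast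
 have "(e - y) \<bullet> vv = 0" by (intro e(2) span_base) simp
 hence "e \<bullet> vv = y \<bullet> vv" by (simp add: inner_diff_left)
 also have "... = real j" using L0 by (simp add: y_def dot_square_norm L)
 also have "e \<bullet> vv = (\<Sum>i\<in>I. real_of_int (z i * ?v i))"
  unfolding inner_vec_def by (rule sum.mono_neutral_cong_right) (auto simp: vv_def z)
 finally have "real_of_int (\<Sum>i\<in>I. z i * ?v i) = real_of_int (int j)" by simp
 hence "(\<Sum>i\<in>I. z i * ?v i) = int j" by (simp only: of_int_eq_iff)
 moreover have "\<bar>real_of_int (z i)\<bar> <= real j / L + 2 ^ CARD('m) * (card I * N) / K" for i
 proof -
  have "\<bar>real_of_int (z i)\<bar> <= norm e" using component_le_norm_cart[of e i] by (simp add: z)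
  also have "... <= norm y + norm (e - y)" using norm_triangle_sub[of e y] by simp
  also have "norm y = real j / L" by (simp add: y_def L power2_eq_square)
  also have "norm (e - y) <= 2 ^ CARD('m) / dl" by (rule order_trans[OF e(3)], intro divide_right_mono power_increasing) (use dl in auto)
  also have "2 ^ CARD('m) / dl = 2 ^ CARD('m) * (card I * N) / K" by (simp add: dl_def)
  finally show ?thesis by simp
 qed
 ultimately show ?thesis unfolding L_def by blast
qed

lemma sum_box_shift_le:
 fixes f :: "int => real" and v e :: "'m => int"
 assumes I: "finite I" and f: "!!t. f t >= 0" and e: "(\<Sum>y\<in>I. e y * v y) = j" "!!y. y \<in> I ==> \<bar>real_of_int (e y)\<bar> <= T * rho"
 shows "(\<Sum>a\<in>int_box T l h I. f (\<Sum>y\<in>I. a y * v y)) <=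
  (\<Sum>b\<in>int_box T (%y. l y - rho) (%y. h y + rho) I. f ((\<Sum>y\<in>I. b y * v y) + j))"
proof -
 define ph where "ph a = restrict (%y. a y - e y) I" for a
 have inj: "inj_on ph (int_box T l h I)"
 proof (rule inj_onI)
  fix a b assume ab: "a \<in> int_box T l h I" "b \<in> int_box T l h I" "ph a = ph b"
  show "a = b"
  proof (rule PiE_ext[OF ab(1,2)[unfolded int_box_def]])
   fix i assume "i \<in> I"
   thus "a i = b i" using fun_cong[OF ab(3), of i] by (simp add: ph_def)
  qed
 qed
 have "f (\<Sum>y\<in>I. a y * v y) = f ((\<Sum>y\<in>I. ph a y * v y) + j)" for a
 proof -
  have "(\<Sum>y\<in>I. ph a y * v y) + j = (\<Sum>y\<in>I. ph a y * v y + e y * v y)" by (simp add: sum.distrib e(1))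
  also have "... = (\<Sum>y\<in>I. a y * v y)" by (intro sum.cong) (auto simp: ph_def algebra_simps)
  finally show ?thesis by simp
 qed
 hence "(\<Sum>a\<in>int_box T l h I. f (\<Sum>y\<in>I. a y * v y)) = (\<Sum>b\<in>ph ` int_box T l h I. f ((\<Sum>y\<in>I. b y * v y) + j))"
  by (simp add: sum.reindex[OF inj])
 also have "... <= (\<Sum>b\<in>int_box T (%y. l y - rho) (%y. h y + rho) I. f ((\<Sum>y\<in>I. b y * v y) + j))"
 proof (intro sum_mono2 finite_int_box I f subsetI)
  fix b assume "b \<in> ph ` int_box T l h I"
  then obtain a where a: "a \<in> int_box T l h I" "b = ph a" by blast
  have "T * (l y - rho) <= real_of_int (b y) & real_of_int (b y) < T * (h y + rho)" if "y \<in> I" for y using a(1) that e(2)[OF that]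
   by (auto simp: int_box_iff right_diff_distrib distrib_left a(2) ph_def)
  thus "b \<in> int_box T (%y. l y - rho) (%y. h y + rho) I" using a by (auto simp: int_box_iff ph_def)
 qed
 finally show ?thesis .
qed

text \<open>A translation by \<open>e\<close> changes the linear form by \<open>j\<close> and
  displaces the box by at most \<open>rho * T\<close>. Averaging over \<open>j < H\<close> and
  exchanging the sums turns single values of \<open>f\<close> into sums over intervals of length
  \<open>H\<close>, one for each \<open>b\<close>; the box is enlarged for the upper bound and
  shrunk for the lower.\<close>

lemma average_over_shifts:
 fixes f :: "int => real" and v :: "'m => int"
 assumes I: "finite I" and f: "!!t. f t >= 0" and H: "H > 0"
  and e: "!!j. j < H ==> \<exists>e. (\<Sum>y\<in>I. e y * v y) = int j & (\<forall>y\<in>I. \<bar>real_of_int (e y)\<bar> <= T * rho)"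
 shows "(!!b. b \<in> int_box T (%y. l y - rho) (%y. h y + rho) I ==> (\<Sum>j<H. f ((\<Sum>y\<in>I. b y * v y) + int j)) <= U * real H) ==>
   (\<Sum>a\<in>int_box T l h I. f (\<Sum>y\<in>I. a y * v y)) <= U * card (int_box T (%y. l y - rho) (%y. h y + rho) I)"
  and "(!!b. b \<in> int_box T (%y. l y + rho) (%y. h y - rho) I ==> (\<Sum>j<H. f ((\<Sum>y\<in>I. b y * v y) + int j)) >= U * real H) ==>
   (\<Sum>a\<in>int_box T l h I. f (\<Sum>y\<in>I. a y * v y)) >= U * card (int_box T (%y. l y + rho) (%y. h y - rho) I)"
proof -
 define S where "S = (\<Sum>a\<in>int_box T l h I. f (\<Sum>y\<in>I. a y * v y))"
 {
  define B where "B = int_box T (%y. l y - rho) (%y. h y + rho) I"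
  assume *: "!!b. b \<in> B ==> (\<Sum>j<H. f ((\<Sum>y\<in>I. b y * v y) + int j)) <= U * real H"
  have "real H * S = (\<Sum>j<H. S)" by simp
  also have "... <= (\<Sum>j<H. \<Sum>b\<in>B. f ((\<Sum>y\<in>I. b y * v y) + int j))"
  proof (intro sum_mono)
   fix j assume "j \<in> {..<H}"
   then obtain e where "(\<Sum>y\<in>I. e y * v y) = int j" "!!y. y \<in> I ==> \<bar>real_of_int (e y)\<bar> <= T * rho" using e[of j] by auto
   thus "S <= (\<Sum>b\<in>B. f ((\<Sum>y\<in>I. b y * v y) + int j))" unfolding S_def B_def by (intro sum_box_shift_le I f)
  qed
  also have "... = (\<Sum>b\<in>B. \<Sum>j<H. f ((\<Sum>y\<in>I. b y * v y) + int j))" by (rule sum.swap)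
  also have "... <= (\<Sum>b\<in>B. U * real H)" by (intro sum_mono *)
  also have "... = real H * (U * card B)" by simp
  finally show "S <= U * card B" using H by simp
 }
 {
  define B where "B = int_box T (%y. l y + rho) (%y. h y - rho) I"
  assume *: "!!b. b \<in> B ==> (\<Sum>j<H. f ((\<Sum>y\<in>I. b y * v y) + int j)) >= U * real H"
  have "real H * (U * card B) = (\<Sum>b\<in>B. U * real H)" by simp
  also have "... <= (\<Sum>b\<in>B. \<Sum>j<H. f ((\<Sum>y\<in>I. b y * v y) + int j))" by (intro sum_mono *)
  also have "... = (\<Sum>j<H. \<Sum>b\<in>B. f ((\<Sum>y\<in>I. b y * v y) + int j))" by (rule sum.swap)
  also have "... <= (\<Sum>j<H. S)"
  proof (intro sum_mono)
   fix j assume "j \<in> {..<H}"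
   then obtain e where "(\<Sum>y\<in>I. e y * v y) = int j" "!!y. y \<in> I ==> \<bar>real_of_int (e y)\<bar> <= T * rho" using e[of j] by auto
   hence "(\<Sum>b\<in>B. f ((\<Sum>y\<in>I. b y * v y) + int j)) <=
    (\<Sum>a\<in>int_box T (%y. l y + rho - rho) (%y. h y - rho + rho) I. f ((\<Sum>y\<in>I. a y * v y) + - int j + int j))"
    unfolding B_def by (intro sum_box_shift_le[where f = "%t. f (t + int j)" and e = "%y. - e y"] I f) (auto simp: sum_negf)
   thus "(\<Sum>b\<in>B. f ((\<Sum>y\<in>I. b y * v y) + int j)) <= S" by (simp add: S_def)
  qed
  also have "... = real H * S" by simp
  finally show "S >= U * card B" using H by simp
 }
qed

text \<open>Union bound over the relation vectors \<open>u\<close>, whose number depends only on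
  \<open>K\<close> and \<open>S\<close>.\<close>

lemma card_kervec_related_le:
 fixes S :: "'m::linorder set"
 assumes S: "finite S" "odd (card S)" and X: "finite X"
 shows "card {x \<in> PiE (pairs S) (%_. X). kervec_related K x S}
  <= card (PiE S (%_. {- K..K})) * (card (pairs S) * card X ^ (card (pairs S) - 1))"
proof -
 define U where "U = {u \<in> PiE S (%_. {- K..K}). \<exists>y\<in>S. u y ~= 0}"
 have fin: "finite (PiE S (%_. {- K..K}))" using S by (intro finite_PiE) auto
 hence finU: "finite U" by (simp add: U_def)
 have finP: "finite (PiE (pairs S) (%_. X))" using finite_pairs[OF S(1)] X by (intro finite_PiE) auto
 have "{x \<in> PiE (pairs S) (%_. X). kervec_related K x S} <=
  (\<Union>u\<in>U. {x \<in> PiE (pairs S) (%_. X). (\<Sum>y\<in>S. u y * kervec x S y) = 0})"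
 proof
  fix x assume x: "x \<in> {x \<in> PiE (pairs S) (%_. X). kervec_related K x S}"
  then obtain u where u: "\<forall>y\<in>S. \<bar>u y\<bar> <= K" "\<exists>y\<in>S. u y ~= 0" "(\<Sum>y\<in>S. u y * kervec x S y) = 0"
   unfolding kervec_related_def by blast
  have "restrict u S \<in> U"
  proof -
   have "u y \<in> {- K..K}" if "y \<in> S" for y using u(1)[rule_format, OF that] unfolding atLeastAtMost_iff by linarith
   thus ?thesis using u(2) by (auto simp: U_def)
  qed
  moreover have "(\<Sum>y\<in>S. restrict u S y * kervec x S y) = 0" using u(3) by simp
  ultimately show "x \<in> (\<Union>u\<in>U. {x \<in> PiE (pairs S) (%_. X). (\<Sum>y\<in>S. u y * kervec x S y) = 0})" using x by blast
 qed
 hence "card {x \<in> PiE (pairs S) (%_. X). kervec_related K x S} <=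
  card (\<Union>u\<in>U. {x \<in> PiE (pairs S) (%_. X). (\<Sum>y\<in>S. u y * kervec x S y) = 0})" using finU finP by (intro card_mono) auto
 also have "... <= (\<Sum>u\<in>U. card {x \<in> PiE (pairs S) (%_. X). (\<Sum>y\<in>S. u y * kervec x S y) = 0})" by (rule card_UN_le[OF finU])
 also have "... <= (\<Sum>u\<in>U. card (pairs S) * card X ^ (card (pairs S) - 1))"
 proof (intro sum_mono)
  fix u assume "u \<in> U"
  then obtain y where "y \<in> S" "u y ~= 0" by (auto simp: U_def)
  thus "card {x \<in> PiE (pairs S) (%_. X). (\<Sum>y\<in>S. u y * kervec x S y) = 0} <= card (pairs S) * card X ^ (card (pairs S) - 1)"
   using S X by (intro card_dot_kervec_zero_le)
 qed
 also have "... <= card (PiE S (%_. {- K..K})) * (card (pairs S) * card X ^ (card (pairs S) - 1))" using fin by (auto simp: U_def intro!: card_mono)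
 finally show ?thesis .
qed

section \<open>Weighted primes for a fixed kernel vector\<close>

definition row_sum :: "real => ('m => real) => ('m => real) => ('m::linorder \<times> 'm => int) => 'm set => real" where
 "row_sum T l h x I = (\<Sum>a\<in>int_box T l h I. prime_weight (\<Sum>y\<in>I. a y * kervec x I y))"

lemma row_sum_nonneg: "row_sum T l h x I >= 0" unfolding row_sum_def by (intro sum_nonneg prime_weight_nonneg)

lemma int_box_subset_symmetric:
 assumes "!!e. e \<in> E ==> \<bar>l e\<bar> <= R & \<bar>h e\<bar> <= R" "T >= 0"
 shows "int_box T l h E <= PiE E (%_. {- \<lceil>R * T\<rceil>..\<lceil>R * T\<rceil>})" (is ?g1)
  and "x \<in> int_box T l h E ==> e \<in> E ==> \<bar>real_of_int (x e)\<bar> <= R * T"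
proof -
 have *: "\<bar>real_of_int (x e)\<bar> <= R * T" if x: "x \<in> int_box T l h E" and e: "e \<in> E" for x e
 proof -
  have "T * l e <= x e" "x e < T * h e" using x e by (auto simp: int_box_iff)
  moreover have "\<bar>T * l e\<bar> <= T * R" "\<bar>T * h e\<bar> <= T * R"
   using assms(1)[OF e] assms(2) by (auto simp: abs_mult intro: mult_left_mono)
  ultimately show ?thesis unfolding mult.commute[of R] by linarith
 qed
 thus "x \<in> int_box T l h E ==> e \<in> E ==> \<bar>real_of_int (x e)\<bar> <= R * T" .
 show ?g1
 proof
  fix x assume x: "x \<in> int_box T l h E"
  have "x e \<in> {- \<lceil>R * T\<rceil>..\<lceil>R * T\<rceil>}" if "e \<in> E" for e using *[OF x that] unfolding atLeastAtMost_iff by linarith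
  thus "x \<in> PiE E (%_. {- \<lceil>R * T\<rceil>..\<lceil>R * T\<rceil>})" using x by (auto simp: int_box_def)
 qed
qed

text \<open>\<open>K\<close> is chosen before \<open>T\<close> and \<open>x\<close>, since it only
  has to keep the rounding cost in \<open>kervec_shift_exists\<close> below a quarter of
  \<open>rho * T\<close>. The interval length \<open>H\<close> grows with the length
  \<open>L\<close> of the kernel vector, which makes the estimate uniform in
  \<open>x\<close>.\<close>

lemma row_sum_good:
 fixes I :: "'m::{finite,linorder} set" and l h :: "'m => real" and R eps :: real
 assumes I: "I ~= {}" and R: "R >= 1" and lh: "\<forall>y\<in>I. \<bar>l y\<bar> <= R & \<bar>h y\<bar> <= R" and rho: "0 < rho" "rho <= 1" and eps: "eps > 0"
 shows "\<exists>K\<ge>1. \<exists>T0. \<forall>T\<ge>T0. \<forall>x. (\<forall>e\<in>pairs I. \<bar>real_of_int (x e)\<bar> <= R * T) --> kervec_primitive x I --> ~ kervec_related K x I -->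
  row_sum T l h x I <= (1 + eps) * card (int_box T (%y. l y - rho) (%y. h y + rho) I) &
  ((\<forall>b\<in>int_box T (%y. l y + rho) (%y. h y - rho) I. 0 <= (\<Sum>y\<in>I. b y * kervec x I y)) -->
   (1 - eps) * card (int_box T (%y. l y + rho) (%y. h y - rho) I) <= row_sum T l h x I)"
proof -
 define k where "k = real (card I)"
 have k: "k >= 1" using I unfolding k_def by (simp add: Suc_leI card_gt_0_iff)
 \<comment> \<open>Makes the second term in \<open>kervec_shift_exists\<close>, taken with
   \<open>N = R * T\<close>, at most \<open>rho * T / 4\<close>.\<close>
 define K where "K = \<lceil>4 * (2 ^ CARD('m) * (k * R)) / rho\<rceil>"
 have kR: "k * R >= 1" using k R by (simp add: mult_ge1_I)
 have K: "K >= 1" "real_of_int K >= 4 * (2 ^ CARD('m) * (k * R)) / rho" using kR rho unfolding K_def by auto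
 \<comment> \<open>Boxes displaced by at most 1 have bounds up to \<open>R + 1\<close>, so the form
   is at most \<open>k * (R + 1) * T * L\<close>, which is \<open>c\<close> times
   \<open>rho * T * L / 4\<close>.\<close>
 define c where "c = 4 * (k * (R + 1)) / rho"
 have c: "c > 0" using k R rho by (simp add: c_def)
 obtain H0 where H0: "!!H x. H >= H0 ==> \<bar>real_of_int x\<bar> <= c * real H ==> (\<Sum>j<H. prime_weight (x + int j)) <= (1 + eps) * real H &
  (x >= 0 --> (\<Sum>j<H. prime_weight (x + int j)) >= (1 - eps) * real H)" using sum_prime_weight_short_interval[OF eps c] by blast
 define T0 where "T0 = max (max 1 (4 * (real H0 + 1) / rho)) (max (4 / rho) (real_of_int K))"
 show ?thesis
 proof (intro exI[of _ K] exI[of _ T0] conjI[OF K(1)] allI impI)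
  fix T and x :: "'m \<times> 'm => int"
  assume T: "T >= T0" and x: "\<forall>e\<in>pairs I. \<bar>real_of_int (x e)\<bar> <= R * T" and prim: "kervec_primitive x I" and nrel: "~ kervec_related K x I"
  have T1: "T >= 1" "T >= 4 * (real H0 + 1) / rho" "T >= 4 / rho" "T >= K" using T unfolding T0_def by auto
  let ?v = "kervec x I"
  define L where "L = L2_set (%y. real_of_int (?v y)) I"
  have vL: "\<bar>real_of_int (?v y)\<bar> <= L" if "y \<in> I" for y
   unfolding L_def using that member_le_L2_set[of I y "%y. \<bar>real_of_int (?v y)\<bar>"] by (simp add: L2_set_def)
  obtain y0 where y0: "y0 \<in> I" "?v y0 ~= 0" using kervec_nonzero_of_unrelated[OF nrel K(1) I] by auto
  have L1: "L >= 1" using y0(2) vL[OF y0(1)] by linarith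
  \<comment> \<open>With this \<open>H\<close> the first term \<open>j / L\<close> of a shift is at
    most \<open>rho * T / 4 + 1\<close>, hence at most \<open>rho * T / 2\<close>.\<close>
  define H where "H = nat \<lceil>rho * T * L / 4\<rceil>"
  have H: "real H >= rho * T * L / 4" "real H <= rho * T * L / 4 + 1" using rho T1 L1 unfolding H_def by auto
  have T4: "rho * T / 4 >= 1" "rho * T / 4 >= real H0 + 1" using T1 rho by (auto simp: field_simps)
  have "rho * T / 4 * 1 <= rho * T / 4 * L" using L1 T4 by (intro mult_left_mono) auto
  hence HH0: "H >= H0" "H > 0" using H(1) T4 by auto
  have e: "\<exists>e. (\<Sum>y\<in>I. e y * ?v y) = int j & (\<forall>y\<in>I. \<bar>real_of_int (e y)\<bar> <= T * rho)" if j: "j < H" for j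
  proof -
   have RT: "R * T > 0" using R T1 by simp
   have "real_of_int K <= T" using T1 by simp
   also have "T <= k * R * T" using kR T1 by simp
   finally have "real_of_int K <= card I * (R * T)" by (simp add: k_def)
   then obtain e where e: "(\<Sum>y\<in>I. e y * ?v y) = int j" "!!y. y \<in> I ==> \<bar>real_of_int (e y)\<bar> <= real j / L + 2 ^ CARD('m) * (card I * (R * T)) / K"
    using kervec_shift_exists[OF I _ RT prim nrel K(1), of j] x unfolding L_def by blast
   have "real j / L <= (rho * T * L / 4 + 1) / L" using j H L1 by (intro divide_right_mono) auto
   also have "... = rho * T / 4 + 1 / L" using L1 by (simp add: field_simps)
   also have "1 / L <= 1" using L1 by simp
   finally have "real j / L <= rho * T / 2" using T4 by simp
   moreover have "2 ^ CARD('m) * (card I * (R * T)) / K <= rho * T / 4"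
   proof -
    have "2 ^ CARD('m) * (k * R) * 4 * T <= K * rho * T" using K(2) rho T1 by (simp add: field_simps)
    moreover have "real_of_int K > 0" using K by simp
    ultimately show ?thesis unfolding k_def by (simp add: field_simps)
   qed
   ultimately have "real j / L + 2 ^ CARD('m) * (card I * (R * T)) / K <= T * rho" using T4 by (simp add: mult.commute)
   thus ?thesis using e by (intro exI[of _ e]) force
  qed
  have cb: "\<bar>real_of_int (\<Sum>y\<in>I. b y * ?v y)\<bar> <= c * real H" if b: "b \<in> int_box T l' h' I" and
   lh': "!!y. y \<in> I ==> \<bar>l' y\<bar> <= R + 1 & \<bar>h' y\<bar> <= R + 1" for b l' h'
  proof -
   have "\<bar>real_of_int (\<Sum>y\<in>I. b y * ?v y)\<bar> <= (\<Sum>y\<in>I. \<bar>real_of_int (b y)\<bar> * \<bar>real_of_int (?v y)\<bar>)"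
    unfolding abs_mult[symmetric] by simp
   also have "... <= (\<Sum>y\<in>I. ((R + 1) * T) * L)"
    using b vL R T1 by (intro sum_mono mult_mono int_box_subset_symmetric(2)[of I l' "R + 1" h' T b] lh') auto
   also have "... = c * (rho * T * L / 4)" using rho by (simp add: c_def k_def)
   also have "... <= c * real H" using c H by simp
   finally show ?thesis .
  qed
  have up: "\<bar>l y - rho\<bar> <= R + 1 & \<bar>h y + rho\<bar> <= R + 1" and dn: "\<bar>l y + rho\<bar> <= R + 1 & \<bar>h y - rho\<bar> <= R + 1" if "y \<in> I" for y
   using lh[rule_format, OF that] rho by auto
  have "row_sum T l h x I <= (1 + eps) * card (int_box T (%y. l y - rho) (%y. h y + rho) I)" unfolding row_sum_def
   by (rule average_over_shifts(1)[OF _ prime_weight_nonneg HH0(2) e]) (use H0[OF HH0(1)] cb[OF _ up] in auto)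
  moreover have "(1 - eps) * card (int_box T (%y. l y + rho) (%y. h y - rho) I) <= row_sum T l h x I"
   if nn: "\<forall>b\<in>int_box T (%y. l y + rho) (%y. h y - rho) I. 0 <= (\<Sum>y\<in>I. b y * ?v y)" unfolding row_sum_def
   by (rule average_over_shifts(2)[OF _ prime_weight_nonneg HH0(2) e]) (use H0[OF HH0(1)] cb[OF _ dn] nn in auto)
  ultimately show "row_sum T l h x I <= (1 + eps) * card (int_box T (%y. l y - rho) (%y. h y + rho) I) &
   ((\<forall>b\<in>int_box T (%y. l y + rho) (%y. h y - rho) I. 0 <= (\<Sum>y\<in>I. b y * ?v y)) -->
    (1 - eps) * card (int_box T (%y. l y + rho) (%y. h y - rho) I) <= row_sum T l h x I)" by blast
 qed
qed

lemma prime_weight_le_ln: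
 assumes "\<bar>real_of_int t\<bar> <= M" "M >= 1"
 shows "prime_weight t <= ln M"
proof (cases "prime t")
 case True
 thus ?thesis using prime_ge_1_int[of t] assms by (simp add: prime_weight_def)
qed (use assms in "simp add: prime_weight_def")

text \<open>If a relation of height \<open>K\<close> holds, the entries \<open>x\<close> themselves
  lose a power of \<open>T\<close>. If there is none but the kernel vector is not primitive, it is
  the row \<open>a\<close> that loses one. In both cases the power outweighs the weight, which is of
  order \<open>ln T\<close>.\<close>

lemma bad_rows_negligible:
 fixes I :: "'m::{finite,linorder} set" and l h :: "'m \<times> 'm => real" and l' h' :: "'m => real" and R :: real and K :: int
 assumes m: "card I = Suc (2 * m)" and R: "R >= 1" and K: "K >= 1"
  and lh: "!!e. e \<in> pairs I ==> \<bar>l e\<bar> <= R & \<bar>h e\<bar> <= R" and lh': "!!y. y \<in> I ==> \<bar>l' y\<bar> <= R & \<bar>h' y\<bar> <= R"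
 shows "((%T. (\<Sum>x\<in>{x \<in> int_box T l h (pairs I). ~ (kervec_primitive x I & ~ kervec_related K x I)}. row_sum T l' h' x I)
  / T ^ (card (pairs I) + card I)) \<longlongrightarrow> 0) at_top" (is ?g1)
  "((%T. card {x \<in> int_box T l h (pairs I). kervec_related K x I} / T ^ card (pairs I)) \<longlongrightarrow> 0) at_top" (is ?g2)
proof -
 define d where "d = card (pairs I)"
 define k where "k = card I"
 have k: "k >= 1" using m by (simp add: k_def)
 define U where "U = card (PiE I (%_. {- K..K}))"
 define C where "C = real k * fact (2 * m)"
 have C1: "C >= 1" using k by (simp add: C_def mult_ge1_I)
 define bad where "bad T = {x \<in> int_box T l h (pairs I). ~ (kervec_primitive x I & ~ kervec_related K x I)}" for T
 define rel where "rel T = {x \<in> int_box T l h (pairs I). kervec_related K x I}" for T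
 define Q where "Q = (real U * real d + 1) * (5 * R) ^ (d + k - 1)"
 have box: "card (PiE E (%_. {- \<lceil>R * T\<rceil>..\<lceil>R * T\<rceil>})) <= (5 * R * T) ^ card E"
  and X: "real (card {- \<lceil>R * T\<rceil>..\<lceil>R * T\<rceil>}) <= 5 * R * T" if "finite E" "T >= 1" for T and E :: "'e set"
 proof -
  have "R * T >= 1" using R that by (simp add: mult_ge1_I)
  thus *: "real (card {- \<lceil>R * T\<rceil>..\<lceil>R * T\<rceil>}) <= 5 * R * T" by simp linarith
  have "real (card {- \<lceil>R * T\<rceil>..\<lceil>R * T\<rceil>}) ^ card E <= (5 * R * T) ^ card E" by (intro power_mono *) auto
  thus "card (PiE E (%_. {- \<lceil>R * T\<rceil>..\<lceil>R * T\<rceil>})) <= (5 * R * T) ^ card E" using that by (simp add: card_PiE)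
 qed
 have relc: "real (card (rel T)) <= real U * real d * (5 * R * T) ^ (d - 1)" if T: "T >= 1" for T
 proof -
  let ?X = "{- \<lceil>R * T\<rceil>..\<lceil>R * T\<rceil>}"
  have "int_box T l h (pairs I) <= PiE (pairs I) (%_. ?X)" using lh T by (intro int_box_subset_symmetric) auto
  hence "card (rel T) <= card {x \<in> PiE (pairs I) (%_. ?X). kervec_related K x I}"
   unfolding rel_def using finite_PiE[of "pairs I" "%_. ?X"] by (intro card_mono) auto
  also have "... <= U * (d * card ?X ^ (d - 1))" unfolding U_def d_def by (rule card_kervec_related_le) (use m in auto)
  finally have "real (card (rel T)) <= real (U * (d * card ?X ^ (d - 1)))" by (simp only: of_nat_le_iff)
  also have "... = real U * real d * real (card ?X) ^ (d - 1)" by simp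
  also have "... <= real U * real d * (5 * R * T) ^ (d - 1)" by (intro mult_left_mono power_mono X[OF finite.emptyI T]) auto
  finally show ?thesis .
 qed
 have main: "(\<Sum>x\<in>bad T. row_sum T l' h' x I) <= Q * T ^ (d + k - 1) * (ln C + (real m + 1) * (ln R + ln T))" if T: "T >= 1" for T
 proof -
  let ?X = "{- \<lceil>R * T\<rceil>..\<lceil>R * T\<rceil>}"
  define M where "M = C * (R * T) ^ Suc m"
  have RT: "R * T >= 1" using R T by (simp add: mult_ge1_I)
  have M1: "M >= 1" unfolding M_def by (rule mult_ge1_I[OF C1 one_le_power[OF RT]])
  have lnM: "ln M = ln C + (real m + 1) * (ln R + ln T)" unfolding M_def using C1 R T RT by (simp add: ln_mult ln_realpow algebra_simps)
  define Lam where "Lam = ln M"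
  have Lam0: "Lam >= 0" using M1 by (simp add: Lam_def)
  have sub: "int_box T l h (pairs I) <= PiE (pairs I) (%_. ?X)" using lh T by (intro int_box_subset_symmetric) auto
  have sub': "int_box T l' h' I <= PiE I (%_. ?X)" using lh' T by (intro int_box_subset_symmetric) auto
  have wt: "prime_weight (\<Sum>y\<in>I. a y * kervec x I y) <= Lam"
   if x: "x \<in> int_box T l h (pairs I)" and a: "a \<in> int_box T l' h' I" for x a unfolding Lam_def
  proof (rule prime_weight_le_ln[OF _ M1])
   have "\<bar>real_of_int (\<Sum>y\<in>I. a y * kervec x I y)\<bar> <= (\<Sum>y\<in>I. \<bar>real_of_int (a y)\<bar> * \<bar>real_of_int (kervec x I y)\<bar>)"
    unfolding abs_mult[symmetric] by simp
   also have "... <= (\<Sum>y\<in>I. (R * T) * (fact (2 * m) * (R * T) ^ m))"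
   proof (intro sum_mono mult_mono)
    fix y assume y: "y \<in> I"
    show "\<bar>real_of_int (a y)\<bar> <= R * T" using int_box_subset_symmetric(2)[OF lh' _ a y] T by simp
    have "\<bar>real_of_int (x e)\<bar> <= R * T" if "e \<in> pairs I" for e using int_box_subset_symmetric(2)[OF lh _ x that] T by simp
    thus "\<bar>real_of_int (kervec x I y)\<bar> <= fact (2 * m) * (R * T) ^ m" unfolding real_kervec using RT y m by (intro abs_kervec_le) auto
   qed (use RT in auto)
   also have "... = M" by (simp add: M_def C_def k_def)
   finally show "\<bar>real_of_int (\<Sum>y\<in>I. a y * kervec x I y)\<bar> <= M" .
  qed
  have triv: "row_sum T l' h' x I <= (5 * R * T) ^ k * Lam" if x: "x \<in> int_box T l h (pairs I)" for x
  proof -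
   have "row_sum T l' h' x I <= (\<Sum>a\<in>int_box T l' h' I. Lam)" unfolding row_sum_def by (intro sum_mono wt x)
   also have "... = real (card (int_box T l' h' I)) * Lam" by simp
   also have "... <= (5 * R * T) ^ k * Lam"
   proof (intro mult_right_mono Lam0)
    have "card (int_box T l' h' I) <= card (PiE I (%_. ?X))" by (intro card_mono sub' finite_PiE) auto
    thus "real (card (int_box T l' h' I)) <= (5 * R * T) ^ k" using box[of I T] T unfolding k_def by simp
   qed
   finally show ?thesis .
  qed
  have nonprim: "row_sum T l' h' x I <= (5 * R * T) ^ (k - 1) * Lam"
   if x: "x \<in> int_box T l h (pairs I)" and np: "~ kervec_primitive x I" and nr: "~ kervec_related K x I" for x
  proof -
   have "I ~= {}" using m by auto
   then obtain y0 where y0: "y0 \<in> I" "kervec x I y0 ~= 0" using kervec_nonzero_of_unrelated[OF nr K] by auto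
   obtain p where p: "prime p" "\<forall>y\<in>I. p dvd kervec x I y" using np unfolding kervec_primitive_def by blast
   \<comment> \<open>All values of the form are multiples of \<open>p\<close>, so \<open>p\<close>
     itself is the only prime value, and only the rows on one hyperplane count.\<close>
   define A where "A = {a \<in> int_box T l' h' I. (\<Sum>y\<in>I. a y * kervec x I y) = p}"
   have fin: "finite (int_box T l' h' I)" by (intro finite_int_box) simp
   have "row_sum T l' h' x I = (\<Sum>a\<in>A. prime_weight (\<Sum>y\<in>I. a y * kervec x I y))" unfolding row_sum_def
   proof (rule sum.mono_neutral_right[OF fin], force simp: A_def, rule ballI)
    fix a assume a: "a \<in> int_box T l' h' I - A"
    have "p dvd (\<Sum>y\<in>I. a y * kervec x I y)" by (intro dvd_sum) (use p in auto)
    hence "prime (\<Sum>y\<in>I. a y * kervec x I y) ==> p = (\<Sum>y\<in>I. a y * kervec x I y)" using p(1) by (intro primes_dvd_imp_eq)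
    thus "prime_weight (\<Sum>y\<in>I. a y * kervec x I y) = 0" using a by (auto simp: prime_weight_def A_def)
   qed
   also have "... <= (\<Sum>a\<in>A. Lam)" by (intro sum_mono wt x) (simp add: A_def)
   also have "... = real (card A) * Lam" by simp
   also have "... <= (5 * R * T) ^ (k - 1) * Lam"
   proof (intro mult_right_mono Lam0)
    have "card A <= card {a \<in> PiE I (%_. ?X). (\<Sum>y\<in>I. a y * kervec x I y) = p}"
     unfolding A_def using sub' finite_PiE[of I "%_. ?X"] by (intro card_mono) auto
    also have "... <= (\<Prod>i\<in>I - {y0}. card ?X)" by (rule card_lin_eq_le[where w = "kervec x I" and X = "%_. ?X"]) (use y0 in auto)
    also have "... = card ?X ^ (k - 1)" using y0 by (simp add: k_def)
    finally have "real (card A) <= real (card ?X ^ (k - 1))" by simp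
    also have "... = real (card ?X) ^ (k - 1)" by simp
    also have "... <= (5 * R * T) ^ (k - 1)" by (intro power_mono X[OF finite.emptyI T]) auto
    finally show "real (card A) <= (5 * R * T) ^ (k - 1)" .
   qed
   finally show ?thesis .
  qed
  define np where "np = bad T - rel T"
  have fb: "finite (bad T)" unfolding bad_def using finite_int_box[of "pairs I"] by simp
  have bsub: "rel T <= bad T" by (auto simp: bad_def rel_def)
  have "(\<Sum>x\<in>bad T. row_sum T l' h' x I) = (\<Sum>x\<in>rel T. row_sum T l' h' x I) + (\<Sum>x\<in>np. row_sum T l' h' x I)"
   unfolding np_def using sum.subset_diff[OF bsub fb] by (simp add: add.commute)
  also have "... <= (\<Sum>x\<in>rel T. (5 * R * T) ^ k * Lam) + (\<Sum>x\<in>np. (5 * R * T) ^ (k - 1) * Lam)"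
   by (intro add_mono sum_mono triv nonprim) (auto simp: rel_def np_def bad_def)
  also have "... = real (card (rel T)) * ((5 * R * T) ^ k * Lam) + real (card np) * ((5 * R * T) ^ (k - 1) * Lam)" by simp
  also have "... <= (real U * real d * (5 * R * T) ^ (d - 1)) * ((5 * R * T) ^ k * Lam) + (5 * R * T) ^ d * ((5 * R * T) ^ (k - 1) * Lam)"
  proof (intro add_mono mult_right_mono relc[OF T])
   have "card np <= card (PiE (pairs I) (%_. ?X))" using sub by (intro card_mono) (auto intro!: finite_PiE simp: np_def bad_def)
   thus "real (card np) <= (5 * R * T) ^ d" using box[of "pairs I" T] T unfolding d_def by simp
  qed (use Lam0 R T in auto)
  also have "... = Q * T ^ (d + k - 1) * Lam"
  proof -
   have "real d * (5 * R * T) ^ (d - 1) * (5 * R * T) ^ k = real d * (5 * R * T) ^ (d + k - 1)" by (cases d) (auto simp: power_add)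
   moreover have "(5 * R * T) ^ d * (5 * R * T) ^ (k - 1) = (5 * R * T) ^ (d + k - 1)" using k by (simp flip: power_add)
   moreover have "(5 * R * T) ^ (d + k - 1) = (5 * R) ^ (d + k - 1) * T ^ (d + k - 1)" by (rule power_mult_distrib)
   ultimately show ?thesis unfolding Q_def by (simp add: algebra_simps)
  qed
  finally show ?thesis unfolding Lam_def lnM .
 qed
 show ?g1 unfolding bad_def[symmetric] d_def[symmetric] k_def[symmetric]
 proof (rule Lim_null_comparison)
  show "((%T. Q * (ln C + (real m + 1) * (ln R + ln T)) / T) \<longlongrightarrow> 0) at_top" by real_asymp
  show "\<forall>\<^sub>F T in at_top. norm ((\<Sum>x\<in>bad T. row_sum T l' h' x I) / T ^ (d + k)) <= Q * (ln C + (real m + 1) * (ln R + ln T)) / T"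
   using eventually_ge_at_top[of 1]
  proof eventually_elim
   case (elim T)
   have "T ^ (d + k) = T ^ (d + k - 1) * T" using k by (metis power_minus_mult add_gr_0 less_le_trans zero_less_one)
   hence "Q * T ^ (d + k - 1) * (ln C + (real m + 1) * (ln R + ln T)) / T ^ (d + k) = Q * (ln C + (real m + 1) * (ln R + ln T)) / T" by simp
   moreover have "(\<Sum>x\<in>bad T. row_sum T l' h' x I) / T ^ (d + k) <= Q * T ^ (d + k - 1) * (ln C + (real m + 1) * (ln R + ln T)) / T ^ (d + k)"
    using elim by (intro divide_right_mono main) auto
   moreover have "(\<Sum>x\<in>bad T. row_sum T l' h' x I) >= 0" by (intro sum_nonneg row_sum_nonneg)
   ultimately show ?case using elim by simp
  qed
 qed
 show ?g2 unfolding rel_def[symmetric] d_def[symmetric]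
 proof (rule Lim_null_comparison)
  show "((%T. real U * real d * (5 * R) ^ (d - 1) / T) \<longlongrightarrow> 0) at_top" by real_asymp
  show "\<forall>\<^sub>F T in at_top. norm (card (rel T) / T ^ d) <= real U * real d * (5 * R) ^ (d - 1) / T" using eventually_ge_at_top[of 1]
  proof eventually_elim
   case (elim T)
   have "card (rel T) / T ^ d <= real U * real d * (5 * R * T) ^ (d - 1) / T ^ d" using elim by (intro divide_right_mono relc) auto
   also have "... = real U * real d * (5 * R) ^ (d - 1) / T" by (cases d) (auto simp: power_mult_distrib)
   finally show ?case using elim by simp
  qed
 qed
qed

section \<open>The weighted count over a box, in terms of row and kernel vector\<close>

lemma tendsto_card_int_box:
 assumes "finite E" "!!e. e \<in> E ==> l e <= h e"
 shows "((%T. real (card (int_box T l h E)) / T ^ card E) \<longlongrightarrow> (\<Prod>e\<in>E. h e - l e)) at_top"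
proof -
 have "((%T. real (card {x \<in> int_box T l h E. True}) / T ^ card E) \<longlongrightarrow>
  real (card {x \<in> PiE E (%_. {0..<1::int}). True}) / real_of_int 1 ^ card E * (\<Prod>e\<in>E. h e - l e)) at_top"
  using assms by (intro tendsto_card_box_periodic) auto
 thus ?thesis using assms(1) by (simp add: card_PiE)
qed

text \<open>\<open>l\<close> and \<open>h\<close> bound the matrix without its first row,
  \<open>l'\<close> and \<open>h'\<close> bound the first row.\<close>

locale odd_box =
 fixes I :: "'m::{finite,linorder} set" and m :: nat and l h :: "'m \<times> 'm => real" and l' h' :: "'m => real"
 assumes card_I: "card I = Suc (2 * m)"
  and lh: "e \<in> pairs I ==> l e < h e" and lh': "y \<in> I ==> l' y < h' y"

begin

definition box_sum :: "real => real" where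
 "box_sum T = (\<Sum>x\<in>int_box T l h (pairs I). row_sum T l' h' x I)"

definition box_limit :: real where
 "box_limit = prodinf (kervec_series I) * (\<Prod>e\<in>pairs I. h e - l e) * (\<Prod>y\<in>I. h' y - l' y)"

lemma box_bound:
 obtains R where "R >= 1" "!!e. e \<in> pairs I ==> \<bar>l e\<bar> <= R & \<bar>h e\<bar> <= R" "!!y. y \<in> I ==> \<bar>l' y\<bar> <= R & \<bar>h' y\<bar> <= R"
proof
 define R where "R = 1 + ((\<Sum>e\<in>pairs I. \<bar>l e\<bar> + \<bar>h e\<bar>) + (\<Sum>y\<in>I. \<bar>l' y\<bar> + \<bar>h' y\<bar>))"
 have nn: "(\<Sum>e\<in>pairs I. \<bar>l e\<bar> + \<bar>h e\<bar>) >= 0" "(\<Sum>y\<in>I. \<bar>l' y\<bar> + \<bar>h' y\<bar>) >= 0" by (intro sum_nonneg; simp)+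
 thus "R >= 1" unfolding R_def by linarith
 show "\<bar>l e\<bar> <= R & \<bar>h e\<bar> <= R" if "e \<in> pairs I" for e
  using member_le_sum[of e "pairs I" "%e. \<bar>l e\<bar> + \<bar>h e\<bar>"] that nn unfolding R_def by force
 show "\<bar>l' y\<bar> <= R & \<bar>h' y\<bar> <= R" if "y \<in> I" for y
  using member_le_sum[of y I "%y. \<bar>l' y\<bar> + \<bar>h' y\<bar>"] that nn unfolding R_def by force
qed

lemma tendsto_box_limit:
 "((%s. (1 + s) * (prodinf (kervec_series I) * (\<Prod>e\<in>pairs I. h e - l e)) * (\<Prod>y\<in>I. (h' y + s) - (l' y - s))) \<longlongrightarrow> box_limit) (at_right 0)"
 "((%s. (1 - s) * (prodinf (kervec_series I) * (\<Prod>e\<in>pairs I. h e - l e)) * (\<Prod>y\<in>I. (h' y - s) - (l' y + s))) \<longlongrightarrow> box_limit) (at_right 0)"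
proof -
 have "((%s. (1 + s) * (prodinf (kervec_series I) * (\<Prod>e\<in>pairs I. h e - l e)) * (\<Prod>y\<in>I. (h' y + s) - (l' y - s))) \<longlongrightarrow>
  (1 + 0) * (prodinf (kervec_series I) * (\<Prod>e\<in>pairs I. h e - l e)) * (\<Prod>y\<in>I. (h' y + 0) - (l' y - 0))) (at_right 0)"
  by (intro tendsto_intros)
 thus "((%s. (1 + s) * (prodinf (kervec_series I) * (\<Prod>e\<in>pairs I. h e - l e)) * (\<Prod>y\<in>I. (h' y + s) - (l' y - s))) \<longlongrightarrow> box_limit) (at_right 0)"
  by (simp add: box_limit_def)
 have "((%s. (1 - s) * (prodinf (kervec_series I) * (\<Prod>e\<in>pairs I. h e - l e)) * (\<Prod>y\<in>I. (h' y - s) - (l' y + s))) \<longlongrightarrow>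
  (1 - 0) * (prodinf (kervec_series I) * (\<Prod>e\<in>pairs I. h e - l e)) * (\<Prod>y\<in>I. (h' y - 0) - (l' y + 0))) (at_right 0)"
  by (intro tendsto_intros)
 thus "((%s. (1 - s) * (prodinf (kervec_series I) * (\<Prod>e\<in>pairs I. h e - l e)) * (\<Prod>y\<in>I. (h' y - s) - (l' y + s))) \<longlongrightarrow> box_limit) (at_right 0)"
  by (simp add: box_limit_def)
qed

lemma box_sum_upper:
 assumes "eta > 0"
 shows "\<forall>\<^sub>F T in at_top. box_sum T / T ^ (card (pairs I) + card I) <= box_limit + eta"
proof -
 obtain R where R: "R >= 1" "!!e. e \<in> pairs I ==> \<bar>l e\<bar> <= R & \<bar>h e\<bar> <= R" "!!y. y \<in> I ==> \<bar>l' y\<bar> <= R & \<bar>h' y\<bar> <= R"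
  using box_bound by blast
 define ph where "ph s = (1 + s) * (prodinf (kervec_series I) * (\<Prod>e\<in>pairs I. h e - l e)) * (\<Prod>y\<in>I. (h' y + s) - (l' y - s))" for s
 have "\<forall>\<^sub>F s in at_right 0. ph s < box_limit + eta" using tendsto_box_limit(1) assms unfolding ph_def by (intro order_tendstoD) auto
 moreover have "\<forall>\<^sub>F s in at_right (0::real). s \<in> {0<..<1}" by (intro eventually_at_right_real) simp
 ultimately have "\<forall>\<^sub>F s in at_right 0. ph s < box_limit + eta & s \<in> {0<..<1}" by eventually_elim simp
 then obtain s where s: "ph s < box_limit + eta" "0 < s" "s < 1" using eventually_happens'[of "at_right (0::real)"] by auto
 have I0: "I ~= {}" using card_I by auto
 have R3: "\<forall>y\<in>I. \<bar>l' y\<bar> <= R & \<bar>h' y\<bar> <= R" using R(3) by blast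
 \<comment> \<open>\<open>s\<close> plays two roles: it is both the size \<open>rho\<close> of the
   shifts and the relative error \<open>eps\<close>.\<close>
 obtain K T0 where K: "K >= 1" and good: "!!T x. T >= T0 ==> \<forall>e\<in>pairs I. \<bar>real_of_int (x e)\<bar> <= R * T ==> kervec_primitive x I ==>
   ~ kervec_related K x I ==> row_sum T l' h' x I <= (1 + s) * card (int_box T (%y. l' y - s) (%y. h' y + s) I)"
  using row_sum_good[OF I0 R(1) R3 s(2) less_imp_le[OF s(3)] s(2)] by blast
 define prim where "prim T = {x \<in> int_box T l h (pairs I). kervec_primitive x I}" for T
 define bad where "bad T = {x \<in> int_box T l h (pairs I). ~ (kervec_primitive x I & ~ kervec_related K x I)}" for T
 define rhs where "rhs T = (1 + s) * (real (card (prim T)) / T ^ card (pairs I)) * (real (card (int_box T (%y. l' y - s) (%y. h' y + s) I)) / T ^ card I)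
   + (\<Sum>x\<in>bad T. row_sum T l' h' x I) / T ^ (card (pairs I) + card I)" for T
 have "(rhs \<longlongrightarrow> (1 + s) * (prodinf (kervec_series I) * (\<Prod>e\<in>pairs I. h e - l e)) * (\<Prod>y\<in>I. (h' y + s) - (l' y - s)) + 0) at_top"
  unfolding rhs_def prim_def bad_def
 proof (intro tendsto_intros tendsto_card_kervec_primitive tendsto_card_int_box bad_rows_negligible[OF card_I R(1) K R(2,3)] less_imp_le lh)
  show "l' y - s < h' y + s" if "y \<in> I" for y using lh'[OF that] s by simp
 qed (auto simp: card_I)
 hence "\<forall>\<^sub>F T in at_top. rhs T < box_limit + eta" using s(1) by (auto simp: ph_def intro!: order_tendstoD)
 thus ?thesis using eventually_ge_at_top[of "max 1 T0"]
 proof eventually_elim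
  case (elim T)
  hence T: "T >= 1" "T >= T0" by auto
  define bx where "bx = real (card (int_box T (%y. l' y - s) (%y. h' y + s) I))"
  define gd where "gd = int_box T l h (pairs I) - bad T"
  have fin: "finite (int_box T l h (pairs I))" by (intro finite_int_box) simp
  have "box_sum T = (\<Sum>x\<in>gd. row_sum T l' h' x I) + (\<Sum>x\<in>bad T. row_sum T l' h' x I)"
   unfolding box_sum_def gd_def by (rule sum.subset_diff[OF _ fin]) (auto simp: bad_def)
  also have "(\<Sum>x\<in>gd. row_sum T l' h' x I) <= (\<Sum>x\<in>gd. (1 + s) * bx)"
  proof (intro sum_mono)
   fix x assume x: "x \<in> gd"
   hence xb: "x \<in> int_box T l h (pairs I)" by (simp add: gd_def)
   have "\<bar>real_of_int (x e)\<bar> <= R * T" if "e \<in> pairs I" for e using int_box_subset_symmetric(2)[OF R(2) _ xb that] T by simp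
   thus "row_sum T l' h' x I <= (1 + s) * bx" unfolding bx_def using x by (intro good T) (auto simp: gd_def bad_def)
  qed
  also have "(\<Sum>x\<in>gd. (1 + s) * bx) = real (card gd) * ((1 + s) * bx)" by simp
  also have "... <= real (card (prim T)) * ((1 + s) * bx)"
  proof (intro mult_right_mono)
   show "real (card gd) <= real (card (prim T))" using fin by (simp, intro card_mono) (auto simp: gd_def prim_def bad_def)
  qed (use s in "auto simp: bx_def")
  finally have "box_sum T / T ^ (card (pairs I) + card I) <= (real (card (prim T)) * ((1 + s) * bx) + (\<Sum>x\<in>bad T. row_sum T l' h' x I)) / T ^ (card (pairs I) + card I)"
   using T by (intro divide_right_mono) auto
  also have "... = rhs T" unfolding rhs_def bx_def[symmetric] by (simp add: add_divide_distrib power_add)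
  finally show ?case using elim by simp
 qed
qed

text \<open>The lower bound for primes in an interval is available only from a non-negative starting
  point, hence the sign hypothesis. Dropping all entries that are related or not primitive only
  decreases the sum; the related ones are subtracted from the count of primitive ones.\<close>

lemma box_sum_lower:
 assumes "eta > 0" and nonneg: "!!T x a. T > 0 ==> x \<in> int_box T l h (pairs I) ==> a \<in> int_box T l' h' I ==> 0 <= (\<Sum>y\<in>I. a y * kervec x I y)"
 shows "\<forall>\<^sub>F T in at_top. box_sum T / T ^ (card (pairs I) + card I) >= box_limit - eta"
proof -
 obtain R where R: "R >= 1" "!!e. e \<in> pairs I ==> \<bar>l e\<bar> <= R & \<bar>h e\<bar> <= R" "!!y. y \<in> I ==> \<bar>l' y\<bar> <= R & \<bar>h' y\<bar> <= R"
  using box_bound by blast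
 define ph where "ph s = (1 - s) * (prodinf (kervec_series I) * (\<Prod>e\<in>pairs I. h e - l e)) * (\<Prod>y\<in>I. (h' y - s) - (l' y + s))" for s
 have "\<forall>\<^sub>F s in at_right 0. ph s > box_limit - eta" using tendsto_box_limit(2) assms unfolding ph_def by (intro order_tendstoD) auto
 moreover have "\<forall>\<^sub>F s in at_right (0::real). s \<in> {0<..<1}" by (intro eventually_at_right_real) simp
 moreover have "\<forall>\<^sub>F s in at_right (0::real). \<forall>y\<in>I. s \<in> {0<..<(h' y - l' y) / 2}"
  by (intro eventually_ball_finite ballI eventually_at_right_real) (use lh' in auto)
 ultimately have "\<forall>\<^sub>F s in at_right 0. ph s > box_limit - eta & s \<in> {0<..<1} & (\<forall>y\<in>I. s \<in> {0<..<(h' y - l' y) / 2})"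
  by eventually_elim simp
 then obtain s where s: "ph s > box_limit - eta" "0 < s" "s < 1" and sI: "!!y. y \<in> I ==> s < (h' y - l' y) / 2"
  using eventually_happens'[OF trivial_limit_at_right_real] by fastforce
 have I0: "I ~= {}" using card_I by auto
 have R3: "\<forall>y\<in>I. \<bar>l' y\<bar> <= R & \<bar>h' y\<bar> <= R" using R(3) by blast
 obtain K T0 where K: "K >= 1" and good: "!!T x. T >= T0 ==> \<forall>e\<in>pairs I. \<bar>real_of_int (x e)\<bar> <= R * T ==> kervec_primitive x I ==>
   ~ kervec_related K x I ==> \<forall>b\<in>int_box T (%y. l' y + s) (%y. h' y - s) I. 0 <= (\<Sum>y\<in>I. b y * kervec x I y) ==>
   (1 - s) * card (int_box T (%y. l' y + s) (%y. h' y - s) I) <= row_sum T l' h' x I"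
  using row_sum_good[OF I0 R(1) R3 s(2) less_imp_le[OF s(3)] s(2)] by blast
 define prim where "prim T = {x \<in> int_box T l h (pairs I). kervec_primitive x I}" for T
 define rel where "rel T = {x \<in> int_box T l h (pairs I). kervec_related K x I}" for T
 define rhs where "rhs T = (1 - s) * (real (card (prim T)) / T ^ card (pairs I) - real (card (rel T)) / T ^ card (pairs I))
   * (real (card (int_box T (%y. l' y + s) (%y. h' y - s) I)) / T ^ card I)" for T
 have "(rhs \<longlongrightarrow> (1 - s) * (prodinf (kervec_series I) * (\<Prod>e\<in>pairs I. h e - l e) - 0) * (\<Prod>y\<in>I. (h' y - s) - (l' y + s))) at_top"
  unfolding rhs_def prim_def rel_def
 proof (intro tendsto_intros tendsto_card_kervec_primitive tendsto_card_int_box bad_rows_negligible(2)[OF card_I R(1) K R(2,3)] less_imp_le lh)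
  show "l' y + s < h' y - s" if "y \<in> I" for y using sI[OF that] by simp
 qed (auto simp: card_I)
 hence "\<forall>\<^sub>F T in at_top. rhs T > box_limit - eta" using s(1) by (auto simp: ph_def intro!: order_tendstoD)
 thus ?thesis using eventually_ge_at_top[of "max 1 T0"]
 proof eventually_elim
  case (elim T)
  hence T: "T >= 1" "T >= T0" by auto
  define bx where "bx = real (card (int_box T (%y. l' y + s) (%y. h' y - s) I))"
  define gd where "gd = prim T - rel T"
  have fin: "finite (int_box T l h (pairs I))" by (intro finite_int_box) simp
  have "(real (card (prim T)) - real (card (rel T))) * ((1 - s) * bx) <= real (card gd) * ((1 - s) * bx)" using diff_card_le_card_Diff[of "rel T" "prim T"] fin s
   by (auto simp: rel_def gd_def bx_def intro!: mult_right_mono)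
  also have "... = (\<Sum>x\<in>gd. (1 - s) * bx)" by simp
  also have "... <= (\<Sum>x\<in>gd. row_sum T l' h' x I)"
  proof (intro sum_mono)
   fix x assume x: "x \<in> gd"
   hence xb: "x \<in> int_box T l h (pairs I)" by (simp add: gd_def prim_def)
   have "\<bar>real_of_int (x e)\<bar> <= R * T" if "e \<in> pairs I" for e using int_box_subset_symmetric(2)[OF R(2) _ xb that] T by simp
   moreover have "0 <= (\<Sum>y\<in>I. b y * kervec x I y)" if b: "b \<in> int_box T (%y. l' y + s) (%y. h' y - s) I" for b
   proof (rule nonneg[OF _ xb])
    have "T * l' y <= T * (l' y + s)" "T * (h' y - s) <= T * h' y" for y using T s by auto
    thus "b \<in> int_box T l' h' I" using b unfolding int_box_iff by (meson order_trans less_le_trans)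
   qed (use T in simp)
   ultimately show "(1 - s) * bx <= row_sum T l' h' x I" unfolding bx_def using x by (intro good T) (auto simp: gd_def prim_def rel_def)
  qed
  also have "... <= box_sum T" unfolding box_sum_def by (intro sum_mono2 fin row_sum_nonneg) (auto simp: gd_def prim_def)
  finally have "(real (card (prim T)) - real (card (rel T))) * ((1 - s) * bx) / T ^ (card (pairs I) + card I) <= box_sum T / T ^ (card (pairs I) + card I)"
   using T by (intro divide_right_mono) auto
  moreover have "(real (card (prim T)) - real (card (rel T))) * ((1 - s) * bx) / T ^ (card (pairs I) + card I) = rhs T"
   unfolding rhs_def bx_def[symmetric] by (simp add: power_add diff_divide_distrib[symmetric])
  ultimately show ?case using elim by simp
 qed
qed

end

section \<open>The weighted count over boxes of skew matrices of even size\<close>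

definition skew_prime_sum :: "real => ('m::{finite,linorder} \<times> 'm => real) => ('m \<times> 'm => real) => real" where
 "skew_prime_sum T l h = (\<Sum>x\<in>int_box T l h (pairs UNIV). prime_weight (subpf x UNIV))"

lemma exists_first: "\<exists>f0::'m::{finite,linorder}. \<forall>y. f0 <= y" by (intro exI[of _ "Min UNIV"]) simp

lemma sum_int_box_first_row:
 fixes f0 :: "'m::{finite,linorder}"
 assumes f0: "\<forall>y. f0 <= y"
 defines "I \<equiv> UNIV - {f0}"
 shows "skew_prime_sum T l h = (\<Sum>x\<in>int_box T l h (pairs I). row_sum T (%y. l (f0, y)) (%y. h (f0, y)) x I)"
proof -
 define A where "A = Pair f0 ` I"
 have AB: "pairs UNIV = A \<union> pairs I" "A \<inter> pairs I = {}" using pairs_UNIV_first[OF f0] by (auto simp: A_def I_def)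
 define join where "join c a e = (if e \<in> A then a (snd e) else if e \<in> pairs I then c e else undefined)"
  for c :: "'m \<times> 'm => int" and a e
 have A_iff: "(f0, y) \<in> A \<longleftrightarrow> y \<in> I" for y by (auto simp: A_def)
 have A_snd: "e \<in> A ==> e = (f0, snd e) & snd e \<in> I" for e by (auto simp: A_def)
 have pf: "subpf (join c a) UNIV = (\<Sum>y\<in>I. a y * kervec c I y)" for c a
 proof -
  have "kervec (join c a) I y = kervec c I y" for y by (rule kervec_cong) (use AB in "auto simp: join_def")
  thus ?thesis unfolding subpf_UNIV_first_row[OF f0] I_def[symmetric] by (intro sum.cong) (auto simp: join_def A_def)
 qed
 have "(\<Sum>x\<in>int_box T l h (pairs I). row_sum T (%y. l (f0, y)) (%y. h (f0, y)) x I) =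
  (\<Sum>(c, a)\<in>int_box T l h (pairs I) \<times> int_box T (%y. l (f0, y)) (%y. h (f0, y)) I. prime_weight (subpf (join c a) UNIV))"
  unfolding row_sum_def pf by (rule sum.cartesian_product)
 also have "... = (\<Sum>x\<in>int_box T l h (pairs UNIV). prime_weight (subpf x UNIV))"
 proof (rule sum.reindex_bij_witness[where j = "%(c, a). join c a" and i = "%x. (restrict x (pairs I), restrict (%y. x (f0, y)) I)"])
  fix q assume q: "q \<in> int_box T l h (pairs I) \<times> int_box T (%y. l (f0, y)) (%y. h (f0, y)) I"
  obtain c a where ca: "q = (c, a)" "c \<in> int_box T l h (pairs I)" "a \<in> int_box T (%y. l (f0, y)) (%y. h (f0, y)) I" using q by auto
  have c: "restrict (join c a) (pairs I) = c" using ca(2) AB(2) by (auto simp: fun_eq_iff join_def int_box_def PiE_def extensional_def)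
  have a: "restrict (%y. join c a (f0, y)) I = a" using ca(3) by (auto simp: join_def A_iff int_box_def PiE_def extensional_def)
  show "(restrict ((%(c, a). join c a) q) (pairs I), restrict (%y. ((%(c, a). join c a) q) (f0, y)) I) = q" using c a by (simp add: ca(1))
  have "T * l e <= join c a e & join c a e < T * h e" if e: "e \<in> pairs UNIV" for e
  proof (cases "e \<in> A")
   case True
   hence e': "e = (f0, snd e)" "snd e \<in> I" using A_snd by auto
   show ?thesis using ca(3) e'(2) True e'(1) by (auto simp: int_box_iff join_def)
  next
   case False
   thus ?thesis using e AB ca(2) False by (auto simp: int_box_iff join_def)
  qed
  moreover have "join c a \<in> extensional (pairs UNIV)" unfolding AB(1) by (auto simp: extensional_def join_def)
  ultimately show "(%(c, a). join c a) q \<in> int_box T l h (pairs UNIV)" by (simp add: ca(1) int_box_iff)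
  show "prime_weight (subpf ((%(c, a). join c a) q) UNIV) = (case q of (c, a) => prime_weight (subpf (join c a) UNIV))" by (simp add: ca(1))
 next
  fix x assume x: "x \<in> int_box T l h (pairs (UNIV :: 'm set))"
  have "join (restrict x (pairs I)) (restrict (%y. x (f0, y)) I) e = x e" for e
  proof -
   consider "e \<in> A" | "e \<notin> A" "e \<in> pairs I" | "e \<notin> pairs UNIV" using AB by blast
   thus ?thesis
   proof cases
    case 1
    thus ?thesis using A_snd 1 by (simp add: join_def)
   next
    case 2
    thus ?thesis by (simp add: join_def)
   next
    case 3
    hence "e \<notin> A" "e \<notin> pairs I" using AB by auto
    moreover have "x e = undefined" using 3 x unfolding int_box_iff by (intro extensional_arb[of x "pairs UNIV"]) auto
    ultimately show ?thesis by (simp add: join_def)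
   qed
  qed
  thus "(%(c, a). join c a) (restrict x (pairs I), restrict (%y. x (f0, y)) I) = x" by auto
  have "(f0, y) \<in> pairs UNIV" if "y \<in> I" for y using that AB A_iff by blast
  thus "(restrict x (pairs I), restrict (%y. x (f0, y)) I) \<in> int_box T l h (pairs I) \<times> int_box T (%y. l (f0, y)) (%y. h (f0, y)) I"
   using x AB by (auto simp: int_box_iff)
 qed
 finally show ?thesis by (simp add: skew_prime_sum_def)
qed

lemma skew_prime_sum_bounds:
 fixes l h :: "'m::{finite,linorder} \<times> 'm => real"
 assumes n: "CARD('m) = 2 * n" and lh: "!!e. e \<in> pairs UNIV ==> l e < h e" and eta: "eta > 0"
 shows "\<forall>\<^sub>F T in at_top. skew_prime_sum T l h / T ^ card (pairs (UNIV :: 'm set)) <= singular_series TYPE('m) * (\<Prod>e\<in>pairs UNIV. h e - l e) + eta" (is ?g1)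
  and "(!!T x. T > 0 ==> x \<in> int_box T l h (pairs UNIV) ==> 0 <= subpf x UNIV) ==>
   \<forall>\<^sub>F T in at_top. skew_prime_sum T l h / T ^ card (pairs (UNIV :: 'm set)) >= singular_series TYPE('m) * (\<Prod>e\<in>pairs UNIV. h e - l e) - eta"
proof -
 obtain f0 :: 'm where f0: "\<forall>y. f0 <= y" using exists_first by blast
 define I where "I = UNIV - {f0}"
 have AB: "pairs UNIV = Pair f0 ` I \<union> pairs I" "Pair f0 ` I \<inter> pairs I = {}" using pairs_UNIV_first[OF f0] by (auto simp: I_def)
 have n0: "n > 0" using n by (cases n) auto
 have inj: "inj_on (Pair f0) I" by (auto simp: inj_on_def)
 have cI: "card I = Suc (2 * (n - 1))" using n n0 by (simp add: I_def)
 interpret odd_box I "n - 1" l h "%y. l (f0, y)" "%y. h (f0, y)"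
 proof
  show "card I = Suc (2 * (n - 1))" by (rule cI)
  show "l e < h e" if "e \<in> pairs I" for e using that AB by (intro lh) auto
  show "l (f0, y) < h (f0, y)" if "y \<in> I" for y using that AB by (intro lh) auto
 qed
 have D: "card (pairs (UNIV :: 'm set)) = card (pairs I) + card I" unfolding AB(1) using AB(2) by (simp add: card_Un_disjoint card_image[OF inj])
 have s: "skew_prime_sum T l h = box_sum T" for T unfolding box_sum_def sum_int_box_first_row[OF f0] I_def[symmetric] ..
 have lim: "singular_series TYPE('m) * (\<Prod>e\<in>pairs UNIV. h e - l e) = box_limit"
 proof -
  have "(\<Prod>e\<in>pairs UNIV. h e - l e) = (\<Prod>e\<in>Pair f0 ` I. h e - l e) * (\<Prod>e\<in>pairs I. h e - l e)"
   unfolding AB(1) using AB(2) by (intro prod.union_disjoint) auto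
  also have "(\<Prod>e\<in>Pair f0 ` I. h e - l e) = (\<Prod>y\<in>I. h (f0, y) - l (f0, y))" by (simp add: prod.reindex[OF inj])
  finally show ?thesis unfolding box_limit_def singular_series_eq_prodinf[OF n f0] I_def[symmetric] by simp
 qed
 show ?g1 unfolding s D lim by (rule box_sum_upper[OF eta])
 assume nn: "!!T x. T > 0 ==> x \<in> int_box T l h (pairs UNIV) ==> 0 <= subpf x UNIV"
 show "\<forall>\<^sub>F T in at_top. skew_prime_sum T l h / T ^ card (pairs (UNIV :: 'm set)) >= singular_series TYPE('m) * (\<Prod>e\<in>pairs UNIV. h e - l e) - eta"
  unfolding s D lim
 proof (rule box_sum_lower[OF eta])
  fix T x a assume T: "T > 0" and x: "x \<in> int_box T l h (pairs I)" and a: "a \<in> int_box T (%y. l (f0, y)) (%y. h (f0, y)) I"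
  define z where "z e = (if e \<in> Pair f0 ` I then a (snd e) else x e)" for e
  have "z \<in> int_box T l h (pairs UNIV)" unfolding int_box_iff
  proof (intro conjI ballI)
   show "z \<in> extensional (pairs UNIV)" using x unfolding AB(1) by (auto simp: extensional_def z_def int_box_def)
   fix e assume "e \<in> pairs (UNIV :: 'm set)"
   thus "T * l e <= z e" "z e < T * h e" using AB x a by (auto simp: int_box_iff z_def)
  qed
  hence "0 <= subpf z UNIV" by (rule nn[OF T])
  moreover have "kervec z I y = kervec x I y" for y by (rule kervec_cong) (use AB in "auto simp: z_def")
  ultimately show "0 <= (\<Sum>y\<in>I. a y * kervec x I y)" unfolding subpf_UNIV_first_row[OF f0] I_def[symmetric] by (simp add: z_def)
 qed
qed

lemma singular_series_pos:
 assumes "CARD('m::{finite,linorder}) = 2 * n"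
 shows "singular_series TYPE('m) > 0"
proof -
 obtain f0 :: 'm where f0: "\<forall>y. f0 <= y" using exists_first by blast
 have n0: "n > 0" using assms by (cases n) auto
 show ?thesis unfolding singular_series_eq_prodinf[OF assms f0] by (rule kervec_series_converges(2)[where m = "n - 1"]) (use assms n0 in auto)
qed

section \<open>Volumes and the cone over the base\<close>

definition coord_measure :: "('m::{finite,linorder} \<times> 'm => real) measure" where
 "coord_measure = Pi\<^sub>M (pairs UNIV) (%_. lborel)"

lemma space_coord_measure: "space coord_measure = extensional (pairs UNIV)" by (simp add: coord_measure_def space_PiM PiE_def)

lemma skew_of_coords_eq: "skew_of_coords = skew_mat" by (auto simp: skew_of_coords_def skew_mat_def skew_fun_def)

lemma measurable_skew_mat: "(skew_mat :: ('m::{finite,linorder} \<times> 'm => real) => _) \<in> borel_measurable coord_measure"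
proof (subst borel_measurable_euclidean_space, rule ballI)
 fix b :: "(real, 'm) sq_matrix" assume "b \<in> Basis"
 then obtain i j where b: "b = axis i (axis j 1)" by (auto simp: Basis_vec_def)
 have [measurable]: "(%x. x e) \<in> borel_measurable coord_measure" if "e \<in> pairs UNIV" for e :: "'m \<times> 'm"
  using measurable_component_singleton[OF that, of "%_. lborel"] by (simp add: coord_measure_def)
 have "(%x. skew_fun x i j) \<in> borel_measurable coord_measure" unfolding skew_fun_def by (cases "i < j"; cases "j < i") (auto simp: pairs_def)
 thus "(%x. skew_mat x \<bullet> b) \<in> borel_measurable coord_measure" by (simp add: b inner_axis skew_mat_def)
qed

lemma skew_lebesgue_eq: "skew_lebesgue = distr coord_measure borel skew_mat"
 unfolding skew_lebesgue_def coord_measure_def skew_of_coords_eq pairs_def by simp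

lemma sets_skew_lebesgue [measurable_cong, simp]: "sets skew_lebesgue = sets borel" by (simp add: skew_lebesgue_def)

interpretation lborel_prod: product_sigma_finite "%_. lborel :: real measure" by (simp add: product_sigma_finite_def sigma_finite_lborel)

lemma emeasure_coord_box:
 assumes "!!e. e \<in> pairs UNIV ==> A e \<in> sets borel"
 shows "emeasure coord_measure (PiE (pairs UNIV) A) = (\<Prod>e\<in>pairs UNIV. emeasure lborel (A e))"
 unfolding coord_measure_def using assms by (intro lborel_prod.emeasure_PiM) auto

lemma emeasure_lborel_scale:
 assumes "T > 0" "A \<in> sets borel"
 shows "ennreal T * emeasure lborel ((*) T -` A) = emeasure lborel (A :: real set)"
proof -
 have "emeasure lborel ((*) T -` A) = emeasure (distr lborel borel ((*) T)) A" using assms by (subst emeasure_distr) auto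
 also have "... = emeasure (density lborel (%_. ennreal (inverse \<bar>T\<bar>))) A" using assms by (subst lborel_distr_mult) auto
 also have "... = ennreal (inverse T) * emeasure lborel A" using assms by (subst emeasure_density) (auto simp: nn_integral_cmult_indicator)
 finally show ?thesis using assms by (simp add: mult.assoc[symmetric] ennreal_mult[symmetric])
qed

text \<open>A product measure is determined by its values on boxes, and each coordinate contributes
  one factor \<open>T\<close>.\<close>

lemma coord_measure_scale:
 assumes "T > 0"
 shows "density (distr coord_measure coord_measure (%x. restrict (%e. T * x e) (pairs UNIV)))
   (%_. ennreal (T ^ card (pairs (UNIV :: 'm::{finite,linorder} set)))) = (coord_measure :: ('m \<times> 'm => real) measure)"
  (is "density (distr _ _ ?f) _ = _")
proof -
 have meas: "?f \<in> measurable coord_measure coord_measure" unfolding coord_measure_def by measurable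
 have "density (distr coord_measure coord_measure ?f) (%_. ennreal (T ^ card (pairs (UNIV :: 'm set)))) = Pi\<^sub>M (pairs UNIV) (%_. lborel)"
 proof (rule lborel_prod.PiM_eqI)
  fix A :: "'m \<times> 'm => real set" assume A: "!!i. i \<in> pairs UNIV ==> A i \<in> sets lborel"
  have PA: "PiE (pairs UNIV) A \<in> sets coord_measure" unfolding coord_measure_def using A by simp
  have pre: "?f -` PiE (pairs UNIV) A \<inter> space coord_measure = PiE (pairs UNIV) (%e. (*) T -` A e)"
   by (auto simp: space_coord_measure PiE_def Pi_def)
  have "emeasure (density (distr coord_measure coord_measure ?f) (%_. ennreal (T ^ card (pairs (UNIV :: 'm set))))) (PiE (pairs UNIV) A)
    = ennreal (T ^ card (pairs (UNIV :: 'm set))) * emeasure (distr coord_measure coord_measure ?f) (PiE (pairs UNIV) A)"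
   using PA by (subst emeasure_density) (auto simp: nn_integral_cmult_indicator)
  also have "emeasure (distr coord_measure coord_measure ?f) (PiE (pairs UNIV) A) = (\<Prod>e\<in>pairs UNIV. emeasure lborel ((*) T -` A e))"
  proof (subst emeasure_distr[OF meas PA], subst pre, rule emeasure_coord_box)
   fix e assume "e \<in> pairs (UNIV :: 'm set)"
   hence "(*) T -` A e \<inter> space borel \<in> sets borel" using A by (intro measurable_sets[of "(*) T" borel borel]) auto
   thus "(*) T -` A e \<in> sets borel" by simp
  qed
  also have "ennreal (T ^ card (pairs (UNIV :: 'm set))) * (\<Prod>e\<in>pairs UNIV. emeasure lborel ((*) T -` A e)) =
   (\<Prod>e\<in>pairs (UNIV :: 'm set). ennreal T * emeasure lborel ((*) T -` A e))" using assms by (simp add: prod.distrib ennreal_power)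
  also have "... = (\<Prod>e\<in>pairs UNIV. emeasure lborel (A e))" using A by (intro prod.cong emeasure_lborel_scale assms) auto
  finally show "emeasure (density (distr coord_measure coord_measure ?f) (%_. ennreal (T ^ card (pairs (UNIV :: 'm set))))) (PiE (pairs UNIV) A) = (\<Prod>e\<in>pairs UNIV. emeasure lborel (A e))" .
 qed (auto simp: coord_measure_def)
 thus ?thesis by (simp add: coord_measure_def)
qed

lemma skew_mat_scale: "skew_mat (restrict (%e. T * x e) (pairs UNIV)) = T *\<^sub>R skew_mat x"
 by (auto simp: skew_mat_def skew_fun_def vec_eq_iff pairs_def)

lemma integral_skew_lebesgue_scale:
 fixes f :: "(real, 'm::{finite,linorder}) sq_matrix => real"
 assumes T: "T > 0" and f[measurable]: "f \<in> borel_measurable borel"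
 shows "(\<integral>X. f X \<partial>skew_lebesgue) = T ^ card (pairs (UNIV :: 'm set)) * (\<integral>X. f (T *\<^sub>R X) \<partial>skew_lebesgue)"
proof -
 let ?s = "%x :: 'm \<times> 'm => real. restrict (%e. T * x e) (pairs UNIV)"
 let ?D = "card (pairs (UNIV :: 'm set))"
 note [measurable] = measurable_skew_mat
 have meas [measurable]: "?s \<in> measurable coord_measure coord_measure" unfolding coord_measure_def by measurable
 have [measurable]: "(%X. f (T *\<^sub>R X)) \<in> borel_measurable borel" by measurable
 have "(\<integral>X. f X \<partial>skew_lebesgue) = (\<integral>x. f (skew_mat x) \<partial>coord_measure)"
  unfolding skew_lebesgue_eq by (rule integral_distr) measurable
 also have "... = (\<integral>x. f (skew_mat x) \<partial>density (distr coord_measure coord_measure ?s) (%_. ennreal (T ^ ?D)))"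
  by (simp only: coord_measure_scale[OF T])
 also have "... = (\<integral>x. T ^ ?D *\<^sub>R f (skew_mat x) \<partial>distr coord_measure coord_measure ?s)"
  using T by (intro integral_density) auto
 also have "... = T ^ ?D * (\<integral>x. f (skew_mat x) \<partial>distr coord_measure coord_measure ?s)" by simp
 also have "(\<integral>x. f (skew_mat x) \<partial>distr coord_measure coord_measure ?s) = (\<integral>x. f (skew_mat (?s x)) \<partial>coord_measure)"
  by (rule integral_distr) measurable
 also have "... = (\<integral>X. f (T *\<^sub>R X) \<partial>skew_lebesgue)"
  unfolding skew_mat_scale skew_lebesgue_eq by (rule integral_distr[symmetric]) measurable
 finally show ?thesis .
qed

lemma norm_skew_mat_le:
 fixes x :: "'m::{finite,linorder} \<times> 'm => real"
 assumes "!!e. e \<in> pairs UNIV ==> \<bar>x e\<bar> <= b" "b >= 0"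
 shows "norm (skew_mat x) <= (real CARD('m))\<^sup>2 * b"
proof -
 have "\<bar>skew_fun x i j\<bar> <= b" for i j using assms(1)[of "(i, j)"] assms(1)[of "(j, i)"] assms(2) by (auto simp: skew_fun_def pairs_def)
 hence row: "norm (skew_mat x $ i) <= real CARD('m) * b" for i
  by (intro order_trans[OF norm_le_l1_cart] order_trans[OF sum_bounded_above[where K = b]]) (auto simp: skew_mat_def)
 have "norm (skew_mat x) <= (\<Sum>i\<in>UNIV. norm (skew_mat x $ i))" unfolding norm_vec_def by (rule L2_set_le_sum) auto
 also have "... <= real CARD('m) * (real CARD('m) * b)" using row by (intro order_trans[OF sum_bounded_above]) auto
 finally show ?thesis by (simp add: power2_eq_square)
qed

lemma coord_le_norm_skew_mat:
 assumes "e \<in> pairs UNIV"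
 shows "\<bar>x e\<bar> <= norm (skew_mat (x :: 'm::{finite,linorder} \<times> 'm => real))"
proof -
 obtain i j where e: "e = (i, j)" by force
 show ?thesis using assms component_le_norm_cart[of "skew_mat x $ i" j] Finite_Cartesian_Product.norm_nth_le[of "skew_mat x" i]
  by (simp add: e skew_mat_def skew_fun_def pairs_def)
qed

lemma skew_mat_diff: "skew_mat x - skew_mat y = skew_mat (%e. x e - y e)" by (auto simp: skew_mat_def skew_fun_def vec_eq_iff)

section \<open>Grid cells and their measure\<close>

definition grid_index :: "nat => ('m::linorder \<times> 'm => real) => 'm \<times> 'm => int" where
 "grid_index N c = restrict (%e. \<lfloor>real N * c e\<rfloor>) (pairs UNIV)"

lemma grid_index_eq_imp_near:
 fixes c c' :: "'m::{finite,linorder} \<times> 'm => real"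
 assumes "grid_index N c = grid_index N c'" "N > 0"
 shows "dist (skew_mat c) (skew_mat c') <= (real CARD('m))\<^sup>2 * (1 / real N)" unfolding dist_norm skew_mat_diff
proof (rule norm_skew_mat_le)
 fix e assume "e \<in> pairs (UNIV :: 'm set)"
 hence "\<lfloor>real N * c e\<rfloor> = \<lfloor>real N * c' e\<rfloor>" using fun_cong[OF assms(1), of e] by (simp add: grid_index_def)
 hence "\<bar>real N * c e - real N * c' e\<bar> <= 1" by linarith
 hence "real N * \<bar>c e - c' e\<bar> <= 1" by (simp flip: right_diff_distrib)
 thus "\<bar>c e - c' e\<bar> <= 1 / real N" using assms(2) by (simp add: field_simps)
qed simp

lemma grid_cell_measure:
 fixes Z :: "('m::{finite,linorder} \<times> 'm => int) set"
 assumes N: "N > 0" and Z: "finite Z" "Z <= extensional (pairs UNIV)"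
 shows "{c \<in> space coord_measure. grid_index N c \<in> Z} \<in> sets coord_measure" (is ?g1)
  "measure coord_measure {c \<in> space coord_measure. grid_index N c \<in> Z} = real (card Z) / real N ^ card (pairs (UNIV :: 'm set))" (is ?g2)
  "emeasure coord_measure {c \<in> space coord_measure. grid_index N c \<in> Z} < \<infinity>" (is ?g3)
proof -
 define cell where "cell z = PiE (pairs UNIV) (%e. {real_of_int (z e) / real N..<(real_of_int (z e) + 1) / real N})" for z :: "'m \<times> 'm => int"
 have mem: "c \<in> cell z \<longleftrightarrow> c \<in> space coord_measure & grid_index N c = z" if "z \<in> Z" for c z
 proof -
  have fl: "\<lfloor>real N * t\<rfloor> = w \<longleftrightarrow> t \<in> {real_of_int w / real N..<(real_of_int w + 1) / real N}" for t w
   using N by (simp add: floor_eq_iff field_simps)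
  have "grid_index N c = z \<longleftrightarrow> (\<forall>e\<in>pairs UNIV. \<lfloor>real N * c e\<rfloor> = z e)"
  proof
   assume *: "\<forall>e\<in>pairs UNIV. \<lfloor>real N * c e\<rfloor> = z e"
   show "grid_index N c = z" by (rule extensionalityI[of _ "pairs UNIV"]) (use * Z that in "auto simp: grid_index_def")
  qed (auto simp: grid_index_def)
  thus ?thesis unfolding fl cell_def by (auto simp: space_coord_measure PiE_iff)
 qed
 have eq: "{c \<in> space coord_measure. grid_index N c \<in> Z} = (\<Union>z\<in>Z. cell z)" by (auto simp: mem)
 have cs: "cell z \<in> sets coord_measure" for z unfolding cell_def coord_measure_def by simp
 thus ?g1 unfolding eq by auto
 have "emeasure coord_measure (cell z) = ennreal ((1 / real N) ^ card (pairs (UNIV :: 'm set)))" for z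
 proof -
  have "emeasure coord_measure (cell z) = (\<Prod>e\<in>pairs (UNIV :: 'm set). ennreal (1 / real N))"
   unfolding cell_def using N by (subst emeasure_coord_box) (auto simp: field_simps)
  thus ?thesis by (simp add: ennreal_power)
 qed
 moreover have "emeasure coord_measure (\<Union>z\<in>Z. cell z) = (\<Sum>z\<in>Z. emeasure coord_measure (cell z))"
  using Z(1) cs mem by (intro sum_emeasure[symmetric]) (auto simp: disjoint_family_on_def)
 ultimately have em: "emeasure coord_measure {c \<in> space coord_measure. grid_index N c \<in> Z} = ennreal (real (card Z) * (1 / real N) ^ card (pairs (UNIV :: 'm set)))"
  unfolding eq by (simp add: ennreal_mult ennreal_of_nat_eq_real_of_nat)
 thus ?g2 unfolding measure_def by (simp add: power_one_over)
 show ?g3 unfolding em by simp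
qed

lemma emeasure_coord_ball_finite:
 "emeasure coord_measure {c \<in> space (coord_measure :: ('m::{finite,linorder} \<times> 'm => real) measure). norm (skew_mat c) <= R} < \<infinity>"
proof -
 have "{c \<in> space coord_measure. norm (skew_mat c) <= R} <= PiE (pairs (UNIV :: 'm set)) (%_. {- R..R})"
 proof
  fix c :: "'m \<times> 'm => real" assume c: "c \<in> {c \<in> space coord_measure. norm (skew_mat c) <= R}"
  have "c e \<in> {- R..R}" if "e \<in> pairs UNIV" for e
   using c coord_le_norm_skew_mat[OF that, of c] unfolding mem_Collect_eq atLeastAtMost_iff by linarith
  thus "c \<in> PiE (pairs (UNIV :: 'm set)) (%_. {- R..R})" using c by (auto simp: space_coord_measure PiE_iff)
 qed
 hence "emeasure coord_measure {c \<in> space (coord_measure :: ('m \<times> 'm => real) measure). norm (skew_mat c) <= R} <= emeasure coord_measure (PiE (pairs (UNIV :: 'm set)) (%_. {- R..R}))"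
  by (intro emeasure_mono) (auto simp: coord_measure_def)
 also have "... = (\<Prod>e\<in>pairs (UNIV :: 'm set). emeasure lborel {- R..R})" by (rule emeasure_coord_box) auto
 also have "... < \<infinity>" by (cases "- R <= R") (auto simp: power_less_top_ennreal)
 finally show ?thesis .
qed

text \<open>The normalised count is the measure of a union of cells of side \<open>1 / N\<close>. By
  \<open>ev\<close> its indicator converges pointwise to that of \<open>A\<close>, and the ball of
  radius \<open>R\<close> gives an integrable majorant.\<close>

lemma tendsto_grid_measure:
 fixes Z :: "nat => ('m::{finite,linorder} \<times> 'm => int) set"
 assumes Z: "!!N. N > 0 ==> finite (Z N) & Z N <= extensional (pairs UNIV)" and A: "A \<in> sets borel"
  and R: "!!N c. N > 0 ==> c \<in> space coord_measure ==> grid_index N c \<in> Z N ==> norm (skew_mat c) <= R"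
  and ev: "!!c. c \<in> space coord_measure ==> \<forall>\<^sub>F N in sequentially. grid_index N c \<in> Z N \<longleftrightarrow> skew_mat c \<in> A"
 shows "(%N. real (card (Z N)) / real N ^ card (pairs (UNIV :: 'm set))) \<longlonglongrightarrow> measure skew_lebesgue A"
proof -
 define G where "G N = {c \<in> space coord_measure. grid_index N c \<in> Z N}" for N
 define A' where "A' = skew_mat -` A \<inter> space coord_measure"
 have A'[measurable]: "A' \<in> sets coord_measure" unfolding A'_def using measurable_skew_mat A by (rule measurable_sets)
 have G: "G (Suc N) \<in> sets coord_measure" "measure coord_measure (G (Suc N)) = real (card (Z (Suc N))) / real (Suc N) ^ card (pairs (UNIV :: 'm set))" for N
  using grid_cell_measure[of "Suc N" "Z (Suc N)"] Z[of "Suc N"] unfolding G_def by auto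
 define Bd where "Bd = {c \<in> space (coord_measure :: ('m \<times> 'm => real) measure). norm (skew_mat c) <= R}"
 have Bd[measurable]: "Bd \<in> sets coord_measure" unfolding Bd_def using measurable_skew_mat by measurable
 have "(%N. \<integral>c. indicator (G (Suc N)) c \<partial>coord_measure) \<longlonglongrightarrow> (\<integral>c. indicator A' c \<partial>coord_measure :: real)"
 proof (rule integral_dominated_convergence[where w = "indicator Bd"])
  show "integrable coord_measure (indicator Bd :: _ => real)"
   by (rule integrable_real_indicator[OF Bd]) (unfold Bd_def, rule emeasure_coord_ball_finite)
  show "AE c in coord_measure. (%N. indicator (G (Suc N)) c :: real) \<longlonglongrightarrow> indicator A' c"
  proof (rule AE_I2)
   fix c :: "'m \<times> 'm => real" assume c: "c \<in> space coord_measure"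
   have "\<forall>\<^sub>F N in sequentially. grid_index (Suc N) c \<in> Z (Suc N) \<longleftrightarrow> skew_mat c \<in> A"
    using ev[OF c] by (rule eventually_sequentially_Suc[THEN iffD2])
   hence "\<forall>\<^sub>F N in sequentially. indicator (G (Suc N)) c = (indicator A' c :: real)"
    by eventually_elim (use c in "auto simp: G_def A'_def indicator_def")
   thus "(%N. indicator (G (Suc N)) c :: real) \<longlonglongrightarrow> indicator A' c" by (rule tendsto_eventually)
  qed
  show "AE c in coord_measure. norm (indicator (G (Suc N)) c :: real) <= indicator Bd c" for N
   by (rule AE_I2) (use R[of "Suc N"] in "auto simp: G_def Bd_def indicator_def")
 qed (use G in auto)
 hence "(%N. real (card (Z (Suc N))) / real (Suc N) ^ card (pairs (UNIV :: 'm set))) \<longlonglongrightarrow> measure coord_measure A'"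
  using G(1)[THEN sets.sets_into_space] by (simp add: Int_absorb2 G(2))
 moreover have "measure coord_measure A' = measure skew_lebesgue A"
  unfolding skew_lebesgue_eq A'_def by (rule measure_distr[OF measurable_skew_mat A, symmetric])
 ultimately show ?thesis by (intro LIMSEQ_imp_Suc[where f = "%N. real (card (Z N)) / real N ^ card (pairs (UNIV :: 'm set))"]) simp
qed

section \<open>Dilates and the cone of positive Pfaffian\<close>

lemma pfaffian_scaleR:
 fixes X :: "(real, 'm::{finite,linorder}) sq_matrix"
 assumes "CARD('m) = 2 * n"
 shows "pfaffian (t *\<^sub>R X) = t ^ n * pfaffian X"
proof -
 have "pf (%i j. (t *\<^sub>R X) $ i $ j) UNIV = pf (%i j. t * X $ i $ j) UNIV" by simp
 moreover have "pf (%i j. t * X $ i $ j) UNIV = t ^ n * pf (%i j. X $ i $ j) UNIV" using pf_scale[of UNIV t "%i j. X $ i $ j"] assms by simp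
 ultimately show ?thesis unfolding pfaffian_eq_pf[OF assms] by (rule trans)
qed

lemma is_skew_scaleR:
 assumes "is_skew (X :: (real, 'm::finite) sq_matrix)"
 shows "is_skew (t *\<^sub>R X)" unfolding is_skew_iff
proof (intro allI)
 fix i j
 have "X $ i $ j = - X $ j $ i" using assms unfolding is_skew_iff by blast
 thus "(t *\<^sub>R X) $ i $ j = - (t *\<^sub>R X) $ j $ i" by simp
qed

lemma dilateI: "0 <= t ==> t <= T ==> w \<in> S ==> t *\<^sub>R w \<in> dilate T S" unfolding dilate_def atLeastAtMost_iff by blast

lemma det_scaleR: "det (t *\<^sub>R X) = t ^ CARD('m) * det (X :: (real, 'm::finite) sq_matrix)"
 by (simp add: det_def prod.distrib sum_distrib_left mult_ac)

lemma continuous_on_det: "continuous_on S (det :: (real, 'm::finite) sq_matrix => real)" unfolding det_def[abs_def] by (intro continuous_intros)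

lemma continuous_on_pfaffian: "continuous_on S (pfaffian :: (real, 'm::{finite,linorder}) sq_matrix => real)"
 unfolding pfaffian_def[abs_def] by (intro continuous_intros)

text \<open>This takes the place of the identity between the determinant and the squared Pfaffian: a
  vanishing Pfaffian produces a kernel vector, which contradicts \<open>det X = 1\<close>.\<close>

lemma pfaffian_nonzero_on_V1:
 fixes X :: "(real, 'm::{finite,linorder}) sq_matrix"
 assumes n: "CARD('m) = 2 * n" and X: "X \<in> V1"
 shows "pfaffian X ~= 0"
proof
 assume "pfaffian X = 0"
 hence pf0: "pf (%i j. X $ i $ j) UNIV = 0" by (simp add: pfaffian_eq_pf[OF n])
 have skew: "!!a b. X $ b $ a = - X $ a $ b" using X unfolding V1_def is_skew_iff by blast
 have "\<exists>w. (\<exists>y\<in>UNIV. w y ~= 0) & (\<forall>i\<in>UNIV. (\<Sum>y\<in>UNIV. X $ i $ y * w y) = 0)"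
 proof (rule pf_zero_imp_kernel[where F = "%i j. X $ i $ j"])
  show "X $ b $ a = - X $ a $ b" for a b by (rule skew)
 qed (use n pf0 in auto)
 then obtain w where w: "\<exists>y. w y ~= 0" "!!i. (\<Sum>y\<in>UNIV. X $ i $ y * w y) = 0" by auto
 have "X *v (\<chi> i. w i) = 0" using w(2) by (simp add: matrix_vector_mult_def vec_eq_iff)
 moreover have "(\<chi> i. w i) ~= (0 :: (real, 'm) vec)" using w(1) by (simp add: vec_eq_iff)
 moreover have "invertible X" using X by (simp add: V1_def invertible_det_nz)
 hence "\<exists>B. B ** X = mat 1" by (auto simp: invertible_def)
 ultimately show False using matrix_left_invertible_ker by blast
qed

lemma dilate_iff: "T > 0 ==> X \<in> dilate T S \<longleftrightarrow> (1 / T) *\<^sub>R X \<in> dilate 1 S"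
proof
 assume T: "T > 0" "X \<in> dilate T S"
 then obtain t w where tw: "X = t *\<^sub>R w" "0 <= t" "t <= T" "w \<in> S" by (auto simp: dilate_def)
 hence "(1 / T) *\<^sub>R X = (t / T) *\<^sub>R w" "t / T \<in> {0..1}" using T by auto
 thus "(1 / T) *\<^sub>R X \<in> dilate 1 S" using tw(4) unfolding dilate_def by blast
next
 assume T: "T > 0" "(1 / T) *\<^sub>R X \<in> dilate 1 S"
 then obtain t w where tw: "(1 / T) *\<^sub>R X = t *\<^sub>R w" "0 <= t" "t <= 1" "w \<in> S" by (auto simp: dilate_def)
 have "X = T *\<^sub>R ((1 / T) *\<^sub>R X)" using T by simp
 also have "... = (T * t) *\<^sub>R w" unfolding tw(1) by simp
 finally have "X = (T * t) *\<^sub>R w" .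
 moreover have "T * t \<in> {0..T}" using tw T by simp
 ultimately show "X \<in> dilate T S" using tw(4) unfolding dilate_def by blast
qed

lemma compact_dilate:
 assumes "compact S"
 shows "compact (dilate T (S :: 'b::real_normed_vector set))"
proof -
 have "dilate T S = (%(t, w). t *\<^sub>R w) ` ({0..T} \<times> S)" by (auto intro!: dilateI) (force simp: dilate_def)
 moreover have "compact ((%(t, w). t *\<^sub>R w) ` ({0..T} \<times> S))"
  using assms by (intro compact_continuous_image compact_Times) (auto simp: case_prod_unfold intro!: continuous_intros)
 ultimately show ?thesis by simp
qed

lemma emeasure_skew_lebesgue_compact:
 assumes "compact (K :: (real, 'm::{finite,linorder}) sq_matrix set)"
 shows "emeasure skew_lebesgue K < \<infinity>"
proof -
 obtain R where R: "!!X. X \<in> K ==> norm X <= R" using compact_imp_bounded[OF assms] by (auto simp: bounded_iff)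
 have K: "K \<in> sets borel" using assms by (intro borel_closed compact_imp_closed)
 have "emeasure skew_lebesgue K = emeasure coord_measure (skew_mat -` K \<inter> space coord_measure)"
  unfolding skew_lebesgue_eq by (rule emeasure_distr[OF measurable_skew_mat K])
 also have "... <= emeasure coord_measure {c \<in> space (coord_measure :: ('m \<times> 'm => real) measure). norm (skew_mat c) <= R}"
  using R measurable_skew_mat[where 'm = 'm] by (intro emeasure_mono) auto
 also have "... < \<infinity>" by (rule emeasure_coord_ball_finite)
 finally show ?thesis .
qed

lemma measure_dilate:
 fixes S :: "(real, 'm::{finite,linorder}) sq_matrix set"
 assumes "compact S" "T > 0"
 shows "measure skew_lebesgue (dilate T S) = T ^ card (pairs (UNIV :: 'm set)) * measure skew_lebesgue (dilate 1 S)"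
proof -
 have b: "dilate t S \<in> sets borel" for t using assms by (intro borel_closed compact_imp_closed compact_dilate)
 have sp: "space skew_lebesgue = (UNIV :: (real, 'm) sq_matrix set)" by (simp add: skew_lebesgue_def)
 have "measure skew_lebesgue (dilate T S) = (\<integral>X. indicator (dilate T S) X \<partial>skew_lebesgue)" by (simp add: sp)
 also have "... = T ^ card (pairs (UNIV :: 'm set)) * (\<integral>X. indicator (dilate T S) (T *\<^sub>R X) \<partial>skew_lebesgue)"
  using b by (intro integral_skew_lebesgue_scale assms) auto
 also have "(%X. indicator (dilate T S) (T *\<^sub>R X) :: real) = indicator (dilate 1 S)"
  using assms dilate_iff[of T "T *\<^sub>R _" S] by (auto simp: indicator_def)
 finally show ?thesis by (simp add: sp)
qed

locale skew_cone =
 fixes n :: nat and \<Omega> :: "(real, 'm::{finite,linorder}) sq_matrix set"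
 assumes n: "n >= 2" and card_m: "CARD('m) = 2 * n"
  and compact_\<Omega>: "compact \<Omega>" and \<Omega>_V1: "\<Omega> <= V1" and nice_\<Omega>: "nice \<Omega>"
  and nonempty: "{X \<in> \<Omega>. pfaffian X > 0} ~= {}" and not_null: "~ V1_null {X \<in> \<Omega>. pfaffian X > 0}"

begin

definition pos :: "(real, 'm) sq_matrix set" where "pos = {X \<in> \<Omega>. pfaffian X > 0}"

definition vol :: real where "vol = measure skew_lebesgue (dilate 1 pos)"

abbreviation dimn :: nat where "dimn \<equiv> 2 * n\<^sup>2 - n"

lemma dimn_ge: "dimn >= 2"
proof -
 have "n * n >= 2 * n" using n by simp
 thus ?thesis using n unfolding power2_eq_square by linarith
qed

text \<open>The Pfaffian does not vanish on \<open>V1\<close>, so strict positivity on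
  \<open>\<Omega>\<close> is the closed condition of non-negativity.\<close>

lemma compact_pos: "compact pos"
proof -
 have "pos = \<Omega> \<inter> {X. 0 <= pfaffian X}" using pfaffian_nonzero_on_V1[OF card_m] \<Omega>_V1 by (force simp: pos_def)
 moreover have "closed {X :: (real, 'm) sq_matrix. 0 <= pfaffian X}" by (intro closed_Collect_le continuous_on_pfaffian continuous_on_const)
 ultimately show ?thesis using compact_\<Omega> by auto
qed

lemma pos_pfaffian_bounds:
 obtains c1 c2 where "c1 > 0" "c2 > 0" "!!X. X \<in> pos ==> c1 <= pfaffian X & pfaffian X <= c2"
proof -
 have ne: "pos ~= {}" using nonempty by (simp add: pos_def)
 obtain a where a: "a \<in> pos" "\<forall>X\<in>pos. pfaffian a <= pfaffian X"
  using continuous_attains_inf[OF compact_pos ne continuous_on_pfaffian] by blast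
 obtain b where b: "b \<in> pos" "\<forall>X\<in>pos. pfaffian X <= pfaffian b"
  using continuous_attains_sup[OF compact_pos ne continuous_on_pfaffian] by blast
 show ?thesis by (rule that[of "pfaffian a" "pfaffian b"]) (use a b in "auto simp: pos_def")
qed

lemma compact_dilate_pos: "compact (dilate T pos)" by (rule compact_dilate[OF compact_pos])

lemma dilate_pos_borel: "dilate T pos \<in> sets borel" by (intro borel_closed compact_imp_closed compact_dilate_pos)

lemma measure_dilate_pos: "T > 0 ==> measure skew_lebesgue (dilate T pos) = T ^ dimn * vol"
 unfolding vol_def by (rule measure_dilate[OF compact_pos, unfolded card_pairs_UNIV[OF card_m]])

lemma vol_pos: "vol > 0"
proof -
 have "emeasure skew_lebesgue (dilate 1 pos) ~= 0"
  using null_setsI[of skew_lebesgue "dilate 1 pos"] dilate_pos_borel[of 1] not_null[folded pos_def, unfolded V1_null_def]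
  unfolding sets_skew_lebesgue by blast
 \<comment> \<open>\<open>measure\<close> is also 0 where \<open>emeasure\<close> is infinite, so
   finiteness, from compactness, enters besides non-nullity.\<close>
 moreover have "emeasure skew_lebesgue (dilate 1 pos) ~= top" using emeasure_skew_lebesgue_compact[OF compact_dilate_pos[of 1]] by simp
 ultimately have "measure skew_lebesgue (dilate 1 pos) ~= 0" unfolding measure_def enn2real_eq_0_iff by blast
 thus ?thesis unfolding vol_def using measure_nonneg[of skew_lebesgue "dilate 1 pos"] by linarith
qed

text \<open>The radial coordinate of the cone: dividing a skew \<open>Y\<close> of positive
  determinant by it gives the point of \<open>V1\<close> on the same ray.\<close>

definition radius :: "(real, 'm) sq_matrix => real" where
 "radius Y = det Y powr (1 / (2 * n))"

lemma radius_cone: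
 assumes "t > 0" "det w = 1"
 shows "det (t *\<^sub>R w :: (real, 'm) sq_matrix) = t ^ (2 * n)" "radius (t *\<^sub>R w) = t"
proof -
 show d: "det (t *\<^sub>R w) = t ^ (2 * n)" using assms by (simp add: det_scaleR card_m)
 show "radius (t *\<^sub>R w) = t" unfolding radius_def d using assms n by (simp add: powr_powr flip: powr_realpow)
qed

text \<open>A version of the cone that is open among the skew matrices, as inner approximation by
  cells requires; \<open>nice\<close> ensures that it has the full volume.\<close>

definition inner_cone :: "(real, 'm) sq_matrix set" where
 "inner_cone = {Y. is_skew Y & 0 < det Y & det Y < 1 & 0 < pfaffian Y & (1 / radius Y) *\<^sub>R Y \<in> top_of_set V1 interior_of \<Omega>}"

lemma inner_cone_subset: "inner_cone <= dilate 1 pos"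
proof
 fix Y assume Y: "Y \<in> inner_cone"
 have d: "0 < det Y" "det Y < 1" using Y by (auto simp: inner_cone_def)
 have r: "0 < radius Y" "radius Y <= 1" unfolding radius_def using d n by (auto intro!: powr_le1)
 define w where "w = (1 / radius Y) *\<^sub>R Y"
 have "w \<in> \<Omega>" using Y interior_of_subset[of "top_of_set V1" \<Omega>] by (auto simp: inner_cone_def w_def)
 moreover have "pfaffian w > 0" using Y r by (simp add: w_def pfaffian_scaleR[OF card_m] inner_cone_def)
 ultimately have "w \<in> pos" by (simp add: pos_def)
 moreover have "Y = radius Y *\<^sub>R w" using r by (simp add: w_def)
 ultimately show "Y \<in> dilate 1 pos" using r dilateI[of "radius Y" 1 w pos] by simp
qed

text \<open>The projection to \<open>V1\<close> along rays is continuous where the determinant is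
  positive, so membership of the projection in a relatively open subset of \<open>V1\<close> is an
  open condition on skew \<open>Y\<close>.\<close>

lemma inner_cone_open: "\<exists>W. open W & inner_cone = {Y. is_skew Y} \<inter> W"
proof -
 have "openin (top_of_set V1) (top_of_set V1 interior_of \<Omega>)" by simp
 then obtain O' where O': "open O'" "top_of_set V1 interior_of \<Omega> = V1 \<inter> O'" unfolding openin_open by blast
 define W0 :: "(real, 'm) sq_matrix set" where "W0 = {Y. 0 < det Y} \<inter> {Y. det Y < 1} \<inter> {Y. 0 < pfaffian Y}"
 define g :: "(real, 'm) sq_matrix => (real, 'm) sq_matrix" where "g Y = (1 / radius Y) *\<^sub>R Y" for Y
 have "open W0" unfolding W0_def by (intro open_Int open_Collect_less continuous_on_det continuous_on_pfaffian continuous_on_const)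
 moreover have "continuous_on W0 g" unfolding g_def radius_def by (intro continuous_intros continuous_on_det) (auto simp: W0_def)
 ultimately have "open (g -` O' \<inter> W0)" using O'(1) by (simp add: continuous_on_open_vimage)
 moreover have "inner_cone = {Y. is_skew Y} \<inter> (g -` O' \<inter> W0)"
 proof -
  have "g Y \<in> V1" if Y: "is_skew Y" "Y \<in> W0" for Y
  proof -
   have d: "det Y > 0" using Y by (simp add: W0_def)
   have "is_skew (g Y)" using Y(1) unfolding g_def by (rule is_skew_scaleR)
   moreover have "det (g Y) = (1 / radius Y) ^ (2 * n) * det Y" by (simp add: g_def det_scaleR card_m)
   moreover have "radius Y ^ (2 * n) = det Y"
   proof -
    have "radius Y ^ (2 * n) = radius Y powr real (2 * n)" using d by (intro powr_realpow[symmetric]) (simp add: radius_def)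
    also have "... = det Y" unfolding radius_def powr_powr using d n by simp
    finally show ?thesis .
   qed
   ultimately show ?thesis using d by (simp add: V1_def power_one_over)
  qed
  thus ?thesis unfolding inner_cone_def O'(2) by (auto simp: g_def W0_def)
 qed
 ultimately show ?thesis by blast
qed

lemma closed_skew: "closed {Y :: (real, 'm) sq_matrix. is_skew Y}"
 unfolding is_skew_iff by (intro closed_Collect_all closed_Collect_eq continuous_intros)

lemma inner_cone_borel: "inner_cone \<in> sets borel" using inner_cone_open closed_skew by auto

text \<open>For \<open>s < 1\<close> the cone \<open>dilate s pos\<close> is covered by
  \<open>inner_cone\<close>, the null cone over the frontier of \<open>\<Omega>\<close>, and
  \<open>dilate (1 - s) pos\<close>. The last set is there to contain the apex, and its measure
  vanishes as \<open>s\<close> tends to 1.\<close>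

lemma measure_inner_cone: "measure skew_lebesgue inner_cone = vol"
proof (rule antisym)
 have fm: "A \<in> fmeasurable skew_lebesgue" if "A \<in> sets borel" "A <= dilate 1 pos" for A by (rule fmeasurableI2[of "dilate 1 pos"])
    (use that dilate_pos_borel emeasure_skew_lebesgue_compact[OF compact_dilate_pos] in "auto simp: fmeasurable_def")
 show "measure skew_lebesgue inner_cone <= vol"
  unfolding vol_def by (intro measure_mono_fmeasurable inner_cone_subset fm dilate_pos_borel) (auto simp: inner_cone_borel)
 define fr where "fr = dilate 1 (top_of_set V1 frontier_of \<Omega>)"
 have fr: "fr \<in> null_sets skew_lebesgue" using nice_\<Omega> by (simp add: nice_def V1_null_def fr_def)
 have key: "s ^ dimn * vol - (1 - s) ^ dimn * vol <= measure skew_lebesgue inner_cone" if s: "0 < s" "s < 1" for s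
 proof -
  have sub: "dilate s pos <= inner_cone \<union> fr \<union> dilate (1 - s) pos"
  proof
   fix Y assume "Y \<in> dilate s pos"
   then obtain t w where tw: "Y = t *\<^sub>R w" "0 <= t" "t <= s" "w \<in> pos" by (auto simp: dilate_def)
   show "Y \<in> inner_cone \<union> fr \<union> dilate (1 - s) pos"
   proof (cases "t = 0")
    case True
    thus ?thesis using dilateI[of 0 "1 - s" w pos] tw s by simp
   next
    case False
    hence t: "0 < t" "t < 1" using tw s by auto
    have w: "w \<in> \<Omega>" "w \<in> V1" "pfaffian w > 0" using tw \<Omega>_V1 by (auto simp: pos_def)
    show ?thesis
    proof (cases "w \<in> top_of_set V1 interior_of \<Omega>")
     case True
     have "det Y = t ^ (2 * n)" "radius Y = t" unfolding tw(1) using t w by (auto intro!: radius_cone simp: V1_def)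
     moreover have "t ^ (2 * n) < 1" using t n by (simp add: power_less_one_iff)
     moreover have "is_skew Y" using w(2) unfolding tw(1) V1_def by (auto intro: is_skew_scaleR)
     moreover have "pfaffian Y > 0" using w t by (simp add: tw(1) pfaffian_scaleR[OF card_m])
     moreover have "(1 / t) *\<^sub>R Y = w" using t by (simp add: tw(1))
     ultimately show ?thesis using True t by (simp add: inner_cone_def)
    next
     case False
     show ?thesis using w closure_of_subset[of \<Omega> "top_of_set V1"] \<Omega>_V1 False t by (auto simp: frontier_of_def tw(1) fr_def intro!: dilateI)
    qed
   qed
  qed
  have in1: "dilate (1 - s) pos <= dilate 1 pos" using s by (force simp: dilate_def)
  have inf: "inner_cone \<union> fr \<in> fmeasurable skew_lebesgue"
   using fm[OF inner_cone_borel inner_cone_subset] fmeasurableI_null_sets[OF fr] by auto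
  have f2: "dilate (1 - s) pos \<in> fmeasurable skew_lebesgue" using fm[OF dilate_pos_borel in1] .
  have "s ^ dimn * vol = measure skew_lebesgue (dilate s pos)" using measure_dilate_pos[OF s(1)] by simp
  also have "... <= measure skew_lebesgue (inner_cone \<union> fr \<union> dilate (1 - s) pos)"
   by (intro measure_mono_fmeasurable sub fmeasurable.Un inf f2) (simp add: dilate_pos_borel)
  also have "... <= measure skew_lebesgue (inner_cone \<union> fr) + measure skew_lebesgue (dilate (1 - s) pos)"
   using inf f2 by (intro measure_Un_le) auto
  also have "measure skew_lebesgue (inner_cone \<union> fr) = measure skew_lebesgue inner_cone"
   using fr inner_cone_borel by (intro measure_Un_null_set) auto
  also have "measure skew_lebesgue (dilate (1 - s) pos) = (1 - s) ^ dimn * vol" using s by (intro measure_dilate_pos) simp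
  finally show ?thesis by simp
 qed
 have ev: "\<forall>\<^sub>F s in at_left (1::real). s ^ dimn * vol - (1 - s) ^ dimn * vol <= measure skew_lebesgue inner_cone"
  using eventually_at_left_real[OF zero_less_one] by eventually_elim (rule key, auto)
 have "((%s. s ^ dimn * vol - (1 - s) ^ dimn * vol) \<longlongrightarrow> 1 ^ dimn * vol - (1 - 1) ^ dimn * vol) (at_left 1)"
  by (intro tendsto_intros)
 moreover have "(0 :: real) ^ dimn = 0" using dimn_ge by simp
 ultimately show "vol <= measure skew_lebesgue inner_cone" by (auto intro!: tendsto_upperbound[OF _ ev])
qed

end

section \<open>Approximating the cone by grid cells\<close>

lemma is_skew_skew_mat_real: "is_skew (skew_mat (x :: 'm::{finite,linorder} \<times> 'm => real))" by (rule is_skew_skew_mat)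

lemma sum_UNION_le:
 fixes f :: "'a => real"
 assumes "finite Z" "!!z. z \<in> Z ==> finite (B z)" "!!x. f x >= 0"
 shows "sum f (\<Union>z\<in>Z. B z) <= (\<Sum>z\<in>Z. sum f (B z))" using assms(1,2)
proof (induction Z rule: finite_induct)
 case (insert a Z)
 have "sum f (B a \<union> (\<Union>z\<in>Z. B z)) + sum f (B a \<inter> (\<Union>z\<in>Z. B z)) = sum f (B a) + sum f (\<Union>z\<in>Z. B z)"
  using insert by (intro sum.union_inter) auto
 moreover have "sum f (B a \<inter> (\<Union>z\<in>Z. B z)) >= 0" by (intro sum_nonneg assms(3))
 moreover have "sum f (\<Union>z\<in>Z. B z) <= (\<Sum>z\<in>Z. sum f (B z))" using insert by simp
 ultimately show ?case using insert.hyps by simp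
qed simp

lemma grid_index_extensional: "grid_index N c \<in> extensional (pairs UNIV)" by (simp add: grid_index_def)

lemma skew_mat_of_int_scale:
 "(1 / T) *\<^sub>R skew_mat (%e. real_of_int (x e)) = skew_mat (restrict (%e. real_of_int (x e) / T) (pairs UNIV))"
 by (auto simp: skew_mat_def skew_fun_def vec_eq_iff pairs_def)

lemma grid_index_int_box:
 fixes x z :: "'m::{finite,linorder} \<times> 'm => int"
 assumes "T > 0" "N > 0" "z \<in> extensional (pairs UNIV)" "x \<in> extensional (pairs UNIV)"
 shows "grid_index N (restrict (%e. real_of_int (x e) / T) (pairs UNIV)) = z \<longleftrightarrow>
  x \<in> int_box T (%e. real_of_int (z e) / N) (%e. (real_of_int (z e) + 1) / N) (pairs UNIV)"
proof -
 have fl: "\<lfloor>real N * (real_of_int a / T)\<rfloor> = b \<longleftrightarrow> T * (real_of_int b / N) <= a & a < T * ((real_of_int b + 1) / N)" for a b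
  using assms by (simp add: floor_eq_iff field_simps)
 have "grid_index N (restrict (%e. real_of_int (x e) / T) (pairs UNIV)) = z \<longleftrightarrow>
  (\<forall>e\<in>pairs UNIV. \<lfloor>real N * (real_of_int (x e) / T)\<rfloor> = z e)"
 proof
  assume *: "\<forall>e\<in>pairs UNIV. \<lfloor>real N * (real_of_int (x e) / T)\<rfloor> = z e"
  show "grid_index N (restrict (%e. real_of_int (x e) / T) (pairs UNIV)) = z"
   by (rule extensionalityI[of _ "pairs UNIV"]) (use * assms in "auto simp: grid_index_def")
 qed (auto simp: grid_index_def)
 thus ?thesis unfolding fl int_box_iff using assms(4) by simp
qed

lemma subpf_real_scale:
 fixes x :: "'m::{finite,linorder} \<times> 'm => int"
 assumes "CARD('m) = 2 * n" "T > 0"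
 shows "real_of_int (subpf x UNIV) = T ^ n * pfaffian ((1 / T) *\<^sub>R skew_mat (%e. real_of_int (x e)))" (is ?g1)
  "real_of_int (subpf x UNIV) = pfaffian (skew_mat (%e. real_of_int (x e)))" (is ?g2)
proof -
 show ?g2 by (auto simp: skew_fun_def pfaffian_skew_mat[OF assms(1)] real_of_int_pf intro!: pf_cong)
 thus ?g1 using assms(2) by (simp add: pfaffian_scaleR[OF assms(1)] power_one_over)
qed

lemma finite_grid_indices:
 assumes "!!c. c \<in> K ==> norm (skew_mat c) <= R" "N > 0"
 shows "finite (grid_index N ` (K :: ('m::{finite,linorder} \<times> 'm => real) set))"
proof (rule finite_subset)
 show "grid_index N ` K <= PiE (pairs UNIV) (%_. {\<lfloor>- (N * R)\<rfloor>..\<lfloor>N * R\<rfloor>})"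
 proof
  fix z assume "z \<in> grid_index N ` K"
  then obtain c where c: "c \<in> K" "z = grid_index N c" by blast
  have "\<lfloor>real N * c e\<rfloor> \<in> {\<lfloor>- (N * R)\<rfloor>..\<lfloor>N * R\<rfloor>}" if "e \<in> pairs UNIV" for e
  proof -
   have "\<bar>real N * c e\<bar> <= real N * R" using coord_le_norm_skew_mat[OF that, of c] assms(1)[OF c(1)] unfolding abs_mult by (simp add: mult_left_mono)
   thus ?thesis by (auto intro: floor_mono)
  qed
  thus "z \<in> PiE (pairs UNIV) (%_. {\<lfloor>- (N * R)\<rfloor>..\<lfloor>N * R\<rfloor>})" unfolding c(2) by (auto simp: grid_index_def)
 qed
 show "finite (PiE (pairs (UNIV :: 'm set)) (%_. {\<lfloor>- (N * R)\<rfloor>..\<lfloor>N * R\<rfloor>}))" by (intro finite_PiE) auto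
qed

context skew_cone

begin

definition lattice_points :: "real => ('m \<times> 'm => int) set" where
 "lattice_points T = {x \<in> extensional (pairs UNIV). skew_mat (%e. real_of_int (x e)) \<in> dilate T pos}"

definition cone_prime_sum :: "real => real" where
 "cone_prime_sum T = (\<Sum>x\<in>lattice_points T. prime_weight (subpf x UNIV))"

lemma cone_bound: obtains R where "R >= 1" "!!X. X \<in> dilate 1 pos ==> norm X <= R"
proof -
 obtain a where a: "!!X. X \<in> dilate 1 pos ==> norm X <= a" using compact_imp_bounded[OF compact_dilate_pos[of 1]] by (auto simp: bounded_iff)
 show ?thesis by (rule that[of "max 1 a"]) (use a in "auto simp: le_max_iff_disj")
qed

lemma lattice_points_iff:
 assumes "T > 0"
 shows "x \<in> lattice_points T \<longleftrightarrow> x \<in> extensional (pairs UNIV) & skew_mat (restrict (%e. real_of_int (x e) / T) (pairs UNIV)) \<in> dilate 1 pos"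
 unfolding lattice_points_def mem_Collect_eq dilate_iff[OF assms] skew_mat_of_int_scale ..

lemma lattice_points_bound:
 assumes "T > 0" "!!X. X \<in> dilate 1 pos ==> norm X <= R"
 shows "lattice_points T <= PiE (pairs UNIV) (%_. {- \<lceil>R * T\<rceil>..\<lceil>R * T\<rceil>})"
proof
 fix x assume "x \<in> lattice_points T"
 hence x: "x \<in> extensional (pairs UNIV)" "skew_mat (restrict (%e. real_of_int (x e) / T) (pairs UNIV)) \<in> dilate 1 pos"
  using lattice_points_iff[OF assms(1)] by auto
 have "x e \<in> {- \<lceil>R * T\<rceil>..\<lceil>R * T\<rceil>}" if "e \<in> pairs UNIV" for e
 proof -
  have "\<bar>real_of_int (x e) / T\<bar> <= R"
   using coord_le_norm_skew_mat[OF that, of "restrict (%e. real_of_int (x e) / T) (pairs UNIV)"] assms(2)[OF x(2)] that by simp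
  hence "\<bar>real_of_int (x e)\<bar> <= R * T" using assms(1) by (simp add: field_simps)
  thus ?thesis unfolding atLeastAtMost_iff by linarith
 qed
 thus "x \<in> PiE (pairs UNIV) (%_. {- \<lceil>R * T\<rceil>..\<lceil>R * T\<rceil>})" using x(1) by (auto simp: PiE_iff)
qed

lemma finite_lattice_points: "T > 0 ==> finite (lattice_points T)"
proof -
 assume T: "T > 0"
 obtain R where "R >= 1" "!!X. X \<in> dilate 1 pos ==> norm X <= R" using cone_bound by blast
 hence "lattice_points T <= PiE (pairs UNIV) (%_. {- \<lceil>R * T\<rceil>..\<lceil>R * T\<rceil>})" using T by (intro lattice_points_bound)
 thus ?thesis by (rule finite_subset) (intro finite_PiE finite_pairs; simp)
qed

definition outer_cells :: "nat => ('m \<times> 'm => int) set" where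
 "outer_cells N = grid_index N ` {c \<in> space coord_measure. skew_mat c \<in> dilate 1 pos}"

text \<open>The cells contained in \<open>inner_cone\<close>; restriction to the image of
  \<open>grid_index\<close> excludes indices of no cell meeting it and keeps the set finite.\<close>

definition inner_cells :: "nat => ('m \<times> 'm => int) set" where
 "inner_cells N = {z \<in> grid_index N ` {c \<in> space coord_measure. skew_mat c \<in> inner_cone}.
   \<forall>c \<in> space coord_measure. grid_index N c = z --> skew_mat c \<in> inner_cone}"

lemma cells_finite: "N > 0 ==> finite (outer_cells N)" "N > 0 ==> finite (inner_cells N)"
proof -
 obtain R where R: "R >= 1" "!!X. X \<in> dilate 1 pos ==> norm X <= R" using cone_bound by blast
 show "N > 0 ==> finite (outer_cells N)" unfolding outer_cells_def by (rule finite_grid_indices[of _ R]) (use R in auto)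
 assume N: "N > 0"
 have "finite (grid_index N ` {c \<in> space coord_measure. skew_mat c \<in> inner_cone})"
  by (rule finite_grid_indices[of _ R]) (use R inner_cone_subset N in auto)
 thus "finite (inner_cells N)" unfolding inner_cells_def by simp
qed

lemma small_eventually:
 assumes "d > 0"
 shows "\<forall>\<^sub>F N in sequentially. N > 0 & (real CARD('m))\<^sup>2 * (1 / real N) < d"
proof -
 have "\<forall>\<^sub>F N in sequentially. (real CARD('m))\<^sup>2 * (1 / real N) < d" using assms by real_asymp
 thus ?thesis using eventually_gt_at_top[of 0] by eventually_elim simp
qed

text \<open>A point outside the compact cone has positive distance from it, so fine cells around it
  miss the cone. As \<open>N >= 1\<close>, all cells in question stay in a fixed ball.\<close>

lemma tendsto_outer_cells: "(%N. real (card (outer_cells N)) / real N ^ dimn) \<longlonglongrightarrow> vol"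
proof -
 obtain R where R: "R >= 1" "!!X. X \<in> dilate 1 pos ==> norm X <= R" using cone_bound by blast
 have "(%N. real (card (outer_cells N)) / real N ^ card (pairs (UNIV :: 'm set))) \<longlonglongrightarrow> measure skew_lebesgue (dilate 1 pos)"
 proof (rule tendsto_grid_measure[where R = "R + (real CARD('m))\<^sup>2"])
  show "finite (outer_cells N) & outer_cells N <= extensional (pairs UNIV)" if "N > 0" for N
   using cells_finite(1)[OF that] by (auto simp: outer_cells_def grid_index_extensional)
  show "dilate 1 pos \<in> sets borel" by (rule dilate_pos_borel)
 next
  fix N :: nat and c assume N: "N > 0" and c: "c \<in> space coord_measure" "grid_index N c \<in> outer_cells N"
  then obtain c' where c': "grid_index N c = grid_index N c'" "skew_mat c' \<in> dilate 1 pos" by (auto simp: outer_cells_def)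
  have "dist (skew_mat c) (skew_mat c') <= (real CARD('m))\<^sup>2 * (1 / real N)" by (rule grid_index_eq_imp_near[OF c'(1) N])
  also have "... <= (real CARD('m))\<^sup>2 * 1" using N by (intro mult_left_mono) auto
  finally have "norm (skew_mat c - skew_mat c') <= (real CARD('m))\<^sup>2" by (simp add: dist_norm)
  moreover have "norm (skew_mat c) <= norm (skew_mat c') + norm (skew_mat c - skew_mat c')" by (rule norm_triangle_sub)
  ultimately show "norm (skew_mat c) <= R + (real CARD('m))\<^sup>2" using R(2)[OF c'(2)] by linarith
 next
  fix c :: "'m \<times> 'm => real" assume c: "c \<in> space coord_measure"
  show "\<forall>\<^sub>F N in sequentially. grid_index N c \<in> outer_cells N \<longleftrightarrow> skew_mat c \<in> dilate 1 pos"
  proof (cases "skew_mat c \<in> dilate 1 pos")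
   case True
   hence "grid_index N c \<in> outer_cells N" for N using c by (auto simp: outer_cells_def)
   thus ?thesis using True by simp
  next
   case False
   have "open (- dilate 1 pos)" using compact_imp_closed[OF compact_dilate_pos] by auto
   then obtain d where d: "d > 0" "ball (skew_mat c) d <= - dilate 1 pos" using False open_contains_ball by blast
   show ?thesis using small_eventually[OF d(1)]
   proof eventually_elim
    case (elim N)
    have "grid_index N c \<notin> outer_cells N"
    proof
     assume "grid_index N c \<in> outer_cells N"
     then obtain c' where c': "grid_index N c = grid_index N c'" "skew_mat c' \<in> dilate 1 pos" by (auto simp: outer_cells_def)
     have "dist (skew_mat c) (skew_mat c') < d" using grid_index_eq_imp_near[OF c'(1)] elim by force
     thus False using d(2) c'(2) by auto
    qed
    thus ?case using False by simp
   qed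
  qed
 qed
 thus ?thesis unfolding vol_def card_pairs_UNIV[OF card_m] .
qed

text \<open>Openness of \<open>inner_cone\<close> among the skew matrices puts all sufficiently fine
  cells around one of its points inside it.\<close>

lemma tendsto_inner_cells: "(%N. real (card (inner_cells N)) / real N ^ dimn) \<longlonglongrightarrow> vol"
proof -
 obtain R where R: "R >= 1" "!!X. X \<in> dilate 1 pos ==> norm X <= R" using cone_bound by blast
 have "(%N. real (card (inner_cells N)) / real N ^ card (pairs (UNIV :: 'm set))) \<longlonglongrightarrow> measure skew_lebesgue inner_cone"
 proof (rule tendsto_grid_measure[where R = R])
  show "finite (inner_cells N) & inner_cells N <= extensional (pairs UNIV)" if "N > 0" for N
   using cells_finite(2)[OF that] by (auto simp: inner_cells_def grid_index_extensional)
  show "inner_cone \<in> sets borel" by (rule inner_cone_borel)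
 next
  fix N :: nat and c assume N: "N > 0" and c: "c \<in> space coord_measure" "grid_index N c \<in> inner_cells N"
  thus "norm (skew_mat c) <= R" using inner_cone_subset unfolding inner_cells_def by (intro R(2)) auto
 next
  fix c :: "'m \<times> 'm => real" assume c: "c \<in> space coord_measure"
  show "\<forall>\<^sub>F N in sequentially. grid_index N c \<in> inner_cells N \<longleftrightarrow> skew_mat c \<in> inner_cone"
  proof (cases "skew_mat c \<in> inner_cone")
   case False
   hence "grid_index N c \<notin> inner_cells N" for N using c by (auto simp: inner_cells_def)
   thus ?thesis using False by simp
  next
   case True
   obtain W where W: "open W" "inner_cone = {Y. is_skew Y} \<inter> W" using inner_cone_open by blast
   then obtain d where d: "d > 0" "ball (skew_mat c) d <= W" using True open_contains_ball by blast
   show ?thesis using small_eventually[OF d(1)]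
   proof eventually_elim
    case (elim N)
    have "skew_mat c' \<in> inner_cone" if "grid_index N c' = grid_index N c" for c' using grid_index_eq_imp_near[OF that[symmetric]] elim d(2)
     by (auto simp: is_skew_skew_mat_real W(2))
    thus ?case using c True unfolding inner_cells_def by simp
   qed
  qed
 qed
 thus ?thesis unfolding measure_inner_cone card_pairs_UNIV[OF card_m] .
qed

abbreviation cell_sum :: "nat => ('m \<times> 'm => int) => real => real" where
 "cell_sum N z T \<equiv> skew_prime_sum T (%e. real_of_int (z e) / N) (%e. (real_of_int (z e) + 1) / N)"

lemma cell_volume:
 assumes "N > 0"
 shows "(\<Prod>e\<in>pairs (UNIV :: 'm set). (real_of_int (z e) + 1) / real N - real_of_int (z e) / real N) = 1 / real N ^ dimn"
proof -
 have "(real_of_int (z e) + 1) / real N - real_of_int (z e) / real N = 1 / real N" for e :: "'m \<times> 'm" by (simp add: add_divide_distrib)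
 thus ?thesis by (simp add: card_pairs_UNIV[OF card_m] power_one_over)
qed

text \<open>The grid size \<open>N\<close> is fixed before \<open>T\<close>, so finitely many boxes
  occur and their errors \<open>eps\<close> add up to at most \<open>eta / 2\<close>.\<close>

lemma cone_prime_sum_upper:
 assumes eta: "eta > 0"
 shows "\<forall>\<^sub>F T in at_top. cone_prime_sum T / T ^ dimn < singular_series TYPE('m) * vol + eta"
proof -
 define S where "S = singular_series TYPE('m)"
 have "(%N. S * (real (card (outer_cells N)) / real N ^ dimn)) \<longlonglongrightarrow> S * vol" by (intro tendsto_intros tendsto_outer_cells)
 hence "\<forall>\<^sub>F N in sequentially. S * (real (card (outer_cells N)) / real N ^ dimn) < S * vol + eta / 2"
  by (rule order_tendstoD) (use eta in simp)
 hence "\<forall>\<^sub>F N in sequentially. N > 0 & S * (real (card (outer_cells N)) / real N ^ dimn) < S * vol + eta / 2"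
  using eventually_gt_at_top[of 0] by eventually_elim simp
 then obtain N where N: "N > 0" "S * (real (card (outer_cells N)) / real N ^ dimn) < S * vol + eta / 2"
  using eventually_happens'[OF sequentially_bot] by blast
 define Z where "Z = outer_cells N"
 define eps where "eps = eta / (2 * (real (card Z) + 1))"
 have eps: "eps > 0" "real (card Z) * eps <= eta / 2" using eta by (auto simp: eps_def field_simps)
 have finZ: "finite Z" using cells_finite(1)[OF N(1)] by (simp add: Z_def)
 have Zext: "Z <= extensional (pairs UNIV)" by (auto simp: Z_def outer_cells_def grid_index_extensional)
 have "\<forall>\<^sub>F T in at_top. \<forall>z\<in>Z. cell_sum N z T / T ^ dimn <= S * (1 / real N ^ dimn) + eps"
 proof (intro eventually_ball_finite[OF finZ] ballI)
  fix z assume "z \<in> Z"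
  show "\<forall>\<^sub>F T in at_top. cell_sum N z T / T ^ dimn <= S * (1 / real N ^ dimn) + eps"
   using skew_prime_sum_bounds(1)[OF card_m _ eps(1), of "%e. real_of_int (z e) / N" "%e. (real_of_int (z e) + 1) / N"] N(1)
   unfolding cell_volume[OF N(1)] card_pairs_UNIV[OF card_m] S_def by (simp add: divide_strict_right_mono)
 qed
 thus ?thesis unfolding S_def[symmetric] using eventually_gt_at_top[of 0]
 proof eventually_elim
  case (elim T)
  have "lattice_points T <= (\<Union>z\<in>Z. int_box T (%e. real_of_int (z e) / N) (%e. (real_of_int (z e) + 1) / N) (pairs UNIV))"
  proof
   fix x assume "x \<in> lattice_points T"
   hence x: "x \<in> extensional (pairs UNIV)" "skew_mat (restrict (%e. real_of_int (x e) / T) (pairs UNIV)) \<in> dilate 1 pos"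
    using lattice_points_iff elim by auto
   define z where "z = grid_index N (restrict (%e. real_of_int (x e) / T) (pairs UNIV))"
   define cc where "cc = restrict (%e. real_of_int (x e) / T) (pairs (UNIV :: 'm set))"
   have zZ: "z \<in> Z" using x(2)[folded cc_def] unfolding Z_def outer_cells_def z_def cc_def[symmetric] by (simp add: space_coord_measure cc_def)
   have "x \<in> int_box T (%e. real_of_int (z e) / N) (%e. (real_of_int (z e) + 1) / N) (pairs UNIV)"
    by (rule iffD1[OF grid_index_int_box]) (use elim N x zZ Zext in "auto simp: z_def grid_index_extensional")
   thus "x \<in> (\<Union>z\<in>Z. int_box T (%e. real_of_int (z e) / N) (%e. (real_of_int (z e) + 1) / N) (pairs UNIV))" using zZ by blast
  qed
  hence "cone_prime_sum T <= (\<Sum>x\<in>(\<Union>z\<in>Z. int_box T (%e. real_of_int (z e) / N) (%e. (real_of_int (z e) + 1) / N) (pairs UNIV)). prime_weight (subpf x UNIV))"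
   unfolding cone_prime_sum_def using finZ by (intro sum_mono2) (auto simp: prime_weight_nonneg intro!: finite_int_box)
  also have "... <= (\<Sum>z\<in>Z. cell_sum N z T)"
   unfolding skew_prime_sum_def using finZ by (intro sum_UNION_le) (auto simp: prime_weight_nonneg intro!: finite_int_box)
  finally have "cone_prime_sum T / T ^ dimn <= (\<Sum>z\<in>Z. cell_sum N z T) / T ^ dimn" using elim by (intro divide_right_mono) auto
  also have "... = (\<Sum>z\<in>Z. cell_sum N z T / T ^ dimn)" by (simp add: sum_divide_distrib)
  also have "... <= (\<Sum>z\<in>Z. S * (1 / real N ^ dimn) + eps)" by (intro sum_mono) (use elim in auto)
  also have "... = S * (real (card Z) / real N ^ dimn) + real (card Z) * eps" by (simp add: algebra_simps)
  also have "... < S * vol + eta" using N(2) eps(2) unfolding Z_def by linarith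
  finally show ?case .
 qed
qed

text \<open>On cells inside \<open>inner_cone\<close> the Pfaffian is positive, which supplies the
  sign hypothesis of \<open>skew_prime_sum_bounds\<close>. The cells are disjoint and their points
  lie in the cone, so the box sums add up to at most \<open>cone_prime_sum\<close>.\<close>

lemma cone_prime_sum_lower:
 assumes eta: "eta > 0"
 shows "\<forall>\<^sub>F T in at_top. cone_prime_sum T / T ^ dimn > singular_series TYPE('m) * vol - eta"
proof -
 define S where "S = singular_series TYPE('m)"
 have "(%N. S * (real (card (inner_cells N)) / real N ^ dimn)) \<longlonglongrightarrow> S * vol" by (intro tendsto_intros tendsto_inner_cells)
 hence "\<forall>\<^sub>F N in sequentially. S * (real (card (inner_cells N)) / real N ^ dimn) > S * vol - eta / 2"
  by (rule order_tendstoD) (use eta in simp)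
 hence "\<forall>\<^sub>F N in sequentially. N > 0 & S * (real (card (inner_cells N)) / real N ^ dimn) > S * vol - eta / 2"
  using eventually_gt_at_top[of 0] by eventually_elim simp
 then obtain N where N: "N > 0" "S * (real (card (inner_cells N)) / real N ^ dimn) > S * vol - eta / 2"
  using eventually_happens'[OF sequentially_bot] by blast
 define Z where "Z = inner_cells N"
 define B where "B z T = int_box T (%e. real_of_int (z e) / N) (%e. (real_of_int (z e) + 1) / N) (pairs (UNIV :: 'm set))" for z :: "'m \<times> 'm => int" and T
 define eps where "eps = eta / (2 * (real (card Z) + 1))"
 have eps: "eps > 0" "real (card Z) * eps <= eta / 2" using eta by (auto simp: eps_def field_simps)
 have finZ: "finite Z" using cells_finite(2)[OF N(1)] by (simp add: Z_def)
 have Zext: "Z <= extensional (pairs UNIV)" by (auto simp: Z_def inner_cells_def grid_index_extensional)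
 have Bidx: "grid_index N (restrict (%e. real_of_int (x e) / T) (pairs UNIV)) = z" if "z \<in> Z" "x \<in> B z T" "T > 0" for z x T
  by (rule iffD2[OF grid_index_int_box]) (use that N Zext in "auto simp: B_def int_box_iff")
 have Bin: "skew_mat (restrict (%e. real_of_int (x e) / T) (pairs UNIV)) \<in> inner_cone" if "z \<in> Z" "x \<in> B z T" "T > 0" for z x T
  using that(1) Bidx[OF that] unfolding Z_def inner_cells_def by (auto simp: space_coord_measure)
 have "\<forall>\<^sub>F T in at_top. \<forall>z\<in>Z. cell_sum N z T / T ^ dimn >= S * (1 / real N ^ dimn) - eps"
 proof (intro eventually_ball_finite[OF finZ] ballI)
  fix z assume z: "z \<in> Z"
  have nn: "0 <= subpf x UNIV" if T: "T > 0" and x: "x \<in> int_box T (%e. real_of_int (z e) / N) (%e. (real_of_int (z e) + 1) / N) (pairs UNIV)" for T x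
  proof -
   have "0 < real_of_int (subpf x UNIV)" using Bin[OF z _ T] x T unfolding B_def subpf_real_scale(1)[OF card_m T] skew_mat_of_int_scale by (auto simp: inner_cone_def)
   thus ?thesis by simp
  qed
  show "\<forall>\<^sub>F T in at_top. cell_sum N z T / T ^ dimn >= S * (1 / real N ^ dimn) - eps"
  proof -
   have "\<forall>\<^sub>F T in at_top. cell_sum N z T / T ^ card (pairs (UNIV :: 'm set)) >=
    singular_series TYPE('m) * (\<Prod>e\<in>pairs (UNIV :: 'm set). (real_of_int (z e) + 1) / real N - real_of_int (z e) / real N) - eps"
    by (rule skew_prime_sum_bounds(2)[OF card_m _ eps(1)]) (use nn N(1) in "auto simp: divide_strict_right_mono")
   thus ?thesis unfolding S_def cell_volume[OF N(1)] card_pairs_UNIV[OF card_m] .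
  qed
 qed
 thus ?thesis unfolding S_def[symmetric] using eventually_gt_at_top[of 0]
 proof eventually_elim
  case (elim T)
  hence T: "T > 0" by simp
  have "S * vol - eta < S * (real (card Z) / real N ^ dimn) - real (card Z) * eps" using N(2) eps(2) unfolding Z_def by linarith
  also have "... = (\<Sum>z\<in>Z. S * (1 / real N ^ dimn) - eps)" by (simp add: algebra_simps)
  also have "... <= (\<Sum>z\<in>Z. cell_sum N z T / T ^ dimn)" by (intro sum_mono) (use elim in auto)
  also have "... = (\<Sum>z\<in>Z. cell_sum N z T) / T ^ dimn" by (simp add: sum_divide_distrib)
  also have "(\<Sum>z\<in>Z. cell_sum N z T) = (\<Sum>x\<in>(\<Union>z\<in>Z. B z T). prime_weight (subpf x UNIV))"
   unfolding skew_prime_sum_def B_def[symmetric]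
  proof (rule sum.UNION_disjoint[symmetric, OF finZ])
   show "\<forall>z\<in>Z. finite (B z T)" unfolding B_def by (auto intro!: finite_int_box)
   show "\<forall>z\<in>Z. \<forall>z'\<in>Z. z ~= z' --> B z T \<inter> B z' T = {}" using Bidx T by blast
  qed
  also have "... <= cone_prime_sum T" unfolding cone_prime_sum_def
  proof (intro sum_mono2 finite_lattice_points T)
   show "(\<Union>z\<in>Z. B z T) <= lattice_points T"
   proof
    fix x assume "x \<in> (\<Union>z\<in>Z. B z T)"
    then obtain z where z: "z \<in> Z" "x \<in> B z T" by blast
    thus "x \<in> lattice_points T" using Bin[OF z T] inner_cone_subset unfolding lattice_points_iff[OF T] by (auto simp: B_def int_box_iff)
   qed
  qed (simp add: prime_weight_nonneg)
  finally show ?case using T by (simp add: divide_right_mono)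
 qed
qed

lemma tendsto_cone_prime_sum: "((%T. cone_prime_sum T / T ^ dimn) \<longlongrightarrow> singular_series TYPE('m) * vol) at_top"
proof (rule order_tendstoI)
 fix a assume "a < singular_series TYPE('m) * vol"
 thus "\<forall>\<^sub>F T in at_top. a < cone_prime_sum T / T ^ dimn" using cone_prime_sum_lower[of "singular_series TYPE('m) * vol - a"] by simp
next
 fix a assume "singular_series TYPE('m) * vol < a"
 thus "\<forall>\<^sub>F T in at_top. cone_prime_sum T / T ^ dimn < a" using cone_prime_sum_upper[of "a - singular_series TYPE('m) * vol"] by simp
qed

end

section \<open>Reduction to matrices with positive Pfaffian\<close>

lemma real_matrix_skew_mat: "real_matrix (skew_mat x) = skew_mat (%e. real_of_int (x e))"
 by (auto simp: real_matrix_def skew_mat_def skew_fun_def vec_eq_iff)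

lemma pfaffian_dilate_pos:
 fixes \<Omega> :: "(real, 'm::{finite,linorder}) sq_matrix set"
 assumes "CARD('m) = 2 * n" "X \<in> dilate T \<Omega>" "pfaffian X > 0"
 shows "X \<in> dilate T {X \<in> \<Omega>. pfaffian X > 0}"
proof -
 obtain t w where tw: "X = t *\<^sub>R w" "0 <= t" "t <= T" "w \<in> \<Omega>" using assms(2) by (auto simp: dilate_def)
 show ?thesis using assms(3) tw(2) tw by (auto simp: tw(1) pfaffian_scaleR[OF assms(1)] zero_less_mult_iff intro!: dilateI)
qed

lemma dilate_mono: "S <= S' ==> dilate T S <= dilate T S'" unfolding dilate_def by blast

text \<open>A prime integer is positive and the sign of the Pfaffian is constant along open rays
  from the origin, so only the part of \<open>\<Omega>\<close> with positive Pfaffian can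
  contribute.\<close>

lemma prime_count_coords:
 fixes \<Omega> :: "(real, 'm::{finite,linorder}) sq_matrix set"
 assumes m: "CARD('m) = 2 * n"
 shows "prime_count T \<Omega> = card {x \<in> extensional (pairs UNIV). skew_mat (%e. real_of_int (x e)) \<in> dilate T {X \<in> \<Omega>. pfaffian X > 0} & prime (subpf x UNIV)}"
 unfolding prime_count_def
proof (rule bij_betw_same_card[of upper_coords], rule bij_betwI[where g = skew_mat])
 let ?A = "{A :: (int, 'm) sq_matrix. is_skew A & real_matrix A \<in> dilate T \<Omega> & prime (pfaffian A)}"
 let ?X = "{x \<in> extensional (pairs UNIV). skew_mat (%e. real_of_int (x e)) \<in> dilate T {X \<in> \<Omega>. pfaffian X > 0} & prime (subpf x UNIV)}"
 show "upper_coords \<in> ?A \<rightarrow> ?X"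
 proof
  fix A :: "(int, 'm) sq_matrix" assume A: "A \<in> ?A"
  define x where "x = upper_coords A"
  have Ax: "A = skew_mat x" using A by (simp add: x_def skew_mat_upper_coords)
  have "pfaffian A = subpf x UNIV" using pfaffian_skew_mat[OF m, of x] unfolding Ax[symmetric] .
  hence pr: "prime (subpf x UNIV)" using A by simp
  have "pfaffian (skew_mat (%e. real_of_int (x e))) > 0" using prime_gt_0_int[OF pr] by (simp flip: subpf_real_scale(2)[OF m zero_less_one])
  moreover have "skew_mat (%e. real_of_int (x e)) = real_matrix A" using real_matrix_skew_mat[of x] unfolding Ax[symmetric] by simp
  hence "skew_mat (%e. real_of_int (x e)) \<in> dilate T \<Omega>" using A by simp
  ultimately have "skew_mat (%e. real_of_int (x e)) \<in> dilate T {X \<in> \<Omega>. pfaffian X > 0}" by (intro pfaffian_dilate_pos[OF m])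
  moreover have "x \<in> extensional (pairs UNIV)" by (simp add: x_def upper_coords_def)
  ultimately show "upper_coords A \<in> ?X" using pr unfolding x_def by simp
 qed
 show "skew_mat \<in> ?X \<rightarrow> ?A" using dilate_mono[of "{X \<in> \<Omega>. pfaffian X > 0}" \<Omega> T]
  by (auto simp: is_skew_skew_mat real_matrix_skew_mat pfaffian_skew_mat[OF m])
qed (auto simp: upper_coords_skew_mat skew_mat_upper_coords)

text \<open>The real value of \<open>1 / log_plus u\<close>, with
  \<open>1 / \<infinity> = 0\<close>.\<close>

definition inv_log :: "real => real" where
 "inv_log u = (if u > 0 then 1 / max 2 (ln u) else 0)"

lemma real_of_ereal_log_plus: "real_of_ereal (1 / log_plus u) = inv_log u"
proof (cases "u > 0")
 case True
 define r where "r = max 2 (ln u)"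
 have "r ~= 0" by (auto simp: r_def)
 moreover have "log_plus u = ereal r" using True unfolding log_plus_def r_def by simp
 moreover have "inv_log u = 1 / r" using True by (simp add: inv_log_def r_def)
 ultimately show ?thesis by (simp add: one_ereal_def)
qed (simp add: log_plus_def inv_log_def)

lemma inv_log_bounds:
 "0 <= inv_log u" "inv_log u <= 1 / 2"
 "0 < u ==> u <= M ==> 2 <= ln M ==> 1 / ln M <= inv_log u"
 "0 < M ==> M <= u ==> 2 <= ln M ==> inv_log u <= 1 / ln M"
proof -
 show "0 <= inv_log u" by (auto simp: inv_log_def)
 show "inv_log u <= 1 / 2" by (auto simp: inv_log_def)
 show "1 / ln M <= inv_log u" if "0 < u" "u <= M" "2 <= ln M" using that by (auto simp: inv_log_def intro!: frac_le)
 show "inv_log u <= 1 / ln M" if "0 < M" "M <= u" "2 <= ln M"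
 proof -
  have "ln M <= ln u" using that by simp
  hence "ln M <= max 2 (ln u)" "0 < ln M" using that by linarith+
  thus ?thesis using that by (auto simp: inv_log_def intro!: frac_le order_refl zero_le_one)
 qed
qed

lemma inv_log_measurable [measurable]: "inv_log \<in> borel_measurable borel" unfolding inv_log_def by measurable

lemma log_integral_pos:
 fixes \<Omega> :: "(real, 'm::{finite,linorder}) sq_matrix set"
 assumes "CARD('m) = 2 * n"
 shows "(LINT x:dilate T \<Omega>|skew_lebesgue. real_of_ereal (1 / log_plus (pfaffian x))) =
  (\<integral>x. indicator (dilate T {X \<in> \<Omega>. pfaffian X > 0}) x * inv_log (pfaffian x) \<partial>skew_lebesgue)"
proof -
 have eq: "indicator (dilate T \<Omega>) x * inv_log (pfaffian x) =
  (indicator (dilate T {X \<in> \<Omega>. pfaffian X > 0}) x * inv_log (pfaffian x) :: real)" for x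
 proof (cases "pfaffian x > 0")
  case True
  thus ?thesis using pfaffian_dilate_pos[OF assms _ True] dilate_mono[of "{X \<in> \<Omega>. pfaffian X > 0}" \<Omega> T] by force
 qed (simp add: inv_log_def)
 show ?thesis unfolding set_lebesgue_integral_def real_of_ereal_log_plus real_scaleR_def eq ..
qed

section \<open>Removing the logarithmic weight\<close>

context skew_cone

begin

definition num :: "real => nat" where
 "num T = card {x \<in> lattice_points T. prime (subpf x UNIV)}"

definition log_integral :: "real => real" where
 "log_integral T = (\<integral>x. indicator (dilate T pos) x * inv_log (pfaffian x) \<partial>skew_lebesgue)"

text \<open>Along rays the Pfaffian is homogeneous of degree \<open>n\<close>, so its bounds on
  \<open>pos\<close> extend to the cone; a point outside \<open>dilate s pos\<close> has radius
  above \<open>s\<close>.\<close>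

lemma pfaffian_dilate_bounds:
 assumes c: "!!X. X \<in> pos ==> c1 <= pfaffian X & pfaffian X <= c2" "c1 > 0" "X \<in> dilate T pos"
 shows "pfaffian X <= c2 * T ^ n" "0 <= s ==> X \<notin> dilate s pos ==> c1 * s ^ n <= pfaffian X & 0 < pfaffian X"
proof -
 obtain t w where tw: "X = t *\<^sub>R w" "0 <= t" "t <= T" "w \<in> pos" using c(3) by (auto simp: dilate_def)
 have w: "c1 <= pfaffian w" "pfaffian w <= c2" using c(1) tw(4) by auto
 have X: "pfaffian X = pfaffian w * t ^ n" by (simp add: tw(1) pfaffian_scaleR[OF card_m])
 show "pfaffian X <= c2 * T ^ n" unfolding X using w tw c(2) by (intro mult_mono power_mono) auto
 assume s: "0 <= s" "X \<notin> dilate s pos"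
 hence "s < t" using dilateI[of t s w pos] tw by force
 thus "c1 * s ^ n <= pfaffian X & 0 < pfaffian X" unfolding X using w c(2) s(1) by (auto intro!: mult_mono power_mono)
qed

text \<open>Both logarithms are asymptotic to \<open>n * ln T\<close>, since
  \<open>ln (ln T)\<close> is negligible. The last limit, where \<open>dimn >= 2\<close> enters,
  makes a cone of radius \<open>T / ln T\<close> negligible on the scale
  \<open>T ^ dimn / ln T\<close>.\<close>

lemma log_limits:
 assumes "c > 0"
 shows "((%T. ln T / ln (c * T ^ n)) \<longlongrightarrow> 1 / n) at_top" (is ?g1)
  "((%T. ln T / ln (c * (T / ln T) ^ n)) \<longlongrightarrow> 1 / n) at_top" (is ?g2)
  "\<forall>\<^sub>F T in at_top. 2 <= ln (c * T ^ n)" (is ?g3) "\<forall>\<^sub>F T in at_top. 2 <= ln (c * (T / ln T) ^ n)" (is ?g4)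
  "((%T::real. (1 / ln T) ^ dimn * ln T) \<longlongrightarrow> 0) at_top" (is ?g5)
proof -
 have n0: "real n > 0" using n by simp
 have e1: "\<forall>\<^sub>F T::real in at_top. ln T / ln (c * T ^ n) = 1 / (ln c / ln T + real n)" using eventually_gt_at_top[of 1]
 proof eventually_elim
  case (elim T)
  hence "ln (c * T ^ n) = ln c + real n * ln T" using assms by (simp add: ln_mult ln_realpow)
  also have "... = ln T * (ln c / ln T + real n)" using elim by (simp add: field_simps)
  finally show ?case using elim by simp
 qed
 have "((%T::real. 1 / (ln c / ln T + real n)) \<longlongrightarrow> 1 / (0 + real n)) at_top"
  by (intro tendsto_intros) (use n0 in "real_asymp | simp")+
 thus ?g1 using e1 by (subst tendsto_cong) auto
 have e2: "\<forall>\<^sub>F T::real in at_top. ln (c * (T / ln T) ^ n) = ln c + real n * (ln T - ln (ln T))" using eventually_gt_at_top[of 1]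
 proof eventually_elim
  case (elim T)
  thus ?case using assms by (simp add: ln_mult ln_realpow ln_div)
 qed
 have e3: "\<forall>\<^sub>F T::real in at_top. ln T / ln (c * (T / ln T) ^ n) = 1 / (ln c / ln T + real n * (1 - ln (ln T) / ln T))"
  using e2 eventually_gt_at_top[of 1]
 proof eventually_elim
  case (elim T)
  show ?case using elim by (simp add: field_simps)
 qed
 have "((%T::real. 1 / (ln c / ln T + real n * (1 - ln (ln T) / ln T))) \<longlongrightarrow> 1 / (0 + real n * (1 - 0))) at_top"
  by (intro tendsto_intros) (use n0 in "real_asymp | simp")+
 thus ?g2 using e3 by (subst tendsto_cong) auto
 have "\<forall>\<^sub>F T::real in at_top. (2 - ln c) / real n <= ln T - ln (ln T)" by real_asymp
 thus ?g4 using e2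
 proof eventually_elim
  case (elim T)
  thus ?case using n0 elim by (simp add: divide_le_eq mult.commute)
 qed
 have "\<forall>\<^sub>F T::real in at_top. (2 - ln c) / real n <= ln T" by real_asymp
 thus ?g3 using eventually_gt_at_top[of 1]
 proof eventually_elim
  case (elim T)
  hence "2 - ln c <= real n * ln T" using n0 by (simp add: divide_le_eq mult.commute)
  moreover have "ln (c * T ^ n) = ln c + real n * ln T" using assms elim by (simp add: ln_mult ln_realpow)
  ultimately show ?case by simp
 qed
 have lim0: "((%T::real. 1 / ln T) \<longlongrightarrow> 0) at_top" by real_asymp
 have z: "(0::real) ^ (dimn - 1) = 0" using dimn_ge by (simp add: power_0_left)
 have pw: "((%T::real. (1 / ln T) ^ (dimn - 1)) \<longlongrightarrow> 0) at_top" using tendsto_power[OF lim0, of "dimn - 1"] unfolding z .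
 have "\<forall>\<^sub>F T::real in at_top. (1 / ln T) ^ dimn * ln T = (1 / ln T) ^ (dimn - 1)" using eventually_gt_at_top[of 1]
 proof eventually_elim
  case (elim T)
  have "(1 / ln T) ^ dimn = (1 / ln T) ^ (dimn - 1) * (1 / ln T)" using dimn_ge by (metis power_minus_mult less_le_trans pos2)
  thus ?case using elim by simp
 qed
 thus ?g5 by (rule iffD2[OF tendsto_cong pw])
qed

text \<open>The cut is at radius \<open>T / ln T\<close>: inside, a trivial bound is of lower order
  than \<open>T ^ dimn / ln T\<close>; outside, the logarithm of the Pfaffian lies between
  \<open>ln (c1 * (T / ln T) ^ n)\<close> and \<open>ln (c2 * T ^ n)\<close>, which have the same
  asymptotics. The count and the integral both have this shape.\<close>

lemma log_sandwich:
 assumes c: "c1 > 0" "c2 > 0" and A: "((%T. A T / T ^ dimn) \<longlongrightarrow> L) at_top"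
  and lo: "\<forall>\<^sub>F T in at_top. A T / ln (c2 * T ^ n) - K * (T / ln T) ^ dimn <= f T"
  and up: "\<forall>\<^sub>F T in at_top. f T <= A T / ln (c1 * (T / ln T) ^ n) + K * (T / ln T) ^ dimn"
 shows "((%T. f T * ln T / T ^ dimn) \<longlongrightarrow> L / n) at_top"
proof (rule tendsto_sandwich)
 let ?e = "%T::real. K * ((1 / ln T) ^ dimn * ln T)"
 have e: "K * (T / ln T) ^ dimn * (ln T / T ^ dimn) = ?e T" if "T > 1" for T using that by (simp add: power_divide)
 show "\<forall>\<^sub>F T in at_top. A T / T ^ dimn * (ln T / ln (c2 * T ^ n)) - ?e T <= f T * ln T / T ^ dimn" using lo eventually_gt_at_top[of 1]
 proof eventually_elim
  case (elim T)
  hence "(A T / ln (c2 * T ^ n) - K * (T / ln T) ^ dimn) * (ln T / T ^ dimn) <= f T * (ln T / T ^ dimn)" by (intro mult_right_mono) auto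
  thus ?case unfolding left_diff_distrib e[OF elim(2)] by (simp add: mult_ac)
 qed
 show "\<forall>\<^sub>F T in at_top. f T * ln T / T ^ dimn <= A T / T ^ dimn * (ln T / ln (c1 * (T / ln T) ^ n)) + ?e T"
  using up eventually_gt_at_top[of 1]
 proof eventually_elim
  case (elim T)
  hence "f T * (ln T / T ^ dimn) <= (A T / ln (c1 * (T / ln T) ^ n) + K * (T / ln T) ^ dimn) * (ln T / T ^ dimn)" by (intro mult_right_mono) auto
  thus ?case unfolding distrib_right e[OF elim(2)] by (simp add: mult_ac)
 qed
 have "((%T. A T / T ^ dimn * (ln T / ln (c2 * T ^ n)) - ?e T) \<longlongrightarrow> L * (1 / n) - K * 0) at_top"
  by (intro tendsto_diff tendsto_mult tendsto_const A log_limits(1)[OF c(2)] log_limits(5)[OF c(1)])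
 thus "((%T. A T / T ^ dimn * (ln T / ln (c2 * T ^ n)) - ?e T) \<longlongrightarrow> L / n) at_top" by simp
 have "((%T. A T / T ^ dimn * (ln T / ln (c1 * (T / ln T) ^ n)) + ?e T) \<longlongrightarrow> L * (1 / n) + K * 0) at_top"
  by (intro tendsto_add tendsto_mult tendsto_const A log_limits(2)[OF c(1)] log_limits(5)[OF c(1)])
 thus "((%T. A T / T ^ dimn * (ln T / ln (c1 * (T / ln T) ^ n)) + ?e T) \<longlongrightarrow> L / n) at_top" by simp
qed

text \<open>Lattice points up to radius \<open>s = T / ln T\<close> are counted trivially by
  \<open>(5 * R * s) ^ dimn\<close>, hence the constant \<open>K\<close>. For the others the weight
  of a prime is at least \<open>ln (c1 * s ^ n)\<close>.\<close>

lemma tendsto_num: "((%T. real (num T) * ln T / T ^ dimn) \<longlongrightarrow> singular_series TYPE('m) * vol / n) at_top"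
proof -
 obtain c1 c2 where c: "c1 > 0" "c2 > 0" "!!X. X \<in> pos ==> c1 <= pfaffian X & pfaffian X <= c2" using pos_pfaffian_bounds by blast
 obtain R where R: "R >= 1" "!!X. X \<in> dilate 1 pos ==> norm X <= R" using cone_bound by blast
 define P where "P T = {x \<in> lattice_points T. prime (subpf x UNIV)}" for T
 have sum_P: "cone_prime_sum T = (\<Sum>x\<in>P T. ln (real_of_int (subpf x UNIV)))" if "T > 0" for T
  unfolding cone_prime_sum_def P_def using finite_lattice_points[OF that] by (intro sum.mono_neutral_cong_right) (auto simp: prime_weight_def)
 have pfP: "real_of_int (subpf x UNIV) = pfaffian (skew_mat (%e. real_of_int (x e)))" for x :: "'m \<times> 'm => int"
  by (rule subpf_real_scale(2)[OF card_m zero_less_one])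
 have dil: "skew_mat (%e. real_of_int (x e)) \<in> dilate T pos" if "x \<in> P T" for x T using that by (simp add: P_def lattice_points_def)
 show ?thesis
 proof (rule log_sandwich[OF c(1,2) tendsto_cone_prime_sum, where K = "(5 * R) ^ dimn"])
  show "\<forall>\<^sub>F T in at_top. cone_prime_sum T / ln (c2 * T ^ n) - (5 * R) ^ dimn * (T / ln T) ^ dimn <= real (num T)"
   using log_limits(3)[OF c(2)] eventually_gt_at_top[of 1]
  proof eventually_elim
   case (elim T)
   have "cone_prime_sum T <= (\<Sum>x\<in>P T. ln (c2 * T ^ n))" unfolding sum_P[of T, OF less_trans[OF zero_less_one elim(2)]]
   proof (intro sum_mono)
    fix x assume x: "x \<in> P T"
    have "real_of_int (subpf x UNIV) <= c2 * T ^ n" unfolding pfP by (rule pfaffian_dilate_bounds(1)[OF c(3) c(1) dil[OF x]])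
    moreover have "real_of_int (subpf x UNIV) > 0" using x prime_gt_0_int by (auto simp: P_def)
    ultimately show "ln (real_of_int (subpf x UNIV)) <= ln (c2 * T ^ n)" by simp
   qed
   also have "... = real (num T) * ln (c2 * T ^ n)" by (simp add: num_def P_def)
   finally have "cone_prime_sum T / ln (c2 * T ^ n) <= real (num T)" using elim by (simp add: divide_le_eq)
   moreover have "0 <= (5 * R) ^ dimn * (T / ln T) ^ dimn" using elim R(1) by simp
   ultimately show ?case by linarith
  qed
  show "\<forall>\<^sub>F T in at_top. real (num T) <= cone_prime_sum T / ln (c1 * (T / ln T) ^ n) + (5 * R) ^ dimn * (T / ln T) ^ dimn"
  proof -
   have "\<forall>\<^sub>F T::real in at_top. T / ln T >= 1" by real_asymp
   thus ?thesis using log_limits(4)[OF c(1)] eventually_gt_at_top[of 1]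
   proof eventually_elim
    case (elim T)
    define s where "s = T / ln T"
    have s: "s >= 1" "2 <= ln (c1 * s ^ n)" using elim by (auto simp: s_def)
    have T: "T > 1" using elim by simp
    have finP: "finite (P T)" using finite_lattice_points[of T] T by (simp add: P_def)
    have "card (lattice_points s) <= card (PiE (pairs (UNIV :: 'm set)) (%_. {- \<lceil>R * s\<rceil>..\<lceil>R * s\<rceil>}))"
     using s(1) R(2) by (intro card_mono lattice_points_bound finite_PiE) auto
    also have "... = card {- \<lceil>R * s\<rceil>..\<lceil>R * s\<rceil>} ^ dimn" by (simp add: card_PiE card_pairs_UNIV[OF card_m])
    finally have "real (card (lattice_points s)) <= real (card {- \<lceil>R * s\<rceil>..\<lceil>R * s\<rceil>} ^ dimn)" by simp
    also have "... = real (card {- \<lceil>R * s\<rceil>..\<lceil>R * s\<rceil>}) ^ dimn" by simp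
    also have "... <= (5 * R * s) ^ dimn"
    proof (intro power_mono)
     have "R * s >= 1" using R(1) s(1) by (simp add: mult_ge1_I)
     thus "real (card {- \<lceil>R * s\<rceil>..\<lceil>R * s\<rceil>}) <= 5 * R * s" by simp linarith
    qed simp
    finally have small: "real (card (lattice_points s)) <= (5 * R * s) ^ dimn" .
    define Q where "Q = P T - lattice_points s"
    have "real (card Q) * ln (c1 * s ^ n) = (\<Sum>x\<in>Q. ln (c1 * s ^ n))" by simp
    also have "... <= (\<Sum>x\<in>Q. ln (real_of_int (subpf x UNIV)))"
    proof (intro sum_mono)
     fix x assume x: "x \<in> Q"
     hence "c1 * s ^ n <= real_of_int (subpf x UNIV)" using pfaffian_dilate_bounds(2)[OF c(3) c(1) dil[of x T], of s] x s unfolding pfP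
      by (auto simp: Q_def P_def lattice_points_def)
     moreover have "c1 * s ^ n > 0" using c s by simp
     ultimately show "ln (c1 * s ^ n) <= ln (real_of_int (subpf x UNIV))" by simp
    qed
    also have "... <= (\<Sum>x\<in>P T. ln (real_of_int (subpf x UNIV)))"
    proof (rule sum_mono2[OF finP])
     fix x assume "x \<in> P T - Q"
     thus "0 <= ln (real_of_int (subpf x UNIV))" using prime_ge_1_int by (auto simp: P_def)
    qed (auto simp: Q_def)
    also have "... = cone_prime_sum T" using sum_P[of T] T by simp
    finally have "real (card Q) <= cone_prime_sum T / ln (c1 * s ^ n)" using s by (simp add: le_divide_eq)
    moreover have "real (num T) <= real (card Q) + real (card (lattice_points s))"
    proof -
     have "card (P T) <= card (Q \<union> lattice_points s)" using finP finite_lattice_points[of s] s by (intro card_mono) (auto simp: Q_def)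
     also have "... <= card Q + card (lattice_points s)" by (rule card_Un_le)
     finally show ?thesis by (simp add: num_def P_def)
    qed
    ultimately show ?case using small unfolding s_def[symmetric] by (simp add: power_mult_distrib)
   qed
  qed
 qed
qed

text \<open>The same sandwich as for \<open>num\<close>, with volume in place of the weighted count.
  The two limits therefore differ exactly by the factor \<open>singular_series\<close>.\<close>

lemma tendsto_log_integral: "((%T. log_integral T * ln T / T ^ dimn) \<longlongrightarrow> vol / n) at_top"
proof -
 obtain c1 c2 where c: "c1 > 0" "c2 > 0" "!!X. X \<in> pos ==> c1 <= pfaffian X & pfaffian X <= c2" using pos_pfaffian_bounds by blast
 have [measurable]: "(pfaffian :: (real, 'm) sq_matrix => real) \<in> borel_measurable borel"
  by (intro borel_measurable_continuous_onI continuous_on_pfaffian)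
 note [measurable] = dilate_pos_borel
 have sp: "space skew_lebesgue = (UNIV :: (real, 'm) sq_matrix set)" by (simp add: skew_lebesgue_def)
 have ind: "integrable skew_lebesgue (indicator (dilate T pos) :: (real, 'm) sq_matrix => real)" for T
  by (rule integrable_real_indicator) (simp_all add: dilate_pos_borel emeasure_skew_lebesgue_compact[OF compact_dilate_pos, unfolded infinity_ennreal_def])
 have int: "integrable skew_lebesgue (%x. indicator (dilate T pos) x * inv_log (pfaffian x))" for T
 proof (rule Bochner_Integration.integrable_bound[OF ind[of T]])
  show "(%x. indicator (dilate T pos) x * inv_log (pfaffian x)) \<in> borel_measurable skew_lebesgue" by measurable
  show "AE x in skew_lebesgue. norm (indicator (dilate T pos) x * inv_log (pfaffian x)) <= norm (indicator (dilate T pos) x :: real)"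
  proof (rule AE_I2)
   fix x :: "(real, 'm) sq_matrix"
   show "norm (indicator (dilate T pos) x * inv_log (pfaffian x)) <= norm (indicator (dilate T pos) x :: real)" using inv_log_bounds(1,2)[of "pfaffian x"]
    by (simp add: indicator_def)
  qed
 qed
 have msr: "(\<integral>x. indicator (dilate T pos) x \<partial>skew_lebesgue) = T ^ dimn * vol" if "T > 0" for T
  using measure_dilate_pos[OF that] by simp
 show ?thesis
 proof (rule log_sandwich[OF c(1,2), where K = vol and A = "%T. T ^ dimn * vol"])
  show "((%T. T ^ dimn * vol / T ^ dimn) \<longlongrightarrow> vol) at_top"
   by (rule tendsto_eventually, rule eventually_mono[OF eventually_gt_at_top[of 0]]) simp
  have ev: "\<forall>\<^sub>F T::real in at_top. T / ln T >= 1 & ln T >= 1" by (intro eventually_conj; real_asymp)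
  show "\<forall>\<^sub>F T in at_top. T ^ dimn * vol / ln (c2 * T ^ n) - vol * (T / ln T) ^ dimn <= log_integral T"
   using ev log_limits(3)[OF c(2)] eventually_gt_at_top[of 1]
  proof eventually_elim
   case (elim T)
   define s where "s = T / ln T"
   have T: "T > 1" using elim by simp
   have s: "s >= 1" "s <= T" using elim by (auto simp: s_def divide_le_eq)
   have sub: "dilate s pos <= dilate T pos" using s by (force simp: dilate_def)
   have "(\<integral>x. (indicator (dilate T pos) x - indicator (dilate s pos) x) * (1 / ln (c2 * T ^ n)) \<partial>skew_lebesgue) <= log_integral T"
    unfolding log_integral_def
   proof (rule integral_mono)
    show "integrable skew_lebesgue (%x. (indicator (dilate T pos) x - indicator (dilate s pos) x :: real) * (1 / ln (c2 * T ^ n)))"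
     by (intro integrable_mult_left Bochner_Integration.integrable_diff ind)
    show "integrable skew_lebesgue (%x. indicator (dilate T pos) x * inv_log (pfaffian x))" by (rule int)
    fix x :: "(real, 'm) sq_matrix"
    show "(indicator (dilate T pos) x - indicator (dilate s pos) x) * (1 / ln (c2 * T ^ n)) <= indicator (dilate T pos) x * inv_log (pfaffian x)"
    proof (cases "x \<in> dilate T pos & x \<notin> dilate s pos")
     case True
     show ?thesis using pfaffian_dilate_bounds(1)[OF c(3) c(1), of x T] pfaffian_dilate_bounds(2)[OF c(3) c(1), of x T s] True s elim by (auto intro!: inv_log_bounds(3))
    next
     case False
     thus ?thesis using sub inv_log_bounds(1)[of "pfaffian x"] by (auto simp: indicator_def)
    qed
   qed
   also have "(\<integral>x. (indicator (dilate T pos) x - indicator (dilate s pos) x) * (1 / ln (c2 * T ^ n)) \<partial>skew_lebesgue) =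
    (T ^ dimn * vol - s ^ dimn * vol) * (1 / ln (c2 * T ^ n))" using msr[of T] msr[of s] T s ind by simp
   finally have "(T ^ dimn * vol - s ^ dimn * vol) * (1 / ln (c2 * T ^ n)) <= log_integral T" .
   moreover have "s ^ dimn * vol / ln (c2 * T ^ n) <= s ^ dimn * vol / 1" using elim s vol_pos by (intro divide_left_mono) auto
   ultimately show ?case by (simp add: s_def[symmetric] diff_divide_distrib mult.commute)
  qed
  show "\<forall>\<^sub>F T in at_top. log_integral T <= T ^ dimn * vol / ln (c1 * (T / ln T) ^ n) + vol * (T / ln T) ^ dimn"
   using ev log_limits(4)[OF c(1)] eventually_gt_at_top[of 1]
  proof eventually_elim
   case (elim T)
   define s where "s = T / ln T"
   have T: "T > 1" using elim by simp
   have s: "s >= 1" "2 <= ln (c1 * s ^ n)" using elim by (auto simp: s_def)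
   \<comment> \<open>On the small cone \<open>inv_log\<close> is estimated by its maximum 1 / 2,
     outside it through the lower bound \<open>c1 * s ^ n\<close> for the Pfaffian.\<close>
   have "log_integral T <= (\<integral>x. indicator (dilate s pos) x * (1 / 2) + indicator (dilate T pos) x * (1 / ln (c1 * s ^ n)) \<partial>skew_lebesgue)"
    unfolding log_integral_def
   proof (rule integral_mono)
    show "integrable skew_lebesgue (%x. indicator (dilate s pos) x * (1 / 2) + indicator (dilate T pos) x * (1 / ln (c1 * s ^ n)) :: real)"
     by (intro Bochner_Integration.integrable_add integrable_mult_left ind)
    show "integrable skew_lebesgue (%x. indicator (dilate T pos) x * inv_log (pfaffian x))" by (rule int)
    fix x :: "(real, 'm) sq_matrix"
    show "indicator (dilate T pos) x * inv_log (pfaffian x) <= indicator (dilate s pos) x * (1 / 2) + indicator (dilate T pos) x * (1 / ln (c1 * s ^ n))"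
    proof (cases "x \<in> dilate T pos")
     case xT: True
     show ?thesis
     proof (cases "x \<in> dilate s pos")
      case True
      have "1 / ln (c1 * s ^ n) >= 0" using s by simp
      hence "inv_log (pfaffian x) <= 1 / 2 + 1 / ln (c1 * s ^ n)" using inv_log_bounds(2)[of "pfaffian x"] by linarith
      thus ?thesis using xT True by simp
     next
      case False
      show ?thesis using pfaffian_dilate_bounds(2)[OF c(3) c(1) xT, of s] False s c(1) xT by (auto intro!: inv_log_bounds(4))
     qed
    qed simp
   qed
   also have "... = s ^ dimn * vol * (1 / 2) + T ^ dimn * vol * (1 / ln (c1 * s ^ n))" using msr[of T] msr[of s] T s
    by (simp only: Bochner_Integration.integral_add[OF integrable_mult_left[OF ind] integrable_mult_left[OF ind]] integral_mult_left_zero)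
   finally have "log_integral T <= s ^ dimn * vol * (1 / 2) + T ^ dimn * vol * (1 / ln (c1 * s ^ n))" .
   moreover have "s ^ dimn * vol * (1 / 2) <= vol * s ^ dimn" using s vol_pos by simp
   ultimately show ?case by (simp add: s_def[symmetric] mult.commute)
  qed
 qed
qed

lemma num_asymp_equiv: "(%T. real (num T)) \<sim>[at_top] (%T. singular_series TYPE('m) * log_integral T)"
proof (rule asymp_equivI')
 define S where "S = singular_series TYPE('m)"
 have S: "S > 0" unfolding S_def by (rule singular_series_pos[OF card_m])
 have lim: "S * vol / n ~= 0" using S vol_pos n by simp
 have "((%T. S * (log_integral T * ln T / T ^ dimn)) \<longlongrightarrow> S * (vol / n)) at_top"
  by (intro tendsto_mult tendsto_const tendsto_log_integral)
 hence L: "((%T. (real (num T) * ln T / T ^ dimn) / (S * (log_integral T * ln T / T ^ dimn))) \<longlongrightarrow> (S * vol / n) / (S * (vol / n))) at_top"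
  by (rule tendsto_divide[OF tendsto_num[folded S_def]]) (use lim in simp)
 have one: "(S * vol / n) / (S * (vol / n)) = 1" using lim by simp
 have ev: "\<forall>\<^sub>F T in at_top. (real (num T) * ln T / T ^ dimn) / (S * (log_integral T * ln T / T ^ dimn)) = real (num T) / (S * log_integral T)"
  using eventually_gt_at_top[of 1] by eventually_elim simp
 show "((%T. real (num T) / (singular_series TYPE('m) * log_integral T)) \<longlongrightarrow> 1) at_top"
  using Lim_transform_eventually[OF L ev] unfolding one unfolding S_def .
qed

end

text \<open>If no point of \<open>\<Omega>\<close> has positive Pfaffian, both sides are identically
  0. Otherwise \<open>nondegenerate\<close> makes the volume of the positive cone positive, so the
  main term does not vanish and the quotient of the two limits is meaningful.\<close>

theorem theorem3p4:
 fixes n :: nat and \<Omega> :: "(real, 'm::{finite,linorder}) sq_matrix set"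
 assumes "n >= 2" and "CARD('m) = 2 * n"
  and "compact \<Omega>" and "\<Omega> <= V1" and "nice \<Omega>"
  and nondegenerate:
   "{X \<in> \<Omega>. pfaffian X > 0} = {} | ~ V1_null {X \<in> \<Omega>. pfaffian X > 0}"
 shows "(%T. real (prime_count T \<Omega>)) \<sim>[at_top]
     (%T. singular_series TYPE('m) *
        (LINT x:dilate T \<Omega>|skew_lebesgue. real_of_ereal (1 / log_plus (pfaffian x))))"
proof (cases "{X \<in> \<Omega>. pfaffian X > 0} = {}")
 case True
 have "dilate T ({} :: (real, 'm) sq_matrix set) = {}" for T by (simp add: dilate_def)
 thus ?thesis unfolding prime_count_coords[OF assms(2)] log_integral_pos[OF assms(2)] True by simp
next
 case False
 interpret skew_cone n \<Omega> by unfold_locales (use assms False in auto)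
 have "prime_count T \<Omega> = num T" for T unfolding prime_count_coords[OF assms(2)] num_def lattice_points_def pos_def by simp
 thus ?thesis using num_asymp_equiv unfolding log_integral_pos[OF assms(2)] log_integral_def pos_def by simp
qed

end
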